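(* Let $u>0$. Then $\boldsymbol{\phi}_w(u)$ satisfies $$\frac{\sigma^2}{2}\boldsymbol{\phi}_w''(u)+c\,\boldsymbol{\phi}_w'(u)+(\mathbf{B}-\delta\,\mathbf{I})\boldsymbol{\phi}_w(u)+\left[\int_0^u \boldsymbol{\alpha}\,\boldsymbol{\phi}_w(u-x)\,p(x)\,dx+\omega(u)\right]\mathbf{b}^{T}=\mathbf{0},$$ where $\omega(u)=\int_u^\infty w(u,x-u)\,p(x)\,dx$, $\mathbf{I}$ is the $n\times n$ identity matrix and $\mathbf{0}$ is the zero column vector of length $n$, with $\boldsymbol{\phi}_w(0)=\mathbf{0}$; while $\boldsymbol{\phi}_d(u)$ satisfies $$\frac{\sigma^2}{2}\boldsymbol{\phi}_d''(u)+c\,\boldsymbol{\phi}_d'(u)-\delta\,\boldsymbol{\phi}_d(u)+\mathbf{B}\boldsymbol{\phi}_d(u)+\left[\int_0^u \boldsymbol{\alpha}\,\boldsymbol{\phi}_d(u-x)\,p(x)\,dx\right]\mathbf{b}^{T}=\mathbf{0},$$ with $\boldsymbol{\phi}_d(0)=\mathbf{e}^{T}$.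
   Context: Risk process. Consider $U(t)=u+ct-\sum_{i=1}^{N(t)}Z_i+\sigma B(t)$, $t\ge 0$, where $u\ge 0$ is the initial capital, $c>0$ the premium rate, $\sigma>0$, and $\{B(t)\}$ a standard Brownian motion with $B(0)=0$. $N(t)=\max\{n\ge 1: V_1+\cdots+V_n\le t\}$ (and $0$ if there is no such $n$) is an ordinary renewal process with i.i.d. interclaim times $V_1,V_2,\ldots$. The claim sizes $Z_1,Z_2,\ldots$ are i.i.d. with distribution function $P$, $P(0)=0$, and density $p$. $\{N(t)\}$, $\{B(t)\}$, $\{Z_i\}$ are mutually independent, and $cE(V_i)>E(Z_i)$. Phase-type interclaim times. The law of $V_k$ is phase-type with representation $(\boldsymbol{\alpha},\mathbf{B},\mathbf{b})$, where $\boldsymbol{\alpha},\mathbf{b}$ are row vectors of length $n$ and $\mathbf{B}$ is an $n\times n$ matrix. That is, $V_k$ is the time to absorption of a terminating continuous-time Markov chain $J^{(k)}_t$ with $n$ transient states $\mathcal{E}_1,\ldots,\mathcal{E}_n$ and one absorbing state $\mathcal{E}_0$, with initial distribution $\boldsymbol{\alpha}$ on the transient states, transient intensity matrix $\mathbf{B}$, and absorption rates $\mathbf{b}$. With $\mathbf{e}$ the row vector of length $n$ of ones, $\mathbf{b}^{T}=-\mathbf{B}\mathbf{e}^{T}$. The density of $V_k$ is $k(t)=\boldsymbol{\alpha}e^{t\mathbf{B}}\mathbf{b}^{T}$, $t\ge 0$. Gerber–Shiu functions. $T=\inf\{t: U(t)\le 0\}$ (with $\inf\emptyset=\infty$) is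 the ruin time, $\delta\ge 0$, and $w(\cdot,\cdot)$ is a penalty function of the surplus $U(T-)$ immediately before ruin and the deficit $|U(T)|$ at ruin. For $i=1,\ldots,n$, $$\phi_w(u;i)=E\big[e^{-\delta T}I(T<\infty,U(T)<0)\,w(U(T-),|U(T)|)\,\big|\,U(0)=u,\ J^{(1)}_0=\mathcal{E}_i\big],$$ $$\phi_d(u;i)=E\big[e^{-\delta T}I(T<\infty,U(T)=0)\,\big|\,U(0)=u,\ J^{(1)}_0=\mathcal{E}_i\big],$$ and $\boldsymbol{\phi}_w(u)=(\phi_w(u;1),\ldots,\phi_w(u;n))^{T}$, $\boldsymbol{\phi}_d(u)=(\phi_d(u;1),\ldots,\phi_d(u;n))^{T}$ are column vectors (superscript $T$ on vectors denotes transpose).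
   Formalization: It is assumed that w is measurable, that the expectation defining φ_w and the integral ω converge absolutely at every positive argument, and that ω is continuous at u; without continuity the equation fails, e.g. at u=1 for w(x,y)=1 if x≥1, else 0. *)

theory Defs
  imports "HOL-Probability.Probability"
begin

(* The product on real ^ 'n ^ 'n used by exp and ^ would be componentwise, so the matrix
   exponential is written out as its power series for the matrix product **. *)
definition mat_exp :: "real ^ 'n ^ 'n \<Rightarrow> real ^ 'n ^ 'n" where
  "mat_exp A = (\<Sum>k. (1 / fact k) *\<^sub>R (((**) A ^^ k) (mat 1)))"

(* Time-homogeneous continuous-time Markov chain on a finite state space, with initial
   distribution mu, intensity matrix Q and transition matrices exp (t Q); the paths are
   right-continuous for the discrete topology. *)
definition markov_chain ::
  "'a measure \<Rightarrow> real ^ 's \<Rightarrow> real ^ 's ^ 's \<Rightarrow> (real \<Rightarrow> 'a \<Rightarrow> 's::finite) \<Rightarrow> bool" where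
  "markov_chain M \<mu> Q X \<longleftrightarrow>
     (\<forall>t\<ge>0. X t \<in> measurable M (count_space UNIV)) \<and>
     (\<forall>\<omega>\<in>space M. \<forall>t\<ge>0. \<exists>\<epsilon>>0. \<forall>s\<in>{t..<t + \<epsilon>}. X s \<omega> = X t \<omega>) \<and>
     (\<forall>m (\<tau> :: nat \<Rightarrow> real) (x :: nat \<Rightarrow> 's). \<tau> 0 = 0 \<and> incseq \<tau> \<longrightarrow>
        measure M {\<omega> \<in> space M. \<forall>k\<le>m. X (\<tau> k) \<omega> = x k} =
          \<mu> $ x 0 * (\<Prod>k<m. mat_exp ((\<tau> (Suc k) - \<tau> k) *\<^sub>R Q) $ x k $ x (Suc k)))"

definition brownian_motion :: "'a measure \<Rightarrow> (real \<Rightarrow> 'a \<Rightarrow> real) \<Rightarrow> bool" where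
  "brownian_motion M W \<longleftrightarrow>
     (\<forall>t\<ge>0. W t \<in> borel_measurable M) \<and>
     (\<forall>\<omega>\<in>space M. W 0 \<omega> = 0 \<and> continuous_on {0..} (\<lambda>t. W t \<omega>)) \<and>
     (\<forall>s t. 0 \<le> s \<and> s < t \<longrightarrow>
        distributed M lborel (\<lambda>\<omega>. W t \<omega> - W s \<omega>) (\<lambda>x. ennreal (normal_density 0 (sqrt (t - s)) x))) \<and>
     (\<forall>\<tau> :: nat \<Rightarrow> real. 0 \<le> \<tau> 0 \<and> incseq \<tau> \<longrightarrow>
        prob_space.indep_vars M (\<lambda>_. borel) (\<lambda>k \<omega>. W (\<tau> (Suc k)) \<omega> - W (\<tau> k) \<omega>) UNIV)"

(* The sigma-algebra generated by the random variables X t, t in I. *)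
definition process_events ::
  "'a measure \<Rightarrow> 'b measure \<Rightarrow> 'i set \<Rightarrow> ('i \<Rightarrow> 'a \<Rightarrow> 'b) \<Rightarrow> 'a set set" where
  "process_events M N I X =
     sigma_sets (space M) (\<Union>t\<in>I. {X t -` A \<inter> space M | A. A \<in> sets N})"

(* State spaces: Some i is the transient state E_i, None is the absorbing state E_0. *)
definition phase_generator ::
  "real ^ 'n ^ 'n \<Rightarrow> real ^ 'n \<Rightarrow> real ^ ('n option) ^ ('n::finite option)" where
  "phase_generator B b =
     (\<chi> s t. case s of None \<Rightarrow> 0
                     | Some i \<Rightarrow> (case t of None \<Rightarrow> b $ i | Some j \<Rightarrow> B $ i $ j))"

definition phase_initial :: "real ^ 'n \<Rightarrow> real ^ ('n::finite option)" where
  "phase_initial \<alpha> = (\<chi> s. case s of None \<Rightarrow> 0 | Some i \<Rightarrow> \<alpha> $ i)"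

definition phase_type_rep ::
  "real ^ 'n \<Rightarrow> real ^ 'n ^ 'n \<Rightarrow> real ^ 'n::finite \<Rightarrow> bool" where
  "phase_type_rep \<alpha> B b \<longleftrightarrow>
     (\<forall>i. 0 \<le> \<alpha> $ i) \<and> (\<Sum>i\<in>UNIV. \<alpha> $ i) = 1 \<and>
     (\<forall>i j. i \<noteq> j \<longrightarrow> 0 \<le> B $ i $ j) \<and> (\<forall>i. 0 \<le> b $ i) \<and> b = - (B *v 1)"

datatype source = Clock nat | Claim nat | Diffusion

(* Indices are shifted by one: J k, Z k belong to the (k+1)-st claim.
   Under P the first chain J 0 has initial distribution beta on the transient states,
   all later ones have initial distribution alpha. *)
definition risk_law ::
  "'a measure \<Rightarrow> real ^ 'n \<Rightarrow> real ^ 'n \<Rightarrow> real ^ 'n ^ 'n \<Rightarrow> real ^ 'n \<Rightarrow> (real \<Rightarrow> real) \<Rightarrow>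
   (nat \<Rightarrow> real \<Rightarrow> 'a \<Rightarrow> 'n::finite option) \<Rightarrow> (nat \<Rightarrow> 'a \<Rightarrow> real) \<Rightarrow> (real \<Rightarrow> 'a \<Rightarrow> real) \<Rightarrow> bool" where
  "risk_law P \<beta> \<alpha> B b p J Z W \<longleftrightarrow>
     prob_space P \<and>
     (\<forall>k. markov_chain P (phase_initial (if k = 0 then \<beta> else \<alpha>)) (phase_generator B b) (J k)) \<and>
     (\<forall>k. distributed P lborel (Z k) (\<lambda>x. ennreal (p x))) \<and>
     brownian_motion P W \<and>
     prob_space.indep_sets P
       (\<lambda>s. case s of
              Clock k \<Rightarrow> process_events P (count_space UNIV) {0..} (J k)
            | Claim k \<Rightarrow> process_events P borel {k} Z
            | Diffusion \<Rightarrow> process_events P borel {0..} W) UNIV"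

(* The interclaim time, infinite if the chain is never absorbed. *)
definition absorption_time :: "(real \<Rightarrow> 'a \<Rightarrow> 'n option) \<Rightarrow> 'a \<Rightarrow> ennreal" where
  "absorption_time X \<omega> = (INF t\<in>{t. 0 \<le> t \<and> X t \<omega> = None}. ennreal t)"

definition claim_number :: "(nat \<Rightarrow> real \<Rightarrow> 'a \<Rightarrow> 'n option) \<Rightarrow> real \<Rightarrow> 'a \<Rightarrow> nat" where
  "claim_number J t \<omega> =
     (let S = {m. 1 \<le> m \<and> (\<Sum>k<m. absorption_time (J k) \<omega>) \<le> ennreal t}
      in if S = {} then 0 else Max S)"

definition surplus ::
  "real \<Rightarrow> real \<Rightarrow> (nat \<Rightarrow> real \<Rightarrow> 'a \<Rightarrow> 'n option) \<Rightarrow> (nat \<Rightarrow> 'a \<Rightarrow> real) \<Rightarrow>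
   (real \<Rightarrow> 'a \<Rightarrow> real) \<Rightarrow> real \<Rightarrow> 'a \<Rightarrow> real \<Rightarrow> real" where
  "surplus c \<sigma> J Z W u \<omega> t =
     u + c * t - (\<Sum>k<claim_number J t \<omega>. Z k \<omega>) + \<sigma> * W t \<omega>"

(* M is the law of the ordinary model.  Pr i is the law given that the first chain starts
   in E_i.  The equation with alpha $ i determines Pr i as elementary conditional law if
   alpha $ i > 0; if alpha $ i = 0 the conditioning has its usual meaning for Markov chains,
   namely the law under which the first chain is started in E_i.
   Transience is the defining property that, started in E_i, the chain visits E_i only
   during a bounded set of times, almost surely. *)
definition perturbed_phase_type_model ::
  "'a measure \<Rightarrow> ('n \<Rightarrow> 'a measure) \<Rightarrow> (nat \<Rightarrow> real \<Rightarrow> 'a \<Rightarrow> 'n::finite option) \<Rightarrow>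
   (nat \<Rightarrow> 'a \<Rightarrow> real) \<Rightarrow> (real \<Rightarrow> 'a \<Rightarrow> real) \<Rightarrow> real \<Rightarrow>
   real ^ 'n \<Rightarrow> real ^ 'n ^ 'n \<Rightarrow> real ^ 'n \<Rightarrow> (real \<Rightarrow> real) \<Rightarrow> bool" where
  "perturbed_phase_type_model M Pr J Z W c \<alpha> B b p \<longleftrightarrow>
     phase_type_rep \<alpha> B b \<and>
     (\<forall>x. 0 \<le> p x) \<and>
     risk_law M \<alpha> \<alpha> B b p J Z W \<and>
     (\<forall>k. cdf (distr M borel (Z k)) 0 = 0) \<and>
     (\<forall>k. (\<integral>\<^sup>+\<omega>. ennreal (Z k \<omega>) \<partial>M) < ennreal c * (\<integral>\<^sup>+\<omega>. absorption_time (J k) \<omega> \<partial>M)) \<and>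
     (\<forall>i. sets (Pr i) = sets M \<and>
          risk_law (Pr i) (axis i 1) \<alpha> B b p J Z W \<and>
          (\<forall>A\<in>sets M. measure M (A \<inter> {\<omega> \<in> space M. J 0 0 \<omega> = Some i}) = \<alpha> $ i * measure (Pr i) A) \<and>
          (AE \<omega> in Pr i. bounded {t. 0 \<le> t \<and> J 0 t \<omega> = Some i}))"

definition ruin_time :: "(real \<Rightarrow> real) \<Rightarrow> ennreal" where
  "ruin_time x = (INF t\<in>{t. 0 \<le> t \<and> x t \<le> 0}. ennreal t)"

(* Discounted penalty of a surplus path x when ruin is caused by a claim; the first
   argument of w is the left limit U(T-). *)
definition penalty_claim :: "real \<Rightarrow> (real \<Rightarrow> real \<Rightarrow> real) \<Rightarrow> (real \<Rightarrow> real) \<Rightarrow> real" where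
  "penalty_claim \<delta> w x =
     (let T = enn2real (ruin_time x) in
      if ruin_time x < \<infinity> \<and> x T < 0
      then exp (- \<delta> * T) * w (Lim (at_left T) x) \<bar>x T\<bar> else 0)"

definition penalty_diffusion :: "real \<Rightarrow> (real \<Rightarrow> real) \<Rightarrow> real" where
  "penalty_diffusion \<delta> x =
     (let T = enn2real (ruin_time x) in
      if ruin_time x < \<infinity> \<and> x T = 0 then exp (- \<delta> * T) else 0)"

definition gs_claim ::
  "('n::finite \<Rightarrow> 'a measure) \<Rightarrow> real \<Rightarrow> (real \<Rightarrow> real \<Rightarrow> real) \<Rightarrow>
   (real \<Rightarrow> 'a \<Rightarrow> real \<Rightarrow> real) \<Rightarrow> real \<Rightarrow> real ^ 'n" where
  "gs_claim Pr \<delta> w U u = (\<chi> i. \<integral>\<omega>. penalty_claim \<delta> w (U u \<omega>) \<partial>Pr i)"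

definition gs_diffusion ::
  "('n::finite \<Rightarrow> 'a measure) \<Rightarrow> real \<Rightarrow> (real \<Rightarrow> 'a \<Rightarrow> real \<Rightarrow> real) \<Rightarrow> real \<Rightarrow> real ^ 'n" where
  "gs_diffusion Pr \<delta> U u = (\<chi> i. \<integral>\<omega>. penalty_diffusion \<delta> (U u \<omega>) \<partial>Pr i)"

definition claim_ruin_rate :: "(real \<Rightarrow> real \<Rightarrow> real) \<Rightarrow> (real \<Rightarrow> real) \<Rightarrow> real \<Rightarrow> real" where
  "claim_ruin_rate w p u = (LBINT x:{u<..}. w u (x - u) * p x)"

end

theory Submission
  imports Defs "HOL-Real_Asymp.Real_Asymp"
begin

text \<open>Between claims the surplus is a Brownian motion with drift, killed when it reaches zero. With
  \<open>q\<close> so large that \<open>B + q I\<close> is nonnegative, uniformization writes the density and the tail of a phase-type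
  interclaim time as a mixture of \<open>exp (- q t) t ^ m / fact m\<close>. Discounting with \<open>\<delta>\<close> therefore only involves
  powers of the resolvent of the killed diffusion at rate \<open>q + \<delta>\<close>, whose kernel is explicit.
  Splitting the penalty at the claim epochs turns the Gerber--Shiu functions into a sum of such powers,
  and hence into a solution of \<open>\<phi> = boundary + resolvent ((B + q I) \<phi> + (\<alpha> \<bullet> \<phi> * p + \<omega>) b)\<close>.
  Since the resolvent inverts the generator of the diffusion, this is the integro-differential equation.
  All of this is done for nonnegative penalties in the extended nonnegative reals, where no integrability is
  needed; a signed penalty is the difference of its positive and negative parts.\<close>

section \<open>The resolvent of Brownian motion with drift killed at zero\<close>

text \<open>Conditioning on a short time interval would presuppose the second derivatives that have
  to be established. Here all smoothness comes from the resolvent: it turns a merely measurable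
  source into a differentiable function, and its second derivative exists wherever the source is
  continuous, so continuity of the claim ruin rate matters only at the point \<open>u\<close>. The
  killed kernel does not come from the joint law of the path and its minimum. The occupation after
  the hitting time is split off by the strong Markov property, and the transform
  \<open>exp (- rho * v)\<close> of the hitting time is found by testing with an interval below
  zero. Taking \<open>q\<close> strictly positive keeps the rate \<open>q + \<delta>\<close>
  positive even without discounting, so that the discounted occupation time is finite. The pathwise
  penalties also see events of probability zero, namely a claim that takes the surplus exactly to
  zero and an accumulation of claim epochs; these are handled separately.\<close>

lemma std_normal_cdf_exists:
  obtains F :: "real \<Rightarrow> real" where
    "\<And>z. (F has_real_derivative std_normal_density z) (at z)"
    "(F \<longlongrightarrow> 0) at_bot" "(F \<longlongrightarrow> 1) at_top"
proof -
  let ?N = "density lborel std_normal_density"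
  interpret N: prob_space ?N
    by (rule prob_space_normal_density) simp
  interpret real_distribution ?N
    by standard (auto simp: space_density)
  have int: "integrable lborel std_normal_density"
    using integrable_normal_density[of 1 0] by simp
  have cdf_diff: "cdf ?N b - cdf ?N a = integral {a..b} std_normal_density" if "a < b" for a b
  proof -
    have "cdf ?N b - cdf ?N a = measure ?N {a<..b}"
      using cdf_diff_eq[OF that] by simp
    also have "\<dots> = (\<integral>x. std_normal_density x * indicator {a<..b} x \<partial>lborel)"
    proof -
      have "emeasure ?N {a<..b} = (\<integral>\<^sup>+x. ennreal (std_normal_density x * indicator {a<..b} x) \<partial>lborel)"
        by (subst emeasure_density) (auto intro!: nn_integral_cong simp: indicator_def)
      also have "\<dots> = ennreal (\<integral>x. std_normal_density x * indicator {a<..b} x \<partial>lborel)"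
        using int by (intro nn_integral_eq_integral integrable_real_mult_indicator) auto
      finally show ?thesis by (simp add: measure_def integral_nonneg_AE)
    qed
    also have "\<dots> = (\<integral>x. indicator {a..b} x *\<^sub>R std_normal_density x \<partial>lborel)"
    proof (rule integral_cong_AE)
      have "AE x in lborel. x \<noteq> a" by (rule AE_lborel_singleton)
      then show "AE x in lborel. std_normal_density x * indicator {a<..b} x
          = indicator {a..b} x *\<^sub>R std_normal_density x"
        by eventually_elim (auto simp: indicator_def)
    qed auto
    also have "\<dots> = integral {a..b} std_normal_density"
      using set_borel_integral_eq_integral(2)[of "{a..b}" std_normal_density]
        set_integrable_subset[of lborel UNIV std_normal_density "{a..b}"] int
      by (auto simp: set_lebesgue_integral_def set_integrable_def)
    finally show ?thesis .
  qed
  have deriv: "(cdf ?N has_real_derivative std_normal_density z) (at z)" for z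
  proof -
    have cont: "continuous_on {z-1..z+1} std_normal_density"
      unfolding std_normal_density_def by (intro continuous_intros) auto
    have "((\<lambda>x. integral {z-1..x} std_normal_density) has_real_derivative std_normal_density z)
        (at z within {z-1..z+1})"
      using integral_has_real_derivative[OF cont, of z] by simp
    then have 1: "((\<lambda>x. integral {z-1..x} std_normal_density) has_real_derivative std_normal_density z) (at z)"
      by (subst (asm) at_within_interior) (auto simp: interior_atLeastAtMost_real)
    have 2: "((\<lambda>x. cdf ?N (z-1) + integral {z-1..x} std_normal_density) has_real_derivative std_normal_density z) (at z)"
      using DERIV_add[OF DERIV_const[of "cdf ?N (z-1)"] 1] by simp
    show ?thesis
    proof (rule has_field_derivative_transform_within_open[OF 2])
      fix x assume "x \<in> {z-1<..<z+1}"
      then have "z - 1 < x" by auto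
      from cdf_diff[OF this] show "cdf ?N (z-1) + integral {z-1..x} std_normal_density = cdf ?N x"
        by simp
    qed auto
  qed
  have "(cdf ?N \<longlongrightarrow> 1) at_top"
    using cdf_lim_at_top N.prob_space by simp
  with deriv cdf_lim_at_bot that show thesis by metis
qed

locale drift_diffusion =
  fixes c \<sigma> lam :: real
  assumes c_pos: "c > 0" and sigma_pos: "\<sigma> > 0" and lam_pos: "lam > 0"
begin

text \<open>\<open>eta\<close> and \<open>- rho\<close> are the two roots \<open>r\<close> of
  \<open>\<sigma>^2 / 2 * r^2 + c * r - lam = 0\<close>, the exponents of the homogeneous equation
  of the diffusion discounted at rate \<open>lam\<close>.\<close>

definition disc :: real where "disc = sqrt (c\<^sup>2 + 2 * lam * \<sigma>\<^sup>2)"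
definition rho :: real where "rho = (disc + c) / \<sigma>\<^sup>2"
definition eta :: real where "eta = (disc - c) / \<sigma>\<^sup>2"

text \<open>The density, at displacement \<open>y\<close>, of the discounted occupation measure of
  Brownian motion with drift \<open>c\<close> and volatility \<open>\<sigma>\<close>;
  \<open>nn_integral_gaussian_time\<close> identifies it.\<close>

definition free_kernel :: "real \<Rightarrow> real" where
  "free_kernel y = exp ((c * y - disc * \<bar>y\<bar>) / \<sigma>\<^sup>2) / disc"

text \<open>\<open>exp (- rho * v)\<close> is the Laplace transform of the hitting time of zero from
  \<open>v\<close>, so the subtracted term is the occupation collected after that time by a process
  starting afresh at zero.\<close>

definition killed_kernel :: "real \<Rightarrow> real \<Rightarrow> real" where
  "killed_kernel v x = free_kernel (x - v) - exp (- rho * v) * free_kernel x"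

lemma disc_sq: "disc\<^sup>2 = c\<^sup>2 + 2 * lam * \<sigma>\<^sup>2"
  using sigma_pos lam_pos by (simp add: disc_def)

lemma disc_gt: "disc > c"
proof -
  have "c = sqrt (c\<^sup>2)" using c_pos by simp
  also have "\<dots> < disc" unfolding disc_def using sigma_pos lam_pos by (intro real_sqrt_less_mono) simp
  finally show ?thesis .
qed

lemma disc_pos: "disc > 0" using disc_gt c_pos by linarith

lemma rho_pos: "rho > 0" and eta_pos: "eta > 0"
  using disc_gt disc_pos c_pos sigma_pos by (auto simp: rho_def eta_def)

lemma rho_eta_sum: "rho + eta = 2 * disc / \<sigma>\<^sup>2"
  and rho_eta_diff: "rho - eta = 2 * c / \<sigma>\<^sup>2"
  by (simp_all add: rho_def eta_def add_divide_distrib diff_divide_distrib)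

lemma rho_eta_prod: "rho * eta = 2 * lam / \<sigma>\<^sup>2"
proof -
  have "rho * eta = (disc\<^sup>2 - c\<^sup>2) / (\<sigma>\<^sup>2 * \<sigma>\<^sup>2)"
    unfolding rho_def eta_def times_divide_times_eq by (simp add: power2_eq_square algebra_simps)
  also have "disc\<^sup>2 - c\<^sup>2 = 2 * lam * \<sigma>\<^sup>2" by (simp add: disc_sq)
  also have "2 * lam * \<sigma>\<^sup>2 / (\<sigma>\<^sup>2 * \<sigma>\<^sup>2) = 2 * lam / \<sigma>\<^sup>2" using sigma_pos by (simp add: power2_eq_square)
  finally show ?thesis .
qed

lemma free_kernel_neg: "y \<le> 0 \<Longrightarrow> free_kernel y = exp (rho * y) / disc"
  and free_kernel_pos: "y \<ge> 0 \<Longrightarrow> free_kernel y = exp (- eta * y) / disc"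
  by (simp_all add: free_kernel_def rho_def eta_def algebra_simps diff_divide_distrib add_divide_distrib)

lemma free_kernel_gt0: "free_kernel y > 0"
  using disc_pos by (simp add: free_kernel_def)

lemma free_kernel_measurable [measurable]: "free_kernel \<in> borel_measurable borel"
  unfolding free_kernel_def by measurable

lemma killed_kernel_measurable [measurable (raw)]:
  assumes [measurable]: "f \<in> borel_measurable M" "g \<in> borel_measurable M"
  shows "(\<lambda>x. killed_kernel (f x) (g x)) \<in> borel_measurable M"
  unfolding killed_kernel_def by measurable

text \<open>The logarithm of the kernel has slopes \<open>rho\<close> and \<open>- eta\<close>, and
  \<open>eta \<le> rho\<close> because \<open>c > 0\<close>; a displacement by \<open>y\<close>
  therefore costs at most the factor \<open>exp (rho * \<bar>y\<bar>)\<close>. This Harnack bound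
  makes potentials of measurable functions continuous.\<close>

lemma free_kernel_le: "free_kernel (x - y) \<le> exp (rho * \<bar>y\<bar>) * free_kernel x"
proof -
  have "c * (x - y) - disc * \<bar>x - y\<bar> \<le> (disc + c) * \<bar>y\<bar> + (c * x - disc * \<bar>x\<bar>)"
  proof -
    have "disc * \<bar>x\<bar> \<le> disc * (\<bar>x - y\<bar> + \<bar>y\<bar>)"
      using disc_pos by (intro mult_left_mono) auto
    moreover have "- (c * y) \<le> c * \<bar>y\<bar>" using c_pos
      by (metis abs_ge_minus_self abs_mult abs_of_pos)
    ultimately show ?thesis by (simp add: algebra_simps)
  qed
  then have "(c * (x - y) - disc * \<bar>x - y\<bar>) / \<sigma>\<^sup>2 \<le> rho * \<bar>y\<bar> + (c * x - disc * \<bar>x\<bar>) / \<sigma>\<^sup>2"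
    unfolding rho_def using sigma_pos by (simp add: divide_simps)
  then have "exp ((c * (x - y) - disc * \<bar>x - y\<bar>) / \<sigma>\<^sup>2) \<le> exp (rho * \<bar>y\<bar>) * exp ((c * x - disc * \<bar>x\<bar>) / \<sigma>\<^sup>2)"
    by (simp flip: exp_add)
  then show ?thesis unfolding free_kernel_def using disc_pos by (simp add: divide_simps)
qed

text \<open>Completing the square absorbs the discount into the drift, which changes from
  \<open>c\<close> to \<open>disc\<close>. What remains is a Gaussian integral in time with an
  explicit primitive built from the normal distribution function.\<close>

lemma nn_integral_gaussian_time:
  assumes "y \<noteq> 0"
  shows "(\<integral>\<^sup>+t. ennreal (exp (- lam * t) * normal_density (c * t) (\<sigma> * sqrt t) y) * indicator {0<..} t \<partial>lborel)
    = ennreal (free_kernel y)"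
proof -
  obtain \<Phi> where Phi: "\<And>z. (\<Phi> has_real_derivative std_normal_density z) (at z)"
    "(\<Phi> \<longlongrightarrow> 0) at_bot" "(\<Phi> \<longlongrightarrow> 1) at_top"
    by (rule std_normal_cdf_exists) blast
  define a where "a = \<bar>y\<bar>"
  define s where "s = disc"
  have a: "a > 0" using assms by (simp add: a_def)
  have s: "s > 0" using disc_pos by (simp add: s_def)
  \<comment> \<open>\<open>E\<close> is the ratio of the normal densities at \<open>z1 t\<close> and
    \<open>z2 t\<close>, which does not depend on \<open>t\<close>. Hence in the derivative of
    \<open>G\<close> the two terms with \<open>a / (2 * t * sqrt t)\<close> cancel and only
    \<open>g\<close> is left.\<close>
  define E where "E = exp (2 * s * a / \<sigma>\<^sup>2)"
  define g where "g = (\<lambda>t. 1 / sqrt (2 * pi * \<sigma>\<^sup>2 * t) * exp (- (s * t - a)\<^sup>2 / (2 * \<sigma>\<^sup>2 * t)))"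
  define z1 where "z1 = (\<lambda>t. (s * sqrt t - a / sqrt t) / \<sigma>)"
  define z2 where "z2 = (\<lambda>t. (s * sqrt t + a / sqrt t) / \<sigma>)"
  define G where "G = (\<lambda>t. (\<Phi> (z1 t) + E * \<Phi> (z2 t)) / s)"
  have dsq: "(sqrt has_real_derivative (1 / (2 * sqrt t))) (at t)" if "t > 0" for t
    using DERIV_real_sqrt[OF that] by (simp add: inverse_eq_divide mult.commute)
  have dz1: "(z1 has_real_derivative (s / (2 * sqrt t) + a / (2 * t * sqrt t)) / \<sigma>) (at t)" if "t > 0" for t
  proof -
    have "((\<lambda>t. s * sqrt t) has_real_derivative s / (2 * sqrt t)) (at t)"
      using DERIV_cmult[OF dsq[OF that], of s] by simp
    moreover have "((\<lambda>t. a / sqrt t) has_real_derivative - (a / (2 * t * sqrt t))) (at t)"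
      using that dsq by (auto intro!: derivative_eq_intros simp: divide_simps)
    ultimately have "((\<lambda>t. s * sqrt t - a / sqrt t) has_real_derivative
        s / (2 * sqrt t) - - (a / (2 * t * sqrt t))) (at t)"
      by (rule DERIV_diff)
    from DERIV_cdivide[OF this, of \<sigma>] show ?thesis by (simp add: z1_def)
  qed
  have dz2: "(z2 has_real_derivative (s / (2 * sqrt t) - a / (2 * t * sqrt t)) / \<sigma>) (at t)" if "t > 0" for t
  proof -
    have "((\<lambda>t. s * sqrt t) has_real_derivative s / (2 * sqrt t)) (at t)"
      using DERIV_cmult[OF dsq[OF that], of s] by simp
    moreover have "((\<lambda>t. a / sqrt t) has_real_derivative - (a / (2 * t * sqrt t))) (at t)"
      using that dsq by (auto intro!: derivative_eq_intros simp: divide_simps)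
    ultimately have "((\<lambda>t. s * sqrt t + a / sqrt t) has_real_derivative
        s / (2 * sqrt t) + - (a / (2 * t * sqrt t))) (at t)"
      by (rule DERIV_add)
    from DERIV_cdivide[OF this, of \<sigma>] show ?thesis by (simp add: z2_def)
  qed
  have z1_sq: "(z1 t)\<^sup>2 = (s * t - a)\<^sup>2 / (\<sigma>\<^sup>2 * t)" if "t > 0" for t
  proof -
    have "s * sqrt t - a / sqrt t = (s * t - a) / sqrt t"
      using that by (simp add: divide_simps)
    then show ?thesis using that by (simp add: z1_def power_divide power_mult_distrib mult.commute)
  qed
  have z2_sq: "(z2 t)\<^sup>2 = (z1 t)\<^sup>2 + 4 * s * a / \<sigma>\<^sup>2" if "t > 0" for t
  proof -
    have "(s * sqrt t + a / sqrt t)\<^sup>2 = (s * sqrt t - a / sqrt t)\<^sup>2 + 4 * s * a"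
      using that by (simp add: power2_eq_square algebra_simps)
    then show ?thesis unfolding z1_def z2_def power_divide by (simp only: add_divide_distrib)
  qed
  have phi2: "E * std_normal_density (z2 t) = std_normal_density (z1 t)" if "t > 0" for t
    unfolding std_normal_density_def E_def z2_sq[OF that]
    by (simp add: exp_add[symmetric] add_divide_distrib diff_divide_distrib)
  have dG: "(G has_real_derivative g t) (at t)" if "t > 0" for t
  proof -
    have "(G has_real_derivative (std_normal_density (z1 t) * ((s / (2 * sqrt t) + a / (2 * t * sqrt t)) / \<sigma>)
        + E * (std_normal_density (z2 t) * ((s / (2 * sqrt t) - a / (2 * t * sqrt t)) / \<sigma>))) / s) (at t)"
      unfolding G_def
      by (intro DERIV_cdivide DERIV_add DERIV_cmult DERIV_chain2[OF Phi(1)] dz1 dz2 that)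
    also have "(std_normal_density (z1 t) * ((s / (2 * sqrt t) + a / (2 * t * sqrt t)) / \<sigma>)
        + E * (std_normal_density (z2 t) * ((s / (2 * sqrt t) - a / (2 * t * sqrt t)) / \<sigma>))) / s
      = (std_normal_density (z1 t) * ((s / (2 * sqrt t) + a / (2 * t * sqrt t)) / \<sigma>)
        + std_normal_density (z1 t) * ((s / (2 * sqrt t) - a / (2 * t * sqrt t)) / \<sigma>)) / s"
      by (simp only: mult.assoc[symmetric] phi2[OF that])
    also have "\<dots> = std_normal_density (z1 t) / (\<sigma> * sqrt t)"
      using s sigma_pos that by (simp add: field_simps)
    also have "\<dots> = g t"
      unfolding std_normal_density_def g_def z1_sq[OF that] using sigma_pos that
      by (simp add: real_sqrt_mult mult_ac)
    finally show ?thesis .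
  qed
  have g_cont: "isCont g t" if "t > 0" for t
    unfolding g_def using that sigma_pos by (intro continuous_intros) auto
  have g_nonneg: "g t \<ge> 0" if "t > 0" for t
    using that by (simp add: g_def)
  have lim_top: "(G \<longlongrightarrow> (1 + E * 1) / s) at_top"
  proof -
    have "filterlim z1 at_top at_top" "filterlim z2 at_top at_top"
      unfolding z1_def z2_def using s a sigma_pos by real_asymp+
    then show ?thesis unfolding G_def using s
      by (intro tendsto_intros filterlim_compose[OF Phi(3)]) auto
  qed
  \<comment> \<open>As \<open>a > 0\<close>, near time zero \<open>z1\<close> tends to minus
    infinity but \<open>z2\<close> to plus infinity. The \<open>z2\<close> parts of \<open>G\<close>
    thus agree at both ends and the integral is \<open>1 / s\<close>.\<close>
  have lim_0: "(G \<longlongrightarrow> (0 + E * 1) / s) (at_right 0)"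
  proof -
    have "filterlim z1 at_bot (at_right 0)" "filterlim z2 at_top (at_right 0)"
      unfolding z1_def z2_def using s a sigma_pos by real_asymp+
    then show ?thesis unfolding G_def using s
      by (intro tendsto_intros filterlim_compose[OF Phi(3)] filterlim_compose[OF Phi(2)]) auto
  qed
  have FTC: "set_integrable lborel (einterval 0 \<infinity>) g"
    "(LBINT t=0..\<infinity>. g t) = (1 + E * 1) / s - (0 + E * 1) / s"
  proof -
    have A: "((G \<circ> real_of_ereal) \<longlongrightarrow> (0 + E * 1) / s) (at_right 0)"
      using lim_0 by (simp add: ereal_tendsto_simps zero_ereal_def)
    have B: "((G \<circ> real_of_ereal) \<longlongrightarrow> (1 + E * 1) / s) (at_left \<infinity>)"
      using lim_top by (simp add: ereal_tendsto_simps)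
    show "set_integrable lborel (einterval 0 \<infinity>) g"
      by (rule interval_integral_FTC_nonneg(1)[where F=G, OF _ _ _ _ A B]) (use dG g_cont g_nonneg in auto)
    show "(LBINT t=0..\<infinity>. g t) = (1 + E * 1) / s - (0 + E * 1) / s"
      by (rule interval_integral_FTC_nonneg(2)[where F=G, OF _ _ _ _ A B]) (use dG g_cont g_nonneg in auto)
  qed
  have g_meas[measurable]: "g \<in> borel_measurable borel" unfolding g_def by measurable
  have set0: "einterval 0 \<infinity> = {0<..}"
    by (auto simp: einterval_def)
  have nng: "(\<integral>\<^sup>+t. ennreal (g t) * indicator {0<..} t \<partial>lborel) = ennreal (1 / s)"
  proof -
    have "(\<integral>\<^sup>+t. ennreal (g t) * indicator {0<..} t \<partial>lborel)
        = (\<integral>\<^sup>+t. ennreal (indicator {0<..} t *\<^sub>R g t) \<partial>lborel)"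
      by (intro nn_integral_cong) (auto simp: indicator_def)
    also have "\<dots> = ennreal (\<integral>t. indicator {0<..} t *\<^sub>R g t \<partial>lborel)"
      using FTC(1) g_nonneg unfolding set0 set_integrable_def
      by (intro nn_integral_eq_integral) (auto split: split_indicator)
    also have "(\<integral>t. indicator {0<..} t *\<^sub>R g t \<partial>lborel) = 1 / s"
      using FTC(2) by (simp add: interval_lebesgue_integral_def set_lebesgue_integral_def set0 add_divide_distrib)
    finally show ?thesis .
  qed
  define K where "K = exp ((c * y - s * a) / \<sigma>\<^sup>2)"
  have dens: "exp (- lam * t) * normal_density (c * t) (\<sigma> * sqrt t) y = K * g t" if "t > 0" for t
  proof -
    have "- lam * t - (y - c * t)\<^sup>2 / (2 * (\<sigma> * sqrt t)\<^sup>2)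
       = (c * y - s * a) / \<sigma>\<^sup>2 - (s * t - a)\<^sup>2 / (2 * \<sigma>\<^sup>2 * t)"
    proof -
      have "(s * t - a)\<^sup>2 = disc\<^sup>2 * t\<^sup>2 - 2 * s * a * t + y\<^sup>2"
        by (simp add: s_def a_def power2_eq_square algebra_simps)
      also have "\<dots> = (y - c * t)\<^sup>2 + 2 * c * t * y + 2 * lam * \<sigma>\<^sup>2 * t\<^sup>2 - 2 * s * a * t"
        unfolding disc_sq by (simp add: power2_eq_square algebra_simps)
      finally have *: "(s * t - a)\<^sup>2 = (y - c * t)\<^sup>2 + 2 * c * t * y + 2 * lam * \<sigma>\<^sup>2 * t\<^sup>2 - 2 * s * a * t" .
      show ?thesis unfolding * using that sigma_pos
        by (simp add: power_mult_distrib field_simps power2_eq_square)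
    qed
    then have "exp (- lam * t) * exp (- (y - c * t)\<^sup>2 / (2 * (\<sigma> * sqrt t)\<^sup>2))
        = K * exp (- (s * t - a)\<^sup>2 / (2 * \<sigma>\<^sup>2 * t))"
      unfolding K_def by (simp add: exp_add[symmetric])
    then show ?thesis using that
      by (simp add: normal_density_def g_def power_mult_distrib mult.assoc mult.left_commute)
  qed
  have "(\<integral>\<^sup>+t. ennreal (exp (- lam * t) * normal_density (c * t) (\<sigma> * sqrt t) y) * indicator {0<..} t \<partial>lborel)
      = (\<integral>\<^sup>+t. ennreal K * (ennreal (g t) * indicator {0<..} t) \<partial>lborel)"
  proof (rule nn_integral_cong)
    fix t :: real
    show "ennreal (exp (- lam * t) * normal_density (c * t) (\<sigma> * sqrt t) y) * indicator {0<..} t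
        = ennreal K * (ennreal (g t) * indicator {0<..} t)"
      by (cases "t > 0") (use dens g_nonneg in \<open>auto simp: ennreal_mult K_def\<close>)
  qed
  also have "\<dots> = ennreal K * ennreal (1 / s)"
    by (subst nn_integral_cmult) (auto simp: nng)
  also have "\<dots> = ennreal (free_kernel y)"
    using s by (simp add: ennreal_mult[symmetric] K_def free_kernel_def s_def a_def)
  finally show ?thesis .
qed

end

section \<open>Differentiability of the resolvent and the equation it solves\<close>

context drift_diffusion
begin

lemma pred_in_intervals [measurable (raw)]:
  fixes f g :: "'a \<Rightarrow> real"
  assumes [measurable]: "f \<in> borel_measurable M" "g \<in> borel_measurable M"
  shows "Measurable.pred M (\<lambda>x. f x \<in> {g x..})" "Measurable.pred M (\<lambda>x. f x \<in> {..g x})"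
    "Measurable.pred M (\<lambda>x. f x \<in> {g x<..})" "Measurable.pred M (\<lambda>x. f x \<in> {..<g x})"
  by simp_all

text \<open>The inverse of the coefficient of the second derivative; it turns the derivative of
  \<open>tail\<close> into the source term of the equation.\<close>

definition slope :: real where "slope = 2 / \<sigma>\<^sup>2"

lemma slope_pos: "slope > 0" using sigma_pos by (simp add: slope_def)

lemma slope_eq: "slope * disc = rho + eta"
  by (simp add: slope_def rho_eta_sum)

text \<open>The integrand is a product of functions of \<open>v\<close>, \<open>t\<close> and
  \<open>x\<close>, and the kink of the kernel on the diagonal is hidden in the range
  \<open>{0..min v x}\<close>. This is what lets the resolvent of a merely measurable function be
  differentiated by the fundamental theorem of calculus.\<close>

lemma killed_kernel_integral:
  assumes "v > 0" "x > 0"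
  shows "ennreal (killed_kernel v x)
    = (\<integral>\<^sup>+t. ennreal (slope * exp (- rho * v) * exp ((rho + eta) * t) * exp (- eta * x)) * indicator {0..min v x} t \<partial>lborel)"
proof -
  let ?m = "min v x"
  let ?K = "exp (- rho * v) * exp (- eta * x) / disc"
  have d: "disc \<noteq> 0" using disc_pos by simp
  have re: "rho + eta > 0" using rho_pos eta_pos by simp
  have "(\<integral>\<^sup>+t\<in>{0..?m}. ennreal (slope * exp (- rho * v) * exp ((rho + eta) * t) * exp (- eta * x)) \<partial>lborel)
      = ennreal (?K * exp ((rho + eta) * ?m) - ?K * exp ((rho + eta) * 0))"
  proof (rule nn_integral_FTC_Icc)
    fix t assume "t \<in> {0..?m}"
    have e: "?K * (exp ((rho + eta) * t) * (rho + eta))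
       = slope * exp (- rho * v) * exp ((rho + eta) * t) * exp (- eta * x)"
    proof -
      have "?K * (exp ((rho + eta) * t) * (rho + eta)) = exp (- rho * v) * exp (- eta * x) * exp ((rho + eta) * t) * ((rho + eta) / disc)"
        by (simp only: divide_inverse mult_ac)
      also have "(rho + eta) / disc = slope" using d slope_eq by (metis nonzero_mult_div_cancel_right)
      finally show ?thesis by (simp add: mult_ac)
    qed
    show "((\<lambda>t. ?K * exp ((rho + eta) * t)) has_real_derivative
        slope * exp (- rho * v) * exp ((rho + eta) * t) * exp (- eta * x)) (at t)"
      unfolding e[symmetric] using d by (auto intro!: derivative_eq_intros)
    show "0 \<le> slope * exp (- rho * v) * exp ((rho + eta) * t) * exp (- eta * x)"
      using slope_pos by simp
  qed (use assms in auto)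
  also have "?K * exp ((rho + eta) * ?m) - ?K * exp ((rho + eta) * 0) = killed_kernel v x"
  proof (cases "x \<le> v")
    case True
    then show ?thesis using assms d
      by (simp add: killed_kernel_def free_kernel_neg free_kernel_pos min_def field_simps exp_add[symmetric] exp_diff)
  next
    case False
    then show ?thesis using assms d
      by (simp add: killed_kernel_def free_kernel_neg free_kernel_pos min_def field_simps exp_add[symmetric] exp_diff)
  qed
  finally show ?thesis by simp
qed

lemma killed_kernel_pos:
  assumes "v > 0" "x > 0"
  shows "killed_kernel v x > 0"
proof -
  have re: "rho + eta > 0" using rho_pos eta_pos by simp
  have d: "disc > 0" using disc_pos by simp
  show ?thesis
  proof (cases "x \<le> v")
    case True
    have "exp (- rho * v) * exp (- eta * x) < exp (rho * (x - v))"
    proof -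
      have "0 < (rho + eta) * x" using re assms by simp
      then show ?thesis by (simp add: exp_add[symmetric] algebra_simps)
    qed
    then show ?thesis using True assms d
      by (simp add: killed_kernel_def free_kernel_neg free_kernel_pos divide_simps)
  next
    case False
    have "exp (- rho * v) * exp (- eta * x) < exp (- eta * (x - v))"
    proof -
      have "0 < (rho + eta) * v" using re assms by simp
      then show ?thesis by (simp add: exp_add[symmetric] algebra_simps)
    qed
    then show ?thesis using False assms d
      by (simp add: killed_kernel_def free_kernel_neg free_kernel_pos divide_simps)
  qed
qed

definition resolvent :: "(real \<Rightarrow> ennreal) \<Rightarrow> real \<Rightarrow> ennreal" where
  "resolvent F v = (\<integral>\<^sup>+x. ennreal (killed_kernel v x) * F x * indicator {0<..} x \<partial>lborel)"

definition tail :: "(real \<Rightarrow> ennreal) \<Rightarrow> real \<Rightarrow> ennreal" where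
  "tail F t = (\<integral>\<^sup>+x. ennreal (exp (- eta * x)) * F x * indicator {t..} x * indicator {0<..} x \<partial>lborel)"

lemma resolvent_measurable [measurable]:
  assumes [measurable]: "F \<in> borel_measurable borel"
  shows "resolvent F \<in> borel_measurable borel"
  unfolding resolvent_def by measurable

lemma tail_measurable [measurable]:
  assumes [measurable]: "F \<in> borel_measurable borel"
  shows "tail F \<in> borel_measurable borel"
  unfolding tail_def by measurable

lemma tail_antimono: "s \<le> t \<Longrightarrow> tail F t \<le> tail F s"
  unfolding tail_def by (intro nn_integral_mono) (auto split: split_indicator)

text \<open>Tonelli applied to the product form of the kernel: the function \<open>F\<close>
  survives only in the monotone function \<open>tail F\<close>, and \<open>v\<close> only in an
  exponential factor and the upper limit.\<close>

lemma resolvent_eq: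
  assumes [measurable]: "F \<in> borel_measurable borel" and v: "v > 0"
  shows "resolvent F v
    = (\<integral>\<^sup>+t. ennreal (slope * exp (- rho * v) * exp ((rho + eta) * t)) * tail F t * indicator {0..v} t \<partial>lborel)"
proof -
  have "resolvent F v = (\<integral>\<^sup>+x. (\<integral>\<^sup>+t. ennreal (slope * exp (- rho * v) * exp ((rho + eta) * t))
      * (ennreal (exp (- eta * x)) * F x * indicator {t..} x * indicator {0<..} x) * indicator {0..v} t \<partial>lborel) \<partial>lborel)"
    unfolding resolvent_def
  proof (rule nn_integral_cong)
    fix x :: real
    show "ennreal (killed_kernel v x) * F x * indicator {0<..} x
      = (\<integral>\<^sup>+t. ennreal (slope * exp (- rho * v) * exp ((rho + eta) * t))
      * (ennreal (exp (- eta * x)) * F x * indicator {t..} x * indicator {0<..} x) * indicator {0..v} t \<partial>lborel)"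
    proof (cases "x > 0")
      case True
      have "ennreal (killed_kernel v x) * F x * indicator {0<..} x
        = (\<integral>\<^sup>+t. ennreal (slope * exp (- rho * v) * exp ((rho + eta) * t) * exp (- eta * x)) * indicator {0..min v x} t * F x \<partial>lborel)"
        unfolding killed_kernel_integral[OF v True] using True
        by (subst nn_integral_multc) auto
      also have "\<dots> = (\<integral>\<^sup>+t. ennreal (slope * exp (- rho * v) * exp ((rho + eta) * t))
      * (ennreal (exp (- eta * x)) * F x * indicator {t..} x * indicator {0<..} x) * indicator {0..v} t \<partial>lborel)"
        using True slope_pos
        by (intro nn_integral_cong) (auto split: split_indicator simp: ennreal_mult mult_ac)
      finally show ?thesis .
    qed simp
  qed
  also have "\<dots> = (\<integral>\<^sup>+t. (\<integral>\<^sup>+x. ennreal (slope * exp (- rho * v) * exp ((rho + eta) * t))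
      * (ennreal (exp (- eta * x)) * F x * indicator {t..} x * indicator {0<..} x) * indicator {0..v} t \<partial>lborel) \<partial>lborel)"
    by (rule lborel_pair.Fubini'[symmetric]) measurable
  also have "\<dots> = (\<integral>\<^sup>+t. ennreal (slope * exp (- rho * v) * exp ((rho + eta) * t)) * tail F t * indicator {0..v} t \<partial>lborel)"
    unfolding tail_def by (intro nn_integral_cong) (simp add: nn_integral_cmult nn_integral_multc)
  finally show ?thesis .
qed

text \<open>If the tail were infinite at \<open>t\<close>, monotonicity would make it infinite on
  all of \<open>{0..t}\<close>, and its integral against a positive weight, the resolvent at
  \<open>t\<close>, would be infinite too.\<close>

lemma tail_finite:
  assumes [measurable]: "F \<in> borel_measurable borel" and t: "t > 0" and fin: "resolvent F t < \<infinity>"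
  shows "tail F t < \<infinity>"
proof (rule ccontr)
  assume "\<not> tail F t < \<infinity>"
  then have inf: "tail F s = \<infinity>" if "s \<le> t" for s
    using tail_antimono[OF that, of F] by (simp add: not_less top_unique)
  have "(\<infinity>::ennreal) = (\<integral>\<^sup>+s. \<infinity> * indicator {0..t} s \<partial>lborel)"
    using t by (subst nn_integral_cmult_indicator) (auto simp: ennreal_top_mult)
  also have "\<dots> \<le> (\<integral>\<^sup>+s. ennreal (slope * exp (- rho * t) * exp ((rho + eta) * s)) * tail F s * indicator {0..t} s \<partial>lborel)"
    using slope_pos by (intro nn_integral_mono) (auto split: split_indicator simp: inf ennreal_mult_top)
  also have "\<dots> = resolvent F t" by (rule resolvent_eq[symmetric]) (use t in auto)
  finally show False using fin by simp
qed

context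
  fixes F :: "real \<Rightarrow> ennreal"
  assumes F [measurable]: "F \<in> borel_measurable borel"
    and fin: "\<And>v. v > 0 \<Longrightarrow> resolvent F v < \<infinity>"
begin

lemma tail_fin: "t > 0 \<Longrightarrow> tail F t < \<infinity>"
  using tail_finite[OF F] fin by auto

lemma tail_isCont:
  assumes "t > 0" shows "isCont (\<lambda>t. enn2real (tail F t)) t"
proof -
  \<comment> \<open>Truncating at \<open>t/2\<close> changes nothing near \<open>t\<close> and keeps
    all tails below the finite tail at \<open>t/2\<close>, which serves as dominating
    integral.\<close>
  have "isCont (\<lambda>s. tail F (max s (t/2))) t"
  proof (rule continuous_at_sequentiallyI)
    fix u assume u: "u \<longlonglongrightarrow> t"
    show "(\<lambda>n. tail F (max (u n) (t/2))) \<longlonglongrightarrow> tail F (max t (t/2))"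
      unfolding tail_def
    proof (rule nn_integral_dominated_convergence[where
          w="\<lambda>x. ennreal (exp (- eta * x)) * F x * indicator {t/2..} x * indicator {0<..} x"])
      show "(\<integral>\<^sup>+x. ennreal (exp (- eta * x)) * F x * indicator {t/2..} x * indicator {0<..} x \<partial>lborel) < \<infinity>"
        using tail_fin[of "t/2"] assms by (simp add: tail_def)
      have "AE x in lborel. x \<noteq> t" by (rule AE_lborel_singleton)
      then show "AE x in lborel. (\<lambda>n. ennreal (exp (- eta * x)) * F x * indicator {max (u n) (t/2)..} x * indicator {0<..} x)
          \<longlonglongrightarrow> ennreal (exp (- eta * x)) * F x * indicator {max t (t/2)..} x * indicator {0<..} x"
      proof eventually_elim
        case (elim x)
        have m: "(\<lambda>n. max (u n) (t/2)) \<longlonglongrightarrow> t"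
          using tendsto_max[OF u tendsto_const[of "t/2"]] assms by simp
        have ev: "\<forall>\<^sub>F n in sequentially. (indicator {max (u n) (t/2)..} x :: ennreal) = indicator {max t (t/2)..} x"
        proof (cases "x < t")
          case True
          have mt: "max t (t/2) = t" using assms by simp
          show ?thesis unfolding mt
            by (rule eventually_mono[OF order_tendstoD(1)[OF m True]]) (use True in \<open>auto simp: indicator_def\<close>)
        next
          case False
          then have "t < x" using elim by simp
          have mt: "max t (t/2) = t" using assms by simp
          show ?thesis unfolding mt
            by (rule eventually_mono[OF order_tendstoD(2)[OF m \<open>t < x\<close>]]) (use False in \<open>auto simp: indicator_def\<close>)
        qed
        show ?case
          by (rule tendsto_eventually) (use ev in \<open>auto elim!: eventually_mono\<close>)
      qed
    qed (auto split: split_indicator)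
  qed
  then have "isCont (\<lambda>s. enn2real (tail F (max s (t/2)))) t"
    unfolding isCont_def using tail_fin assms by (intro tendsto_enn2real) (auto simp: max_def)
  moreover have "\<forall>\<^sub>F s in nhds t. enn2real (tail F (max s (t/2))) = enn2real (tail F s)"
    using eventually_nhds_in_open[of "{t/2<..}" t] assms by (auto elim!: eventually_mono simp: max_def)
  ultimately show ?thesis by (simp add: isCont_cong)
qed

lemma resolvent_scaled:
  assumes "v > 0"
  shows "ennreal (exp (rho * v)) * resolvent F v
    = (\<integral>\<^sup>+t. ennreal (slope * exp ((rho + eta) * t) * enn2real (tail F t)) * indicator {0..v} t \<partial>lborel)"
proof -
  have "ennreal (exp (rho * v)) * resolvent F v
    = (\<integral>\<^sup>+t. ennreal (exp (rho * v)) * (ennreal (slope * exp (- rho * v) * exp ((rho + eta) * t)) * tail F t * indicator {0..v} t) \<partial>lborel)"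
    unfolding resolvent_eq[OF F assms] by (subst nn_integral_cmult) auto
  also have "\<dots> = (\<integral>\<^sup>+t. ennreal (slope * exp ((rho + eta) * t) * enn2real (tail F t)) * indicator {0..v} t \<partial>lborel)"
  proof (rule nn_integral_cong_AE)
    \<comment> \<open>At time zero the tail may be infinite, and then its real part is the default
      0; a single point does not affect the integral.\<close>
    have "AE x in lborel. x \<noteq> (0::real)" by (rule AE_lborel_singleton)
    then show "AE t in lborel. ennreal (exp (rho * v)) * (ennreal (slope * exp (- rho * v) * exp ((rho + eta) * t)) * tail F t * indicator {0..v} t)
      = ennreal (slope * exp ((rho + eta) * t) * enn2real (tail F t)) * indicator {0..v} t"
    proof eventually_elim
      case (elim t)
      show ?case
      proof (cases "t \<in> {0..v}")
        case True
        then have t: "t > 0" using elim by auto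
        have "ennreal (slope * exp ((rho + eta) * t) * enn2real (tail F t))
           = ennreal (exp (rho * v) * (slope * exp (- rho * v) * exp ((rho + eta) * t))) * tail F t"
          using slope_pos tail_fin[OF t] by (simp add: ennreal_mult exp_minus field_simps)
        then show ?thesis using True slope_pos by (simp add: ennreal_mult mult.assoc)
      qed simp
    qed
  qed
  finally show ?thesis .
qed

lemma resolvent_has_derivative:
  assumes v: "v > 0"
  shows "((\<lambda>v. enn2real (resolvent F v)) has_real_derivative
    - rho * enn2real (resolvent F v) + slope * exp (eta * v) * enn2real (tail F v)) (at v)"
proof -
  define l where "l = (\<lambda>t. slope * exp ((rho + eta) * t) * enn2real (tail F t))"
  have l_meas[measurable]: "l \<in> borel_measurable borel" unfolding l_def by measurable
  have l_nonneg: "l t \<ge> 0" for t using slope_pos by (simp add: l_def)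
  \<comment> \<open>The integral up to \<open>e\<close> is a finite constant, stored in
    \<open>K\<close>. Continuity of the integrand is available only away from zero, and starting the
    primitive at \<open>d < e\<close> makes it differentiable from both sides on all of
    \<open>{e..x}\<close>.\<close>
  define d e b where "d = v / 4" and "e = v / 2" and "b = v + 1"
  have e: "0 < e" "e < v" "v < b" and d: "0 < d" "d < e" using v by (auto simp: d_def e_def b_def)
  have cont: "continuous_on {d..b} l"
    unfolding l_def using d(1) by (intro continuous_intros continuous_at_imp_continuous_on) (auto intro!: tail_isCont)
  define G where "G = (\<lambda>x. integral {d..x} l)"
  have G: "(G has_real_derivative l x) (at x)" if "x \<in> {d<..<b}" for x
  proof -
    have "(G has_real_derivative l x) (at x within {d..b})"
      unfolding G_def using integral_has_real_derivative[OF cont, of x] that by simp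
    then show ?thesis
      using that by (subst (asm) at_within_interior) (auto simp: interior_atLeastAtMost_real)
  qed
  define K where "K = enn2real (ennreal (exp (rho * e)) * resolvent F e) - G e"
  have h_eq: "enn2real (resolvent F x) = exp (- rho * x) * (K + G x)" if x: "x \<in> {e<..<b}" for x
  proof -
    have x0: "x > 0" using x e by auto
    have "ennreal (exp (rho * x)) * resolvent F x = (\<integral>\<^sup>+t. ennreal (l t) * indicator {0..x} t \<partial>lborel)"
      using resolvent_scaled[OF x0] by (simp add: l_def)
    also have "\<dots> = (\<integral>\<^sup>+t. ennreal (l t) * indicator {0..e} t + ennreal (l t) * indicator {e..x} t \<partial>lborel)"
    proof (rule nn_integral_cong_AE)
      have "AE t in lborel. t \<noteq> e" by (rule AE_lborel_singleton)
      then show "AE t in lborel. ennreal (l t) * indicator {0..x} t = ennreal (l t) * indicator {0..e} t + ennreal (l t) * indicator {e..x} t"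
        by eventually_elim (use x e in \<open>auto split: split_indicator\<close>)
    qed
    also have "\<dots> = (\<integral>\<^sup>+t. ennreal (l t) * indicator {0..e} t \<partial>lborel) + (\<integral>\<^sup>+t. ennreal (l t) * indicator {e..x} t \<partial>lborel)"
      by (rule nn_integral_add) auto
    also have "(\<integral>\<^sup>+t. ennreal (l t) * indicator {0..e} t \<partial>lborel) = ennreal (exp (rho * e)) * resolvent F e"
      using resolvent_scaled[OF e(1)] by (simp add: l_def)
    also have "(\<integral>\<^sup>+t. ennreal (l t) * indicator {e..x} t \<partial>lborel) = ennreal (G x - G e)"
    proof (rule nn_integral_FTC_Icc[where F=G])
      fix t assume "t \<in> {e..x}"
      then show "(G has_real_derivative l t) (at t)"
        using x d by (intro G) auto
    qed (use x l_nonneg in auto)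
    finally have *: "ennreal (exp (rho * x)) * resolvent F x = ennreal (exp (rho * e)) * resolvent F e + ennreal (G x - G e)" .
    have Gx: "G x - G e \<ge> 0"
    proof -
      have "G e \<le> G x"
      proof (rule DERIV_nonneg_imp_nondecreasing[of e x G])
        show "e \<le> x" using x by simp
      next
        fix t assume "e \<le> t" "t \<le> x"
        then show "\<exists>y. (G has_real_derivative y) (at t) \<and> y \<ge> 0"
          using G[of t] x d l_nonneg[of t] by auto
      qed
      then show ?thesis by simp
    qed
    have "exp (rho * x) * enn2real (resolvent F x) = K + G x"
      using arg_cong[OF *, of enn2real] Gx fin[OF e(1)]
      by (simp add: enn2real_mult K_def enn2real_plus ennreal_mult_less_top)
    then show ?thesis by (simp add: exp_minus field_simps)
  qed
  have "((\<lambda>x. exp (- rho * x) * (K + G x)) has_real_derivative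
     (exp (- rho * v) * (- rho)) * (K + G v) + l v * exp (- rho * v)) (at v)"
  proof -
    have "(G has_real_derivative l v) (at v)"
      using G[of v] e d by simp
    then show ?thesis by (auto intro!: derivative_eq_intros)
  qed
  then have "((\<lambda>v. enn2real (resolvent F v)) has_real_derivative
     (exp (- rho * v) * (- rho)) * (K + G v) + l v * exp (- rho * v)) (at v)"
    by (rule has_field_derivative_transform_within_open[where S="{e<..<b}"]) (use e h_eq in auto)
  moreover have "(exp (- rho * v) * (- rho)) * (K + G v) + l v * exp (- rho * v)
    = - rho * enn2real (resolvent F v) + slope * exp (eta * v) * enn2real (tail F v)"
  proof -
    have "exp ((rho + eta) * v) * exp (- rho * v) = exp (eta * v)"
      by (simp add: exp_add[symmetric] algebra_simps)
    then have "l v * exp (- rho * v) = slope * exp (eta * v) * enn2real (tail F v)"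
      by (simp add: l_def mult_ac)
    then show ?thesis using e by (simp add: h_eq)
  qed
  ultimately show ?thesis by simp
qed

lemma resolvent_tendsto_0: "((\<lambda>v. enn2real (resolvent F v)) \<longlongrightarrow> 0) (at_right 0)"
proof (rule tendsto_at_right_sequentially[where b=1])
  fix S :: "nat \<Rightarrow> real"
  assume S: "\<And>n. 0 < S n" "\<And>n. S n < 1" "decseq S" "S \<longlonglongrightarrow> 0"
  let ?l = "\<lambda>t. slope * exp ((rho + eta) * t) * enn2real (tail F t)"
  have "(\<lambda>n. ennreal (exp (rho * S n)) * resolvent F (S n)) \<longlonglongrightarrow> (\<integral>\<^sup>+(t::real). 0 \<partial>lborel)"
    unfolding resolvent_scaled[OF S(1)]
  proof (rule nn_integral_dominated_convergence[where w="\<lambda>t. ennreal (?l t) * indicator {0..1} t"])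
    show "(\<integral>\<^sup>+t. ennreal (?l t) * indicator {0..1} t \<partial>lborel) < \<infinity>"
      unfolding resolvent_scaled[OF zero_less_one, symmetric] using fin[of 1] by (simp add: ennreal_mult_less_top)
    show "AE t in lborel. ennreal (?l t) * indicator {0..S i} t \<le> ennreal (?l t) * indicator {0..1} t" for i
      using S(2)[of i] by (intro AE_I2) (auto split: split_indicator)
    have "AE t in lborel. t \<noteq> (0::real)" by (rule AE_lborel_singleton)
    then show "AE t in lborel. (\<lambda>n. ennreal (?l t) * indicator {0..S n} t) \<longlonglongrightarrow> 0"
    proof eventually_elim
      case (elim t)
      have "\<forall>\<^sub>F n in sequentially. ennreal (?l t) * indicator {0..S n} t = 0"
      proof (cases "t < 0")
        case False
        then have "0 < t" using elim by simp
        show ?thesis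
          by (rule eventually_mono[OF order_tendstoD(2)[OF S(4) \<open>0 < t\<close>]]) (auto simp: indicator_def)
      qed auto
      then show ?case by (rule tendsto_eventually)
    qed
  qed auto
  then have "(\<lambda>n. enn2real (ennreal (exp (rho * S n)) * resolvent F (S n))) \<longlonglongrightarrow> enn2real 0"
    by (intro tendsto_enn2real) auto
  then have "(\<lambda>n. exp (rho * S n) * enn2real (resolvent F (S n))) \<longlonglongrightarrow> 0"
    by (simp add: enn2real_mult)
  moreover have "(\<lambda>n. exp (- rho * S n)) \<longlonglongrightarrow> exp (- rho * 0)"
    by (intro tendsto_intros S)
  ultimately have "(\<lambda>n. exp (- rho * S n) * (exp (rho * S n) * enn2real (resolvent F (S n)))) \<longlonglongrightarrow> exp (- rho * 0) * 0"
    by (intro tendsto_mult)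
  moreover have "exp (- rho * S n) * (exp (rho * S n) * x) = x" for n x
    by (simp add: exp_minus)
  ultimately show "(\<lambda>n. enn2real (resolvent F (S n))) \<longlonglongrightarrow> 0"
    by (simp only: mult_zero_right)
qed simp

text \<open>The tail is a primitive of \<open>- exp (- eta * y) * F y\<close> as a real function,
  which prepares the second differentiation.\<close>

lemma tail_diff:
  assumes "0 < a" "a \<le> x" and F_fin: "\<And>y. F y < \<infinity>"
  shows "(\<lambda>y. exp (- eta * y) * enn2real (F y)) integrable_on {a..x}"
    "enn2real (tail F a) - enn2real (tail F x) = integral {a..x} (\<lambda>y. exp (- eta * y) * enn2real (F y))"
proof -
  let ?g = "\<lambda>y. exp (- eta * y) * enn2real (F y)"
  have "tail F a = (\<integral>\<^sup>+y. ennreal (exp (- eta * y)) * F y * indicator {x..} y * indicator {0<..} y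
      + ennreal (indicator {a..x} y *\<^sub>R ?g y) \<partial>lborel)"
    unfolding tail_def
  proof (rule nn_integral_cong_AE)
    have "AE t in lborel. t \<noteq> x" by (rule AE_lborel_singleton)
    then show "AE y in lborel. ennreal (exp (- eta * y)) * F y * indicator {a..} y * indicator {0<..} y
       = ennreal (exp (- eta * y)) * F y * indicator {x..} y * indicator {0<..} y
      + ennreal (indicator {a..x} y *\<^sub>R ?g y)"
      by eventually_elim (use assms in \<open>auto split: split_indicator simp: ennreal_mult\<close>)
  qed
  also have "\<dots> = tail F x + (\<integral>\<^sup>+y. ennreal (indicator {a..x} y *\<^sub>R ?g y) \<partial>lborel)"
    unfolding tail_def by (rule nn_integral_add) auto
  finally have *: "tail F a = tail F x + (\<integral>\<^sup>+y. ennreal (indicator {a..x} y *\<^sub>R ?g y) \<partial>lborel)" .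
  then have f: "(\<integral>\<^sup>+y. ennreal (indicator {a..x} y *\<^sub>R ?g y) \<partial>lborel) < \<infinity>"
    using tail_fin[OF assms(1)] by (auto simp: top_unique less_top[symmetric])
  have int: "set_integrable lborel {a..x} ?g"
    unfolding set_integrable_def by (rule integrableI_nonneg) (use f in auto)
  then show "?g integrable_on {a..x}" by (rule set_borel_integral_eq_integral)
  have "(\<integral>\<^sup>+y. ennreal (indicator {a..x} y *\<^sub>R ?g y) \<partial>lborel) = ennreal (LBINT y:{a..x}. ?g y)"
    using int unfolding set_integrable_def set_lebesgue_integral_def
    by (intro nn_integral_eq_integral) auto
  then have "tail F a = tail F x + ennreal (LBINT y:{a..x}. ?g y)" using * by simp
  moreover have "(LBINT y:{a..x}. ?g y) \<ge> 0"
    unfolding set_lebesgue_integral_def by (intro integral_nonneg_AE) auto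
  ultimately have "enn2real (tail F a) = enn2real (tail F x) + (LBINT y:{a..x}. ?g y)"
    using tail_fin[of x] assms by (simp add: enn2real_plus)
  then show "enn2real (tail F a) - enn2real (tail F x) = integral {a..x} ?g"
    using set_borel_integral_eq_integral(2)[OF int] by simp
qed

end

text \<open>The generator minus \<open>lam\<close> factors as \<open>\<sigma>^2 / 2\<close> times
  \<open>(D - eta) (D + rho)\<close>. Inverting the inner factor is
  \<open>resolvent_has_derivative\<close> and needs no continuity; the outer one is the fundamental
  theorem at a continuity point of \<open>f\<close>. Two nonnegative sources are carried along
  because the source of a signed penalty is a difference, and only that difference is
  continuous.\<close>

lemma resolvent_ode:
  fixes F1 F2 :: "real \<Rightarrow> ennreal" and h f :: "real \<Rightarrow> real"
  assumes F1 [measurable]: "F1 \<in> borel_measurable borel" and F2 [measurable]: "F2 \<in> borel_measurable borel"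
    and F1_fin: "\<And>y. F1 y < \<infinity>" and F2_fin: "\<And>y. F2 y < \<infinity>"
    and r1: "\<And>v. v > 0 \<Longrightarrow> resolvent F1 v < \<infinity>" and r2: "\<And>v. v > 0 \<Longrightarrow> resolvent F2 v < \<infinity>"
  defines "h \<equiv> \<lambda>v. enn2real (resolvent F1 v) - enn2real (resolvent F2 v)"
    and "f \<equiv> \<lambda>v. enn2real (F1 v) - enn2real (F2 v)"
  obtains h' where "\<And>v. v > 0 \<Longrightarrow> (h has_real_derivative h' v) (at v)"
    "\<And>u. u > 0 \<Longrightarrow> isCont f u \<Longrightarrow> \<exists>h2. (h' has_real_derivative h2) (at u) \<and>
        \<sigma>\<^sup>2 / 2 * h2 + c * h' u - lam * h u + f u = 0"
    "(h \<longlongrightarrow> 0) (at_right 0)"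
proof
  define j where "j = (\<lambda>t. enn2real (tail F1 t) - enn2real (tail F2 t))"
  define h' where "h' = (\<lambda>v. - rho * h v + slope * exp (eta * v) * j v)"
  show dh: "(h has_real_derivative h' v) (at v)" if "v > 0" for v
    using DERIV_diff[OF resolvent_has_derivative[OF F1 r1 that] resolvent_has_derivative[OF F2 r2 that]]
    by (simp add: h_def h'_def j_def algebra_simps)
  show "(h \<longlongrightarrow> 0) (at_right 0)"
    using tendsto_diff[OF resolvent_tendsto_0[OF F1 r1] resolvent_tendsto_0[OF F2 r2]]
    by (simp add: h_def)
  fix u :: real assume u: "u > 0" and cont: "isCont f u"
  define a b where "a = u / 2" and "b = u + 1"
  have ab: "0 < a" "a < u" "u < b" using u by (auto simp: a_def b_def)
  let ?g1 = "\<lambda>y. exp (- eta * y) * enn2real (F1 y)" and ?g2 = "\<lambda>y. exp (- eta * y) * enn2real (F2 y)"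
  have j_eq: "j x = j a - integral {a..x} (\<lambda>y. exp (- eta * y) * f y)" if "x \<in> {a..b}" for x
  proof -
    have "integral {a..x} (\<lambda>y. ?g1 y - ?g2 y) = integral {a..x} ?g1 - integral {a..x} ?g2"
      using tail_diff(1)[OF F1 r1 ab(1) _ F1_fin, of x] tail_diff(1)[OF F2 r2 ab(1) _ F2_fin, of x] that
      by (intro Henstock_Kurzweil_Integration.integral_diff) auto
    then show ?thesis
      using tail_diff(2)[OF F1 r1 ab(1) _ F1_fin, of x] tail_diff(2)[OF F2 r2 ab(1) _ F2_fin, of x] that
      by (simp add: j_def f_def algebra_simps)
  qed
  have int: "(\<lambda>y. exp (- eta * y) * f y) integrable_on {a..b}"
  proof -
    have "(\<lambda>y. ?g1 y - ?g2 y) integrable_on {a..b}"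
      using tail_diff(1)[OF F1 r1 ab(1) _ F1_fin, of b] tail_diff(1)[OF F2 r2 ab(1) _ F2_fin, of b] ab
      by (intro integrable_diff) auto
    then show ?thesis by (simp add: f_def algebra_simps)
  qed
  have "((\<lambda>x. integral {a..x} (\<lambda>y. exp (- eta * y) * f y)) has_vector_derivative exp (- eta * u) * f u) (at u within {a..b})"
  proof -
    have "isCont (\<lambda>y. exp (- eta * y) * f y) u"
      by (intro isCont_mult cont continuous_intros)
    then have "continuous (at u within {a..b}) (\<lambda>y. exp (- eta * y) * f y)"
      by (rule continuous_at_imp_continuous_at_within)
    then show ?thesis
      using integral_has_vector_derivative_continuous_at[OF int, of u "{}"] ab by simp
  qed
  then have "((\<lambda>x. integral {a..x} (\<lambda>y. exp (- eta * y) * f y)) has_real_derivative exp (- eta * u) * f u) (at u)"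
    using ab by (subst (asm) at_within_interior)
      (auto simp: interior_atLeastAtMost_real has_real_derivative_iff_has_vector_derivative)
  then have "((\<lambda>x. j a - integral {a..x} (\<lambda>y. exp (- eta * y) * f y)) has_real_derivative - (exp (- eta * u) * f u)) (at u)"
    by (auto intro!: derivative_eq_intros)
  then have dj: "(j has_real_derivative - (exp (- eta * u) * f u)) (at u)"
  proof (rule has_field_derivative_transform_within_open[where S="{a<..<b}"])
    fix x assume "x \<in> {a<..<b}"
    then show "j a - integral {a..x} (\<lambda>y. exp (- eta * y) * f y) = j x"
      using j_eq[of x] by simp
  qed (use ab in auto)
  define h2 where "h2 = - rho * h' u + (slope * exp (eta * u) * eta * j u - slope * f u)"
  have de: "((\<lambda>v. slope * exp (eta * v)) has_real_derivative slope * (exp (eta * u) * eta)) (at u)"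
    by (auto intro!: derivative_eq_intros)
  have "((\<lambda>v. - rho * h v + slope * exp (eta * v) * j v) has_real_derivative
     - rho * h' u + (slope * (exp (eta * u) * eta) * j u + - (exp (- eta * u) * f u) * (slope * exp (eta * u)))) (at u)"
    by (rule DERIV_add[OF DERIV_cmult[OF dh[OF u]] DERIV_mult[OF de dj]])
  also have "(\<lambda>v. - rho * h v + slope * exp (eta * v) * j v) = h'"
    by (simp add: h'_def)
  also have "- rho * h' u + (slope * (exp (eta * u) * eta) * j u + - (exp (- eta * u) * f u) * (slope * exp (eta * u))) = h2"
    by (simp add: h2_def exp_minus)
  finally have "(h' has_real_derivative h2) (at u)" .
  moreover have "\<sigma>\<^sup>2 / 2 * h2 + c * h' u - lam * h u + f u = 0"
  proof -
    have s: "\<sigma>\<^sup>2 / 2 * slope = 1" using sigma_pos by (simp add: slope_def)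
    have d: "\<sigma>\<^sup>2 / 2 * (rho - eta) = c" using sigma_pos by (simp add: rho_eta_diff)
    have p: "\<sigma>\<^sup>2 / 2 * (rho * eta) = lam" using sigma_pos by (simp add: rho_eta_prod)
    have "h2 = - rho * h' u + eta * (h' u + rho * h u) - slope * f u"
      by (simp add: h2_def h'_def algebra_simps)
    then have "\<sigma>\<^sup>2 / 2 * h2 = \<sigma>\<^sup>2 / 2 * (- rho * h' u + eta * (h' u + rho * h u) - slope * f u)"
      by simp
    also have "\<dots> = - (\<sigma>\<^sup>2 / 2 * (rho - eta)) * h' u + (\<sigma>\<^sup>2 / 2 * (rho * eta)) * h u - (\<sigma>\<^sup>2 / 2 * slope) * f u"
      by (simp add: field_simps)
    finally have "\<sigma>\<^sup>2 / 2 * h2 = - (\<sigma>\<^sup>2 / 2 * (rho - eta)) * h' u + (\<sigma>\<^sup>2 / 2 * (rho * eta)) * h u - (\<sigma>\<^sup>2 / 2 * slope) * f u" .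
    then show ?thesis unfolding s d p by linarith
  qed
  ultimately show "\<exists>h2. (h' has_real_derivative h2) (at u) \<and> \<sigma>\<^sup>2 / 2 * h2 + c * h' u - lam * h u + f u = 0"
    by blast
qed

end

section \<open>Independence and sigma-algebras of processes\<close>

text \<open>The identity map, seen as a random variable into \<open>G1\<close> and into
  \<open>G2\<close>, gives two independent variables whose joint law is a product; Tonelli on that
  product replaces the diagonal by a double integral. Every later use of independence passes through
  this form.\<close>

lemma (in prob_space) nn_integral_freeze:
  assumes sp: "space G1 = space M" "space G2 = space M"
    and sub: "sets G1 \<subseteq> sets M" "sets G2 \<subseteq> sets M"
    and ind: "indep_set (sets G1) (sets G2)"
    and H [measurable]: "case_prod H \<in> borel_measurable (G1 \<Otimes>\<^sub>M G2)"
  shows "(\<integral>\<^sup>+\<omega>. H \<omega> \<omega> \<partial>M) = (\<integral>\<^sup>+\<omega>. (\<integral>\<^sup>+\<omega>'. H \<omega> \<omega>' \<partial>M) \<partial>M)"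
proof -
  have id: "(\<lambda>\<omega>. \<omega>) \<in> measurable M G" if "space G = space M" "sets G \<subseteq> sets M" for G
    by (rule measurableI) (use that in \<open>auto simp: vimage_ident\<close>)
  have id1 [measurable]: "(\<lambda>\<omega>. \<omega>) \<in> measurable M G1" and id2 [measurable]: "(\<lambda>\<omega>. \<omega>) \<in> measurable M G2"
    using sp sub by (auto intro: id)
  have pre: "sigma_sets (space M) {(\<lambda>\<omega>. \<omega>) -` A \<inter> space M |A. A \<in> sets G} = sets G"
    if "space G = space M" for G
  proof -
    have "(\<lambda>\<omega>. \<omega>) -` A \<inter> space M = A" if "A \<in> sets G" for A
      using sets.Int_space_eq2[OF that] \<open>space G = space M\<close> by (simp add: vimage_ident)
    then have "{(\<lambda>\<omega>. \<omega>) -` A \<inter> space M |A. A \<in> sets G} = sets G"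
      unfolding Setcompr_eq_image by (simp cong: image_cong)
    then show ?thesis using sets.sigma_sets_eq[of G] that by simp
  qed
  have "indep_var G1 (\<lambda>\<omega>. \<omega>) G2 (\<lambda>\<omega>. \<omega>)"
    unfolding indep_var_eq pre[OF sp(1)] pre[OF sp(2)] using ind by simp
  then have eq: "distr M G1 (\<lambda>\<omega>. \<omega>) \<Otimes>\<^sub>M distr M G2 (\<lambda>\<omega>. \<omega>) = distr M (G1 \<Otimes>\<^sub>M G2) (\<lambda>\<omega>. (\<omega>, \<omega>))"
    unfolding indep_var_distribution_eq by simp
  interpret D1: prob_space "distr M G1 (\<lambda>\<omega>. \<omega>)" by (rule prob_space_distr) simp
  interpret D2: prob_space "distr M G2 (\<lambda>\<omega>. \<omega>)" by (rule prob_space_distr) simp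
  have H2 [measurable]: "(\<lambda>\<omega>'. H \<omega> \<omega>') \<in> borel_measurable G2" if "\<omega> \<in> space M" for \<omega>
    using measurable_Pair2[OF H, of \<omega>] that sp by simp
  have "(\<integral>\<^sup>+\<omega>. H \<omega> \<omega> \<partial>M) = (\<integral>\<^sup>+x. case_prod H x \<partial>distr M (G1 \<Otimes>\<^sub>M G2) (\<lambda>\<omega>. (\<omega>, \<omega>)))"
    by (subst nn_integral_distr) auto
  also have "\<dots> = (\<integral>\<^sup>+\<omega>. (\<integral>\<^sup>+\<omega>'. H \<omega> \<omega>' \<partial>distr M G2 (\<lambda>\<omega>. \<omega>)) \<partial>distr M G1 (\<lambda>\<omega>. \<omega>))"
    unfolding eq[symmetric] by (subst D2.nn_integral_fst[symmetric]) auto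
  also have "\<dots> = (\<integral>\<^sup>+\<omega>. (\<integral>\<^sup>+\<omega>'. H \<omega> \<omega>' \<partial>distr M G2 (\<lambda>\<omega>. \<omega>)) \<partial>M)"
  proof (rule nn_integral_distr)
    have "(\<lambda>\<omega>. \<integral>\<^sup>+\<omega>'. H \<omega> \<omega>' \<partial>distr M G2 (\<lambda>\<omega>. \<omega>)) \<in> borel_measurable G1"
      by (rule D2.borel_measurable_nn_integral) simp
    then show "(\<lambda>\<omega>. \<integral>\<^sup>+\<omega>'. H \<omega> \<omega>' \<partial>distr M G2 (\<lambda>\<omega>. \<omega>)) \<in> borel_measurable (distr M G1 (\<lambda>\<omega>. \<omega>))"
      by simp
  qed simp
  also have "\<dots> = (\<integral>\<^sup>+\<omega>. (\<integral>\<^sup>+\<omega>'. H \<omega> \<omega>' \<partial>M) \<partial>M)"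
    by (intro nn_integral_cong nn_integral_distr) auto
  finally show ?thesis .
qed

lemma (in prob_space) indep_set_mono:
  assumes "indep_set A B" and sub: "A' \<subseteq> A" "B' \<subseteq> B"
  shows "indep_set A' B'"
proof -
  have "A \<subseteq> events" "B \<subseteq> events" and *: "\<And>a b. a \<in> A \<Longrightarrow> b \<in> B \<Longrightarrow> prob (a \<inter> b) = prob a * prob b"
    using assms(1) by (auto simp: indep_sets2_eq)
  with sub show ?thesis
    unfolding indep_sets2_eq by (intro conjI ballI *) auto
qed

definition process_sigma ::
  "'a measure \<Rightarrow> 'b measure \<Rightarrow> 'i set \<Rightarrow> ('i \<Rightarrow> 'a \<Rightarrow> 'b) \<Rightarrow> 'a measure" where
  "process_sigma M N I X = sigma (space M) (process_events M N I X)"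

lemma process_events_subset_Pow: "process_events M N I X \<subseteq> Pow (space M)"
proof -
  have "(\<Union>t\<in>I. {X t -` A \<inter> space M |A. A \<in> sets N}) \<subseteq> Pow (space M)" by auto
  from sigma_sets_into_sp[OF this] show ?thesis unfolding process_events_def by auto
qed

lemma space_process_sigma [simp]: "space (process_sigma M N I X) = space M"
  by (simp add: process_sigma_def space_measure_of_conv)

lemma sets_process_sigma: "sets (process_sigma M N I X) = process_events M N I X"
proof -
  have "(\<Union>t\<in>I. {X t -` A \<inter> space M |A. A \<in> sets N}) \<subseteq> Pow (space M)" by auto
  then interpret sigma_algebra "space M" "process_events M N I X"
    unfolding process_events_def by (rule sigma_algebra_sigma_sets)
  show ?thesis
    unfolding process_sigma_def using process_events_subset_Pow[of M N I X]
    by (simp add: sets_measure_of_conv sigma_sets_eq)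
qed

lemma measurable_process_sigma:
  assumes "t \<in> I" "X t \<in> space M \<rightarrow> space N"
  shows "X t \<in> measurable (process_sigma M N I X) N"
  using assms unfolding measurable_def
  by (auto simp: sets_process_sigma process_events_def intro!: sigma_sets.Basic)

lemma process_events_subset_sets:
  assumes "\<And>t. t \<in> I \<Longrightarrow> X t \<in> measurable F N" and sp: "space F = space M"
  shows "process_events M N I X \<subseteq> sets F"
  unfolding process_events_def sp[symmetric]
proof (rule sets.sigma_sets_subset, safe)
  fix t A assume "t \<in> I" "A \<in> sets N"
  then show "X t -` A \<inter> space F \<in> sets F" using assms(1) by (auto intro: measurable_sets)
qed

lemma process_events_mono: "I \<subseteq> I' \<Longrightarrow> process_events M N I X \<subseteq> process_events M N I' X"
  unfolding process_events_def by (rule sigma_sets_mono') auto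

lemma process_sigma_sub:
  assumes "\<And>t. t \<in> I \<Longrightarrow> X t \<in> measurable M N"
  shows "sets (process_sigma M N I X) \<subseteq> sets M"
  unfolding sets_process_sigma by (rule process_events_subset_sets) (use assms in auto)

lemma Int_stable_incseq_Union:
  assumes "incseq A" and "\<And>n. Int_stable (A n)"
  shows "Int_stable (\<Union>n::nat. A n)"
proof (rule Int_stableI)
  fix a b assume "a \<in> (\<Union>n. A n)" "b \<in> (\<Union>n. A n)"
  then obtain m n where "a \<in> A m" "b \<in> A n" by auto
  then have "a \<in> A (max m n)" "b \<in> A (max m n)"
    using incseqD[OF assms(1)] by (meson max.cobounded1 max.cobounded2 subsetD)+
  then show "a \<inter> b \<in> (\<Union>n. A n)"
    using Int_stableD[OF assms(2)] by blast
qed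

lemma Int_stable_process_events: "Int_stable (process_events M N I X)"
  unfolding sets_process_sigma[symmetric] by (rule sets.Int_stable)

section \<open>Continuous processes\<close>

definition path_shift :: "real \<Rightarrow> (real \<Rightarrow> real) \<Rightarrow> real \<Rightarrow> real" where
  "path_shift s y = (\<lambda>t. y (s + t) - y s)"

definition cont_process :: "'a measure \<Rightarrow> (real \<Rightarrow> 'a \<Rightarrow> real) \<Rightarrow> bool" where
  "cont_process F Y \<longleftrightarrow> (\<forall>t\<ge>0. Y t \<in> borel_measurable F) \<and>
     (\<forall>\<omega>\<in>space F. continuous_on {0..} (\<lambda>t. Y t \<omega>))"

lemma cont_process_compose:
  assumes "cont_process F Y" and "f \<in> measurable G F"
  shows "cont_process G (\<lambda>t \<omega>. Y t (f \<omega>))"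
  using assms measurable_space[OF assms(2)] unfolding cont_process_def
  by (auto intro: measurable_compose[OF assms(2)])

text \<open>A random time rounded down to a grid takes countably many values, and path continuity
  passes to the limit. Processes are controlled only for nonnegative times, hence the truncation by
  \<open>max 0\<close>.\<close>

lemma cont_process_at:
  assumes Y: "cont_process F Y" and T [measurable]: "T \<in> borel_measurable F"
  shows "(\<lambda>\<omega>. Y (max 0 (T \<omega>)) \<omega>) \<in> borel_measurable F"
proof (rule borel_measurable_LIMSEQ_real)
  define r where "r = (\<lambda>(n::nat) t::real. real (nat \<lfloor>real (Suc n) * max 0 t\<rfloor>) / real (Suc n))"
  have [measurable]: "Y t \<in> borel_measurable F" if "t \<ge> 0" for t
    using Y that by (simp add: cont_process_def)
  show "(\<lambda>\<omega>. Y (r n (T \<omega>)) \<omega>) \<in> borel_measurable F" for n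
    unfolding r_def
    by (rule measurable_compose_countable[where f="\<lambda>k \<omega>. Y (real k / real (Suc n)) \<omega>" and g="\<lambda>\<omega>. nat \<lfloor>real (Suc n) * max 0 (T \<omega>)\<rfloor>"]) measurable
  fix \<omega> assume w: "\<omega> \<in> space F"
  define t where "t = max 0 (T \<omega>)"
  have t: "t \<ge> 0" by (simp add: t_def)
  have le: "r n t \<le> t" and ge: "t - 1 / real (Suc n) \<le> r n t" and nn: "r n t \<ge> 0" for n
  proof -
    have 1: "real (nat \<lfloor>real (Suc n) * max 0 t\<rfloor>) = of_int \<lfloor>real (Suc n) * t\<rfloor>"
      using t by (simp add: max_def)
    have "of_int \<lfloor>real (Suc n) * t\<rfloor> \<le> real (Suc n) * t" by linarith
    then show "r n t \<le> t" unfolding r_def 1 by (simp add: divide_le_eq mult.commute)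
    have "real (Suc n) * t - 1 \<le> of_int \<lfloor>real (Suc n) * t\<rfloor>" by linarith
    then have "(real (Suc n) * t - 1) / real (Suc n) \<le> of_int \<lfloor>real (Suc n) * t\<rfloor> / real (Suc n)"
      by (rule divide_right_mono) simp
    then show "t - 1 / real (Suc n) \<le> r n t" unfolding r_def 1 by (simp add: diff_divide_distrib)
    show "r n t \<ge> 0" by (simp add: r_def)
  qed
  have lim: "(\<lambda>n. r n t) \<longlonglongrightarrow> t"
  proof (rule real_tendsto_sandwich)
    show "(\<lambda>n. t - 1 / real (Suc n)) \<longlonglongrightarrow> t"
      using tendsto_diff[OF tendsto_const[of t] LIMSEQ_inverse_real_of_nat]
      by (simp add: inverse_eq_divide)
  qed (use le ge in auto)
  have "continuous_on {0..} (\<lambda>t. Y t \<omega>)" using Y w by (simp add: cont_process_def)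
  then have "(\<lambda>n. Y (r n t) \<omega>) \<longlonglongrightarrow> Y t \<omega>"
    using continuous_on_tendsto_compose[OF _ lim] t nn by fastforce
  moreover have "r n t = r n (T \<omega>)" for n by (simp add: r_def t_def)
  ultimately show "(\<lambda>n. Y (r n (T \<omega>)) \<omega>) \<longlonglongrightarrow> Y (max 0 (T \<omega>)) \<omega>"
    by (simp add: t_def)
qed

lemma cont_process_shift:
  assumes Y: "cont_process F Y" and [measurable]: "S \<in> borel_measurable F" and S: "\<And>\<omega>. \<omega> \<in> space F \<Longrightarrow> S \<omega> \<ge> 0"
  shows "cont_process F (\<lambda>t \<omega>. path_shift (S \<omega>) (\<lambda>t. Y t \<omega>) t)"
  unfolding cont_process_def
proof (intro conjI allI ballI impI)
  fix t :: real assume t: "t \<ge> 0"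
  have "(\<lambda>\<omega>. Y (max 0 (S \<omega> + t)) \<omega> - Y (max 0 (S \<omega>)) \<omega>) \<in> borel_measurable F"
    by (intro borel_measurable_diff cont_process_at[OF Y]) measurable
  then show "(\<lambda>\<omega>. path_shift (S \<omega>) (\<lambda>t. Y t \<omega>) t) \<in> borel_measurable F"
    by (rule measurable_cong[THEN iffD1, rotated]) (use S t in \<open>simp add: path_shift_def max_def\<close>)
next
  fix \<omega> assume w: "\<omega> \<in> space F"
  have "continuous_on {0..} (\<lambda>t. Y t \<omega>)" using Y w by (simp add: cont_process_def)
  then have "continuous_on {0..} (\<lambda>t. Y (S \<omega> + t) \<omega>)"
    by (rule continuous_on_compose2) (use S[OF w] in \<open>auto intro!: continuous_intros\<close>)
  then show "continuous_on {0..} (\<lambda>t. path_shift (S \<omega>) (\<lambda>t. Y t \<omega>) t)"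
    unfolding path_shift_def by (intro continuous_intros)
qed

lemma process_events_dense:
  fixes X :: "real \<Rightarrow> 'a \<Rightarrow> real"
  assumes dense: "\<And>t. t \<in> I \<Longrightarrow> \<exists>r. (\<forall>n. r n \<in> D) \<and> r \<longlonglongrightarrow> t" and "D \<subseteq> I"
    and cont: "\<And>\<omega>. \<omega> \<in> space M \<Longrightarrow> continuous_on I (\<lambda>t. X t \<omega>)"
  shows "process_events M borel I X \<subseteq> process_events M borel D X"
proof -
  let ?F = "process_sigma M borel D X"
  have "process_events M borel I X \<subseteq> sets ?F"
  proof (rule process_events_subset_sets)
    fix t assume t: "t \<in> I"
    from dense[OF t] obtain r where r: "\<And>n. r n \<in> D" "r \<longlonglongrightarrow> t" by auto
    show "X t \<in> borel_measurable ?F"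
    proof (rule borel_measurable_LIMSEQ_real)
      show "X (r n) \<in> borel_measurable ?F" for n
        by (rule measurable_process_sigma) (use r in auto)
      fix \<omega> assume "\<omega> \<in> space ?F"
      then have "continuous_on I (\<lambda>t. X t \<omega>)" using cont by simp
      moreover have "\<forall>\<^sub>F n in sequentially. r n \<in> I" using r(1) \<open>D \<subseteq> I\<close> by (intro always_eventually) blast
      ultimately show "(\<lambda>n. X (r n) \<omega>) \<longlonglongrightarrow> X t \<omega>"
        using continuous_on_tendsto_compose[OF _ r(2) t] by simp
    qed
  qed simp
  then show ?thesis by (simp add: sets_process_sigma)
qed

section \<open>Brownian motion\<close>

locale brownian = prob_space P for P :: "'a measure" +
  fixes W :: "real \<Rightarrow> 'a \<Rightarrow> real"
  assumes bm: "brownian_motion P W"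
begin

lemma W_measurable [measurable (raw)]: "t \<ge> 0 \<Longrightarrow> W t \<in> borel_measurable P"
  and W_0: "\<omega> \<in> space P \<Longrightarrow> W 0 \<omega> = 0"
  and W_cont: "\<omega> \<in> space P \<Longrightarrow> continuous_on {0..} (\<lambda>t. W t \<omega>)"
  and W_distr: "0 \<le> s \<Longrightarrow> s < t \<Longrightarrow>
        distributed P lborel (\<lambda>\<omega>. W t \<omega> - W s \<omega>) (\<lambda>x. ennreal (normal_density 0 (sqrt (t - s)) x))"
  and W_indep: "0 \<le> \<tau> 0 \<Longrightarrow> incseq \<tau> \<Longrightarrow> indep_vars (\<lambda>_. borel) (\<lambda>k \<omega>. W (\<tau> (Suc k)) \<omega> - W (\<tau> k) \<omega>) UNIV"
  using bm unfolding brownian_motion_def by blast+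

lemma cont_W: "cont_process P W"
  using W_measurable W_cont by (simp add: cont_process_def)

lemma brownian_shift:
  assumes s: "s \<ge> 0"
  shows "brownian P (\<lambda>t \<omega>. path_shift s (\<lambda>t. W t \<omega>) t)"
proof
  show "brownian_motion P (\<lambda>t \<omega>. path_shift s (\<lambda>t. W t \<omega>) t)"
    unfolding brownian_motion_def
  proof (intro conjI allI impI ballI)
    fix t :: real assume "t \<ge> 0"
    then show "(\<lambda>\<omega>. path_shift s (\<lambda>t. W t \<omega>) t) \<in> borel_measurable P"
      unfolding path_shift_def using s by (intro borel_measurable_diff W_measurable) auto
  next
    fix \<omega> assume w: "\<omega> \<in> space P"
    show "path_shift s (\<lambda>t. W t \<omega>) 0 = 0" by (simp add: path_shift_def)
    have "cont_process P (\<lambda>t \<omega>. path_shift s (\<lambda>t. W t \<omega>) t)"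
      by (rule cont_process_shift[OF cont_W]) (use s in auto)
    then show "continuous_on {0..} (\<lambda>t. path_shift s (\<lambda>t. W t \<omega>) t)"
      using w by (simp add: cont_process_def)
  next
    fix r t :: real assume "0 \<le> r \<and> r < t"
    then show "distributed P lborel (\<lambda>\<omega>. path_shift s (\<lambda>t. W t \<omega>) t - path_shift s (\<lambda>t. W t \<omega>) r)
        (\<lambda>x. ennreal (normal_density 0 (sqrt (t - r)) x))"
      using W_distr[of "s + r" "s + t"] s by (simp add: path_shift_def)
  next
    fix \<tau> :: "nat \<Rightarrow> real" assume t: "0 \<le> \<tau> 0 \<and> incseq \<tau>"
    have "incseq (\<lambda>k. s + \<tau> k)" using t by (auto simp: incseq_def)
    then show "indep_vars (\<lambda>_. borel) (\<lambda>k \<omega>. path_shift s (\<lambda>t. W t \<omega>) (\<tau> (Suc k)) - path_shift s (\<lambda>t. W t \<omega>) (\<tau> k)) UNIV"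
      using W_indep[of "\<lambda>k. s + \<tau> k"] s t by (simp add: path_shift_def)
  qed
qed

definition past :: "real \<Rightarrow> 'a measure" where
  "past s = process_sigma P borel {0..s} W"

definition future :: "real \<Rightarrow> 'a measure" where
  "future s = process_sigma P borel {0..} (\<lambda>t \<omega>. path_shift s (\<lambda>t. W t \<omega>) t)"

lemma space_past [simp]: "space (past s) = space P" and space_future [simp]: "space (future s) = space P"
  by (simp_all add: past_def future_def)

lemma sets_past_sub: "sets (past s) \<subseteq> sets P"
  unfolding past_def by (rule process_sigma_sub) auto

lemma sets_future_sub: "s \<ge> 0 \<Longrightarrow> sets (future s) \<subseteq> sets P"
  unfolding future_def
  by (rule process_sigma_sub) (auto simp: path_shift_def intro!: borel_measurable_diff W_measurable)

text \<open>Stopping at \<open>s\<close> extends the past to a continuous process on the whole half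
  line, so that the lemmas on \<open>cont_process\<close> apply to it.\<close>

lemma cont_past:
  assumes "s \<ge> 0" shows "cont_process (past s) (\<lambda>t. W (min t s))"
  unfolding cont_process_def
proof (intro conjI allI impI ballI)
  fix t :: real assume "t \<ge> 0"
  then show "W (min t s) \<in> borel_measurable (past s)"
    unfolding past_def using assms by (intro measurable_process_sigma) auto
next
  fix \<omega> assume "\<omega> \<in> space (past s)"
  then have "continuous_on {0..} (\<lambda>t. W t \<omega>)" using W_cont by simp
  then show "continuous_on {0..} (\<lambda>t. W (min t s) \<omega>)"
    by (rule continuous_on_compose2) (use assms in \<open>auto intro!: continuous_intros\<close>)
qed

lemma cont_future:
  assumes "s \<ge> 0" shows "cont_process (future s) (\<lambda>t \<omega>. path_shift s (\<lambda>t. W t \<omega>) t)"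
proof -
  interpret S: brownian P "\<lambda>t \<omega>. path_shift s (\<lambda>t. W t \<omega>) t" by (rule brownian_shift[OF assms])
  show ?thesis
    unfolding cont_process_def future_def
    by (auto intro!: measurable_process_sigma S.W_cont)
qed

text \<open>Independence is given only for increments along one increasing sequence of times. On
  each dyadic level a single sequence covers both sides of \<open>s\<close>; the levels increase to
  intersection-stable generators, and path continuity recovers all real times.\<close>

lemma indep_past_future:
  assumes s: "s \<ge> 0"
  shows "indep_set (sets (past s)) (sets (future s))"
proof -
  let ?S = "\<lambda>t \<omega>. path_shift s (\<lambda>t. W t \<omega>) t"
  define D1 where "D1 = (\<lambda>n::nat. {s * real k / 2 ^ n |k. k \<le> 2 ^ n})"
  define D2 where "D2 = (\<lambda>n::nat. {real k / 2 ^ n |k. True})"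
  define A where "A = (\<lambda>n. process_events P borel (D1 n) W)"
  define B where "B = (\<lambda>n. process_events P borel (D2 n) ?S)"
  have indAB: "indep_set (A n) (B n)" for n
  proof -
    define N where "N = (2::nat) ^ n"
    have N: "N > 0" by (simp add: N_def)
    \<comment> \<open>The first \<open>N\<close> increments divide \<open>{0..s}\<close> into equal
      parts and the later ones have length \<open>1 / N\<close> after \<open>s\<close>. Doubling
      \<open>N\<close> refines both grids, so the sigma-algebras grow with \<open>n\<close>.\<close>
    define \<tau> where "\<tau> = (\<lambda>k. if k \<le> N then s * real k / real N else s + real (k - N) / real N)"
    have "incseq \<tau>"
    proof (rule incseq_SucI)
      fix k show "\<tau> k \<le> \<tau> (Suc k)"
      proof (cases "Suc k \<le> N")
        case True
        then show ?thesis using s N by (auto simp: \<tau>_def divide_simps intro!: mult_left_mono)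
      next
        case False
        then have "k = N \<or> N < k" by auto
        then show ?thesis
        proof
          assume "N < k"
          then have "real (k - N) \<le> real (Suc k - N)" by simp
          then have "real (k - N) / real N \<le> real (Suc k - N) / real N" by (intro divide_right_mono) auto
          then show ?thesis using \<open>N < k\<close> by (simp add: \<tau>_def)
        qed (use N in \<open>simp add: \<tau>_def\<close>)
      qed
    qed
    moreover have "0 \<le> \<tau> 0" by (simp add: \<tau>_def)
    ultimately have iv: "indep_vars (\<lambda>_. borel) (\<lambda>k \<omega>. W (\<tau> (Suc k)) \<omega> - W (\<tau> k) \<omega>) UNIV"
      by (intro W_indep)
    define X where "X = (\<lambda>k \<omega>. W (\<tau> (Suc k)) \<omega> - W (\<tau> k) \<omega>)"
    define E where "E = (\<lambda>k. sigma_sets (space P) {X k -` C \<inter> space P |C. C \<in> sets borel})"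
    have indE: "indep_sets E UNIV"
      using iv unfolding indep_vars_def E_def X_def by simp
    define I where "I = (\<lambda>b. if b then {..<N} else {N..})"
    have indI: "indep_sets (\<lambda>j. sigma_sets (space P) (\<Union>i\<in>I j. E i)) UNIV"
    proof (rule indep_sets_collect_sigma)
      show "indep_sets E (\<Union>j\<in>UNIV. I j)"
        by (rule indep_sets_mono_index[OF _ indE]) auto
      show "Int_stable (E i)" for i
      proof -
        have "{X i -` C \<inter> space P |C. C \<in> sets borel} \<subseteq> Pow (space P)" by auto
        then interpret sigma_algebra "space P" "E i" unfolding E_def by (rule sigma_algebra_sigma_sets)
        show ?thesis by (rule Int_stable)
      qed
      show "disjoint_family_on I UNIV" by (auto simp: disjoint_family_on_def I_def)
    qed
    define S where "S = (\<lambda>j. sigma (space P) (\<Union>i\<in>I j. E i))"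
    have Epow: "(\<Union>i\<in>I j. E i) \<subseteq> Pow (space P)" for j
    proof -
      have "{X i -` C \<inter> space P |C. C \<in> sets borel} \<subseteq> Pow (space P)" for i by auto
      from sigma_sets_into_sp[OF this] show ?thesis unfolding E_def by blast
    qed
    have spS: "space (S j) = space P" for j by (simp add: S_def space_measure_of_conv)
    have setsS: "sets (S j) = sigma_sets (space P) (\<Union>i\<in>I j. E i)" for j
      unfolding S_def by (rule sets_measure_of[OF Epow])
    have XS: "X k \<in> borel_measurable (S j)" if "k \<in> I j" for k j
      unfolding measurable_def setsS spS
      using that by (auto simp: E_def intro!: sigma_sets.Basic)
    have W1: "W (\<tau> k) \<in> borel_measurable (S True)" if "k \<le> N" for k
    proof -
      have "(\<lambda>\<omega>. \<Sum>i<k. X i \<omega>) \<in> borel_measurable (S True)"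
        by (rule borel_measurable_sum) (use that XS[of _ True] in \<open>auto simp: I_def\<close>)
      then show ?thesis
      proof (rule measurable_cong[THEN iffD1, rotated])
        fix \<omega> assume "\<omega> \<in> space (S True)"
        then have "W (\<tau> 0) \<omega> = 0" using W_0 by (simp add: spS \<tau>_def)
        then show "(\<Sum>i<k. X i \<omega>) = W (\<tau> k) \<omega>"
          using sum_lessThan_telescope[of "\<lambda>i. W (\<tau> i) \<omega>" k] by (simp add: X_def)
      qed
    qed
    have W2: "?S (real k / real N) \<in> borel_measurable (S False)" for k
    proof -
      have "(\<lambda>\<omega>. \<Sum>i<k. X (N + i) \<omega>) \<in> borel_measurable (S False)"
        by (rule borel_measurable_sum) (use XS[of _ False] in \<open>auto simp: I_def\<close>)
      then show ?thesis
      proof (rule measurable_cong[THEN iffD1, rotated])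
        fix \<omega>
        have "(\<Sum>i<k. X (N + i) \<omega>) = W (\<tau> (N + k)) \<omega> - W (\<tau> N) \<omega>"
          using sum_lessThan_telescope[of "\<lambda>i. W (\<tau> (N + i)) \<omega>" k] by (simp add: X_def)
        moreover have "\<tau> N = s" using N by (simp add: \<tau>_def)
        moreover have "\<tau> (N + k) = s + real k / real N" using N by (simp add: \<tau>_def)
        ultimately show "(\<Sum>i<k. X (N + i) \<omega>) = ?S (real k / real N) \<omega>" by (simp add: path_shift_def)
      qed
    qed
    have "A n \<subseteq> sets (S True)"
      unfolding A_def
    proof (rule process_events_subset_sets)
      fix t assume "t \<in> D1 n"
      then obtain k where k: "k \<le> N" "t = s * real k / real N" by (auto simp: D1_def N_def)
      then show "W t \<in> borel_measurable (S True)" using W1[OF k(1)] by (simp add: \<tau>_def)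
    qed (simp add: spS)
    moreover have "B n \<subseteq> sets (S False)"
      unfolding B_def
    proof (rule process_events_subset_sets)
      fix t assume "t \<in> D2 n"
      then obtain k where k: "t = real k / real N" by (auto simp: D2_def N_def)
      then show "?S t \<in> borel_measurable (S False)" using W2 by simp
    qed (simp add: spS)
    moreover have "indep_set (sets (S True)) (sets (S False))"
    proof -
      have "(\<lambda>j. sigma_sets (space P) (\<Union>i\<in>I j. E i)) = case_bool (sets (S True)) (sets (S False))"
        by (auto simp: fun_eq_iff setsS split: bool.split)
      then show ?thesis using indI by (simp add: indep_set_def)
    qed
    ultimately show ?thesis unfolding indep_sets2_eq by blast
  qed
  have D_mono: "incseq D1" "incseq D2"
  proof -
    show "incseq D1"
    proof (rule incseq_SucI, rule subsetI)
      fix n t assume "t \<in> D1 n"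
      then obtain k where "k \<le> 2 ^ n" "t = s * real k / 2 ^ n" by (auto simp: D1_def)
      then show "t \<in> D1 (Suc n)" unfolding D1_def by (intro CollectI exI[of _ "2 * k"]) auto
    qed
    show "incseq D2"
    proof (rule incseq_SucI, rule subsetI)
      fix n t assume "t \<in> D2 n"
      then obtain k where "t = real k / 2 ^ n" by (auto simp: D2_def)
      then show "t \<in> D2 (Suc n)" unfolding D2_def by (intro CollectI exI[of _ "2 * k"]) auto
    qed
  qed
  have AB_mono: "incseq A" "incseq B"
    unfolding A_def B_def
    by (rule incseq_SucI, rule process_events_mono, rule incseq_SucD, rule D_mono)+
  have "indep_set (\<Union>n. A n) (\<Union>n. B n)"
    unfolding indep_sets2_eq
  proof (intro conjI ballI)
    show "(\<Union>n. A n) \<subseteq> events" "(\<Union>n. B n) \<subseteq> events"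
      using indAB unfolding indep_sets2_eq by blast+
    fix a b assume "a \<in> (\<Union>n. A n)" "b \<in> (\<Union>n. B n)"
    then obtain m n where "a \<in> A m" "b \<in> B n" by auto
    then have "a \<in> A (max m n)" "b \<in> B (max m n)"
      using incseqD[OF AB_mono(1)] incseqD[OF AB_mono(2)] by (meson max.cobounded1 max.cobounded2 subsetD)+
    then show "prob (a \<inter> b) = prob a * prob b"
      using indAB unfolding indep_sets2_eq by blast
  qed
  then have ind: "indep_set (sigma_sets (space P) (\<Union>n. A n)) (sigma_sets (space P) (\<Union>n. B n))"
    by (rule indep_set_sigma_sets)
       (intro Int_stable_incseq_Union AB_mono; simp add: A_def B_def Int_stable_process_events)+
  have dyadic: "(\<lambda>n. real (nat \<lfloor>x * 2 ^ n\<rfloor>) / 2 ^ n) \<longlonglongrightarrow> x" if "x \<ge> 0" for x :: real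
  proof (rule real_tendsto_sandwich)
    have le: "of_int \<lfloor>x * 2 ^ n\<rfloor> \<le> x * 2 ^ n" "x * 2 ^ n - 1 \<le> of_int \<lfloor>x * 2 ^ n\<rfloor>" for n by linarith+
    show "\<forall>\<^sub>F n in sequentially. real (nat \<lfloor>x * 2 ^ n\<rfloor>) / 2 ^ n \<le> x"
      using le(1) that by (intro always_eventually allI) (simp add: divide_le_eq)
    show "\<forall>\<^sub>F n in sequentially. x - (1/2) ^ n \<le> real (nat \<lfloor>x * 2 ^ n\<rfloor>) / 2 ^ n"
    proof (intro always_eventually allI)
      fix n
      have "x - (1/2) ^ n = (x * 2 ^ n - 1) / 2 ^ n" by (simp add: field_simps power_divide)
      also have "\<dots> \<le> of_int \<lfloor>x * 2 ^ n\<rfloor> / 2 ^ n" using le(2) by (intro divide_right_mono) auto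
      finally show "x - (1/2) ^ n \<le> real (nat \<lfloor>x * 2 ^ n\<rfloor>) / 2 ^ n" using that by simp
    qed
    show "(\<lambda>n. x - (1/2) ^ n) \<longlonglongrightarrow> x"
      using tendsto_diff[OF tendsto_const LIMSEQ_realpow_zero[of "1/2"]] by simp
  qed simp
  have U1: "process_events P borel (\<Union>n. D1 n) W \<subseteq> sigma_sets (space P) (\<Union>n. A n)"
    unfolding process_events_def by (rule sigma_sets_mono) (auto simp: A_def process_events_def intro!: sigma_sets.Basic)
  have U2: "process_events P borel (\<Union>n. D2 n) ?S \<subseteq> sigma_sets (space P) (\<Union>n. B n)"
    unfolding process_events_def by (rule sigma_sets_mono) (auto simp: B_def process_events_def intro!: sigma_sets.Basic)
  have P1: "process_events P borel {0..s} W \<subseteq> process_events P borel (\<Union>n. D1 n) W"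
  proof (rule process_events_dense)
    fix t assume t: "t \<in> {0..s}"
    \<comment> \<open>For \<open>s = 0\<close> the only time is zero, and any point of the unit
      interval represents it.\<close>
    define x where "x = (if s = 0 then 0 else t / s)"
    have x: "0 \<le> x" "x \<le> 1" "t = s * x" using t by (auto simp: x_def)
    have nle: "nat \<lfloor>x * 2 ^ n\<rfloor> \<le> 2 ^ n" for n
    proof -
      have "x * 2 ^ n \<le> of_int (2 ^ n)" using x by simp
      then have "\<lfloor>x * 2 ^ n\<rfloor> \<le> \<lfloor>of_int (2 ^ n) :: real\<rfloor>" by (rule floor_mono)
      then have "\<lfloor>x * 2 ^ n\<rfloor> \<le> 2 ^ n" by (simp only: floor_of_int)
      then show ?thesis by (simp add: nat_le_iff)
    qed
    have "s * (real (nat \<lfloor>x * 2 ^ n\<rfloor>) / 2 ^ n) \<in> (\<Union>n. D1 n)" for n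
      unfolding D1_def
      by (intro UN_I[of n] UNIV_I CollectI exI[of _ "nat \<lfloor>x * 2 ^ n\<rfloor>"] conjI nle) simp
    moreover have "(\<lambda>n. s * (real (nat \<lfloor>x * 2 ^ n\<rfloor>) / 2 ^ n)) \<longlonglongrightarrow> t"
      unfolding x(3) by (intro tendsto_mult tendsto_const dyadic x)
    ultimately show "\<exists>r. (\<forall>n. r n \<in> (\<Union>n. D1 n)) \<and> r \<longlonglongrightarrow> t"
      by (intro exI[of _ "\<lambda>n. s * (real (nat \<lfloor>x * 2 ^ n\<rfloor>) / 2 ^ n)"] conjI allI)
  next
    show "(\<Union>n. D1 n) \<subseteq> {0..s}"
    proof
      fix t assume "t \<in> (\<Union>n. D1 n)"
      then obtain n k where k: "k \<le> 2 ^ n" "t = s * (real k / 2 ^ n)" by (auto simp: D1_def)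
      have "real k \<le> real (2 ^ n)" using k(1) by (simp only: of_nat_le_iff)
      then have "real k / 2 ^ n \<le> 1" by simp
      from mult_left_mono[OF this s] have "s * (real k / 2 ^ n) \<le> s" by simp
      moreover have "0 \<le> s * (real k / 2 ^ n)" using s by (intro mult_nonneg_nonneg) auto
      ultimately show "t \<in> {0..s}" unfolding k(2) by (simp only: atLeastAtMost_iff)
    qed
    show "\<And>\<omega>. \<omega> \<in> space P \<Longrightarrow> continuous_on {0..s} (\<lambda>t. W t \<omega>)"
      by (rule continuous_on_subset[OF W_cont]) auto
  qed
  have P2: "process_events P borel {0..} ?S \<subseteq> process_events P borel (\<Union>n. D2 n) ?S"
  proof (rule process_events_dense)
    fix t :: real assume t: "t \<in> {0..}"
    show "\<exists>r. (\<forall>n. r n \<in> (\<Union>n. D2 n)) \<and> r \<longlonglongrightarrow> t"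
    proof (intro exI[of _ "\<lambda>n. real (nat \<lfloor>t * 2 ^ n\<rfloor>) / 2 ^ n"] conjI allI)
      show "(\<lambda>n. real (nat \<lfloor>t * 2 ^ n\<rfloor>) / 2 ^ n) \<longlonglongrightarrow> t" using dyadic[of t] t by simp
      show "real (nat \<lfloor>t * 2 ^ n\<rfloor>) / 2 ^ n \<in> (\<Union>n. D2 n)" for n
        unfolding D2_def by (intro UN_I[of n] UNIV_I CollectI exI[of _ "nat \<lfloor>t * 2 ^ n\<rfloor>"] conjI refl TrueI)
    qed
  next
    show "(\<Union>n. D2 n) \<subseteq> {0..}" by (auto simp: D2_def)
    show "\<And>\<omega>. \<omega> \<in> space P \<Longrightarrow> continuous_on {0..} (\<lambda>t. ?S t \<omega>)"
      using brownian.W_cont[OF brownian_shift[OF s]] by simp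
  qed
  show ?thesis
    unfolding past_def future_def sets_process_sigma
    by (rule indep_set_mono[OF ind order.trans[OF P1 U1] order.trans[OF P2 U2]])
qed

end

section \<open>Paths killed at zero\<close>

definition drifted :: "real \<Rightarrow> real \<Rightarrow> real \<Rightarrow> (real \<Rightarrow> real) \<Rightarrow> real \<Rightarrow> real" where
  "drifted c \<sigma> v y t = v + c * t + \<sigma> * y t"

definition alive :: "(real \<Rightarrow> real) \<Rightarrow> real \<Rightarrow> bool" where
  "alive x t \<longleftrightarrow> (\<forall>r\<in>{0..t}. x r > 0)"

lemma drifted_shift: "drifted c \<sigma> v y (s + t) = drifted c \<sigma> (drifted c \<sigma> v y s) (path_shift s y) t"
  by (simp add: drifted_def path_shift_def algebra_simps)

lemma alive_shift:
  assumes "s \<ge> 0" "t \<ge> 0"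
  shows "alive (drifted c \<sigma> v y) (s + t) \<longleftrightarrow>
    alive (drifted c \<sigma> v y) s \<and> alive (drifted c \<sigma> (drifted c \<sigma> v y s) (path_shift s y)) t"
  (is "?L \<longleftrightarrow> ?A \<and> ?B")
proof
  assume L: ?L
  have "drifted c \<sigma> (drifted c \<sigma> v y s) (path_shift s y) r > 0" if "r \<in> {0..t}" for r
    using L that assms unfolding drifted_shift[symmetric] alive_def by auto
  with L show "?A \<and> ?B" using assms by (auto simp: alive_def)
next
  assume "?A \<and> ?B"
  then have a: "\<And>r. r \<in> {0..s} \<Longrightarrow> drifted c \<sigma> v y r > 0"
    and b: "\<And>r. r \<in> {0..t} \<Longrightarrow> drifted c \<sigma> v y (s + r) > 0"
    unfolding alive_def drifted_shift by auto
  show ?L unfolding alive_def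
  proof
    fix r assume r: "r \<in> {0..s + t}"
    show "drifted c \<sigma> v y r > 0"
    proof (cases "r \<le> s")
      case True then show ?thesis using a[of r] r by auto
    next
      case False
      then show ?thesis using b[of "r - s"] r by auto
    qed
  qed
qed

lemma alive_antimono: "alive x t \<Longrightarrow> s \<le> t \<Longrightarrow> alive x s"
  by (auto simp: alive_def)

lemma alive_cong: "(\<And>r. 0 \<le> r \<Longrightarrow> r \<le> t \<Longrightarrow> x r = y r) \<Longrightarrow> alive x t = alive y t"
  by (auto simp: alive_def)

lemma ruin_time_less: "0 \<le> t \<Longrightarrow> x t \<le> 0 \<Longrightarrow> ruin_time x \<le> ennreal t"
  unfolding ruin_time_def by (rule INF_lower) simp

text \<open>The minimum over a compact interval is attained, so positivity is uniform and can be
  tested on a dense set with a bound \<open>1 / real (Suc m)\<close>. Using rational multiples of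
  \<open>t\<close> keeps the condition countable when \<open>t\<close> itself is random.\<close>

lemma alive_iff_rational:
  fixes x :: "real \<Rightarrow> real"
  assumes x: "continuous_on {0..} x" and t: "t \<ge> 0"
  shows "alive x t \<longleftrightarrow> (\<exists>m::nat. \<forall>q::rat. 0 \<le> q \<and> q \<le> 1 \<longrightarrow> x (of_rat q * t) \<ge> 1 / real (Suc m))"
proof
  assume a: "alive x t"
  have "continuous_on {0..t} x" by (rule continuous_on_subset[OF x]) auto
  then obtain r where r: "r \<in> {0..t}" "\<And>s. s \<in> {0..t} \<Longrightarrow> x r \<le> x s"
    using continuous_attains_inf[of "{0..t}" x] t by auto
  have "x r > 0" using a r(1) by (auto simp: alive_def)
  then obtain m where m: "1 / real (Suc m) < x r" using nat_approx_posE by metis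
  have "x (of_rat q * t) \<ge> 1 / real (Suc m)" if "0 \<le> q \<and> q \<le> 1" for q
  proof -
    have "of_rat q * t \<in> {0..t}" using that t by (auto intro: mult_left_le_one_le)
    then show ?thesis using r(2)[of "of_rat q * t"] m by linarith
  qed
  then show "\<exists>m::nat. \<forall>q::rat. 0 \<le> q \<and> q \<le> 1 \<longrightarrow> x (of_rat q * t) \<ge> 1 / real (Suc m)" by blast
next
  assume "\<exists>m::nat. \<forall>q::rat. 0 \<le> q \<and> q \<le> 1 \<longrightarrow> x (of_rat q * t) \<ge> 1 / real (Suc m)"
  then obtain m where m: "\<And>q. 0 \<le> q \<Longrightarrow> q \<le> 1 \<Longrightarrow> x (of_rat q * t) \<ge> 1 / real (Suc m)" by blast
  show "alive x t" unfolding alive_def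
  proof
    fix r assume r: "r \<in> {0..t}"
    define z where "z = (if t = 0 then 0 else r / t)"
    have z: "0 \<le> z" "z \<le> 1" "r = z * t" using r by (auto simp: z_def)
    define q where "q = (\<lambda>n::nat. of_int \<lfloor>z * real (Suc n)\<rfloor> / of_nat (Suc n) :: rat)"
    have qr: "of_rat (q n) = of_int \<lfloor>z * real (Suc n)\<rfloor> / real (Suc n)" for n
      by (simp add: q_def of_rat_divide del: of_nat_Suc)
    have q1: "real_of_rat (q n) \<le> z" for n
    proof -
      have "of_int \<lfloor>z * real (Suc n)\<rfloor> \<le> z * real (Suc n)" by linarith
      then show ?thesis unfolding qr by (simp add: divide_le_eq)
    qed
    have q2: "z - 1 / real (Suc n) \<le> real_of_rat (q n)" for n
    proof -
      have "z - 1 / real (Suc n) = (z * real (Suc n) - 1) / real (Suc n)" by (simp add: diff_divide_distrib)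
      also have "\<dots> \<le> real_of_rat (q n)" unfolding qr by (intro divide_right_mono) linarith+
      finally show ?thesis .
    qed
    have q0: "real_of_rat (q n) \<ge> 0" for n
      unfolding qr using z by (intro divide_nonneg_nonneg) auto
    have qb: "0 \<le> q n" "q n \<le> 1" for n
      using q0[of n] order.trans[OF q1[of n] z(2)] by simp_all
    have lim: "(\<lambda>n. real_of_rat (q n)) \<longlonglongrightarrow> z"
    proof (rule real_tendsto_sandwich)
      show "(\<lambda>n. z - 1 / real (Suc n)) \<longlonglongrightarrow> z"
        using tendsto_diff[OF tendsto_const[of z] LIMSEQ_inverse_real_of_nat] by (simp add: inverse_eq_divide)
    qed (use q1 q2 in auto)
    have "(\<lambda>n. of_rat (q n) * t) \<longlonglongrightarrow> r"
      unfolding z(3) by (intro tendsto_intros lim)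
    then have "(\<lambda>n. x (of_rat (q n) * t)) \<longlonglongrightarrow> x r"
      by (rule continuous_on_tendsto_compose[OF x]) (use r q0 t in auto)
    then have "1 / real (Suc m) \<le> x r"
      by (rule tendsto_lowerbound) (use m qb in auto)
    moreover have "1 / real (Suc m) > 0" by simp
    ultimately show "x r > 0" by linarith
  qed
qed

lemma cont_process_drifted:
  assumes Y: "cont_process F Y" and [measurable]: "v \<in> borel_measurable F"
  shows "cont_process F (\<lambda>t \<omega>. drifted c \<sigma> (v \<omega>) (\<lambda>t. Y t \<omega>) t)"
  using Y unfolding cont_process_def drifted_def by (auto intro!: continuous_intros)

lemma pred_alive:
  assumes X: "cont_process F X" and [measurable]: "T \<in> borel_measurable F"
  shows "Measurable.pred F (\<lambda>\<omega>. 0 \<le> T \<omega> \<and> alive (\<lambda>t. X t \<omega>) (T \<omega>))"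
proof -
  have [measurable]: "(\<lambda>\<omega>. X (max 0 (of_rat q * T \<omega>)) \<omega>) \<in> borel_measurable F" for q
    by (rule cont_process_at[OF X]) measurable
  have A: "Measurable.pred F (\<lambda>\<omega>. 0 \<le> T \<omega> \<and> (\<exists>m::nat. \<forall>q::rat. 0 \<le> q \<and> q \<le> 1 \<longrightarrow> X (max 0 (of_rat q * T \<omega>)) \<omega> \<ge> 1 / real (Suc m)))"
    by measurable
  have B: "(0 \<le> T \<omega> \<and> (\<exists>m::nat. \<forall>q::rat. 0 \<le> q \<and> q \<le> 1 \<longrightarrow> X (max 0 (of_rat q * T \<omega>)) \<omega> \<ge> 1 / real (Suc m)))
     \<longleftrightarrow> (0 \<le> T \<omega> \<and> alive (\<lambda>t. X t \<omega>) (T \<omega>))" if "\<omega> \<in> space F" for \<omega>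
  proof (rule conj_cong[OF refl])
    assume T: "0 \<le> T \<omega>"
    have "alive (\<lambda>t. X t \<omega>) (T \<omega>) \<longleftrightarrow> (\<exists>m::nat. \<forall>q::rat. 0 \<le> q \<and> q \<le> 1 \<longrightarrow> X (of_rat q * T \<omega>) \<omega> \<ge> 1 / real (Suc m))"
      using X that T by (intro alive_iff_rational) (auto simp: cont_process_def)
    moreover have "max 0 (of_rat q * T \<omega>) = of_rat q * T \<omega>" if "0 \<le> q" for q
      using that T by (simp add: max_def)
    ultimately show "(\<exists>m::nat. \<forall>q::rat. 0 \<le> q \<and> q \<le> 1 \<longrightarrow> X (max 0 (of_rat q * T \<omega>)) \<omega> \<ge> 1 / real (Suc m))
       \<longleftrightarrow> alive (\<lambda>t. X t \<omega>) (T \<omega>)" by auto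
  qed
  show ?thesis by (rule measurable_cong[THEN iffD1, rotated, OF A]) (rule B)
qed

text \<open>The inequality is strict because positivity at \<open>t\<close> persists for some
  \<open>d > 0\<close>, which pushes every later zero beyond \<open>t + d\<close>.\<close>

lemma alive_iff_ruin_time:
  assumes x: "continuous_on {0..} x" and t: "t \<ge> 0"
  shows "alive x t \<longleftrightarrow> ennreal t < ruin_time x"
proof
  assume a: "alive x t"
  then have "x t > 0" using t by (auto simp: alive_def)
  have "(x \<longlongrightarrow> x t) (at t within {0..})" using x t by (auto simp: continuous_on_def)
  then have "\<forall>\<^sub>F r in at t within {0..}. x r > 0" using \<open>x t > 0\<close> by (rule order_tendstoD)
  then obtain d where d: "d > 0" "\<And>r. r \<in> {0..} \<Longrightarrow> r \<noteq> t \<Longrightarrow> dist r t < d \<Longrightarrow> x r > 0"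
    unfolding eventually_at by auto
  have "ennreal (t + d) \<le> ruin_time x"
    unfolding ruin_time_def
  proof (rule INF_greatest)
    fix r assume "r \<in> {t. 0 \<le> t \<and> x t \<le> 0}"
    then have r: "0 \<le> r" "x r \<le> 0" by auto
    have "\<not> r \<le> t" using a r unfolding alive_def by (metis atLeastAtMost_iff not_less)
    then have "t + d \<le> r" using d(2)[of r] r by (force simp: dist_real_def)
    then show "ennreal (t + d) \<le> ennreal r" by (rule ennreal_leI)
  qed
  moreover have "ennreal t < ennreal (t + d)" using t d(1) by (simp add: ennreal_less_iff)
  ultimately show "ennreal t < ruin_time x" by simp
next
  assume "ennreal t < ruin_time x"
  show "alive x t" unfolding alive_def
  proof
    fix r assume r: "r \<in> {0..t}"
    show "x r > 0"
    proof (rule ccontr)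
      assume "\<not> x r > 0"
      then have "ruin_time x \<le> ennreal r" using r by (intro ruin_time_less) auto
      also have "\<dots> \<le> ennreal t" using r by (intro ennreal_leI) auto
      finally show False using \<open>ennreal t < ruin_time x\<close> by simp
    qed
  qed
qed

text \<open>Before \<open>T\<close> the path is positive and at \<open>T\<close> it is not, so
  continuity leaves zero as the only possible value: a continuous path is ruined by creeping, never
  by overshoot.\<close>

lemma ruin_time_hit:
  assumes x: "continuous_on {0..} x" and x0: "x 0 > 0" and fin: "ruin_time x < \<infinity>"
  defines "T \<equiv> enn2real (ruin_time x)"
  shows "T > 0" "x T = 0" "ruin_time x = ennreal T"
proof -
  show rt: "ruin_time x = ennreal T" using fin by (simp add: T_def)
  have "alive x 0" using x0 by (simp add: alive_def)
  then have "ennreal 0 < ruin_time x" using alive_iff_ruin_time[OF x] by blast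
  then show T: "T > 0" using rt by (auto simp: ennreal_zero_less_mult_iff)
  have "\<not> alive x T" using alive_iff_ruin_time[OF x, of T] rt T by simp
  then obtain r where r: "0 \<le> r" "r \<le> T" "x r \<le> 0" unfolding alive_def by force
  have al: "alive x s" if "0 \<le> s" "s < T" for s
    using alive_iff_ruin_time[OF x, of s] rt that by (simp add: ennreal_less_iff)
  have "r = T"
  proof (rule ccontr)
    assume "r \<noteq> T"
    then have "alive x r" "r \<in> {0..r}" using al[of r] r by auto
    then show False using r(3) unfolding alive_def by (meson not_less)
  qed
  then have le: "x T \<le> 0" using r by simp
  have "(x \<longlongrightarrow> x T) (at T within {0..<T})"
  proof -
    have "(x \<longlongrightarrow> x T) (at T within {0..})" using x T by (simp add: continuous_on_def)
    then show ?thesis by (rule tendsto_within_subset) auto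
  qed
  moreover have "at T within {0..<T} \<noteq> bot"
    using T by (simp add: at_within_eq_bot_iff)
  moreover have "\<forall>\<^sub>F s in at T within {0..<T}. 0 \<le> x s"
  proof -
    have "0 \<le> x s" if "s \<in> {0..<T}" for s
    proof -
      have "alive x s" "s \<in> {0..s}" using al that by auto
      then show ?thesis unfolding alive_def by (meson less_imp_le)
    qed
    then show ?thesis unfolding eventually_at_filter by (intro always_eventually) blast
  qed
  ultimately have "0 \<le> x T" by (intro tendsto_lowerbound)
  with le show "x T = 0" by simp
qed

lemma ruin_time_measurable:
  assumes X: "cont_process F X"
  shows "(\<lambda>\<omega>. ruin_time (\<lambda>t. X t \<omega>)) \<in> borel_measurable F"
proof (rule borel_measurableI_greater)
  fix y :: ennreal
  show "{\<omega> \<in> space F. y < ruin_time (\<lambda>t. X t \<omega>)} \<in> sets F"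
  proof (cases "y = \<infinity>")
    case False
    then obtain r where r: "r \<ge> 0" "y = ennreal r" by (cases y rule: ennreal_cases) auto
    have "{\<omega> \<in> space F. 0 \<le> r \<and> alive (\<lambda>t. X t \<omega>) r} \<in> sets F"
      by (rule predE, rule pred_alive[OF X]) simp
    moreover have "{\<omega> \<in> space F. y < ruin_time (\<lambda>t. X t \<omega>)} = {\<omega> \<in> space F. 0 \<le> r \<and> alive (\<lambda>t. X t \<omega>) r}"
    proof (intro Collect_cong conj_cong refl)
      fix \<omega> assume "\<omega> \<in> space F"
      then have "continuous_on {0..} (\<lambda>t. X t \<omega>)" using X by (simp add: cont_process_def)
      from alive_iff_ruin_time[OF this r(1)] show "y < ruin_time (\<lambda>t. X t \<omega>) \<longleftrightarrow> 0 \<le> r \<and> alive (\<lambda>t. X t \<omega>) r"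
        using r by simp
    qed
    ultimately show ?thesis by (simp only:)
  qed simp
qed

lemma cont_process_drifted_at:
  assumes "cont_process F Y" and "v \<in> borel_measurable F" and "T \<in> borel_measurable F"
  shows "(\<lambda>\<omega>. drifted c \<sigma> (v \<omega>) (\<lambda>r. Y r \<omega>) (max 0 (T \<omega>))) \<in> borel_measurable F"
  using cont_process_at[OF cont_process_drifted[OF assms(1,2)] assms(3)] .

section \<open>The Markov property at the hitting time\<close>

text \<open>The position at time \<open>a\<close> belongs to the past and the shifted path to the
  future, so \<open>nn_integral_freeze\<close> applies. The functional \<open>K\<close> takes the
  starting point and the driving path separately, since the increments after \<open>a\<close> do not
  know the position.\<close>

lemma (in brownian) markov:
  assumes a: "a \<ge> 0" and h [measurable]: "h \<in> borel_measurable (past a)"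
    and K: "(\<lambda>z. K (fst z) (path_shift a (\<lambda>r. W r (snd z)))) \<in> borel_measurable (borel \<Otimes>\<^sub>M future a)"
  shows "(\<integral>\<^sup>+\<omega>. h \<omega> * K (drifted c \<sigma> v (\<lambda>r. W r \<omega>) a) (path_shift a (\<lambda>r. W r \<omega>)) \<partial>P)
    = (\<integral>\<^sup>+\<omega>. h \<omega> * (\<integral>\<^sup>+\<omega>'. K (drifted c \<sigma> v (\<lambda>r. W r \<omega>) a) (path_shift a (\<lambda>r. W r \<omega>')) \<partial>P) \<partial>P)"
proof -
  have X: "(\<lambda>\<omega>. drifted c \<sigma> v (\<lambda>r. W r \<omega>) a) \<in> borel_measurable (past a)"
    using cont_process_drifted_at[OF cont_past[OF a], of "\<lambda>_. v" "\<lambda>_. a" c \<sigma>] a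
    by (simp add: drifted_def)
  have "(\<integral>\<^sup>+\<omega>. h \<omega> * K (drifted c \<sigma> v (\<lambda>r. W r \<omega>) a) (path_shift a (\<lambda>r. W r \<omega>)) \<partial>P)
    = (\<integral>\<^sup>+\<omega>. \<integral>\<^sup>+\<omega>'. h \<omega> * K (drifted c \<sigma> v (\<lambda>r. W r \<omega>) a) (path_shift a (\<lambda>r. W r \<omega>')) \<partial>P \<partial>P)"
  proof (rule nn_integral_freeze[OF _ _ sets_past_sub sets_future_sub indep_past_future])
    have "(\<lambda>z. (drifted c \<sigma> v (\<lambda>r. W r (fst z)) a, snd z)) \<in> past a \<Otimes>\<^sub>M future a \<rightarrow>\<^sub>M borel \<Otimes>\<^sub>M future a"
      by (intro measurable_Pair measurable_compose[OF measurable_fst X] measurable_snd)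
    from measurable_compose[OF this K]
    have [measurable]: "(\<lambda>z. K (drifted c \<sigma> v (\<lambda>r. W r (fst z)) a) (path_shift a (\<lambda>r. W r (snd z)))) \<in> borel_measurable (past a \<Otimes>\<^sub>M future a)"
      by simp
    show "(\<lambda>(\<omega>, \<omega>'). h \<omega> * K (drifted c \<sigma> v (\<lambda>r. W r \<omega>) a) (path_shift a (\<lambda>r. W r \<omega>'))) \<in> borel_measurable (past a \<Otimes>\<^sub>M future a)"
      unfolding split_beta by measurable
  qed (use a in auto)
  also have "\<dots> = (\<integral>\<^sup>+\<omega>. h \<omega> * (\<integral>\<^sup>+\<omega>'. K (drifted c \<sigma> v (\<lambda>r. W r \<omega>) a) (path_shift a (\<lambda>r. W r \<omega>')) \<partial>P) \<partial>P)"
  proof (intro nn_integral_cong nn_integral_cmult)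
    fix \<omega>
    have "(\<lambda>\<omega>'. (drifted c \<sigma> v (\<lambda>r. W r \<omega>) a, \<omega>')) \<in> future a \<rightarrow>\<^sub>M borel \<Otimes>\<^sub>M future a"
      by (intro measurable_Pair) auto
    from measurable_compose[OF this K]
    have "(\<lambda>\<omega>'. K (drifted c \<sigma> v (\<lambda>r. W r \<omega>) a) (path_shift a (\<lambda>r. W r \<omega>'))) \<in> borel_measurable (future a)"
      by simp
    then show "(\<lambda>\<omega>'. K (drifted c \<sigma> v (\<lambda>r. W r \<omega>) a) (path_shift a (\<lambda>r. W r \<omega>'))) \<in> borel_measurable P"
      using measurable_mono[OF order_refl refl sets_future_sub[OF a], of borel] by auto
  qed
  finally show ?thesis .
qed

lemma nn_integral_translate:
  fixes f :: "real \<Rightarrow> ennreal"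
  assumes [measurable]: "f \<in> borel_measurable borel"
  shows "(\<integral>\<^sup>+t. f t \<partial>lborel) = (\<integral>\<^sup>+t. f (a + t) \<partial>lborel)"
  using nn_integral_real_affine[of f 1 a] by simp

text \<open>Stated for arbitrary paths because it serves both the diffusion restarted at a fixed
  time and the surplus path with jumps restarted at a claim.\<close>

lemma ruin_time_shift:
  assumes a: "a \<ge> 0" and al: "\<And>r. 0 \<le> r \<Longrightarrow> r < a \<Longrightarrow> x r > 0"
  shows "ruin_time x = ennreal a + ruin_time (\<lambda>t. x (a + t))"
proof (rule antisym)
  have "ruin_time x - ennreal a \<le> ruin_time (\<lambda>t. x (a + t))"
    unfolding ruin_time_def[of "\<lambda>t. x (a + t)"]
  proof (rule INF_greatest)
    fix t assume "t \<in> {t. 0 \<le> t \<and> x (a + t) \<le> 0}"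
    then have "0 \<le> t" and "x (a + t) \<le> 0" by auto
    then have "ruin_time x \<le> ennreal (a + t)" using a by (intro ruin_time_less) auto
    with \<open>0 \<le> t\<close>
    show "ruin_time x - ennreal a \<le> ennreal t" using a by (simp add: ennreal_minus_le_iff)
  qed
  then show "ruin_time x \<le> ennreal a + ruin_time (\<lambda>t. x (a + t))"
    by (simp add: ennreal_minus_le_iff)
  show "ennreal a + ruin_time (\<lambda>t. x (a + t)) \<le> ruin_time x"
    unfolding ruin_time_def[of x]
  proof (rule INF_greatest)
    fix t assume "t \<in> {t. 0 \<le> t \<and> x t \<le> 0}"
    then have t: "0 \<le> t" "x t \<le> 0" by auto
    have "\<not> t < a" using al[of t] t by auto
    then have "ruin_time (\<lambda>t. x (a + t)) \<le> ennreal (t - a)" using t by (intro ruin_time_less) auto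
    then have "ennreal a + ruin_time (\<lambda>t. x (a + t)) \<le> ennreal a + ennreal (t - a)" by (rule add_left_mono)
    also have "\<dots> = ennreal t" using a \<open>\<not> t < a\<close> by (simp flip: ennreal_plus)
    finally show "ennreal a + ruin_time (\<lambda>t. x (a + t)) \<le> ennreal t" .
  qed
qed

section \<open>Occupation and potential of the diffusion without killing\<close>

context drift_diffusion
begin

definition occupation :: "real \<Rightarrow> (real \<Rightarrow> ennreal) \<Rightarrow> real \<Rightarrow> (real \<Rightarrow> real) \<Rightarrow> ennreal" where
  "occupation a g x y = (\<integral>\<^sup>+t. ennreal (exp (- lam * t)) * g (drifted c \<sigma> x y t) * indicator {a..} t \<partial>lborel)"

definition potential :: "(real \<Rightarrow> ennreal) \<Rightarrow> real \<Rightarrow> ennreal" where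
  "potential g x = (\<integral>\<^sup>+z. ennreal (free_kernel (z - x)) * g z \<partial>lborel)"

lemma potential_measurable [measurable]:
  assumes [measurable]: "g \<in> borel_measurable borel"
  shows "potential g \<in> borel_measurable borel"
  unfolding potential_def by measurable

lemma occupation_measurable:
  assumes Y: "cont_process F Y" and v: "v \<in> borel_measurable F" and T: "T \<in> borel_measurable F"
    and T0: "\<And>\<omega>. \<omega> \<in> space F \<Longrightarrow> T \<omega> \<ge> 0"
    and g [measurable]: "g \<in> borel_measurable borel"
  shows "(\<lambda>\<omega>. occupation (T \<omega>) g (v \<omega>) (\<lambda>r. Y r \<omega>)) \<in> borel_measurable F"
proof -
  have [measurable]: "(\<lambda>z. drifted c \<sigma> (v (fst z)) (\<lambda>r. Y r (fst z)) (max 0 (snd z))) \<in> borel_measurable (F \<Otimes>\<^sub>M lborel)"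
    by (rule cont_process_drifted_at[OF cont_process_compose[OF Y measurable_fst]])
       (auto intro: measurable_compose[OF measurable_fst v])
  note [measurable] = T
  have "(\<lambda>\<omega>. \<integral>\<^sup>+t. ennreal (exp (- lam * t)) * g (drifted c \<sigma> (v \<omega>) (\<lambda>r. Y r \<omega>) (max 0 t)) * indicator {T \<omega>..} t \<partial>lborel) \<in> borel_measurable F"
    by measurable
  then show ?thesis
  proof (rule measurable_cong[THEN iffD1, rotated])
    fix \<omega> assume "\<omega> \<in> space F"
    then have "T \<omega> \<ge> 0" by (rule T0)
    then show "(\<integral>\<^sup>+t. ennreal (exp (- lam * t)) * g (drifted c \<sigma> (v \<omega>) (\<lambda>r. Y r \<omega>) (max 0 t)) * indicator {T \<omega>..} t \<partial>lborel)
      = occupation (T \<omega>) g (v \<omega>) (\<lambda>r. Y r \<omega>)"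
      unfolding occupation_def by (intro nn_integral_cong) (auto split: split_indicator simp: max_def)
  qed
qed

lemma exp_time_integral: "(\<integral>\<^sup>+t. ennreal (exp (- lam * t)) * indicator {0..} t \<partial>lborel) = ennreal (1 / lam)"
proof -
  have "(\<integral>\<^sup>+t. ennreal (exp (- lam * t)) * indicator {0..} t \<partial>lborel) = ennreal (0 - (- exp (- lam * 0) / lam))"
  proof (rule nn_integral_FTC_atLeast)
    show "((\<lambda>t. - exp (- lam * t) / lam) has_real_derivative exp (- lam * t)) (at t)" for t
      using lam_pos by (auto intro!: derivative_eq_intros)
    show "((\<lambda>t. - exp (- lam * t) / lam) \<longlongrightarrow> 0) at_top"
      using lam_pos by real_asymp
  qed auto
  then show ?thesis by simp
qed

lemma expectation_occupation:
  assumes "brownian P W" and g [measurable]: "g \<in> borel_measurable borel"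
  shows "(\<integral>\<^sup>+\<omega>. occupation 0 g v (\<lambda>r. W r \<omega>) \<partial>P) = potential g v"
proof -
  interpret B: brownian P W by fact
  have XM [measurable]: "(\<lambda>z. drifted c \<sigma> v (\<lambda>r. W r (fst z)) (max 0 (snd z))) \<in> borel_measurable (P \<Otimes>\<^sub>M lborel)"
    by (rule cont_process_drifted_at[OF cont_process_compose[OF B.cont_W measurable_fst]]) auto
  have inner: "(\<integral>\<^sup>+\<omega>. g (drifted c \<sigma> v (\<lambda>r. W r \<omega>) (max 0 t)) \<partial>P)
     = (\<integral>\<^sup>+x. ennreal (normal_density (c * t) (\<sigma> * sqrt t) (x - v)) * g x \<partial>lborel)" if t: "t > 0" for t
  proof -
    have "distributed P lborel (\<lambda>\<omega>. W t \<omega> - W 0 \<omega>) (\<lambda>x. ennreal (normal_density 0 (sqrt (t - 0)) x))"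
      by (rule B.W_distr) (use t in auto)
    then have "distributed P lborel (\<lambda>\<omega>. W t \<omega> - W 0 \<omega>) (\<lambda>x. ennreal (normal_density 0 (sqrt t) x))"
      by simp
    from B.normal_density_affine[OF this, of \<sigma> "v + c * t"]
    have D: "distributed P lborel (\<lambda>\<omega>. (v + c * t) + \<sigma> * (W t \<omega> - W 0 \<omega>)) (\<lambda>x. ennreal (normal_density (v + c * t) (\<sigma> * sqrt t) x))"
      using sigma_pos t by simp
    have "(\<integral>\<^sup>+\<omega>. g (drifted c \<sigma> v (\<lambda>r. W r \<omega>) (max 0 t)) \<partial>P) = (\<integral>\<^sup>+\<omega>. g ((v + c * t) + \<sigma> * (W t \<omega> - W 0 \<omega>)) \<partial>P)"
      using t by (intro nn_integral_cong) (simp add: drifted_def B.W_0)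
    also have "\<dots> = (\<integral>\<^sup>+x. ennreal (normal_density (v + c * t) (\<sigma> * sqrt t) x) * g x \<partial>lborel)"
      by (rule distributed_nn_integral[OF D, symmetric]) simp
    also have "\<dots> = (\<integral>\<^sup>+x. ennreal (normal_density (c * t) (\<sigma> * sqrt t) (x - v)) * g x \<partial>lborel)"
      by (simp add: normal_density_def algebra_simps)
    finally show ?thesis .
  qed
  have "(\<integral>\<^sup>+\<omega>. occupation 0 g v (\<lambda>r. W r \<omega>) \<partial>P)
    = (\<integral>\<^sup>+\<omega>. \<integral>\<^sup>+t. ennreal (exp (- lam * t)) * g (drifted c \<sigma> v (\<lambda>r. W r \<omega>) (max 0 t)) * indicator {0..} t \<partial>lborel \<partial>P)"
    unfolding occupation_def by (intro nn_integral_cong) (auto split: split_indicator simp: max_def)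
  also have "\<dots> = (\<integral>\<^sup>+t. \<integral>\<^sup>+\<omega>. ennreal (exp (- lam * t)) * g (drifted c \<sigma> v (\<lambda>r. W r \<omega>) (max 0 t)) * indicator {0..} t \<partial>P \<partial>lborel)"
  proof -
    interpret pair_sigma_finite P lborel by standard
    show ?thesis by (rule Fubini'[symmetric]) measurable
  qed
  also have "\<dots> = (\<integral>\<^sup>+t. \<integral>\<^sup>+x. ennreal (exp (- lam * t) * normal_density (c * t) (\<sigma> * sqrt t) (x - v)) * indicator {0<..} t * g x \<partial>lborel \<partial>lborel)"
  proof (rule nn_integral_cong_AE)
    \<comment> \<open>At time zero the position is a point mass and has no Gaussian density.\<close>
    have "AE t in lborel. t \<noteq> (0::real)" by (rule AE_lborel_singleton)
    then show "AE t in lborel. (\<integral>\<^sup>+\<omega>. ennreal (exp (- lam * t)) * g (drifted c \<sigma> v (\<lambda>r. W r \<omega>) (max 0 t)) * indicator {0..} t \<partial>P)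
      = (\<integral>\<^sup>+x. ennreal (exp (- lam * t) * normal_density (c * t) (\<sigma> * sqrt t) (x - v)) * indicator {0<..} t * g x \<partial>lborel)"
    proof eventually_elim
      case (elim t)
      show ?case
      proof (cases "t > 0")
        case True
        have [measurable]: "(\<lambda>\<omega>. drifted c \<sigma> v (\<lambda>r. W r \<omega>) t) \<in> borel_measurable P"
          using cont_process_drifted_at[OF B.cont_W, of "\<lambda>_. v" "\<lambda>_. t" c \<sigma>] True by simp
        have "(\<integral>\<^sup>+\<omega>. ennreal (exp (- lam * t)) * g (drifted c \<sigma> v (\<lambda>r. W r \<omega>) (max 0 t)) * indicator {0..} t \<partial>P)
          = ennreal (exp (- lam * t)) * (\<integral>\<^sup>+\<omega>. g (drifted c \<sigma> v (\<lambda>r. W r \<omega>) (max 0 t)) \<partial>P)"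
          using True by (subst nn_integral_cmult[symmetric]) auto
        also have "\<dots> = (\<integral>\<^sup>+x. ennreal (exp (- lam * t)) * (ennreal (normal_density (c * t) (\<sigma> * sqrt t) (x - v)) * g x) \<partial>lborel)"
          unfolding inner[OF True] by (subst nn_integral_cmult) (auto simp: normal_density_def)
        also have "\<dots> = (\<integral>\<^sup>+x. ennreal (exp (- lam * t) * normal_density (c * t) (\<sigma> * sqrt t) (x - v)) * indicator {0<..} t * g x \<partial>lborel)"
          using True by (intro nn_integral_cong) (simp add: ennreal_mult mult.assoc)
        finally show ?thesis .
      qed (use elim in auto)
    qed
  qed
  also have "\<dots> = (\<integral>\<^sup>+x. \<integral>\<^sup>+t. ennreal (exp (- lam * t) * normal_density (c * t) (\<sigma> * sqrt t) (x - v)) * indicator {0<..} t * g x \<partial>lborel \<partial>lborel)"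
    by (rule lborel_pair.Fubini'[symmetric]) (simp add: normal_density_def)
  also have "\<dots> = (\<integral>\<^sup>+x. ennreal (free_kernel (x - v)) * g x \<partial>lborel)"
  proof (rule nn_integral_cong_AE)
    have "AE x in lborel. x \<noteq> v" by (rule AE_lborel_singleton)
    then show "AE x in lborel. (\<integral>\<^sup>+t. ennreal (exp (- lam * t) * normal_density (c * t) (\<sigma> * sqrt t) (x - v)) * indicator {0<..} t * g x \<partial>lborel)
       = ennreal (free_kernel (x - v)) * g x"
    proof eventually_elim
      case (elim x)
      then show ?case
        using nn_integral_gaussian_time[of "x - v"]
        by (subst nn_integral_multc) (auto simp: normal_density_def)
    qed
  qed
  finally show ?thesis by (simp add: potential_def)
qed

lemma occupation_le:
  assumes "\<And>x. g x \<le> 1" "a \<ge> 0"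
  shows "occupation a g x y \<le> ennreal (1 / lam)"
  unfolding occupation_def exp_time_integral[symmetric]
proof (rule nn_integral_mono)
  fix t
  have "ennreal (exp (- lam * t)) * g (drifted c \<sigma> x y t) \<le> ennreal (exp (- lam * t)) * 1"
    by (rule mult_left_mono) (use assms in auto)
  then show "ennreal (exp (- lam * t)) * g (drifted c \<sigma> x y t) * indicator {a..} t \<le> ennreal (exp (- lam * t)) * indicator {0..} t"
    using assms(2) by (auto split: split_indicator)
qed

lemma occupation_shift:
  assumes y: "continuous_on {0..} y" and a: "a \<ge> 0" and g [measurable]: "g \<in> borel_measurable borel"
  shows "occupation a g x y = ennreal (exp (- lam * a)) * occupation 0 g (drifted c \<sigma> x y a) (path_shift a y)"
proof -
  have cp: "cont_process borel (\<lambda>t (_::real). y t)" using y by (simp add: cont_process_def)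
  have [measurable]: "(\<lambda>t. drifted c \<sigma> x y (max 0 t)) \<in> borel_measurable borel"
    by (rule cont_process_drifted_at[OF cp, of "\<lambda>_. x" "\<lambda>t. t"]) auto
  have "occupation a g x y = (\<integral>\<^sup>+t. ennreal (exp (- lam * t)) * g (drifted c \<sigma> x y (max 0 t)) * indicator {a..} t \<partial>lborel)"
    unfolding occupation_def using a by (intro nn_integral_cong) (auto split: split_indicator simp: max_def)
  also have "\<dots> = (\<integral>\<^sup>+t. ennreal (exp (- lam * (a + t))) * g (drifted c \<sigma> x y (max 0 (a + t))) * indicator {a..} (a + t) \<partial>lborel)"
    by (rule nn_integral_translate) measurable
  also have "\<dots> = (\<integral>\<^sup>+t. ennreal (exp (- lam * a)) * (ennreal (exp (- lam * t)) * g (drifted c \<sigma> x y (max 0 (a + t))) * indicator {0..} t) \<partial>lborel)"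
  proof (intro nn_integral_cong)
    fix t
    have "exp (- lam * (a + t)) = exp (- lam * a) * exp (- lam * t)" by (simp add: exp_add[symmetric] algebra_simps)
    then show "ennreal (exp (- lam * (a + t))) * g (drifted c \<sigma> x y (max 0 (a + t))) * indicator {a..} (a + t) =
       ennreal (exp (- lam * a)) * (ennreal (exp (- lam * t)) * g (drifted c \<sigma> x y (max 0 (a + t))) * indicator {0..} t)"
      by (simp only: ennreal_mult[OF exp_ge_zero exp_ge_zero]) (auto split: split_indicator simp: mult.assoc)
  qed
  also have "\<dots> = ennreal (exp (- lam * a)) * (\<integral>\<^sup>+t. ennreal (exp (- lam * t)) * g (drifted c \<sigma> x y (max 0 (a + t))) * indicator {0..} t \<partial>lborel)"
    by (rule nn_integral_cmult) measurable
  also have "(\<integral>\<^sup>+t. ennreal (exp (- lam * t)) * g (drifted c \<sigma> x y (max 0 (a + t))) * indicator {0..} t \<partial>lborel)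
     = occupation 0 g (drifted c \<sigma> x y a) (path_shift a y)"
    unfolding occupation_def using a
    by (intro nn_integral_cong) (auto split: split_indicator simp: max_def drifted_shift)
  finally show ?thesis .
qed

lemma potential_le:
  assumes [measurable]: "g \<in> borel_measurable borel"
  shows "potential g y \<le> ennreal (exp (rho * \<bar>y\<bar>)) * potential g 0"
    and "potential g 0 \<le> ennreal (exp (rho * \<bar>y\<bar>)) * potential g y"
proof -
  have 1: "free_kernel (z - y) \<le> exp (rho * \<bar>y\<bar>) * free_kernel z" for z
    by (rule free_kernel_le)
  have 2: "free_kernel z \<le> exp (rho * \<bar>y\<bar>) * free_kernel (z - y)" for z
    using free_kernel_le[of "z - y" "- y"] by simp
  show "potential g y \<le> ennreal (exp (rho * \<bar>y\<bar>)) * potential g 0"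
    unfolding potential_def using free_kernel_gt0 1
    by (subst nn_integral_cmult[symmetric])
       (auto intro!: nn_integral_mono mult_right_mono ennreal_leI simp: mult.assoc[symmetric] ennreal_mult[symmetric] less_imp_le)
  show "potential g 0 \<le> ennreal (exp (rho * \<bar>y\<bar>)) * potential g y"
    unfolding potential_def using free_kernel_gt0 2
    by (subst nn_integral_cmult[symmetric])
       (auto intro!: nn_integral_mono mult_right_mono ennreal_leI simp: mult.assoc[symmetric] ennreal_mult[symmetric] less_imp_le)
qed

lemma potential_bound:
  assumes [measurable]: "g \<in> borel_measurable borel" and g1: "\<And>x. g x \<le> 1"
    and "brownian P W"
  shows "potential g y \<le> ennreal (1 / lam)"
proof -
  interpret B: brownian P W by fact
  have "potential g y = (\<integral>\<^sup>+\<omega>. occupation 0 g y (\<lambda>r. W r \<omega>) \<partial>P)"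
    by (rule expectation_occupation[symmetric]) fact+
  also have "\<dots> \<le> (\<integral>\<^sup>+\<omega>. ennreal (1 / lam) \<partial>P)"
    by (intro nn_integral_mono occupation_le g1) simp
  also have "\<dots> = ennreal (1 / lam)" by (simp add: B.emeasure_space_1)
  finally show ?thesis .
qed

text \<open>The Harnack bound in both directions squeezes the potential between multiples of its
  value at zero with factors tending to one, although \<open>g\<close> is only measurable.\<close>

lemma potential_tendsto:
  assumes [measurable]: "g \<in> borel_measurable borel"
    and u: "u \<longlonglongrightarrow> (0::real)"
  shows "(\<lambda>n. potential g (u n)) \<longlonglongrightarrow> potential g 0"
proof (rule tendsto_sandwich)
  show "\<forall>\<^sub>F n in sequentially. ennreal (exp (- (rho * \<bar>u n\<bar>))) * potential g 0 \<le> potential g (u n)"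
  proof (intro always_eventually allI)
    fix n
    have "ennreal (exp (- (rho * \<bar>u n\<bar>))) * potential g 0 \<le> ennreal (exp (- (rho * \<bar>u n\<bar>))) * (ennreal (exp (rho * \<bar>u n\<bar>)) * potential g (u n))"
      by (intro mult_left_mono potential_le) auto
    also have "\<dots> = potential g (u n)"
      by (simp add: mult.assoc[symmetric] ennreal_mult[symmetric] exp_add[symmetric])
    finally show "ennreal (exp (- (rho * \<bar>u n\<bar>))) * potential g 0 \<le> potential g (u n)" .
  qed
  show "\<forall>\<^sub>F n in sequentially. potential g (u n) \<le> ennreal (exp (rho * \<bar>u n\<bar>)) * potential g 0"
    by (intro always_eventually allI potential_le) auto
  have "(\<lambda>n. exp (- (rho * \<bar>u n\<bar>))) \<longlonglongrightarrow> exp (- (rho * \<bar>0\<bar>))" "(\<lambda>n. exp (rho * \<bar>u n\<bar>)) \<longlonglongrightarrow> exp (rho * \<bar>0\<bar>)"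
    by (intro tendsto_intros u)+
  then have 1: "(\<lambda>n. ennreal (exp (- (rho * \<bar>u n\<bar>)))) \<longlonglongrightarrow> 1" "(\<lambda>n. ennreal (exp (rho * \<bar>u n\<bar>))) \<longlonglongrightarrow> 1"
    by (auto dest: tendsto_ennrealI)
  have "(\<lambda>n. ennreal (exp (- (rho * \<bar>u n\<bar>))) * potential g 0) \<longlonglongrightarrow> 1 * potential g 0"
    by (rule tendsto_mult_ennreal[OF 1(1) tendsto_const]) auto
  then show "(\<lambda>n. ennreal (exp (- (rho * \<bar>u n\<bar>))) * potential g 0) \<longlonglongrightarrow> potential g 0" by simp
  have "(\<lambda>n. ennreal (exp (rho * \<bar>u n\<bar>)) * potential g 0) \<longlonglongrightarrow> 1 * potential g 0"
    by (rule tendsto_mult_ennreal[OF 1(2) tendsto_const]) auto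
  then show "(\<lambda>n. ennreal (exp (rho * \<bar>u n\<bar>)) * potential g 0) \<longlonglongrightarrow> potential g 0" by simp
qed

end

text \<open>Windows open on the left and closed on the right correspond to being alive at
  \<open>k / N\<close> and no longer alive at \<open>Suc k / N\<close>.\<close>

lemma ceiling_window:
  assumes "T > 0" "N > 0"
  shows "real k / N < T \<and> T \<le> real (Suc k) / N \<longleftrightarrow> k = nat \<lceil>N * T\<rceil> - 1"
    and "real (Suc (nat \<lceil>N * T\<rceil> - 1)) / N = of_int \<lceil>N * T\<rceil> / N"
proof -
  have p: "\<lceil>N * T\<rceil> \<ge> 1" using assms by (simp add: le_ceiling_iff)
  have "real k / N < T \<and> T \<le> real (Suc k) / N \<longleftrightarrow> real k < N * T \<and> N * T \<le> real k + 1"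
    using assms by (simp add: field_simps)
  also have "\<dots> \<longleftrightarrow> \<lceil>N * T\<rceil> = int k + 1"
    by (auto simp: ceiling_eq_iff)
  also have "\<dots> \<longleftrightarrow> k = nat \<lceil>N * T\<rceil> - 1" using p by linarith
  finally show "real k / N < T \<and> T \<le> real (Suc k) / N \<longleftrightarrow> k = nat \<lceil>N * T\<rceil> - 1" .
  have "real (Suc (nat \<lceil>N * T\<rceil> - 1)) = of_int \<lceil>N * T\<rceil>" using p by simp
  then show "real (Suc (nat \<lceil>N * T\<rceil> - 1)) / N = of_int \<lceil>N * T\<rceil> / N" by (simp only:)
qed

lemma alive_past:
  assumes "brownian P W" and a: "0 \<le> a" and s: "0 \<le> s" "s \<le> a"
  shows "Measurable.pred (brownian.past P W a) (\<lambda>\<omega>. alive (drifted c \<sigma> v (\<lambda>r. W r \<omega>)) s)"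
proof -
  interpret B: brownian P W by fact
  have "Measurable.pred (B.past a) (\<lambda>\<omega>. 0 \<le> s \<and> alive (\<lambda>t. drifted c \<sigma> v (\<lambda>r. W (min r a) \<omega>) t) s)"
    by (rule pred_alive[OF cont_process_drifted[OF B.cont_past[OF a]]]) auto
  moreover have "alive (\<lambda>t. drifted c \<sigma> v (\<lambda>r. W (min r a) \<omega>) t) s \<longleftrightarrow> alive (drifted c \<sigma> v (\<lambda>r. W r \<omega>)) s" for \<omega>
    by (rule alive_cong) (use s in \<open>auto simp: drifted_def min_def\<close>)
  ultimately show ?thesis using s by simp
qed

section \<open>The strong Markov property at the hitting time of zero\<close>

context drift_diffusion
begin

context
  fixes P :: "'a measure" and W :: "real \<Rightarrow> 'a \<Rightarrow> real" and v :: real and g :: "real \<Rightarrow> ennreal"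
  assumes W: "brownian P W" and v: "v > 0"
begin

interpretation B: brownian P W by (rule W)

abbreviation "X \<omega> \<equiv> drifted c \<sigma> v (\<lambda>r. W r \<omega>)"
abbreviation "hit \<omega> \<equiv> enn2real (ruin_time (X \<omega>))"

lemma cont_X: "\<omega> \<in> space P \<Longrightarrow> continuous_on {0..} (X \<omega>)"
  using cont_process_drifted[OF B.cont_W, of "\<lambda>_. v" c \<sigma>] by (simp add: cont_process_def)

lemma X_0: "\<omega> \<in> space P \<Longrightarrow> X \<omega> 0 = v"
  by (simp add: drifted_def B.W_0)

lemma ruin_measurable [measurable]: "(\<lambda>\<omega>. ruin_time (X \<omega>)) \<in> borel_measurable P"
  using ruin_time_measurable[OF cont_process_drifted[OF B.cont_W, of "\<lambda>_. v" c \<sigma>]] by simp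

lemma hit_facts:
  assumes "\<omega> \<in> space P" "ruin_time (X \<omega>) < \<infinity>"
  shows "hit \<omega> > 0" "X \<omega> (hit \<omega>) = 0" "ruin_time (X \<omega>) = ennreal (hit \<omega>)"
  using ruin_time_hit[OF cont_X[OF assms(1)] _ assms(2)] X_0[OF assms(1)] v by auto

lemma alive_X: "\<omega> \<in> space P \<Longrightarrow> t \<ge> 0 \<Longrightarrow> alive (X \<omega>) t \<longleftrightarrow> ennreal t < ruin_time (X \<omega>)"
  by (rule alive_iff_ruin_time[OF cont_X])

text \<open>Rounding up rather than down: whether the hitting time lies in a window is decided by
  the path up to the right end of that window, where the simple Markov property can be
  applied.\<close>

definition grid_hit :: "nat \<Rightarrow> 'a \<Rightarrow> real" where
  "grid_hit n \<omega> = of_int \<lceil>real (Suc n) * hit \<omega>\<rceil> / real (Suc n)"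

lemma grid_hit_measurable [measurable]: "grid_hit n \<in> borel_measurable P"
  unfolding grid_hit_def by measurable

lemma grid_hit_bounds: "hit \<omega> \<le> grid_hit n \<omega>" "grid_hit n \<omega> \<le> hit \<omega> + 1 / real (Suc n)"
proof -
  have "real (Suc n) * hit \<omega> \<le> of_int \<lceil>real (Suc n) * hit \<omega>\<rceil>" by linarith
  then show "hit \<omega> \<le> grid_hit n \<omega>" unfolding grid_hit_def by (simp add: pos_le_divide_eq mult.commute)
  have "of_int \<lceil>real (Suc n) * hit \<omega>\<rceil> \<le> real (Suc n) * hit \<omega> + 1" by linarith
  then have "grid_hit n \<omega> \<le> (real (Suc n) * hit \<omega> + 1) / real (Suc n)"
    unfolding grid_hit_def by (intro divide_right_mono) auto
  also have "\<dots> = hit \<omega> + 1 / real (Suc n)" by (simp add: add_divide_distrib)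
  finally show "grid_hit n \<omega> \<le> hit \<omega> + 1 / real (Suc n)" .
qed

lemma grid_hit_nonneg: "grid_hit n \<omega> \<ge> 0"
  using grid_hit_bounds(1)[of \<omega> n] by (meson enn2real_nonneg order.trans)

lemma grid_hit_tendsto: "(\<lambda>n. grid_hit n \<omega>) \<longlonglongrightarrow> hit \<omega>"
proof (rule real_tendsto_sandwich[where f="\<lambda>_. hit \<omega>"])
  show "(\<lambda>n. hit \<omega> + 1 / real (Suc n)) \<longlonglongrightarrow> hit \<omega>"
    using tendsto_add[OF tendsto_const LIMSEQ_inverse_real_of_nat, of "hit \<omega>"] by (simp add: inverse_eq_divide)
qed (use grid_hit_bounds in auto)

text \<open>At most one window contains the hitting time, so the sum over all windows has at most
  one nonzero term. It decomposes a functional at the random grid time into functionals at fixed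
  times.\<close>

lemma grid_sum:
  fixes f :: "real \<Rightarrow> ennreal"
  assumes w: "\<omega> \<in> space P"
  shows "(\<Sum>k. if alive (X \<omega>) (real k / real (Suc n)) \<and> \<not> alive (X \<omega>) (real (Suc k) / real (Suc n))
      then f (real (Suc k) / real (Suc n)) else 0)
    = (if ruin_time (X \<omega>) < \<infinity> then f (grid_hit n \<omega>) else 0)"
proof (cases "ruin_time (X \<omega>) < \<infinity>")
  case True
  note h = hit_facts[OF w True]
  define N where "N = real (Suc n)"
  have N: "N > 0" by (simp add: N_def)
  define k0 where "k0 = nat \<lceil>N * hit \<omega>\<rceil> - 1"
  have iff: "alive (X \<omega>) (real k / N) \<and> \<not> alive (X \<omega>) (real (Suc k) / N) \<longleftrightarrow> k = k0" for k
  proof -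
    have al: "alive (X \<omega>) s \<longleftrightarrow> s < hit \<omega>" if "s \<ge> 0" for s
    proof -
      have "ennreal s < ruin_time (X \<omega>) \<longleftrightarrow> ennreal s < ennreal (hit \<omega>)"
        by (rule arg_cong[OF h(3)])
      then show ?thesis using alive_X[OF w that] that by (simp add: ennreal_less_iff)
    qed
    have "alive (X \<omega>) (real k / N) \<longleftrightarrow> real k / N < hit \<omega>"
      using N by (intro al) auto
    moreover have "alive (X \<omega>) (real (Suc k) / N) \<longleftrightarrow> real (Suc k) / N < hit \<omega>"
      using N by (intro al) auto
    ultimately have "alive (X \<omega>) (real k / N) \<and> \<not> alive (X \<omega>) (real (Suc k) / N) \<longleftrightarrow> real k / N < hit \<omega> \<and> hit \<omega> \<le> real (Suc k) / N"
      by auto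
    then show ?thesis unfolding k0_def using ceiling_window(1)[OF h(1) N] by simp
  qed
  have "(\<Sum>k. if k = k0 then f (real (Suc k) / N) else 0) = f (real (Suc k0) / N)"
    by (rule sums_unique[symmetric]) (rule sums_single)
  also have "real (Suc k0) / N = grid_hit n \<omega>"
    unfolding k0_def grid_hit_def using ceiling_window(2)[OF h(1) N] by (simp only: N_def)
  finally show ?thesis using True iff unfolding N_def by simp
next
  case False
  then have "ruin_time (X \<omega>) = \<infinity>" by (simp add: less_top[symmetric])
  then have "alive (X \<omega>) (real (Suc k) / real (Suc n))" for k
    using alive_X[OF w, of "real (Suc k) / real (Suc n)"] by simp
  then show ?thesis using False by simp
qed

context
  assumes g [measurable]: "g \<in> borel_measurable borel" and g_le: "\<And>x. g x \<le> 1"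
begin

lemma X_at [measurable]:
  assumes [measurable]: "T \<in> borel_measurable F" and f [measurable]: "f \<in> measurable F P"
  shows "(\<lambda>z. X (f z) (max 0 (T z))) \<in> borel_measurable F"
  by (rule cont_process_drifted_at[OF cont_process_compose[OF B.cont_W f]]) auto

lemma occupation_X_measurable:
  assumes [measurable]: "T \<in> borel_measurable P" and "\<And>\<omega>. \<omega> \<in> space P \<Longrightarrow> T \<omega> \<ge> 0"
  shows "(\<lambda>\<omega>. occupation (T \<omega>) g v (\<lambda>r. W r \<omega>)) \<in> borel_measurable P"
  by (rule occupation_measurable[OF B.cont_W]) (use assms in auto)

lemma occupation_restart:
  assumes a: "a \<ge> 0" and Q: "Measurable.pred (B.past a) Q"
  shows "(\<integral>\<^sup>+\<omega>. (if Q \<omega> then occupation a g v (\<lambda>r. W r \<omega>) else 0) \<partial>P)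
    = (\<integral>\<^sup>+\<omega>. (if Q \<omega> then ennreal (exp (- lam * a)) * potential g (X \<omega> a) else 0) \<partial>P)"
proof -
  let ?h = "\<lambda>\<omega>. if Q \<omega> then ennreal (exp (- lam * a)) else 0"
  note [measurable] = Q
  have "(\<integral>\<^sup>+\<omega>. (if Q \<omega> then occupation a g v (\<lambda>r. W r \<omega>) else 0) \<partial>P)
     = (\<integral>\<^sup>+\<omega>. ?h \<omega> * occupation 0 g (X \<omega> a) (path_shift a (\<lambda>r. W r \<omega>)) \<partial>P)"
    by (intro nn_integral_cong) (simp add: occupation_shift[OF B.W_cont a g])
  also have "\<dots> = (\<integral>\<^sup>+\<omega>. ?h \<omega> * (\<integral>\<^sup>+\<omega>'. occupation 0 g (X \<omega> a) (path_shift a (\<lambda>r. W r \<omega>')) \<partial>P) \<partial>P)"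
  proof (rule B.markov[OF a])
    show "(\<lambda>z. occupation 0 g (fst z) (path_shift a (\<lambda>r. W r (snd z)))) \<in> borel_measurable (borel \<Otimes>\<^sub>M B.future a)"
      using occupation_measurable[OF cont_process_compose[OF B.cont_future[OF a] measurable_snd] measurable_fst, where T="\<lambda>_. 0" and g=g]
      by simp
  qed measurable
  also have "\<dots> = (\<integral>\<^sup>+\<omega>. (if Q \<omega> then ennreal (exp (- lam * a)) * potential g (X \<omega> a) else 0) \<partial>P)"
    using expectation_occupation[OF B.brownian_shift[OF a] g]
    by (intro nn_integral_cong) simp
  finally show ?thesis .
qed

lemma occupation_grid_hit:
  "(\<integral>\<^sup>+\<omega>. (if ruin_time (X \<omega>) < \<infinity> then occupation (grid_hit n \<omega>) g v (\<lambda>r. W r \<omega>) else 0) \<partial>P)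
    = (\<integral>\<^sup>+\<omega>. (if ruin_time (X \<omega>) < \<infinity> then ennreal (exp (- lam * grid_hit n \<omega>)) * potential g (X \<omega> (grid_hit n \<omega>)) else 0) \<partial>P)"
proof -
  define N where "N = real (Suc n)"
  have N: "N > 0" by (simp add: N_def)
  define Q where "Q = (\<lambda>k \<omega>. alive (X \<omega>) (real k / N) \<and> \<not> alive (X \<omega>) (real (Suc k) / N))"
  have Qp: "Measurable.pred (B.past (real (Suc k) / N)) (Q k)" for k
  proof -
    have "Measurable.pred (B.past (real (Suc k) / N)) (\<lambda>\<omega>. alive (X \<omega>) (real k / N))"
      by (rule alive_past[OF W]) (use N in \<open>auto intro: divide_right_mono\<close>)
    moreover have "Measurable.pred (B.past (real (Suc k) / N)) (\<lambda>\<omega>. alive (X \<omega>) (real (Suc k) / N))"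
      by (rule alive_past[OF W]) (use N in auto)
    ultimately show ?thesis unfolding Q_def by measurable
  qed
  have [measurable]: "Measurable.pred P (Q k)" for k
    using measurable_mono[OF order_refl refl B.sets_past_sub[of "real (Suc k) / N"], of "count_space UNIV"] Qp by auto
  have [measurable]: "(\<lambda>\<omega>. occupation (real (Suc k) / N) g v (\<lambda>r. W r \<omega>)) \<in> borel_measurable P" for k
    by (rule occupation_X_measurable) (use N in auto)
  have [measurable]: "(\<lambda>\<omega>. X \<omega> (real (Suc k) / N)) \<in> borel_measurable P" for k
    using X_at[of "\<lambda>_. real (Suc k) / N" P "\<lambda>\<omega>. \<omega>"] N by (simp add: max_def)
  have "(\<integral>\<^sup>+\<omega>. (if ruin_time (X \<omega>) < \<infinity> then occupation (grid_hit n \<omega>) g v (\<lambda>r. W r \<omega>) else 0) \<partial>P)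
     = (\<integral>\<^sup>+\<omega>. (\<Sum>k. if Q k \<omega> then occupation (real (Suc k) / N) g v (\<lambda>r. W r \<omega>) else 0) \<partial>P)"
    unfolding Q_def N_def
  proof (intro nn_integral_cong)
    fix \<omega> assume "\<omega> \<in> space P"
    from grid_sum[OF this, of n "\<lambda>a. occupation a g v (\<lambda>r. W r \<omega>)", symmetric]
    show "(if ruin_time (X \<omega>) < \<infinity> then occupation (grid_hit n \<omega>) g v (\<lambda>r. W r \<omega>) else 0)
      = (\<Sum>k. if alive (X \<omega>) (real k / real (Suc n)) \<and> \<not> alive (X \<omega>) (real (Suc k) / real (Suc n))
         then occupation (real (Suc k) / real (Suc n)) g v (\<lambda>r. W r \<omega>) else 0)" .
  qed
  also have "\<dots> = (\<Sum>k. \<integral>\<^sup>+\<omega>. (if Q k \<omega> then occupation (real (Suc k) / N) g v (\<lambda>r. W r \<omega>) else 0) \<partial>P)"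
    by (rule nn_integral_suminf) measurable
  also have "\<dots> = (\<Sum>k. \<integral>\<^sup>+\<omega>. (if Q k \<omega> then ennreal (exp (- lam * (real (Suc k) / N))) * potential g (X \<omega> (real (Suc k) / N)) else 0) \<partial>P)"
    by (intro suminf_cong occupation_restart Qp) (use N in auto)
  also have "\<dots> = (\<integral>\<^sup>+\<omega>. (\<Sum>k. if Q k \<omega> then ennreal (exp (- lam * (real (Suc k) / N))) * potential g (X \<omega> (real (Suc k) / N)) else 0) \<partial>P)"
    by (rule nn_integral_suminf[symmetric]) measurable
  also have "\<dots> = (\<integral>\<^sup>+\<omega>. (if ruin_time (X \<omega>) < \<infinity> then ennreal (exp (- lam * grid_hit n \<omega>)) * potential g (X \<omega> (grid_hit n \<omega>)) else 0) \<partial>P)"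
    unfolding Q_def N_def
  proof (intro nn_integral_cong)
    fix \<omega> assume "\<omega> \<in> space P"
    from grid_sum[OF this, of n "\<lambda>a. ennreal (exp (- lam * a)) * potential g (X \<omega> a)"]
    show "(\<Sum>k. if alive (X \<omega>) (real k / real (Suc n)) \<and> \<not> alive (X \<omega>) (real (Suc k) / real (Suc n))
         then ennreal (exp (- lam * (real (Suc k) / real (Suc n)))) * potential g (X \<omega> (real (Suc k) / real (Suc n))) else 0)
       = (if ruin_time (X \<omega>) < \<infinity> then ennreal (exp (- lam * grid_hit n \<omega>)) * potential g (X \<omega> (grid_hit n \<omega>)) else 0)" .
  qed
  finally show ?thesis .
qed

text \<open>For the rounded hitting times the identity holds window by window. On the left the
  occupation converges because the time sets differ by shrinking intervals; on the right the rounded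
  positions converge to zero and the potential is continuous there. The bound \<open>1 / lam\<close>
  dominates both.\<close>

lemma strong_markov:
  "(\<integral>\<^sup>+\<omega>. (if ruin_time (X \<omega>) < \<infinity> then occupation (hit \<omega>) g v (\<lambda>r. W r \<omega>) else 0) \<partial>P)
    = (\<integral>\<^sup>+\<omega>. (if ruin_time (X \<omega>) < \<infinity> then ennreal (exp (- lam * hit \<omega>)) else 0) \<partial>P) * potential g 0"
proof -
  have [measurable]: "(\<lambda>\<omega>. X \<omega> (grid_hit n \<omega>)) \<in> borel_measurable P" for n
    using X_at[of "grid_hit n" P "\<lambda>\<omega>. \<omega>"] grid_hit_nonneg by (simp add: max_def)
  have [measurable]: "(\<lambda>\<omega>. occupation (grid_hit n \<omega>) g v (\<lambda>r. W r \<omega>)) \<in> borel_measurable P" for n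
    by (rule occupation_X_measurable) (use grid_hit_nonneg in auto)
  have [measurable]: "(\<lambda>\<omega>. occupation (hit \<omega>) g v (\<lambda>r. W r \<omega>)) \<in> borel_measurable P"
    by (rule occupation_X_measurable) auto
  have lam_fin: "(\<integral>\<^sup>+\<omega>. ennreal (1 / lam) \<partial>P) < \<infinity>" by (simp add: B.emeasure_space_1)
  have "(\<lambda>n. \<integral>\<^sup>+\<omega>. (if ruin_time (X \<omega>) < \<infinity> then occupation (grid_hit n \<omega>) g v (\<lambda>r. W r \<omega>) else 0) \<partial>P)
    \<longlonglongrightarrow> (\<integral>\<^sup>+\<omega>. (if ruin_time (X \<omega>) < \<infinity> then occupation (hit \<omega>) g v (\<lambda>r. W r \<omega>) else 0) \<partial>P)"
  proof (rule nn_integral_dominated_convergence[where w="\<lambda>_. ennreal (1 / lam)"])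
    show "AE \<omega> in P. (if ruin_time (X \<omega>) < \<infinity> then occupation (grid_hit n \<omega>) g v (\<lambda>r. W r \<omega>) else 0) \<le> ennreal (1 / lam)" for n
      using occupation_le[OF g_le grid_hit_nonneg] by (intro AE_I2) auto
    show "AE \<omega> in P. (\<lambda>n. if ruin_time (X \<omega>) < \<infinity> then occupation (grid_hit n \<omega>) g v (\<lambda>r. W r \<omega>) else 0)
       \<longlonglongrightarrow> (if ruin_time (X \<omega>) < \<infinity> then occupation (hit \<omega>) g v (\<lambda>r. W r \<omega>) else 0)"
    proof (rule AE_I2)
      fix \<omega> assume w: "\<omega> \<in> space P"
      have [measurable]: "(\<lambda>t. X \<omega> (max 0 t)) \<in> borel_measurable borel"
        using X_at[of "\<lambda>t. t" borel "\<lambda>_. \<omega>"] w by simp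
      let ?f = "\<lambda>a t. ennreal (exp (- lam * t)) * g (X \<omega> (max 0 t)) * indicator {a..} t"
      have occ: "occupation a g v (\<lambda>r. W r \<omega>) = (\<integral>\<^sup>+t. ?f a t \<partial>lborel)" if "a \<ge> 0" for a
        unfolding occupation_def using that by (intro nn_integral_cong) (auto split: split_indicator simp: max_def)
      have "(\<lambda>n. \<integral>\<^sup>+t. ?f (grid_hit n \<omega>) t \<partial>lborel) \<longlonglongrightarrow> (\<integral>\<^sup>+t. ?f (hit \<omega>) t \<partial>lborel)"
      proof (rule nn_integral_dominated_convergence[where w="\<lambda>t. ennreal (exp (- lam * t)) * indicator {0..} t"])
        show "(\<integral>\<^sup>+t. ennreal (exp (- lam * t)) * indicator {0..} t \<partial>lborel) < \<infinity>"
          unfolding exp_time_integral by simp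
        show "AE t in lborel. ?f (grid_hit n \<omega>) t \<le> ennreal (exp (- lam * t)) * indicator {0..} t" for n
        proof (rule AE_I2)
          fix t
          have "ennreal (exp (- lam * t)) * g (X \<omega> (max 0 t)) \<le> ennreal (exp (- lam * t)) * 1"
            by (intro mult_left_mono g_le) auto
          then show "?f (grid_hit n \<omega>) t \<le> ennreal (exp (- lam * t)) * indicator {0..} t"
            using grid_hit_nonneg[of n \<omega>] by (auto split: split_indicator)
        qed
        have "AE t in lborel. t \<noteq> hit \<omega>" by (rule AE_lborel_singleton)
        then show "AE t in lborel. (\<lambda>n. ?f (grid_hit n \<omega>) t) \<longlonglongrightarrow> ?f (hit \<omega>) t"
        proof eventually_elim
          case (elim t)
          have "\<forall>\<^sub>F n in sequentially. ?f (grid_hit n \<omega>) t = ?f (hit \<omega>) t"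
          proof (cases "t < hit \<omega>")
            case True
            then have "t < grid_hit n \<omega>" for n using grid_hit_bounds(1)[of \<omega> n] by linarith
            then show ?thesis using True by (intro always_eventually allI) (auto split: split_indicator simp: not_le)
          next
            case False
            then have "hit \<omega> < t" using elim by simp
            show ?thesis
              by (rule eventually_mono[OF order_tendstoD(2)[OF grid_hit_tendsto \<open>hit \<omega> < t\<close>]])
                 (use \<open>hit \<omega> < t\<close> in \<open>auto split: split_indicator\<close>)
          qed
          then show ?case by (rule tendsto_eventually)
        qed
      qed measurable
      then show "(\<lambda>n. if ruin_time (X \<omega>) < \<infinity> then occupation (grid_hit n \<omega>) g v (\<lambda>r. W r \<omega>) else 0)
       \<longlonglongrightarrow> (if ruin_time (X \<omega>) < \<infinity> then occupation (hit \<omega>) g v (\<lambda>r. W r \<omega>) else 0)"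
        using occ[OF grid_hit_nonneg] occ[OF enn2real_nonneg] by simp
    qed
  qed (use lam_fin in auto)
  moreover have "(\<lambda>n. \<integral>\<^sup>+\<omega>. (if ruin_time (X \<omega>) < \<infinity> then occupation (grid_hit n \<omega>) g v (\<lambda>r. W r \<omega>) else 0) \<partial>P)
    \<longlonglongrightarrow> (\<integral>\<^sup>+\<omega>. (if ruin_time (X \<omega>) < \<infinity> then ennreal (exp (- lam * hit \<omega>)) * potential g 0 else 0) \<partial>P)"
    unfolding occupation_grid_hit
  proof (rule nn_integral_dominated_convergence[where w="\<lambda>_. ennreal (1 / lam)"])
    show "AE \<omega> in P. (if ruin_time (X \<omega>) < \<infinity> then ennreal (exp (- lam * grid_hit n \<omega>)) * potential g (X \<omega> (grid_hit n \<omega>)) else 0) \<le> ennreal (1 / lam)" for n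
    proof (rule AE_I2)
      fix \<omega>
      have "ennreal (exp (- lam * grid_hit n \<omega>)) \<le> 1"
        using grid_hit_nonneg[of n \<omega>] lam_pos by (simp add: ennreal_le_1)
      then have "ennreal (exp (- lam * grid_hit n \<omega>)) * potential g (X \<omega> (grid_hit n \<omega>)) \<le> 1 * ennreal (1 / lam)"
        by (rule mult_mono) (use potential_bound[OF g g_le W] in auto)
      then show "(if ruin_time (X \<omega>) < \<infinity> then ennreal (exp (- lam * grid_hit n \<omega>)) * potential g (X \<omega> (grid_hit n \<omega>)) else 0) \<le> ennreal (1 / lam)"
        by simp
    qed
    show "AE \<omega> in P. (\<lambda>n. if ruin_time (X \<omega>) < \<infinity> then ennreal (exp (- lam * grid_hit n \<omega>)) * potential g (X \<omega> (grid_hit n \<omega>)) else 0)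
       \<longlonglongrightarrow> (if ruin_time (X \<omega>) < \<infinity> then ennreal (exp (- lam * hit \<omega>)) * potential g 0 else 0)"
    proof (rule AE_I2)
      fix \<omega> assume w: "\<omega> \<in> space P"
      show "(\<lambda>n. if ruin_time (X \<omega>) < \<infinity> then ennreal (exp (- lam * grid_hit n \<omega>)) * potential g (X \<omega> (grid_hit n \<omega>)) else 0)
       \<longlonglongrightarrow> (if ruin_time (X \<omega>) < \<infinity> then ennreal (exp (- lam * hit \<omega>)) * potential g 0 else 0)"
      proof (cases "ruin_time (X \<omega>) < \<infinity>")
        case True
        note h = hit_facts[OF w True]
        have "(\<lambda>n. X \<omega> (grid_hit n \<omega>)) \<longlonglongrightarrow> X \<omega> (hit \<omega>)"
          by (rule continuous_on_tendsto_compose[OF cont_X[OF w] grid_hit_tendsto]) (auto simp: grid_hit_nonneg)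
        then have 1: "(\<lambda>n. potential g (X \<omega> (grid_hit n \<omega>))) \<longlonglongrightarrow> potential g 0"
          unfolding h(2) by (rule potential_tendsto[OF g])
        have 2: "(\<lambda>n. ennreal (exp (- lam * grid_hit n \<omega>))) \<longlonglongrightarrow> ennreal (exp (- lam * hit \<omega>))"
          by (intro tendsto_intros tendsto_ennrealI grid_hit_tendsto)
        have "potential g 0 < \<infinity>"
          using potential_bound[OF g g_le W, of 0] by (simp add: le_less_trans)
        then have "(\<lambda>n. ennreal (exp (- lam * grid_hit n \<omega>)) * potential g (X \<omega> (grid_hit n \<omega>))) \<longlonglongrightarrow> ennreal (exp (- lam * hit \<omega>)) * potential g 0"
          by (intro tendsto_mult_ennreal 1 2) auto
        then show ?thesis using True by simp
      qed simp
    qed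
  qed (use lam_fin in auto)
  ultimately have "(\<integral>\<^sup>+\<omega>. (if ruin_time (X \<omega>) < \<infinity> then occupation (hit \<omega>) g v (\<lambda>r. W r \<omega>) else 0) \<partial>P)
    = (\<integral>\<^sup>+\<omega>. (if ruin_time (X \<omega>) < \<infinity> then ennreal (exp (- lam * hit \<omega>)) * potential g 0 else 0) \<partial>P)"
    by (rule LIMSEQ_unique)
  also have "\<dots> = (\<integral>\<^sup>+\<omega>. (if ruin_time (X \<omega>) < \<infinity> then ennreal (exp (- lam * hit \<omega>)) else 0) * potential g 0 \<partial>P)"
    by (intro nn_integral_cong) simp
  also have "\<dots> = (\<integral>\<^sup>+\<omega>. (if ruin_time (X \<omega>) < \<infinity> then ennreal (exp (- lam * hit \<omega>)) else 0) \<partial>P) * potential g 0"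
    by (rule nn_integral_multc) measurable
  finally show ?thesis .
qed

end
end
end

section \<open>Occupation before ruin and the killed resolvent\<close>

lemma alive_time_measurable:
  assumes "continuous_on {0..} x"
  shows "Measurable.pred borel (\<lambda>t. 0 \<le> t \<and> alive x t)"
proof -
  have cp: "cont_process borel (\<lambda>t (_::real). x t)" using assms by (simp add: cont_process_def)
  show ?thesis by (rule pred_alive[OF cp, of "\<lambda>t. t"]) auto
qed

lemma cont_time_measurable:
  fixes x :: "real \<Rightarrow> real"
  assumes "continuous_on {0..} x"
  shows "(\<lambda>t. x (max 0 t)) \<in> borel_measurable borel"
proof -
  have cp: "cont_process borel (\<lambda>t (_::real). x t)" using assms by (simp add: cont_process_def)
  show ?thesis by (rule cont_process_at[OF cp, of "\<lambda>t. t"]) auto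
qed

lemma continuous_on_drifted:
  "continuous_on {0..} y \<Longrightarrow> continuous_on {0..} (drifted c \<sigma> v y)"
  unfolding drifted_def by (intro continuous_intros)

lemma power_time_integral:
  fixes T K :: real
  assumes "T \<ge> 0" "K \<ge> 0"
  shows "(\<integral>\<^sup>+a. ennreal (K * (T - a) ^ k / fact k) * indicator {0..T} a \<partial>lborel) = ennreal (K * T ^ Suc k / fact (Suc k))"
proof -
  let ?F = "\<lambda>a. - (K * (T - a) ^ Suc k / fact (Suc k))"
  have "(\<integral>\<^sup>+a. ennreal (K * (T - a) ^ k / fact k) * indicator {0..T} a \<partial>lborel) = ennreal (?F T - ?F 0)"
  proof (rule nn_integral_FTC_Icc[where F="?F"])
    fix a assume a: "a \<in> {0..T}"
    have "((\<lambda>a. (T - a) ^ Suc k) has_real_derivative real (Suc k) * (T - a) ^ k * (- 1)) (at a)"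
      by (auto intro!: derivative_eq_intros simp del: power_Suc)
    then have "((\<lambda>a. - (K / fact (Suc k)) * (T - a) ^ Suc k) has_real_derivative
        - (K / fact (Suc k)) * (real (Suc k) * (T - a) ^ k * (- 1))) (at a)"
      by (rule DERIV_cmult)
    also have "(\<lambda>a. - (K / fact (Suc k)) * (T - a) ^ Suc k) = ?F" by (auto simp: fun_eq_iff)
    also have "- (K / fact (Suc k)) * (real (Suc k) * (T - a) ^ k * (- 1)) = K * (T - a) ^ k / fact k"
      by (simp add: fact_Suc divide_simps del: of_nat_Suc)
    finally show "(?F has_real_derivative K * (T - a) ^ k / fact k) (at a)" .
    show "0 \<le> K * (T - a) ^ k / fact k" using assms a by simp
  qed (use assms in auto)
  then show ?thesis by simp
qed

context drift_diffusion
begin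

text \<open>The weights \<open>t ^ k / fact k\<close> are those of the uniformized phase-type law;
  they are also the volumes of the ordered \<open>k\<close>-tuples of intermediate times, which is
  why they produce powers of the resolvent.\<close>

definition killed_occ :: "nat \<Rightarrow> (real \<Rightarrow> ennreal) \<Rightarrow> real \<Rightarrow> (real \<Rightarrow> real) \<Rightarrow> ennreal" where
  "killed_occ k g x y = (\<integral>\<^sup>+t. (if 0 \<le> t \<and> alive (drifted c \<sigma> x y) t
     then ennreal (exp (- lam * t) * t ^ k / fact k) * g (drifted c \<sigma> x y t) else 0) \<partial>lborel)"

definition hit_moment :: "nat \<Rightarrow> real \<Rightarrow> (real \<Rightarrow> real) \<Rightarrow> ennreal" where
  "hit_moment k x y = (let T = ruin_time (drifted c \<sigma> x y) in
     if T < \<infinity> then ennreal (exp (- lam * enn2real T) * enn2real T ^ k / fact k) else 0)"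

lemma killed_occ_measurable:
  assumes Y: "cont_process F Y" and v: "v \<in> borel_measurable F" and g [measurable]: "g \<in> borel_measurable borel"
  shows "(\<lambda>\<omega>. killed_occ k g (v \<omega>) (\<lambda>r. Y r \<omega>)) \<in> borel_measurable F"
proof -
  have cp: "cont_process (F \<Otimes>\<^sub>M lborel) (\<lambda>t z. Y t (fst z))" by (rule cont_process_compose[OF Y measurable_fst])
  have v': "(\<lambda>z. v (fst z)) \<in> borel_measurable (F \<Otimes>\<^sub>M lborel)" by (rule measurable_compose[OF measurable_fst v])
  have [measurable]: "(\<lambda>z. drifted c \<sigma> (v (fst z)) (\<lambda>r. Y r (fst z)) (max 0 (snd z))) \<in> borel_measurable (F \<Otimes>\<^sub>M lborel)"
    by (rule cont_process_drifted_at[OF cp v']) auto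
  have [measurable]: "Measurable.pred (F \<Otimes>\<^sub>M lborel) (\<lambda>z. 0 \<le> snd z \<and> alive (drifted c \<sigma> (v (fst z)) (\<lambda>r. Y r (fst z))) (snd z))"
    using pred_alive[OF cont_process_drifted[OF cp v'], of snd c \<sigma>] by simp
  have "(\<lambda>\<omega>. \<integral>\<^sup>+t. (if 0 \<le> t \<and> alive (drifted c \<sigma> (v \<omega>) (\<lambda>r. Y r \<omega>)) t
     then ennreal (exp (- lam * t) * t ^ k / fact k) * g (drifted c \<sigma> (v \<omega>) (\<lambda>r. Y r \<omega>) (max 0 t)) else 0) \<partial>lborel) \<in> borel_measurable F"
    by (rule sigma_finite_measure.borel_measurable_nn_integral) (auto intro: sigma_finite_lborel simp: split_beta)
  then show ?thesis
    unfolding killed_occ_def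
    by (rule measurable_cong[THEN iffD1, rotated]) (intro nn_integral_cong, simp add: max_def)
qed

lemma hit_moment_measurable:
  assumes Y: "cont_process F Y" and v: "v \<in> borel_measurable F"
  shows "(\<lambda>\<omega>. hit_moment k (v \<omega>) (\<lambda>r. Y r \<omega>)) \<in> borel_measurable F"
proof -
  have [measurable]: "(\<lambda>\<omega>. ruin_time (drifted c \<sigma> (v \<omega>) (\<lambda>r. Y r \<omega>))) \<in> borel_measurable F"
    using ruin_time_measurable[OF cont_process_drifted[OF Y v]] by simp
  show ?thesis unfolding hit_moment_def Let_def by measurable
qed

text \<open>The time axis is cut at the hitting time. The strong Markov property turns the later
  part into the transform of the hitting time multiplied by the potential at zero.\<close>

lemma potential_split:
  assumes W: "brownian P W" and v: "v > 0" and g [measurable]: "g \<in> borel_measurable borel" and g_le: "\<And>x. g x \<le> 1"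
  shows "potential g v = (\<integral>\<^sup>+\<omega>. killed_occ 0 g v (\<lambda>r. W r \<omega>) \<partial>P) + (\<integral>\<^sup>+\<omega>. hit_moment 0 v (\<lambda>r. W r \<omega>) \<partial>P) * potential g 0"
proof -
  interpret B: brownian P W by (rule W)
  let ?X = "\<lambda>\<omega>. drifted c \<sigma> v (\<lambda>r. W r \<omega>)"
  let ?O = "\<lambda>\<omega>. if ruin_time (?X \<omega>) < \<infinity> then occupation (enn2real (ruin_time (?X \<omega>))) g v (\<lambda>r. W r \<omega>) else 0"
  have [measurable]: "(\<lambda>\<omega>. ruin_time (?X \<omega>)) \<in> borel_measurable P"
    by (rule ruin_measurable[OF W v])
  have [measurable]: "(\<lambda>\<omega>. occupation (enn2real (ruin_time (?X \<omega>))) g v (\<lambda>r. W r \<omega>)) \<in> borel_measurable P"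
    by (rule occupation_measurable[OF B.cont_W]) auto
  have [measurable]: "(\<lambda>\<omega>. killed_occ 0 g v (\<lambda>r. W r \<omega>)) \<in> borel_measurable P"
    by (rule killed_occ_measurable[OF B.cont_W]) auto
  have split: "occupation 0 g v (\<lambda>r. W r \<omega>) = killed_occ 0 g v (\<lambda>r. W r \<omega>) + ?O \<omega>" if w: "\<omega> \<in> space P" for \<omega>
  proof -
    have c: "continuous_on {0..} (?X \<omega>)" by (rule continuous_on_drifted[OF B.W_cont[OF w]])
    note [measurable] = alive_time_measurable[OF c] cont_time_measurable[OF c]
    have "occupation 0 g v (\<lambda>r. W r \<omega>) = (\<integral>\<^sup>+t. (if 0 \<le> t \<and> alive (?X \<omega>) t
        then ennreal (exp (- lam * t) * t ^ 0 / fact 0) * g (?X \<omega> (max 0 t)) else 0)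
        + (if ruin_time (?X \<omega>) < \<infinity> then ennreal (exp (- lam * t)) * g (?X \<omega> (max 0 t)) * indicator {enn2real (ruin_time (?X \<omega>))..} t else 0) \<partial>lborel)"
      unfolding occupation_def
    proof (rule nn_integral_cong)
      fix t
      show "ennreal (exp (- lam * t)) * g (?X \<omega> t) * indicator {0..} t = (if 0 \<le> t \<and> alive (?X \<omega>) t
        then ennreal (exp (- lam * t) * t ^ 0 / fact 0) * g (?X \<omega> (max 0 t)) else 0)
        + (if ruin_time (?X \<omega>) < \<infinity> then ennreal (exp (- lam * t)) * g (?X \<omega> (max 0 t)) * indicator {enn2real (ruin_time (?X \<omega>))..} t else 0)"
      proof (cases "t \<ge> 0")
        case False
        then have "t < enn2real (ruin_time (?X \<omega>))" by (meson enn2real_nonneg not_le order.trans order_le_less_trans)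
        then show ?thesis using False by simp
      next
        case t: True
        show ?thesis
        proof (cases "ruin_time (?X \<omega>)" rule: ennreal_cases)
          case (real r)
          then have "alive (?X \<omega>) t \<longleftrightarrow> t < r"
            using alive_iff_ruin_time[OF c t] t by (simp add: ennreal_less_iff)
          then show ?thesis using t real by (auto split: split_indicator)
        next
          case top
          then have "alive (?X \<omega>) t" using alive_iff_ruin_time[OF c t] by simp
          then show ?thesis using t top by simp
        qed
      qed
    qed
    also have "\<dots> = (\<integral>\<^sup>+t. (if 0 \<le> t \<and> alive (?X \<omega>) t
        then ennreal (exp (- lam * t) * t ^ 0 / fact 0) * g (?X \<omega> (max 0 t)) else 0) \<partial>lborel)
        + (\<integral>\<^sup>+t. (if ruin_time (?X \<omega>) < \<infinity> then ennreal (exp (- lam * t)) * g (?X \<omega> (max 0 t)) * indicator {enn2real (ruin_time (?X \<omega>))..} t else 0) \<partial>lborel)"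
      by (rule nn_integral_add) measurable
    also have "(\<integral>\<^sup>+t. (if 0 \<le> t \<and> alive (?X \<omega>) t
        then ennreal (exp (- lam * t) * t ^ 0 / fact 0) * g (?X \<omega> (max 0 t)) else 0) \<partial>lborel) = killed_occ 0 g v (\<lambda>r. W r \<omega>)"
      unfolding killed_occ_def by (intro nn_integral_cong) (simp add: max_def)
    also have "(\<integral>\<^sup>+t. (if ruin_time (?X \<omega>) < \<infinity> then ennreal (exp (- lam * t)) * g (?X \<omega> (max 0 t)) * indicator {enn2real (ruin_time (?X \<omega>))..} t else 0) \<partial>lborel) = ?O \<omega>"
    proof -
      have m: "max 0 t = t" if "t \<in> {enn2real (ruin_time (?X \<omega>))..}" for t
        using that enn2real_nonneg[of "ruin_time (?X \<omega>)"] by (simp only: atLeast_iff max_def) (meson order.trans)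
      show ?thesis unfolding occupation_def by (auto intro!: nn_integral_cong simp: m split: split_indicator)
    qed
    finally show ?thesis .
  qed
  have "potential g v = (\<integral>\<^sup>+\<omega>. occupation 0 g v (\<lambda>r. W r \<omega>) \<partial>P)"
    by (rule expectation_occupation[OF W g, symmetric])
  also have "\<dots> = (\<integral>\<^sup>+\<omega>. killed_occ 0 g v (\<lambda>r. W r \<omega>) + ?O \<omega> \<partial>P)"
    by (intro nn_integral_cong split)
  also have "\<dots> = (\<integral>\<^sup>+\<omega>. killed_occ 0 g v (\<lambda>r. W r \<omega>) \<partial>P) + (\<integral>\<^sup>+\<omega>. ?O \<omega> \<partial>P)"
    by (rule nn_integral_add) measurable
  also have "(\<integral>\<^sup>+\<omega>. ?O \<omega> \<partial>P) = (\<integral>\<^sup>+\<omega>. hit_moment 0 v (\<lambda>r. W r \<omega>) \<partial>P) * potential g 0"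
    using strong_markov[OF W v g g_le] by (simp add: hit_moment_def Let_def cong: if_cong)
  finally show ?thesis .
qed

lemma killed_occ_0_pos:
  assumes "\<And>x. x > 0 \<Longrightarrow> g x = h x"
  shows "killed_occ k g v y = killed_occ k h v y"
  unfolding killed_occ_def
proof (intro nn_integral_cong)
  fix t
  have "drifted c \<sigma> v y t > 0" if "0 \<le> t" "alive (drifted c \<sigma> v y) t"
    using that by (simp add: alive_def)
  then show "(if 0 \<le> t \<and> alive (drifted c \<sigma> v y) t then ennreal (exp (- lam * t) * t ^ k / fact k) * g (drifted c \<sigma> v y t) else 0)
     = (if 0 \<le> t \<and> alive (drifted c \<sigma> v y) t then ennreal (exp (- lam * t) * t ^ k / fact k) * h (drifted c \<sigma> v y t) else 0)"
    using assms by simp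
qed

text \<open>The test function lives on \<open>{-1..0}\<close>, which is never visited before ruin,
  so \<open>potential_split\<close> has no killed part. On that set the free kernel started at
  \<open>v\<close> is \<open>exp (- rho * v)\<close> times the one started at zero. The common
  factor \<open>potential g 0\<close> is positive and finite and cancels.\<close>

lemma laplace_hit:
  assumes W: "brownian P W" and v: "v > 0"
  shows "(\<integral>\<^sup>+\<omega>. hit_moment 0 v (\<lambda>r. W r \<omega>) \<partial>P) = ennreal (exp (- rho * v))"
proof -
  define g :: "real \<Rightarrow> ennreal" where "g = indicator {-1..0}"
  have g [measurable]: "g \<in> borel_measurable borel" and g_le: "\<And>x. g x \<le> 1"
    by (auto simp: g_def split: split_indicator)
  have "killed_occ 0 g v y = killed_occ 0 (\<lambda>_. 0) v y" for y
    by (rule killed_occ_0_pos) (auto simp: g_def)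
  moreover have "killed_occ 0 (\<lambda>_. 0) v y = 0" for y
    unfolding killed_occ_def by (subst nn_integral_cong[where v="\<lambda>_. 0"]) auto
  ultimately have "killed_occ 0 g v y = 0" for y by simp
  with potential_split[OF W v g g_le]
  have 1: "potential g v = (\<integral>\<^sup>+\<omega>. hit_moment 0 v (\<lambda>r. W r \<omega>) \<partial>P) * potential g 0" by simp
  have 2: "potential g v = ennreal (exp (- rho * v)) * potential g 0"
  proof -
    have "potential g v = (\<integral>\<^sup>+z. ennreal (exp (- rho * v)) * (ennreal (free_kernel (z - 0)) * g z) \<partial>lborel)"
      unfolding potential_def
    proof (intro nn_integral_cong)
      fix z
      have "free_kernel (z - v) = exp (- rho * v) * free_kernel (z - 0)" if "z \<le> 0"
        using that v by (simp add: free_kernel_neg exp_add[symmetric] algebra_simps)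
      then show "ennreal (free_kernel (z - v)) * g z = ennreal (exp (- rho * v)) * (ennreal (free_kernel (z - 0)) * g z)"
        using free_kernel_gt0[of z] by (auto simp: g_def ennreal_mult less_imp_le split: split_indicator)
    qed
    also have "\<dots> = ennreal (exp (- rho * v)) * potential g 0"
      unfolding potential_def by (rule nn_integral_cmult) measurable
    finally show ?thesis .
  qed
  have fin: "potential g 0 < \<infinity>" using potential_bound[OF g g_le W, of 0] by (simp add: le_less_trans)
  have pos: "potential g 0 \<noteq> 0"
  proof -
    have "0 < ennreal (exp (- rho) / disc)" using disc_pos by simp
    also have "ennreal (exp (- rho) / disc) = (\<integral>\<^sup>+(z::real). ennreal (exp (- rho) / disc) * indicator {-1..0} z \<partial>lborel)"
      by (subst nn_integral_cmult_indicator) auto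
    also have "\<dots> \<le> potential g 0"
      unfolding potential_def g_def
    proof (intro nn_integral_mono)
      fix z :: real
      have "exp (- rho) / disc \<le> free_kernel z" if "-1 \<le> z" "z \<le> 0"
      proof -
        have "rho * (- 1) \<le> rho * z" using that rho_pos by (intro mult_left_mono) auto
        then show ?thesis using that disc_pos by (simp add: free_kernel_neg divide_right_mono)
      qed
      then show "ennreal (exp (- rho) / disc) * indicator {-1..0} z \<le> ennreal (free_kernel (z - 0)) * indicator {-1..0} z"
        by (auto split: split_indicator intro: ennreal_leI)
    qed
    finally show ?thesis by simp
  qed
  from 1 2 have "potential g 0 * (\<integral>\<^sup>+\<omega>. hit_moment 0 v (\<lambda>r. W r \<omega>) \<partial>P) = potential g 0 * ennreal (exp (- rho * v))"
    by (simp add: mult.commute)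
  then show ?thesis using fin pos by (auto simp: ennreal_mult_cancel_left)
qed

text \<open>Both sides differ from \<open>potential g v\<close> by the same finite amount: the
  killed kernel is designed to make the decomposition of the free kernel match
  \<open>potential_split\<close>.\<close>

lemma killed_resolvent_indicator:
  assumes W: "brownian P W" and v: "v > 0" and A [measurable]: "A \<in> sets borel"
  shows "(\<integral>\<^sup>+\<omega>. killed_occ 0 (indicator A) v (\<lambda>r. W r \<omega>) \<partial>P) = resolvent (indicator A) v"
proof -
  define g :: "real \<Rightarrow> ennreal" where "g = indicator (A \<inter> {0<..})"
  have g [measurable]: "g \<in> borel_measurable borel" and g_le: "\<And>x. g x \<le> 1"
    by (auto simp: g_def split: split_indicator)
  have "killed_occ 0 (indicator A) v y = killed_occ 0 g v y" for y
    by (rule killed_occ_0_pos) (auto simp: g_def indicator_def)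
  then have 1: "(\<integral>\<^sup>+\<omega>. killed_occ 0 (indicator A) v (\<lambda>r. W r \<omega>) \<partial>P) + ennreal (exp (- rho * v)) * potential g 0 = potential g v"
    using potential_split[OF W v g g_le] laplace_hit[OF W v] by simp
  have 2: "potential g v = resolvent (indicator A) v + ennreal (exp (- rho * v)) * potential g 0"
  proof -
    have "potential g v = (\<integral>\<^sup>+z. ennreal (killed_kernel v z) * indicator A z * indicator {0<..} z
        + ennreal (exp (- rho * v)) * (ennreal (free_kernel (z - 0)) * g z) \<partial>lborel)"
      unfolding potential_def
    proof (intro nn_integral_cong)
      fix z
      have "ennreal (free_kernel (z - v)) = ennreal (killed_kernel v z) + ennreal (exp (- rho * v)) * ennreal (free_kernel z)" if "z > 0"
        using killed_kernel_pos[OF v that] free_kernel_gt0[of z] free_kernel_gt0[of "z - v"]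
        by (simp add: ennreal_mult[symmetric] ennreal_plus[symmetric] less_imp_le killed_kernel_def del: ennreal_plus)
      then show "ennreal (free_kernel (z - v)) * g z = ennreal (killed_kernel v z) * indicator A z * indicator {0<..} z
        + ennreal (exp (- rho * v)) * (ennreal (free_kernel (z - 0)) * g z)"
        by (auto simp: g_def split: split_indicator)
    qed
    also have "\<dots> = resolvent (indicator A) v + (\<integral>\<^sup>+z. ennreal (exp (- rho * v)) * (ennreal (free_kernel (z - 0)) * g z) \<partial>lborel)"
      unfolding resolvent_def by (rule nn_integral_add) measurable
    also have "(\<integral>\<^sup>+z. ennreal (exp (- rho * v)) * (ennreal (free_kernel (z - 0)) * g z) \<partial>lborel) = ennreal (exp (- rho * v)) * potential g 0"
      unfolding potential_def by (rule nn_integral_cmult) measurable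
    finally show ?thesis .
  qed
  have "potential g 0 < \<infinity>" using potential_bound[OF g g_le W, of 0] by (simp add: le_less_trans)
  then have "ennreal (exp (- rho * v)) * potential g 0 \<noteq> \<infinity>" by (simp add: ennreal_mult_eq_top_iff)
  with 1 2 show ?thesis by (metis ennreal_add_left_cancel add.commute infinity_ennreal_def)
qed

text \<open>Both sides are integrals of \<open>g\<close> against measures on the line that agree on
  every Borel set, which lifts the identity from indicators to unbounded nonnegative
  functions.\<close>

lemma killed_resolvent:
  assumes W: "brownian P W" and v: "v > 0" and g [measurable]: "g \<in> borel_measurable borel"
  shows "(\<integral>\<^sup>+\<omega>. killed_occ 0 g v (\<lambda>r. W r \<omega>) \<partial>P) = resolvent g v"
proof -
  interpret B: brownian P W by (rule W)
  let ?X = "\<lambda>z. drifted c \<sigma> v (\<lambda>r. W r (fst z)) (max 0 (snd z))"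
  let ?d = "\<lambda>z. if 0 \<le> snd z \<and> alive (drifted c \<sigma> v (\<lambda>r. W r (fst z))) (snd z) then ennreal (exp (- lam * snd z)) else 0"
  have cp: "cont_process (P \<Otimes>\<^sub>M lborel) (\<lambda>t z. W t (fst z))" by (rule cont_process_compose[OF B.cont_W measurable_fst])
  have X [measurable]: "?X \<in> borel_measurable (P \<Otimes>\<^sub>M lborel)"
    by (rule cont_process_drifted_at[OF cp]) auto
  have [measurable]: "Measurable.pred (P \<Otimes>\<^sub>M lborel) (\<lambda>z. 0 \<le> snd z \<and> alive (drifted c \<sigma> v (\<lambda>r. W r (fst z))) (snd z))"
    using pred_alive[OF cont_process_drifted[OF cp, of "\<lambda>_. v"], of snd c \<sigma>] by simp
  have d [measurable]: "?d \<in> borel_measurable (P \<Otimes>\<^sub>M lborel)" by measurable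
  have ko: "(\<integral>\<^sup>+\<omega>. killed_occ 0 h v (\<lambda>r. W r \<omega>) \<partial>P) = (\<integral>\<^sup>+x. h x \<partial>distr (density (P \<Otimes>\<^sub>M lborel) ?d) borel ?X)"
    if [measurable]: "h \<in> borel_measurable borel" for h :: "real \<Rightarrow> ennreal"
  proof -
    have "(\<integral>\<^sup>+x. h x \<partial>distr (density (P \<Otimes>\<^sub>M lborel) ?d) borel ?X) = (\<integral>\<^sup>+z. ?d z * h (?X z) \<partial>(P \<Otimes>\<^sub>M lborel))"
      by (subst nn_integral_distr) (auto simp: nn_integral_density)
    also have "\<dots> = (\<integral>\<^sup>+\<omega>. \<integral>\<^sup>+t. ?d (\<omega>, t) * h (?X (\<omega>, t)) \<partial>lborel \<partial>P)"
      by (rule lborel.nn_integral_fst[symmetric]) measurable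
    also have "\<dots> = (\<integral>\<^sup>+\<omega>. killed_occ 0 h v (\<lambda>r. W r \<omega>) \<partial>P)"
      unfolding killed_occ_def by (intro nn_integral_cong) (simp add: max_def)
    finally show ?thesis by simp
  qed
  have re: "resolvent h v = (\<integral>\<^sup>+x. h x \<partial>density lborel (\<lambda>x. ennreal (killed_kernel v x) * indicator {0<..} x))"
    if [measurable]: "h \<in> borel_measurable borel" for h :: "real \<Rightarrow> ennreal"
    unfolding resolvent_def by (subst nn_integral_density) (auto intro!: nn_integral_cong simp: mult_ac)
  have "distr (density (P \<Otimes>\<^sub>M lborel) ?d) borel ?X = density lborel (\<lambda>x. ennreal (killed_kernel v x) * indicator {0<..} x)"
  proof (rule measure_eqI)
    fix A assume "A \<in> sets (distr (density (P \<Otimes>\<^sub>M lborel) ?d) borel ?X)"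
    then have A [measurable]: "A \<in> sets borel" by simp
    show "emeasure (distr (density (P \<Otimes>\<^sub>M lborel) ?d) borel ?X) A = emeasure (density lborel (\<lambda>x. ennreal (killed_kernel v x) * indicator {0<..} x)) A"
      using killed_resolvent_indicator[OF W v A] unfolding ko[of "indicator A", simplified] re[of "indicator A", simplified]
      by simp
  qed simp
  then show ?thesis using ko[OF g] re[OF g] by simp
qed

end

section \<open>Powers of the resolvent\<close>

context drift_diffusion
begin

text \<open>The weight at \<open>Suc k\<close> is the integral over an intermediate time
  \<open>a\<close> of the weight at \<open>k\<close> for the remaining time \<open>t - a\<close>.
  Survival up to \<open>t\<close> splits into survival up to \<open>a\<close> and survival of the
  path restarted at \<open>a\<close>.\<close>

lemma killed_occ_Suc:
  assumes y: "continuous_on {0..} y" and g [measurable]: "g \<in> borel_measurable borel"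
  shows "killed_occ (Suc k) g x y = (\<integral>\<^sup>+a. (if 0 \<le> a \<and> alive (drifted c \<sigma> x y) a
     then ennreal (exp (- lam * a)) * killed_occ k g (drifted c \<sigma> x y a) (path_shift a y) else 0) \<partial>lborel)"
proof -
  let ?X = "drifted c \<sigma> x y"
  have c: "continuous_on {0..} ?X" by (rule continuous_on_drifted[OF y])
  note [measurable] = alive_time_measurable[OF c] cont_time_measurable[OF c]
  let ?G = "\<lambda>a t. if 0 \<le> a \<and> a \<le> t \<and> (0 \<le> t \<and> alive ?X t)
     then ennreal (exp (- lam * t) * (t - a) ^ k / fact k) * g (?X (max 0 t)) else 0"
  have "(\<integral>\<^sup>+a. (if 0 \<le> a \<and> alive ?X a then ennreal (exp (- lam * a)) * killed_occ k g (?X a) (path_shift a y) else 0) \<partial>lborel)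
     = (\<integral>\<^sup>+a. \<integral>\<^sup>+t. ?G a t \<partial>lborel \<partial>lborel)"
  proof (rule nn_integral_cong)
    fix a :: real
    show "(if 0 \<le> a \<and> alive ?X a then ennreal (exp (- lam * a)) * killed_occ k g (?X a) (path_shift a y) else 0) = (\<integral>\<^sup>+t. ?G a t \<partial>lborel)"
    proof (cases "0 \<le> a \<and> alive ?X a")
      case True
      have "continuous_on {0..} (\<lambda>r. ?X (a + r))"
        by (rule continuous_on_compose2[OF c]) (use True in \<open>auto intro!: continuous_intros\<close>)
      then have c2: "continuous_on {0..} (drifted c \<sigma> (?X a) (path_shift a y))" by (simp add: drifted_shift)
      note [measurable] = alive_time_measurable[OF c2] cont_time_measurable[OF c2]
      have "(\<integral>\<^sup>+t. ?G a t \<partial>lborel) = (\<integral>\<^sup>+r. ?G a (a + r) \<partial>lborel)"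
        by (rule nn_integral_translate) measurable
      also have "\<dots> = (\<integral>\<^sup>+r. ennreal (exp (- lam * a)) * (if 0 \<le> r \<and> alive (drifted c \<sigma> (?X a) (path_shift a y)) r
          then ennreal (exp (- lam * r) * r ^ k / fact k) * g (drifted c \<sigma> (?X a) (path_shift a y) (max 0 r)) else 0) \<partial>lborel)"
      proof (rule nn_integral_cong)
        fix r :: real
        have e: "exp (- (lam * (a + r))) * r ^ k / fact k = exp (- (lam * a)) * (exp (- (lam * r)) * r ^ k / fact k)"
          by (simp add: exp_add[symmetric] algebra_simps)
        show "?G a (a + r) = ennreal (exp (- lam * a)) * (if 0 \<le> r \<and> alive (drifted c \<sigma> (?X a) (path_shift a y)) r
          then ennreal (exp (- lam * r) * r ^ k / fact k) * g (drifted c \<sigma> (?X a) (path_shift a y) (max 0 r)) else 0)"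
        proof (cases "r \<ge> 0")
          case r: True
          have "alive ?X (a + r) \<longleftrightarrow> alive (drifted c \<sigma> (?X a) (path_shift a y)) r"
            using alive_shift[of a r c \<sigma> x y] True r by simp
          then show ?thesis using True r
            by (simp add: e ennreal_mult mult.assoc drifted_shift max_def del: times_divide_eq_right)
        qed simp
      qed
      also have "\<dots> = ennreal (exp (- lam * a)) * (\<integral>\<^sup>+r. (if 0 \<le> r \<and> alive (drifted c \<sigma> (?X a) (path_shift a y)) r
          then ennreal (exp (- lam * r) * r ^ k / fact k) * g (drifted c \<sigma> (?X a) (path_shift a y) (max 0 r)) else 0) \<partial>lborel)"
        by (rule nn_integral_cmult) measurable
      also have "(\<integral>\<^sup>+r. (if 0 \<le> r \<and> alive (drifted c \<sigma> (?X a) (path_shift a y)) r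
          then ennreal (exp (- lam * r) * r ^ k / fact k) * g (drifted c \<sigma> (?X a) (path_shift a y) (max 0 r)) else 0) \<partial>lborel)
          = killed_occ k g (?X a) (path_shift a y)"
        unfolding killed_occ_def by (intro nn_integral_cong) (simp add: max_def)
      finally show ?thesis using True by simp
    next
      case False
      then have "?G a t = 0" for t using alive_antimono[of ?X t a] by auto
      then show ?thesis unfolding if_not_P[OF False] by simp
    qed
  qed
  also have "\<dots> = (\<integral>\<^sup>+t. \<integral>\<^sup>+a. ?G a t \<partial>lborel \<partial>lborel)"
    by (rule lborel_pair.Fubini') measurable
  also have "\<dots> = killed_occ (Suc k) g x y"
    unfolding killed_occ_def
  proof (rule nn_integral_cong)
    fix t :: real
    show "(\<integral>\<^sup>+a. ?G a t \<partial>lborel) = (if 0 \<le> t \<and> alive ?X t then ennreal (exp (- lam * t) * t ^ Suc k / fact (Suc k)) * g (?X t) else 0)"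
    proof (cases "0 \<le> t \<and> alive ?X t")
      case True
      then have "(\<integral>\<^sup>+a. ?G a t \<partial>lborel) = (\<integral>\<^sup>+a. ennreal (exp (- lam * t) * (t - a) ^ k / fact k) * indicator {0..t} a * g (?X t) \<partial>lborel)"
        by (intro nn_integral_cong) (auto simp: max_def split: split_indicator)
      also have "\<dots> = (\<integral>\<^sup>+a. ennreal (exp (- lam * t) * (t - a) ^ k / fact k) * indicator {0..t} a \<partial>lborel) * g (?X t)"
        by (rule nn_integral_multc) measurable
      also have "\<dots> = ennreal (exp (- lam * t) * t ^ Suc k / fact (Suc k)) * g (?X t)"
        using True by (subst power_time_integral) auto
      finally show ?thesis using True by simp
    next
      case False
      then have "(\<integral>\<^sup>+a. ?G a t \<partial>lborel) = 0" by (subst nn_integral_cong[where v="\<lambda>_. 0"]) auto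
      then show ?thesis unfolding if_not_P[OF False] .
    qed
  qed
  finally show ?thesis by simp
qed

text \<open>As for \<open>killed_occ_Suc\<close>, with the hitting time in place of
  \<open>t\<close>: a path alive at \<open>a\<close> has remaining hitting time
  \<open>T - a\<close>.\<close>

lemma hit_moment_Suc:
  assumes y: "continuous_on {0..} y" and y0: "y 0 = 0" and x: "x > 0"
  shows "hit_moment (Suc k) x y = (\<integral>\<^sup>+a. (if 0 \<le> a \<and> alive (drifted c \<sigma> x y) a
     then ennreal (exp (- lam * a)) * hit_moment k (drifted c \<sigma> x y a) (path_shift a y) else 0) \<partial>lborel)"
proof -
  let ?X = "drifted c \<sigma> x y"
  have c: "continuous_on {0..} ?X" by (rule continuous_on_drifted[OF y])
  have X0: "?X 0 > 0" using y0 x by (simp add: drifted_def)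
  have rt: "ruin_time ?X = ennreal a + ruin_time (drifted c \<sigma> (?X a) (path_shift a y))"
    if "0 \<le> a" "alive ?X a" for a
    using ruin_time_shift[OF that(1), of ?X] that(2) by (simp add: alive_def drifted_shift)
  show ?thesis
  proof (cases "ruin_time ?X" rule: ennreal_cases)
    case (real T)
    have "ruin_time ?X < \<infinity>" using real by simp
    note h = ruin_time_hit[OF c X0 this]
    have T: "enn2real (ruin_time ?X) = T" using real by simp
    have "(\<integral>\<^sup>+a. (if 0 \<le> a \<and> alive ?X a then ennreal (exp (- lam * a)) * hit_moment k (?X a) (path_shift a y) else 0) \<partial>lborel)
      = (\<integral>\<^sup>+a. ennreal (exp (- lam * T) * (T - a) ^ k / fact k) * indicator {0..T} a \<partial>lborel)"
    proof (rule nn_integral_cong_AE)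
      have "AE a in lborel. a \<noteq> T" by (rule AE_lborel_singleton)
      then show "AE a in lborel. (if 0 \<le> a \<and> alive ?X a then ennreal (exp (- lam * a)) * hit_moment k (?X a) (path_shift a y) else 0)
         = ennreal (exp (- lam * T) * (T - a) ^ k / fact k) * indicator {0..T} a"
      proof eventually_elim
        case (elim a)
        have al: "alive ?X a \<longleftrightarrow> a < T" if "0 \<le> a"
          using alive_iff_ruin_time[OF c that] that real by (simp add: ennreal_less_iff)
        show ?case
        proof (cases "0 \<le> a \<and> a < T")
          case True
          then have "ennreal T = ennreal a + ruin_time (drifted c \<sigma> (?X a) (path_shift a y))"
            using rt[of a] al real by simp
          moreover have "ennreal T = ennreal a + ennreal (T - a)"
            using True by (simp flip: ennreal_plus)
          ultimately have R: "ruin_time (drifted c \<sigma> (?X a) (path_shift a y)) = ennreal (T - a)"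
            by (metis ennreal_add_left_cancel ennreal_neq_top infinity_ennreal_def)
          have "exp (- lam * T) = exp (- lam * a) * exp (- lam * (T - a))"
            by (simp add: exp_add[symmetric] algebra_simps)
          then have "exp (- lam * T) * (T - a) ^ k / fact k = exp (- lam * a) * (exp (- lam * (T - a)) * (T - a) ^ k / fact k)"
            by simp
          then have "ennreal (exp (- lam * T) * (T - a) ^ k / fact k) = ennreal (exp (- lam * a)) * ennreal (exp (- lam * (T - a)) * (T - a) ^ k / fact k)"
            using True by (simp only:) (intro ennreal_mult, auto)
          then show ?thesis using True al
            by (simp add: hit_moment_def R Let_def)
        next
          case False
          then show ?thesis using elim al by auto
        qed
      qed
    qed
    also have "\<dots> = ennreal (exp (- lam * T) * T ^ Suc k / fact (Suc k))"
      using real by (intro power_time_integral) auto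
    finally show ?thesis by (simp add: hit_moment_def real Let_def del: power_Suc fact_Suc)
  next
    case top
    have "hit_moment k (?X a) (path_shift a y) = 0" if "0 \<le> a \<and> alive ?X a" for a
    proof -
      have "ennreal a + ruin_time (drifted c \<sigma> (?X a) (path_shift a y)) = \<top>"
        using rt[of a] that top by simp
      then have "ruin_time (drifted c \<sigma> (?X a) (path_shift a y)) = \<top>" by (simp add: ennreal_add_eq_top)
      then show ?thesis by (simp add: hit_moment_def Let_def)
    qed
    then have "(if 0 \<le> a \<and> alive ?X a then ennreal (exp (- lam * a)) * hit_moment k (?X a) (path_shift a y) else 0) = 0" for a
      by simp
    then show ?thesis using top by (simp add: hit_moment_def Let_def)
  qed
qed

text \<open>The Markov property at each fixed time \<open>a\<close>, integrated over
  \<open>a\<close> by Tonelli. Since \<open>alive\<close> at \<open>a\<close> forces a positive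
  position, the expectation of \<open>K\<close> is needed only for positive starting points. The
  free weight \<open>u\<close> allows both the exponential of the resolvent and a phase-type
  density.\<close>

lemma markov_time:
  assumes W: "brownian P W" and k [measurable]: "k \<in> borel_measurable borel" and u [measurable]: "u \<in> borel_measurable borel"
    and M1: "(\<lambda>z. K (drifted c \<sigma> v (\<lambda>r. W r (fst z)) (max 0 (snd z))) (path_shift (max 0 (snd z)) (\<lambda>r. W r (fst z)))) \<in> borel_measurable (P \<Otimes>\<^sub>M lborel)"
    and M2: "\<And>a. a \<ge> 0 \<Longrightarrow> (\<lambda>z. K (fst z) (path_shift a (\<lambda>r. W r (snd z)))) \<in> borel_measurable (borel \<Otimes>\<^sub>M brownian.future P W a)"
    and E: "\<And>a x. a \<ge> 0 \<Longrightarrow> x > 0 \<Longrightarrow> (\<integral>\<^sup>+\<omega>. K x (path_shift a (\<lambda>r. W r \<omega>)) \<partial>P) = k x"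
  shows "(\<integral>\<^sup>+\<omega>. \<integral>\<^sup>+a. (if 0 \<le> a \<and> alive (drifted c \<sigma> v (\<lambda>r. W r \<omega>)) a
     then u a * K (drifted c \<sigma> v (\<lambda>r. W r \<omega>) a) (path_shift a (\<lambda>r. W r \<omega>)) else 0) \<partial>lborel \<partial>P) = (\<integral>\<^sup>+\<omega>. \<integral>\<^sup>+a. (if 0 \<le> a \<and> alive (drifted c \<sigma> v (\<lambda>r. W r \<omega>)) a
     then u a * k (drifted c \<sigma> v (\<lambda>r. W r \<omega>) a) else 0) \<partial>lborel \<partial>P)"
proof -
  interpret B: brownian P W by (rule W)
  interpret PL: pair_sigma_finite P lborel by standard
  let ?X = "\<lambda>\<omega>. drifted c \<sigma> v (\<lambda>r. W r \<omega>)"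
  let ?h = "\<lambda>a \<omega>. if 0 \<le> a \<and> alive (?X \<omega>) a then u a else 0"
  have cp: "cont_process (P \<Otimes>\<^sub>M lborel) (\<lambda>t z. W t (fst z))" by (rule cont_process_compose[OF B.cont_W measurable_fst])
  have X [measurable]: "(\<lambda>z. ?X (fst z) (max 0 (snd z))) \<in> borel_measurable (P \<Otimes>\<^sub>M lborel)"
    by (rule cont_process_drifted_at[OF cp]) auto
  have [measurable]: "Measurable.pred (P \<Otimes>\<^sub>M lborel) (\<lambda>z. 0 \<le> snd z \<and> alive (?X (fst z)) (snd z))"
    using pred_alive[OF cont_process_drifted[OF cp, of "\<lambda>_. v"], of snd c \<sigma>] by simp
  note [measurable] = M1
  have "(\<integral>\<^sup>+\<omega>. \<integral>\<^sup>+a. (if 0 \<le> a \<and> alive (?X \<omega>) a then u a * K (?X \<omega> a) (path_shift a (\<lambda>r. W r \<omega>)) else 0) \<partial>lborel \<partial>P)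
     = (\<integral>\<^sup>+\<omega>. \<integral>\<^sup>+a. ?h a \<omega> * K (?X \<omega> (max 0 a)) (path_shift (max 0 a) (\<lambda>r. W r \<omega>)) \<partial>lborel \<partial>P)"
    by (intro nn_integral_cong) (simp add: max_def)
  also have "\<dots> = (\<integral>\<^sup>+a. \<integral>\<^sup>+\<omega>. ?h a \<omega> * K (?X \<omega> (max 0 a)) (path_shift (max 0 a) (\<lambda>r. W r \<omega>)) \<partial>P \<partial>lborel)"
    by (rule PL.Fubini'[symmetric]) (simp add: split_beta)
  also have "\<dots> = (\<integral>\<^sup>+a. \<integral>\<^sup>+\<omega>. ?h a \<omega> * k (?X \<omega> (max 0 a)) \<partial>P \<partial>lborel)"
  proof (rule nn_integral_cong)
    fix a :: real
    show "(\<integral>\<^sup>+\<omega>. ?h a \<omega> * K (?X \<omega> (max 0 a)) (path_shift (max 0 a) (\<lambda>r. W r \<omega>)) \<partial>P) = (\<integral>\<^sup>+\<omega>. ?h a \<omega> * k (?X \<omega> (max 0 a)) \<partial>P)"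
    proof (cases "a \<ge> 0")
      case True
      have [measurable]: "Measurable.pred (B.past a) (\<lambda>\<omega>. alive (?X \<omega>) a)"
        by (rule alive_past[OF W]) (use True in auto)
      have "(\<integral>\<^sup>+\<omega>. ?h a \<omega> * K (?X \<omega> a) (path_shift a (\<lambda>r. W r \<omega>)) \<partial>P)
         = (\<integral>\<^sup>+\<omega>. ?h a \<omega> * (\<integral>\<^sup>+\<omega>'. K (?X \<omega> a) (path_shift a (\<lambda>r. W r \<omega>')) \<partial>P) \<partial>P)"
        by (rule B.markov[OF True]) (measurable, rule M2[OF True])
      also have "\<dots> = (\<integral>\<^sup>+\<omega>. ?h a \<omega> * k (?X \<omega> a) \<partial>P)"
      proof (rule nn_integral_cong)
        fix \<omega>
        have "?X \<omega> a > 0" if "alive (?X \<omega>) a" using that True by (simp add: alive_def)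
        then show "?h a \<omega> * (\<integral>\<^sup>+\<omega>'. K (?X \<omega> a) (path_shift a (\<lambda>r. W r \<omega>')) \<partial>P) = ?h a \<omega> * k (?X \<omega> a)"
          using E[OF True] by simp
      qed
      finally show ?thesis using True by (simp add: max_def)
    qed simp
  qed
  also have "\<dots> = (\<integral>\<^sup>+\<omega>. \<integral>\<^sup>+a. ?h a \<omega> * k (?X \<omega> (max 0 a)) \<partial>lborel \<partial>P)"
    by (rule PL.Fubini') (simp add: split_beta)
  also have "\<dots> = (\<integral>\<^sup>+\<omega>. \<integral>\<^sup>+a. (if 0 \<le> a \<and> alive (?X \<omega>) a then u a * k (?X \<omega> a) else 0) \<partial>lborel \<partial>P)"
    by (intro nn_integral_cong) (simp add: max_def)
  finally show ?thesis .
qed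

lemma markov_resolvent:
  assumes W: "brownian P W" and v: "v > 0" and k [measurable]: "k \<in> borel_measurable borel"
    and M1: "(\<lambda>z. K (drifted c \<sigma> v (\<lambda>r. W r (fst z)) (max 0 (snd z))) (path_shift (max 0 (snd z)) (\<lambda>r. W r (fst z)))) \<in> borel_measurable (P \<Otimes>\<^sub>M lborel)"
    and M2: "\<And>a. a \<ge> 0 \<Longrightarrow> (\<lambda>z. K (fst z) (path_shift a (\<lambda>r. W r (snd z)))) \<in> borel_measurable (borel \<Otimes>\<^sub>M brownian.future P W a)"
    and E: "\<And>a x. a \<ge> 0 \<Longrightarrow> x > 0 \<Longrightarrow> (\<integral>\<^sup>+\<omega>. K x (path_shift a (\<lambda>r. W r \<omega>)) \<partial>P) = k x"
  shows "(\<integral>\<^sup>+\<omega>. \<integral>\<^sup>+a. (if 0 \<le> a \<and> alive (drifted c \<sigma> v (\<lambda>r. W r \<omega>)) a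
     then ennreal (exp (- lam * a)) * K (drifted c \<sigma> v (\<lambda>r. W r \<omega>) a) (path_shift a (\<lambda>r. W r \<omega>)) else 0) \<partial>lborel \<partial>P) = resolvent k v"
proof -
  have "(\<integral>\<^sup>+\<omega>. \<integral>\<^sup>+a. (if 0 \<le> a \<and> alive (drifted c \<sigma> v (\<lambda>r. W r \<omega>)) a
     then ennreal (exp (- lam * a)) * K (drifted c \<sigma> v (\<lambda>r. W r \<omega>) a) (path_shift a (\<lambda>r. W r \<omega>)) else 0) \<partial>lborel \<partial>P)
    = (\<integral>\<^sup>+\<omega>. \<integral>\<^sup>+a. (if 0 \<le> a \<and> alive (drifted c \<sigma> v (\<lambda>r. W r \<omega>)) a
     then ennreal (exp (- lam * a)) * k (drifted c \<sigma> v (\<lambda>r. W r \<omega>) a) else 0) \<partial>lborel \<partial>P)"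
    by (rule markov_time[OF W k _ M1 M2 E]) auto
  also have "\<dots> = (\<integral>\<^sup>+\<omega>. killed_occ 0 k v (\<lambda>r. W r \<omega>) \<partial>P)"
    unfolding killed_occ_def by (intro nn_integral_cong) simp
  also have "\<dots> = resolvent k v" by (rule killed_resolvent[OF W v k])
  finally show ?thesis .
qed

lemma resolvent_power_measurable [measurable]:
  "g \<in> borel_measurable borel \<Longrightarrow> (resolvent ^^ n) g \<in> borel_measurable borel"
  by (induction n) auto

lemma shifted_path_measurable:
  fixes P :: "'a measure" and K :: "real \<Rightarrow> (real \<Rightarrow> real) \<Rightarrow> ennreal"
  assumes W: "brownian P W"
    and K: "\<And>(F :: ('a \<times> real) measure) Y w. cont_process F Y \<Longrightarrow> w \<in> borel_measurable F \<Longrightarrow> (\<lambda>\<omega>. K (w \<omega>) (\<lambda>r. Y r \<omega>)) \<in> borel_measurable F"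
  shows "(\<lambda>z. K (drifted c \<sigma> v (\<lambda>r. W r (fst z)) (max 0 (snd z))) (path_shift (max 0 (snd z)) (\<lambda>r. W r (fst z)))) \<in> borel_measurable (P \<Otimes>\<^sub>M lborel)"
proof -
  interpret B: brownian P W by (rule W)
  have cp: "cont_process (P \<Otimes>\<^sub>M lborel) (\<lambda>t z. W t (fst z))" by (rule cont_process_compose[OF B.cont_W measurable_fst])
  have X: "(\<lambda>z. drifted c \<sigma> v (\<lambda>r. W r (fst z)) (max 0 (snd z))) \<in> borel_measurable (P \<Otimes>\<^sub>M lborel)"
    by (rule cont_process_drifted_at[OF cp]) auto
  have "cont_process (P \<Otimes>\<^sub>M lborel) (\<lambda>t z. path_shift (max 0 (snd z)) (\<lambda>r. W r (fst z)) t)"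
    by (rule cont_process_shift[OF cp]) auto
  from K[OF this X] show ?thesis by simp
qed

lemma future_path_measurable:
  fixes P :: "'a measure" and K :: "real \<Rightarrow> (real \<Rightarrow> real) \<Rightarrow> ennreal"
  assumes W: "brownian P W" and a: "a \<ge> 0"
    and K: "\<And>(F :: (real \<times> 'a) measure) Y w. cont_process F Y \<Longrightarrow> w \<in> borel_measurable F \<Longrightarrow> (\<lambda>\<omega>. K (w \<omega>) (\<lambda>r. Y r \<omega>)) \<in> borel_measurable F"
  shows "(\<lambda>z. K (fst z) (path_shift a (\<lambda>r. W r (snd z)))) \<in> borel_measurable (borel \<Otimes>\<^sub>M brownian.future P W a)"
proof -
  interpret B: brownian P W by (rule W)
  have 1: "cont_process (borel \<Otimes>\<^sub>M B.future a) (\<lambda>t (z :: real \<times> 'a). path_shift a (\<lambda>r. W r (snd z)) t)"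
    by (rule cont_process_compose[OF B.cont_future[OF a] measurable_snd])
  have 2: "fst \<in> borel_measurable (borel \<Otimes>\<^sub>M B.future a)" by (rule measurable_fst)
  from K[OF 1 2] show ?thesis by simp
qed

text \<open>The induction ranges over all Brownian motions as well as all starting points, because
  the path after an intermediate time is driven by the shifted motion.\<close>

lemma killed_resolvent_power:
  assumes "brownian P W" and "v > 0" and g: "g \<in> borel_measurable borel"
  shows "(\<integral>\<^sup>+\<omega>. killed_occ n g v (\<lambda>r. W r \<omega>) \<partial>P) = (resolvent ^^ Suc n) g v"
  using assms(1,2)
proof (induction n arbitrary: W v)
  case 0
  then show ?case using killed_resolvent[OF 0 g] by simp
next
  case (Suc n)
  interpret B: brownian P W by (rule Suc.prems(1))
  have "(\<integral>\<^sup>+\<omega>. killed_occ (Suc n) g v (\<lambda>r. W r \<omega>) \<partial>P)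
    = (\<integral>\<^sup>+\<omega>. \<integral>\<^sup>+a. (if 0 \<le> a \<and> alive (drifted c \<sigma> v (\<lambda>r. W r \<omega>)) a
     then ennreal (exp (- lam * a)) * killed_occ n g (drifted c \<sigma> v (\<lambda>r. W r \<omega>) a) (path_shift a (\<lambda>r. W r \<omega>)) else 0) \<partial>lborel \<partial>P)"
    by (intro nn_integral_cong killed_occ_Suc B.W_cont g)
  also have "\<dots> = resolvent ((resolvent ^^ Suc n) g) v"
  proof (rule markov_resolvent[OF Suc.prems resolvent_power_measurable[OF g]])
    show "(\<integral>\<^sup>+\<omega>. killed_occ n g x (path_shift a (\<lambda>r. W r \<omega>)) \<partial>P) = (resolvent ^^ Suc n) g x" if "a \<ge> 0" "x > 0" for a x
      using Suc.IH[OF B.brownian_shift[OF that(1)] that(2)] by simp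
  qed (intro shifted_path_measurable future_path_measurable Suc.prems killed_occ_measurable g; assumption)+
  finally show ?case by simp
qed

lemma hit_moment_power:
  assumes "brownian P W" and "v > 0"
  shows "(\<integral>\<^sup>+\<omega>. hit_moment n v (\<lambda>r. W r \<omega>) \<partial>P) = (resolvent ^^ n) (\<lambda>v. ennreal (exp (- rho * v))) v"
  using assms
proof (induction n arbitrary: W v)
  case 0
  then show ?case using laplace_hit[OF 0] by simp
next
  case (Suc n)
  interpret B: brownian P W by (rule Suc.prems(1))
  let ?h = "\<lambda>v. ennreal (exp (- rho * v))"
  have h: "?h \<in> borel_measurable borel" by measurable
  have "(\<integral>\<^sup>+\<omega>. hit_moment (Suc n) v (\<lambda>r. W r \<omega>) \<partial>P)
    = (\<integral>\<^sup>+\<omega>. \<integral>\<^sup>+a. (if 0 \<le> a \<and> alive (drifted c \<sigma> v (\<lambda>r. W r \<omega>)) a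
     then ennreal (exp (- lam * a)) * hit_moment n (drifted c \<sigma> v (\<lambda>r. W r \<omega>) a) (path_shift a (\<lambda>r. W r \<omega>)) else 0) \<partial>lborel \<partial>P)"
    by (intro nn_integral_cong hit_moment_Suc B.W_cont B.W_0 Suc.prems)
  also have "\<dots> = resolvent ((resolvent ^^ n) ?h) v"
  proof (rule markov_resolvent[OF Suc.prems resolvent_power_measurable[OF h]])
    show "(\<integral>\<^sup>+\<omega>. hit_moment n x (path_shift a (\<lambda>r. W r \<omega>)) \<partial>P) = (resolvent ^^ n) ?h x" if "a \<ge> 0" "x > 0" for a x
      using Suc.IH[OF B.brownian_shift[OF that(1)] that(2)] by simp
  qed (intro shifted_path_measurable future_path_measurable Suc.prems hit_moment_measurable; assumption)+
  finally show ?case by simp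
qed

end

section \<open>Phase-type laws by uniformization\<close>

lemma binomial_sum_Suc:
  fixes p :: "nat \<Rightarrow> 'v::real_vector"
  shows "(\<Sum>k\<le>n. (real (n choose k) * q ^ (n - k)) *\<^sub>R p (Suc k)) + q *\<^sub>R (\<Sum>k\<le>n. (real (n choose k) * q ^ (n - k)) *\<^sub>R p k)
    = (\<Sum>k\<le>Suc n. (real (Suc n choose k) * q ^ (Suc n - k)) *\<^sub>R p k)"
proof -
  have "(\<Sum>k\<le>Suc n. (real (Suc n choose k) * q ^ (Suc n - k)) *\<^sub>R p k)
     = q ^ Suc n *\<^sub>R p 0 + (\<Sum>k\<le>n. (real (Suc n choose Suc k) * q ^ (n - k)) *\<^sub>R p (Suc k))"
    by (subst sum.atMost_Suc_shift) simp
  also have "(\<Sum>k\<le>n. (real (Suc n choose Suc k) * q ^ (n - k)) *\<^sub>R p (Suc k))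
     = (\<Sum>k\<le>n. (real (n choose k) * q ^ (n - k)) *\<^sub>R p (Suc k)) + (\<Sum>k\<le>n. (real (n choose Suc k) * q ^ (n - k)) *\<^sub>R p (Suc k))"
    by (simp only: binomial_Suc_Suc of_nat_add distrib_right scaleR_left_distrib sum.distrib)
  also have "(\<Sum>k\<le>n. (real (n choose Suc k) * q ^ (n - k)) *\<^sub>R p (Suc k))
     = (\<Sum>k<n. (real (n choose Suc k) * q ^ (n - k)) *\<^sub>R p (Suc k))"
    by (simp add: lessThan_Suc_atMost[symmetric])
  also have "\<dots> = (\<Sum>k<n. q *\<^sub>R ((real (n choose Suc k) * q ^ (n - Suc k)) *\<^sub>R p (Suc k)))"
  proof (rule sum.cong[OF refl])
    fix k assume "k \<in> {..<n}"
    then have "n - k = Suc (n - Suc k)" by auto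
    then have "q ^ (n - k) = q * q ^ (n - Suc k)" by simp
    then show "(real (n choose Suc k) * q ^ (n - k)) *\<^sub>R p (Suc k) = q *\<^sub>R ((real (n choose Suc k) * q ^ (n - Suc k)) *\<^sub>R p (Suc k))"
      by simp
  qed
  also have "q ^ Suc n *\<^sub>R p 0 + ((\<Sum>k\<le>n. (real (n choose k) * q ^ (n - k)) *\<^sub>R p (Suc k)) + (\<Sum>k<n. q *\<^sub>R ((real (n choose Suc k) * q ^ (n - Suc k)) *\<^sub>R p (Suc k))))
     = (\<Sum>k\<le>n. (real (n choose k) * q ^ (n - k)) *\<^sub>R p (Suc k)) + q *\<^sub>R (q ^ n *\<^sub>R p 0 + (\<Sum>k<n. (real (n choose Suc k) * q ^ (n - Suc k)) *\<^sub>R p (Suc k)))"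
    by (simp add: scaleR_sum_right scaleR_right_distrib)
  also have "q ^ n *\<^sub>R p 0 + (\<Sum>k<n. (real (n choose Suc k) * q ^ (n - Suc k)) *\<^sub>R p (Suc k)) = (\<Sum>k\<le>n. (real (n choose k) * q ^ (n - k)) *\<^sub>R p k)"
    by (subst sum.atMost_shift) simp
  finally show ?thesis by simp
qed

text \<open>The binomial theorem applies because a multiple of the identity commutes with
  \<open>f\<close>.\<close>

lemma linear_shift_power:
  fixes f :: "'v::real_vector \<Rightarrow> 'v"
  assumes f: "linear f"
  shows "((\<lambda>x. f x + q *\<^sub>R x) ^^ n) x = (\<Sum>k\<le>n. (real (n choose k) * q ^ (n - k)) *\<^sub>R (f ^^ k) x)"
proof (induction n)
  case (Suc n)
  have "((\<lambda>x. f x + q *\<^sub>R x) ^^ Suc n) x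
     = (\<Sum>k\<le>n. (real (n choose k) * q ^ (n - k)) *\<^sub>R (f ^^ Suc k) x) + q *\<^sub>R (\<Sum>k\<le>n. (real (n choose k) * q ^ (n - k)) *\<^sub>R (f ^^ k) x)"
    by (simp add: Suc.IH linear_sum[OF f] linear_scale[OF f])
  then show ?case by (simp only: binomial_sum_Suc[of n q "\<lambda>k. (f ^^ k) x"])
qed simp

lemma bounded_linear_power_le:
  fixes f :: "'v::real_normed_vector \<Rightarrow> 'v"
  assumes f: "bounded_linear f"
  shows "norm ((f ^^ k) x) \<le> onorm f ^ k * norm x"
proof (induction k)
  case (Suc k)
  have "norm ((f ^^ Suc k) x) \<le> onorm f * norm ((f ^^ k) x)" using onorm[OF f] by simp
  also have "\<dots> \<le> onorm f * (onorm f ^ k * norm x)"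
    by (rule mult_left_mono[OF Suc.IH onorm_pos_le[OF f]])
  finally show ?case by simp
qed simp

lemma summable_exp_bounded:
  fixes a :: "nat \<Rightarrow> real"
  assumes "\<And>k. \<bar>a k\<bar> \<le> K * L ^ k"
  shows "summable (\<lambda>k. norm (t ^ k / fact k * a k))" "summable (\<lambda>k. t ^ k / fact k * a k)"
proof -
  show 1: "summable (\<lambda>k. norm (t ^ k / fact k * a k))"
  proof (rule summable_comparison_test'[where N=0])
    show "summable (\<lambda>k. K * ((\<bar>t\<bar> * L) ^ k /\<^sub>R fact k))"
      by (intro summable_mult summable_exp_generic)
    fix k
    have "norm (norm (t ^ k / fact k * a k)) = \<bar>t\<bar> ^ k / fact k * \<bar>a k\<bar>" by (simp add: abs_mult power_abs)
    also have "\<dots> \<le> \<bar>t\<bar> ^ k / fact k * (K * L ^ k)" by (intro mult_left_mono assms) auto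
    also have "\<dots> = K * ((\<bar>t\<bar> * L) ^ k /\<^sub>R fact k)" by (simp add: power_mult_distrib divide_inverse)
    finally show "norm (norm (t ^ k / fact k * a k)) \<le> K * ((\<bar>t\<bar> * L) ^ k /\<^sub>R fact k)" .
  qed
  then show "summable (\<lambda>k. t ^ k / fact k * a k)" by (rule summable_norm_cancel)
qed

text \<open>The scalar shadow of \<open>exp (q * t)\<close> times the exponential of
  \<open>t A\<close> being the exponential of \<open>t (A + q I)\<close>, as a Cauchy product. It is
  applied to coefficients obtained by pairing powers of a matrix with fixed vectors.\<close>

lemma exp_shift_series:
  fixes a :: "nat \<Rightarrow> real"
  assumes a: "\<And>k. \<bar>a k\<bar> \<le> K * L ^ k"
  shows "exp (q * t) * (\<Sum>k. t ^ k / fact k * a k) = (\<Sum>n. t ^ n / fact n * (\<Sum>k\<le>n. real (n choose k) * q ^ (n - k) * a k))"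
proof -
  have "(\<lambda>n. \<Sum>k\<le>n. (t ^ k / fact k * a k) * ((q * t) ^ (n - k) /\<^sub>R fact (n - k))) sums
      ((\<Sum>k. t ^ k / fact k * a k) * (\<Sum>k. (q * t) ^ k /\<^sub>R fact k))"
    by (rule Cauchy_product_sums[OF summable_exp_bounded(1)[OF a] summable_norm_exp])
  moreover have "(\<Sum>k. (q * t) ^ k /\<^sub>R fact k) = exp (q * t)" by (simp add: exp_def)
  moreover have "(\<Sum>k\<le>n. (t ^ k / fact k * a k) * ((q * t) ^ (n - k) /\<^sub>R fact (n - k)))
      = t ^ n / fact n * (\<Sum>k\<le>n. real (n choose k) * q ^ (n - k) * a k)" for n
    unfolding sum_distrib_left
  proof (rule sum.cong[OF refl])
    fix k assume "k \<in> {..n}"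
    then have k: "k \<le> n" by simp
    have "t ^ n = t ^ k * t ^ (n - k)" using k by (simp add: power_add[symmetric])
    then show "(t ^ k / fact k * a k) * ((q * t) ^ (n - k) /\<^sub>R fact (n - k)) = t ^ n / fact n * (real (n choose k) * q ^ (n - k) * a k)"
      using binomial_fact[OF k, where 'a=real] by (simp add: power_mult_distrib divide_inverse)
  qed
  ultimately show ?thesis by (simp add: sums_iff mult.commute)
qed

lemma linear_funpow:
  fixes f :: "'v::real_vector \<Rightarrow> 'v"
  shows "linear f \<Longrightarrow> linear (f ^^ n)"
proof (induction n)
  case (Suc n)
  then show ?case using linear_compose[of "f ^^ n" f] by (simp add: o_def)
qed (simp add: linear_id)

lemma mat_power_vector:
  fixes A :: "real ^ 's::finite ^ 's"
  shows "((**) A ^^ k) (mat 1) *v x = (((*v) A) ^^ k) x"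
  by (induction k) (simp_all add: matrix_vector_mul_assoc[symmetric])

lemma mat_entry: "(A :: real ^ 's ^ 's::finite) $ i $ j = (A *v axis j 1) $ i"
  by (simp add: matrix_vector_mult_basis column_def)

lemma inner_power_bound:
  fixes A :: "real ^ 's::finite ^ 's"
  shows "\<bar>w \<bullet> (((*v) A) ^^ k) x\<bar> \<le> (norm w * norm x) * onorm ((*v) A) ^ k"
proof -
  have "\<bar>w \<bullet> (((*v) A) ^^ k) x\<bar> \<le> norm w * norm ((((*v) A) ^^ k) x)" by (rule Cauchy_Schwarz_ineq2)
  also have "\<dots> \<le> norm w * (onorm ((*v) A) ^ k * norm x)"
    by (intro mult_left_mono bounded_linear_power_le matrix_vector_mul_bounded_linear) auto
  finally show ?thesis by (simp add: mult_ac)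
qed

lemma vector_nth_inner: "(x :: real ^ 's::finite) $ i = axis i 1 \<bullet> x"
  by (simp add: inner_axis inner_commute)

text \<open>Column \<open>j\<close> of a matrix power is that power applied to a basis vector, so
  matrix powers become iterates of a linear map. Entrywise convergence suffices for the matrix
  series.\<close>

lemma mat_exp_entry:
  fixes A :: "real ^ 's::finite ^ 's"
  shows "mat_exp (t *\<^sub>R A) $ i $ j = (\<Sum>k. t ^ k / fact k * ((((*v) A) ^^ k) (axis j 1) $ i))"
    and "summable (\<lambda>k. t ^ k / fact k * ((((*v) A) ^^ k) (axis j 1) $ i))"
proof -
  define f where "f = (\<lambda>k. (1 / fact k) *\<^sub>R ((((**) (t *\<^sub>R A)) ^^ k) (mat 1)))"
  have pw: "(((*v) (t *\<^sub>R A)) ^^ k) x = t ^ k *\<^sub>R ((((*v) A) ^^ k) x)" for k and x :: "real ^ 's"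
    by (induction k) (simp_all add: scaleR_matrix_vector_assoc[symmetric] matrix_vector_mult_scaleR mult.commute)
  have f_entry: "f k $ i $ j = t ^ k / fact k * ((((*v) A) ^^ k) (axis j 1) $ i)" for k i j
    unfolding f_def by (simp add: mat_entry[of "((**) (t *\<^sub>R A) ^^ k) (mat 1)"] mat_power_vector pw)
  show summ: "summable (\<lambda>k. t ^ k / fact k * ((((*v) A) ^^ k) (axis j 1) $ i))" for i j
    unfolding vector_nth_inner[of _ i] by (rule summable_exp_bounded(2)[OF inner_power_bound])
  have "f sums (\<chi> i j. \<Sum>k. t ^ k / fact k * ((((*v) A) ^^ k) (axis j 1) $ i))"
    unfolding sums_def
  proof (intro vec_tendstoI)
    fix i j
    show "(\<lambda>n. (\<Sum>k<n. f k) $ i $ j) \<longlonglongrightarrow> (\<chi> i j. \<Sum>k. t ^ k / fact k * ((((*v) A) ^^ k) (axis j 1) $ i)) $ i $ j"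
      using summable_LIMSEQ[OF summ[of j i]] by (simp add: sum_component f_entry)
  qed
  then have "mat_exp (t *\<^sub>R A) = (\<chi> i j. \<Sum>k. t ^ k / fact k * ((((*v) A) ^^ k) (axis j 1) $ i))"
    unfolding mat_exp_def f_def by (simp add: sums_iff)
  then show "mat_exp (t *\<^sub>R A) $ i $ j = (\<Sum>k. t ^ k / fact k * ((((*v) A) ^^ k) (axis j 1) $ i))"
    by simp
qed

lemma sum_UNIV_option: "(\<Sum>s\<in>UNIV. f s) = f None + (\<Sum>i\<in>UNIV. f (Some i))" for f :: "'n::finite option \<Rightarrow> real"
  by (simp add: UNIV_option_conv sum.reindex)

lemma phase_generator_mult:
  fixes B :: "real ^ 'n::finite ^ 'n"
  shows "(phase_generator B b *v x) $ None = 0"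
    and "(phase_generator B b *v x) $ Some i = b $ i * x $ None + (\<Sum>j\<in>UNIV. B $ i $ j * x $ Some j)"
  unfolding matrix_vector_mult_def sum_UNIV_option by (simp_all add: phase_generator_def sum_UNIV_option)

text \<open>The row of the absorbing state vanishes, so vectors without a component there stay such
  and on them the generator acts as \<open>B\<close>.\<close>

lemma phase_generator_power:
  fixes B :: "real ^ 'n::finite ^ 'n" and b :: "real ^ 'n" and j :: 'n
  shows "(((*v) (phase_generator B b)) ^^ k) (axis (Some j) 1) $ None = 0"
    and "(((*v) (phase_generator B b)) ^^ k) (axis (Some j) 1) $ Some i = (((*v) B) ^^ k) (axis j 1) $ i"
proof (induction k arbitrary: i)
  case 0
  { case 1 then show ?case by (simp add: axis_def) }
  { case 2 then show ?case by (simp add: axis_def) }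
next
  case (Suc k)
  { case 1 then show ?case by (simp add: phase_generator_mult) }
  { case 2 then show ?case by (simp add: phase_generator_mult Suc.IH) (simp add: matrix_vector_mult_def) }
qed

locale phase_type =
  fixes B :: "real ^ 'n::finite ^ 'n" and b :: "real ^ 'n" and q :: real
  assumes B_off: "i \<noteq> j \<Longrightarrow> 0 \<le> B $ i $ j" and b_nonneg: "0 \<le> b $ i" and b_eq: "b = - (B *v 1)"
    and q_pos: "q > 0" and q_ge: "- B $ i $ i \<le> q"
begin

text \<open>With \<open>q I\<close> added the matrix has no negative entry, so that all series below can be
  summed in the extended nonnegative reals.\<close>

definition uni :: "real ^ 'n \<Rightarrow> real ^ 'n" where "uni x = B *v x + q *\<^sub>R x"

definition weight :: "real ^ 'n \<Rightarrow> real ^ 'n \<Rightarrow> nat \<Rightarrow> real" where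
  "weight \<beta> x n = \<beta> \<bullet> (uni ^^ n) x"

text \<open>The uniformized form of \<open>\<beta>\<close> times the exponential of
  \<open>t B\<close> times \<open>x\<close>. With \<open>x = 1\<close> it is the survival function
  of the phase-type law with initial distribution \<open>\<beta>\<close>, with \<open>x = b\<close>
  its density.\<close>

definition phase_series :: "real ^ 'n \<Rightarrow> real ^ 'n \<Rightarrow> real \<Rightarrow> real" where
  "phase_series \<beta> x t = exp (- q * t) * (\<Sum>n. t ^ n / fact n * weight \<beta> x n)"

lemma uni_matrix: "uni = (*v) (B + q *\<^sub>R mat 1)"
  by (rule ext) (simp add: uni_def matrix_vector_mult_add_rdistrib scaleR_matrix_vector_assoc[symmetric])

lemma linear_uni: "linear uni" unfolding uni_matrix by (rule matrix_vector_mul_linear)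

lemma uni_nonneg:
  assumes "\<And>i. 0 \<le> x $ i" shows "0 \<le> uni x $ i"
proof -
  have "0 \<le> (B + q *\<^sub>R mat 1) $ i $ j" for j
    using B_off[of i j] q_ge[of i] by (cases "i = j") (auto simp: mat_def)
  then show ?thesis unfolding uni_matrix
    by (simp add: matrix_vector_mult_def del: vector_add_component vector_scaleR_component)
       (intro sum_nonneg mult_nonneg_nonneg assms)
qed

lemma uni_power_nonneg: "(\<And>i. 0 \<le> x $ i) \<Longrightarrow> 0 \<le> (uni ^^ n) x $ i"
  by (induction n arbitrary: i) (auto intro: uni_nonneg)

lemma weight_nonneg: "(\<And>i. 0 \<le> \<beta> $ i) \<Longrightarrow> (\<And>i. 0 \<le> x $ i) \<Longrightarrow> 0 \<le> weight \<beta> x n"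
  unfolding weight_def inner_vec_def by (intro sum_nonneg) (auto intro!: mult_nonneg_nonneg uni_power_nonneg)

lemma weight_summable: "summable (\<lambda>n. t ^ n / fact n * weight \<beta> x n)"
  unfolding weight_def uni_matrix by (rule summable_exp_bounded(2)[OF inner_power_bound])

text \<open>This is \<open>B *v 1 = - b\<close> read through the iterates of \<open>uni\<close>; it
  makes the density minus the derivative of the survival function.\<close>

lemma weight_Suc: "weight \<beta> 1 (Suc n) = q * weight \<beta> 1 n - weight \<beta> b n"
proof -
  have "uni 1 = q *\<^sub>R 1 - b" by (simp add: uni_def b_eq)
  moreover have lin: "linear (uni ^^ n)" by (rule linear_funpow[OF linear_uni])
  ultimately have "(uni ^^ Suc n) 1 = q *\<^sub>R (uni ^^ n) 1 - (uni ^^ n) b"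
    by (simp only: funpow_Suc_right o_apply) (simp add: linear_diff[OF lin] linear_scale[OF lin])
  then show ?thesis by (simp add: weight_def inner_diff_right)
qed

lemma phase_series_derivative:
  "((\<lambda>t. phase_series \<beta> 1 t) has_real_derivative - phase_series \<beta> b t) (at t)"
proof -
  let ?a = "\<lambda>n. weight \<beta> 1 n / fact n"
  have s: "summable (\<lambda>n. ?a n * y ^ n)" for y using weight_summable[of y \<beta> 1] by (simp add: mult.commute)
  have "((\<lambda>x. \<Sum>n. ?a n * x ^ n) has_real_derivative (\<Sum>n. diffs ?a n * t ^ n)) (at t)"
    by (rule termdiffs_strong_converges_everywhere[OF s])
  then have d: "((\<lambda>x. \<Sum>n. x ^ n / fact n * weight \<beta> 1 n) has_real_derivative (\<Sum>n. t ^ n / fact n * weight \<beta> 1 (Suc n))) (at t)"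
  proof -
    have "diffs ?a n * t ^ n = t ^ n / fact n * weight \<beta> 1 (Suc n)" for n
      by (simp add: diffs_def fact_Suc field_simps del: of_nat_Suc)
    moreover have "?a n * x ^ n = x ^ n / fact n * weight \<beta> 1 n" for n x by simp
    ultimately show ?thesis using \<open>((\<lambda>x. \<Sum>n. ?a n * x ^ n) has_real_derivative (\<Sum>n. diffs ?a n * t ^ n)) (at t)\<close>
      by (simp only:)
  qed
  have e: "((\<lambda>t. exp (- q * t)) has_real_derivative (exp (- q * t) * (- q))) (at t)"
    by (auto intro!: derivative_eq_intros)
  have "((\<lambda>t. phase_series \<beta> 1 t) has_real_derivative
      (exp (- q * t) * (- q)) * (\<Sum>n. t ^ n / fact n * weight \<beta> 1 n) + (\<Sum>n. t ^ n / fact n * weight \<beta> 1 (Suc n)) * exp (- q * t)) (at t)"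
    unfolding phase_series_def by (rule DERIV_mult[OF e d])
  moreover have "(\<Sum>n. t ^ n / fact n * weight \<beta> 1 (Suc n)) = q * (\<Sum>n. t ^ n / fact n * weight \<beta> 1 n) - (\<Sum>n. t ^ n / fact n * weight \<beta> b n)"
  proof -
    have "(\<Sum>n. t ^ n / fact n * weight \<beta> 1 (Suc n)) = (\<Sum>n. q * (t ^ n / fact n * weight \<beta> 1 n) - t ^ n / fact n * weight \<beta> b n)"
      unfolding weight_Suc by (simp add: algebra_simps)
    also have "\<dots> = (\<Sum>n. q * (t ^ n / fact n * weight \<beta> 1 n)) - (\<Sum>n. t ^ n / fact n * weight \<beta> b n)"
      by (rule suminf_diff[symmetric]) (intro summable_mult weight_summable)+
    finally show ?thesis by (simp only: suminf_mult[OF weight_summable])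
  qed
  then have "(exp (- q * t) * (- q)) * (\<Sum>n. t ^ n / fact n * weight \<beta> 1 n) + (\<Sum>n. t ^ n / fact n * weight \<beta> 1 (Suc n)) * exp (- q * t)
     = - phase_series \<beta> b t"
    by (simp only:) (simp add: phase_series_def algebra_simps)
  ultimately show ?thesis by (simp only:)
qed

lemma phase_series_0: "phase_series \<beta> x 0 = \<beta> \<bullet> x"
proof -
  have "(\<Sum>n. 0 ^ n / fact n * weight \<beta> x n) = (\<Sum>n. if n = 0 then weight \<beta> x n else 0)"
    by (rule suminf_cong) simp
  also have "\<dots> = weight \<beta> x 0" by (rule sums_unique[symmetric], rule sums_single)
  finally show ?thesis by (simp add: phase_series_def weight_def)
qed

lemma phase_series_nonneg:
  "t \<ge> 0 \<Longrightarrow> (\<And>i. 0 \<le> \<beta> $ i) \<Longrightarrow> (\<And>i. 0 \<le> x $ i) \<Longrightarrow> 0 \<le> phase_series \<beta> x t"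
  unfolding phase_series_def by (intro mult_nonneg_nonneg suminf_nonneg weight_summable weight_nonneg) auto

lemma phase_series_ennreal:
  assumes "t \<ge> 0" "\<And>i. 0 \<le> \<beta> $ i" "\<And>i. 0 \<le> x $ i"
  shows "ennreal (phase_series \<beta> x t) = (\<Sum>n. ennreal (exp (- q * t) * t ^ n / fact n) * ennreal (weight \<beta> x n))"
proof -
  have w: "0 \<le> weight \<beta> x n" for n by (rule weight_nonneg) (use assms in auto)
  have "phase_series \<beta> x t = (\<Sum>n. exp (- q * t) * (t ^ n / fact n * weight \<beta> x n))"
    unfolding phase_series_def by (rule suminf_mult[OF weight_summable, symmetric])
  also have "ennreal \<dots> = (\<Sum>n. ennreal (exp (- q * t) * (t ^ n / fact n * weight \<beta> x n)))"
  proof (rule suminf_ennreal2[symmetric])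
    show "summable (\<lambda>n. exp (- q * t) * (t ^ n / fact n * weight \<beta> x n))" by (intro summable_mult weight_summable)
  qed (use assms w in auto)
  also have "\<dots> = (\<Sum>n. ennreal (exp (- q * t) * t ^ n / fact n) * ennreal (weight \<beta> x n))"
    using w assms by (intro suminf_cong) (simp add: ennreal_mult[symmetric] mult.assoc)
  finally show ?thesis .
qed

lemma phase_series_measurable [measurable]: "phase_series \<beta> x \<in> borel_measurable borel"
  unfolding phase_series_def by measurable

text \<open>The transient block of the transition matrix is the exponential of \<open>t B\<close>;
  summing columns applies it to the vector of ones, and \<open>exp_shift_series\<close> passes to
  nonnegative coefficients.\<close>

lemma transient_mass:
  assumes t: "t \<ge> 0"
  shows "(\<Sum>i\<in>UNIV. \<Sum>j\<in>UNIV. \<beta> $ i * mat_exp (t *\<^sub>R phase_generator B b) $ Some i $ Some j) = phase_series \<beta> 1 t"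
proof -
  let ?p = "\<lambda>k. \<beta> \<bullet> (((*v) B) ^^ k) 1"
  have lin: "linear (((*v) B) ^^ k)" for k
    by (rule linear_funpow[OF matrix_vector_mul_linear])
  have one: "(1 :: real ^ 'n) = (\<Sum>j\<in>UNIV. axis j 1)"
    by (auto simp: vec_eq_iff sum_component axis_def)
  have p_eq: "?p k = (\<Sum>i\<in>UNIV. \<Sum>j\<in>UNIV. \<beta> $ i * (((*v) B) ^^ k) (axis j 1) $ i)" for k
  proof -
    have "(((*v) B) ^^ k) 1 = (\<Sum>j\<in>UNIV. (((*v) B) ^^ k) (axis j 1))" unfolding one by (rule linear_sum[OF lin])
    then show ?thesis by (simp add: inner_vec_def sum_component sum_distrib_left)
  qed
  have summ: "summable (\<lambda>k. t ^ k / fact k * (((*v) B) ^^ k) (axis j 1) $ i)" for i j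
    using mat_exp_entry(2)[of t B j i] .
  have "(\<Sum>i\<in>UNIV. \<Sum>j\<in>UNIV. \<beta> $ i * mat_exp (t *\<^sub>R phase_generator B b) $ Some i $ Some j)
    = (\<Sum>i\<in>UNIV. \<Sum>j\<in>UNIV. (\<Sum>k. \<beta> $ i * (t ^ k / fact k * (((*v) B) ^^ k) (axis j 1) $ i)))"
    unfolding mat_exp_entry(1) phase_generator_power by (simp only: suminf_mult[OF summ])
  also have "\<dots> = (\<Sum>k. \<Sum>i\<in>UNIV. \<Sum>j\<in>UNIV. \<beta> $ i * (t ^ k / fact k * (((*v) B) ^^ k) (axis j 1) $ i))"
    by (subst suminf_sum; (intro summable_sum summable_mult summ)?) (subst suminf_sum; (intro summable_mult summ refl)?)
  also have "\<dots> = (\<Sum>k. t ^ k / fact k * ?p k)"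
    unfolding p_eq by (simp add: sum_distrib_left mult_ac)
  also have "\<dots> = exp (- q * t) * (exp (q * t) * (\<Sum>k. t ^ k / fact k * ?p k))"
    by (simp add: mult.assoc[symmetric] exp_add[symmetric])
  also have "exp (q * t) * (\<Sum>k. t ^ k / fact k * ?p k) = (\<Sum>n. t ^ n / fact n * (\<Sum>k\<le>n. real (n choose k) * q ^ (n - k) * ?p k))"
    by (rule exp_shift_series[OF inner_power_bound])
  also have "\<dots> = (\<Sum>n. t ^ n / fact n * weight \<beta> 1 n)"
    unfolding weight_def uni_def[abs_def] linear_shift_power[OF matrix_vector_mul_linear]
    by (simp add: inner_sum_right mult.assoc)
  finally show ?thesis by (simp add: phase_series_def)
qed

lemma no_return:
  "mat_exp (t *\<^sub>R phase_generator B b) $ None $ Some j = 0"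
  unfolding mat_exp_entry(1) phase_generator_power by simp

end

section \<open>The law of the absorption time\<close>

lemma measure_eqI_atMost:
  fixes M N :: "real measure"
  assumes "sets M = sets borel" "sets N = sets borel"
    and eq: "\<And>x. emeasure M {..x} = emeasure N {..x}" and fin: "\<And>x. emeasure M {..x} \<noteq> \<infinity>"
  shows "M = N"
proof (rule measure_eqI_generator_eq[where E="range atMost" and \<Omega>=UNIV and A="\<lambda>i::nat. {..real i}"])
  show "Int_stable (range atMost :: real set set)"
    by (auto simp: Int_stable_def Int_atMost)
  show "sets M = sigma_sets UNIV (range atMost)" "sets N = sigma_sets UNIV (range atMost)"
    using assms(1,2) by (simp_all add: borel_eq_atMost)
  show "(\<Union>i::nat. {..real i}) = UNIV" by (auto intro: real_arch_simple)
qed (use eq fin in auto)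

text \<open>By right continuity an absorbed path stays absorbed for a short while, so a rational
  time already witnesses the strict inequality.\<close>

lemma absorption_time_less_iff:
  assumes rc: "\<And>t. t \<ge> 0 \<Longrightarrow> \<exists>\<epsilon>>0. \<forall>s\<in>{t..<t + \<epsilon>}. X s \<omega> = X t \<omega>"
  shows "absorption_time X \<omega> < y \<longleftrightarrow> (\<exists>q::rat. 0 \<le> q \<and> X (of_rat q) \<omega> = None \<and> ennreal (of_rat q) < y)"
proof
  assume "absorption_time X \<omega> < y"
  then obtain t where t: "0 \<le> t" "X t \<omega> = None" "ennreal t < y"
    unfolding absorption_time_def INF_less_iff by blast
  obtain e where e: "e > 0" "\<And>s. s \<in> {t..<t + e} \<Longrightarrow> X s \<omega> = X t \<omega>" using rc[OF t(1)] by blast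
  obtain r where r: "r > t" "\<And>s. t < s \<Longrightarrow> s < r \<Longrightarrow> ennreal s < y"
  proof (cases y rule: ennreal_cases)
    case (real z)
    with t have "t < z" by (simp add: ennreal_less_iff)
    moreover have "ennreal s < y" if "t < s" "s < z" for s using that t real by (simp add: ennreal_less_iff)
    ultimately show ?thesis using that by blast
  next
    case top
    then show ?thesis using that[of "t + 1"] by simp
  qed
  obtain q where q: "t < real_of_rat q" "real_of_rat q < min r (t + e)"
    using of_rat_dense[of t "min r (t + e)"] r e by auto
  have "0 \<le> q" using q(1) t(1) by (metis less_le_trans less_imp_le zero_le_of_rat_iff order.trans)
  moreover have "X (of_rat q) \<omega> = None" using e(2)[of "of_rat q"] q t by auto
  moreover have "ennreal (of_rat q) < y" using r(2)[of "of_rat q"] q by auto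
  ultimately show "\<exists>q::rat. 0 \<le> q \<and> X (of_rat q) \<omega> = None \<and> ennreal (of_rat q) < y" by blast
next
  assume "\<exists>q::rat. 0 \<le> q \<and> X (of_rat q) \<omega> = None \<and> ennreal (of_rat q) < y"
  then obtain q :: rat where "0 \<le> q" "X (of_rat q) \<omega> = None" "ennreal (of_rat q) < y" by blast
  then show "absorption_time X \<omega> < y"
    unfolding absorption_time_def INF_less_iff by (intro bexI[of _ "of_rat q"]) auto
qed

lemma absorption_time_measurable:
  assumes X: "\<And>t. t \<ge> 0 \<Longrightarrow> X t \<in> measurable F (count_space UNIV)"
    and rc: "\<And>\<omega> t. \<omega> \<in> space F \<Longrightarrow> t \<ge> 0 \<Longrightarrow> \<exists>\<epsilon>>0. \<forall>s\<in>{t..<t + \<epsilon>}. X s \<omega> = X t \<omega>"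
  shows "absorption_time X \<in> borel_measurable F"
proof (rule borel_measurableI_less)
  fix y
  have [measurable]: "Measurable.pred F (\<lambda>\<omega>. 0 \<le> q \<and> X (of_rat q) \<omega> = None \<and> ennreal (of_rat q) < y)" for q :: rat
  proof (cases "0 \<le> q")
    case True
    then have [measurable]: "X (of_rat q) \<in> measurable F (count_space UNIV)" by (intro X) simp
    show ?thesis by measurable
  qed simp
  have "{\<omega> \<in> space F. \<exists>q::rat. 0 \<le> q \<and> X (of_rat q) \<omega> = None \<and> ennreal (of_rat q) < y} \<in> sets F"
    by (rule predE) measurable
  moreover have "{\<omega> \<in> space F. \<exists>q::rat. 0 \<le> q \<and> X (of_rat q) \<omega> = None \<and> ennreal (of_rat q) < y} = {\<omega> \<in> space F. absorption_time X \<omega> < y}"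
    using absorption_time_less_iff[of X] rc by (intro Collect_cong) blast
  ultimately show "{\<omega> \<in> space F. absorption_time X \<omega> < y} \<in> sets F" by (simp only:)
qed

locale phase_clock = phase_type B b q + prob_space P
  for B :: "real ^ 'n::finite ^ 'n" and b q and P :: "'a measure" +
  fixes X :: "real \<Rightarrow> 'a \<Rightarrow> 'n option" and \<beta> :: "real ^ 'n"
  assumes chain: "markov_chain P (phase_initial \<beta>) (phase_generator B b) X"
    and beta_nonneg: "0 \<le> \<beta> $ i" and beta_sum: "(\<Sum>i\<in>UNIV. \<beta> $ i) = 1"
begin

abbreviation V :: "'a \<Rightarrow> ennreal" where "V \<equiv> absorption_time X"

lemma X_measurable: "t \<ge> 0 \<Longrightarrow> X t \<in> measurable P (count_space UNIV)"
  and right_cont: "\<omega> \<in> space P \<Longrightarrow> t \<ge> 0 \<Longrightarrow> \<exists>\<epsilon>>0. \<forall>s\<in>{t..<t + \<epsilon>}. X s \<omega> = X t \<omega>"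
  using chain unfolding markov_chain_def by blast+

lemma fdd: "\<tau> 0 = 0 \<Longrightarrow> incseq \<tau> \<Longrightarrow>
        prob {\<omega> \<in> space P. \<forall>k\<le>m. X (\<tau> k) \<omega> = x k} =
          phase_initial \<beta> $ x 0 * (\<Prod>k<m. mat_exp ((\<tau> (Suc k) - \<tau> k) *\<^sub>R phase_generator B b) $ x k $ x (Suc k))"
  using chain unfolding markov_chain_def by blast

lemma V_measurable [measurable]: "V \<in> borel_measurable P"
  by (rule absorption_time_measurable[OF X_measurable right_cont])

lemma pred_X [measurable (raw)]: "t \<ge> 0 \<Longrightarrow> Measurable.pred P (\<lambda>\<omega>. X t \<omega> = s)"
  using measurable_compose[OF X_measurable, of t "\<lambda>x. x = s"] by simp

lemma survival_at:
  assumes t: "t \<ge> 0"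
  shows "prob {\<omega> \<in> space P. X t \<omega> \<noteq> None} = phase_series \<beta> 1 t"
proof -
  note [measurable] = pred_X[OF t] pred_X[OF order_refl]
  have two: "prob {\<omega> \<in> space P. X 0 \<omega> = s \<and> X t \<omega> = Some j} = phase_initial \<beta> $ s * mat_exp (t *\<^sub>R phase_generator B b) $ s $ Some j" for s j
  proof -
    \<comment> \<open>The finite-dimensional laws are indexed by an infinite increasing sequence of
      times; only its first two members enter for \<open>m = 1\<close>.\<close>
    let ?\<tau> = "\<lambda>k::nat. if k = 0 then 0 else t"
    have "incseq ?\<tau>" using t by (auto simp: incseq_def)
    from fdd[OF _ this, of 1 "\<lambda>k. if k = 0 then s else Some j"]
    have "prob {\<omega> \<in> space P. \<forall>k\<le>1. X (?\<tau> k) \<omega> = (if k = 0 then s else Some j)}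
      = phase_initial \<beta> $ s * mat_exp (t *\<^sub>R phase_generator B b) $ s $ Some j" by simp
    also have "{\<omega> \<in> space P. \<forall>k\<le>1. X (?\<tau> k) \<omega> = (if k = 0 then s else Some j)}
      = {\<omega> \<in> space P. X 0 \<omega> = s \<and> X t \<omega> = Some j}"
      by (auto simp: le_Suc_eq all_conj_distrib)
    finally show ?thesis .
  qed
  have "prob {\<omega> \<in> space P. X t \<omega> \<noteq> None} = (\<Sum>z\<in>UNIV. prob {\<omega> \<in> space P. X 0 \<omega> = fst z \<and> X t \<omega> = Some (snd z)})"
    by (rule prob_sum) auto
  also have "\<dots> = (\<Sum>z\<in>UNIV \<times> UNIV. phase_initial \<beta> $ fst z * mat_exp (t *\<^sub>R phase_generator B b) $ fst z $ Some (snd z))"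
    unfolding two by simp
  also have "\<dots> = (\<Sum>s\<in>UNIV. \<Sum>j\<in>UNIV. phase_initial \<beta> $ s * mat_exp (t *\<^sub>R phase_generator B b) $ s $ Some j)"
    unfolding sum.cartesian_product by (simp add: split_beta)
  also have "\<dots> = (\<Sum>i\<in>UNIV. \<Sum>j\<in>UNIV. \<beta> $ i * mat_exp (t *\<^sub>R phase_generator B b) $ Some i $ Some j)"
    by (subst sum_UNIV_option) (simp add: phase_initial_def)
  finally show ?thesis by (simp only: transient_mass[OF t])
qed

text \<open>The transition matrix has zero entries from the absorbing state to any transient one, so
  each of the finitely many three-time events has probability zero.\<close>

lemma absorbed_stays:
  assumes s: "0 \<le> s" "s \<le> t"
  shows "AE \<omega> in P. X s \<omega> = None \<longrightarrow> X t \<omega> = None"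
proof -
  have t: "0 \<le> t" using s by linarith
  note [measurable] = pred_X[OF s(1)] pred_X[OF t] pred_X[OF order_refl]
  have "AE \<omega> in P. \<not> (X 0 \<omega> = r \<and> X s \<omega> = None \<and> X t \<omega> = Some j)" for r j
  proof -
    let ?\<tau> = "\<lambda>k::nat. if k = 0 then 0 else if k = 1 then s else t"
    have "incseq ?\<tau>" using s by (auto simp: incseq_def)
    from fdd[OF _ this, of 2 "\<lambda>k. if k = 0 then r else if k = 1 then None else Some j"]
    have "prob {\<omega> \<in> space P. \<forall>k\<le>2. X (?\<tau> k) \<omega> = (if k = 0 then r else if k = 1 then None else Some j)} = 0"
      by (simp add: numeral_2_eq_2 no_return)
    also have "{\<omega> \<in> space P. \<forall>k\<le>2. X (?\<tau> k) \<omega> = (if k = 0 then r else if k = 1 then None else Some j)}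
      = {\<omega> \<in> space P. X 0 \<omega> = r \<and> X s \<omega> = None \<and> X t \<omega> = Some j}"
      by (auto simp: le_Suc_eq numeral_2_eq_2 all_conj_distrib disj_imp)
    finally have "prob {\<omega> \<in> space P. X 0 \<omega> = r \<and> X s \<omega> = None \<and> X t \<omega> = Some j} = 0" .
    then show ?thesis by (subst (asm) prob_eq_0) (auto elim: eventually_mono)
  qed
  then have "AE \<omega> in P. \<forall>r\<in>UNIV. \<forall>j\<in>UNIV. \<not> (X 0 \<omega> = r \<and> X s \<omega> = None \<and> X t \<omega> = Some j)"
    by (intro AE_finite_allI) auto
  then show ?thesis by eventually_elim auto
qed

text \<open>Being absorbed at \<open>t\<close> implies absorption by time \<open>t\<close>.
  Conversely, absorption by \<open>t\<close> gives, for each \<open>s > t\<close>, a rational time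
  before \<open>s\<close> in the absorbing state, hence almost surely absorption at
  \<open>s\<close>; letting \<open>s\<close> decrease to \<open>t\<close> uses continuity of the
  survival function.\<close>

lemma prob_absorbed_by:
  assumes t: "t \<ge> 0"
  shows "prob {\<omega> \<in> space P. V \<omega> \<le> ennreal t} = 1 - phase_series \<beta> 1 t"
proof (rule antisym)
  have at: "prob {\<omega> \<in> space P. X t \<omega> = None} = 1 - phase_series \<beta> 1 t" if "t \<ge> 0" for t
  proof -
    note [measurable] = pred_X[OF that]
    have "prob {\<omega> \<in> space P. \<not> X t \<omega> \<noteq> None} = 1 - prob {\<omega> \<in> space P. X t \<omega> \<noteq> None}"
      by (rule prob_neg) measurable
    then show ?thesis using survival_at[OF that] by simp
  qed
  show "1 - phase_series \<beta> 1 t \<le> prob {\<omega> \<in> space P. V \<omega> \<le> ennreal t}"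
  proof -
    have "V \<omega> \<le> ennreal t" if "X t \<omega> = None" for \<omega>
      unfolding absorption_time_def by (rule INF_lower) (use t that in auto)
    then show ?thesis unfolding at[OF t, symmetric] by (intro finite_measure_mono) auto
  qed
  have upper: "prob {\<omega> \<in> space P. V \<omega> \<le> ennreal t} \<le> 1 - phase_series \<beta> 1 s" if s: "t < s" for s
  proof -
    have s0: "s \<ge> 0" using s t by simp
    have "AE \<omega> in P. \<forall>q::rat. 0 \<le> q \<and> of_rat q \<le> s \<longrightarrow> X (of_rat q) \<omega> = None \<longrightarrow> X s \<omega> = None"
      unfolding AE_all_countable
    proof
      fix q :: rat
      show "AE \<omega> in P. 0 \<le> q \<and> of_rat q \<le> s \<longrightarrow> X (of_rat q) \<omega> = None \<longrightarrow> X s \<omega> = None"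
        using absorbed_stays[of "of_rat q" s] by (cases "0 \<le> q \<and> of_rat q \<le> s") auto
    qed
    then have "AE \<omega> in P. \<omega> \<in> {\<omega> \<in> space P. V \<omega> \<le> ennreal t} \<longrightarrow> \<omega> \<in> {\<omega> \<in> space P. X s \<omega> = None}"
    proof eventually_elim
      case (elim \<omega>)
      show ?case
      proof
        assume w: "\<omega> \<in> {\<omega> \<in> space P. V \<omega> \<le> ennreal t}"
        then have "V \<omega> < ennreal s" using s t by (auto simp: ennreal_less_iff intro: le_less_trans)
        then obtain q :: rat where "0 \<le> q" "X (of_rat q) \<omega> = None" "ennreal (of_rat q) < ennreal s"
          using absorption_time_less_iff[of X \<omega> "ennreal s"] right_cont w by auto
        then show "\<omega> \<in> {\<omega> \<in> space P. X s \<omega> = None}"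
          using elim w by (auto simp: ennreal_less_iff less_imp_le)
      qed
    qed
    then show ?thesis unfolding at[OF s0, symmetric]
      by (rule finite_measure_mono_AE) (use pred_X[OF s0, of None] in measurable)
  qed
  have "isCont (phase_series \<beta> 1) t" by (rule DERIV_isCont[OF phase_series_derivative])
  then have "((\<lambda>s. 1 - phase_series \<beta> 1 s) \<longlongrightarrow> 1 - phase_series \<beta> 1 t) (at_right t)"
    by (intro tendsto_intros) (simp add: isCont_def filterlim_at_split)
  then show "prob {\<omega> \<in> space P. V \<omega> \<le> ennreal t} \<le> 1 - phase_series \<beta> 1 t"
  proof (rule tendsto_lowerbound)
    show "\<forall>\<^sub>F s in at_right t. prob {\<omega> \<in> space P. V \<omega> \<le> ennreal t} \<le> 1 - phase_series \<beta> 1 s"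
      using upper by (auto simp: eventually_at_filter)
  qed simp
qed

lemma survival:
  assumes t: "t \<ge> 0"
  shows "emeasure P {\<omega> \<in> space P. ennreal t < V \<omega>} = ennreal (phase_series \<beta> 1 t)"
proof -
  have "prob {\<omega> \<in> space P. \<not> V \<omega> \<le> ennreal t} = 1 - prob {\<omega> \<in> space P. V \<omega> \<le> ennreal t}"
    by (rule prob_neg) measurable
  then show ?thesis using prob_absorbed_by[OF t] by (simp add: emeasure_eq_measure not_le)
qed

text \<open>The absorption time may be infinite, so its law is first restricted to finite values.
  This sub-probability and the one with density \<open>phase_series \<beta> b\<close> have the same
  distribution function.\<close>

lemma absorption_law:
  assumes h [measurable]: "h \<in> borel_measurable borel"
  shows "(\<integral>\<^sup>+\<omega>. (if V \<omega> < \<infinity> then h (enn2real (V \<omega>)) else 0) \<partial>P)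
    = (\<integral>\<^sup>+t. (if 0 \<le> t then ennreal (phase_series \<beta> b t) * h t else 0) \<partial>lborel)"
proof -
  define M1 where "M1 = distr (density P (\<lambda>\<omega>. if V \<omega> < \<infinity> then 1 else 0)) borel (\<lambda>\<omega>. enn2real (V \<omega>))"
  define M2 where "M2 = density lborel (\<lambda>t. if 0 \<le> t then ennreal (phase_series \<beta> b t) else 0)"
  have e1: "emeasure M1 {..x} = (if 0 \<le> x then ennreal (1 - phase_series \<beta> 1 x) else 0)" for x
  proof -
    have "emeasure M1 {..x} = (\<integral>\<^sup>+\<omega>. (if V \<omega> < \<infinity> then 1 else 0) * indicator {..x} (enn2real (V \<omega>)) \<partial>P)"
      unfolding M1_def
      by (subst emeasure_distr) (auto simp: emeasure_density intro!: nn_integral_cong split: split_indicator)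
    also have "\<dots> = (\<integral>\<^sup>+\<omega>. indicator {\<omega> \<in> space P. 0 \<le> x \<and> V \<omega> \<le> ennreal x} \<omega> \<partial>P)"
    proof (rule nn_integral_cong)
      fix \<omega> assume "\<omega> \<in> space P"
      then show "(if V \<omega> < \<infinity> then 1 else 0) * indicator {..x} (enn2real (V \<omega>)) = (indicator {\<omega> \<in> space P. 0 \<le> x \<and> V \<omega> \<le> ennreal x} \<omega> :: ennreal)"
        by (cases "V \<omega>" rule: ennreal_cases) (auto split: split_indicator simp: ennreal_le_iff top_unique intro: order.trans)
    qed
    also have "\<dots> = (if 0 \<le> x then ennreal (1 - phase_series \<beta> 1 x) else 0)"
      using prob_absorbed_by[of x] by (simp add: emeasure_eq_measure)
    finally show ?thesis .
  qed
  have e2: "emeasure M2 {..x} = (if 0 \<le> x then ennreal (1 - phase_series \<beta> 1 x) else 0)" for x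
  proof -
    have "emeasure M2 {..x} = (\<integral>\<^sup>+t. ennreal (phase_series \<beta> b t) * indicator {0..x} t \<partial>lborel)"
      unfolding M2_def by (subst emeasure_density) (auto intro!: nn_integral_cong split: split_indicator)
    also have "\<dots> = (if 0 \<le> x then ennreal (1 - phase_series \<beta> 1 x) else 0)"
    proof (cases "0 \<le> x")
      case True
      have "(\<integral>\<^sup>+t. ennreal (phase_series \<beta> b t) * indicator {0..x} t \<partial>lborel) = ennreal (- phase_series \<beta> 1 x - (- phase_series \<beta> 1 0))"
      proof (rule nn_integral_FTC_Icc[where F="\<lambda>t. - phase_series \<beta> 1 t"])
        show "((\<lambda>t. - phase_series \<beta> 1 t) has_real_derivative phase_series \<beta> b t) (at t)" for t
          using DERIV_minus[OF phase_series_derivative] by simp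
        show "0 \<le> phase_series \<beta> b t" if "t \<in> {0..x}" for t
          using that by (intro phase_series_nonneg beta_nonneg b_nonneg) auto
      qed (use True in auto)
      then show ?thesis using True beta_sum by (simp add: phase_series_0 inner_vec_def)
    qed simp
    finally show ?thesis .
  qed
  have "M1 = M2"
  proof (rule measure_eqI_atMost)
    show "sets M1 = sets borel" "sets M2 = sets borel" by (simp_all add: M1_def M2_def)
  qed (simp_all add: e1 e2)
  have "(\<integral>\<^sup>+\<omega>. (if V \<omega> < \<infinity> then h (enn2real (V \<omega>)) else 0) \<partial>P) = (\<integral>\<^sup>+t. h t \<partial>M1)"
    unfolding M1_def by (subst nn_integral_distr) (auto simp: nn_integral_density intro!: nn_integral_cong)
  also have "\<dots> = (\<integral>\<^sup>+t. (if 0 \<le> t then ennreal (phase_series \<beta> b t) * h t else 0) \<partial>lborel)"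
    unfolding \<open>M1 = M2\<close> M2_def by (subst nn_integral_density) (auto intro!: nn_integral_cong)
  finally show ?thesis .
qed

end

section \<open>Surplus paths from claim to claim\<close>

text \<open>A deterministic copy of the claim number in terms of a sequence of interclaim times, so
  that restarting after a claim just drops the first entry.\<close>

definition claim_count :: "(nat \<Rightarrow> ennreal) \<Rightarrow> real \<Rightarrow> nat" where
  "claim_count vs t = (let S = {m. 1 \<le> m \<and> (\<Sum>k<m. vs k) \<le> ennreal t} in if S = {} then 0 else Max S)"

definition claim_path :: "real \<Rightarrow> real \<Rightarrow> (nat \<Rightarrow> ennreal) \<Rightarrow> (nat \<Rightarrow> real) \<Rightarrow> (real \<Rightarrow> real) \<Rightarrow> real \<Rightarrow> real \<Rightarrow> real" where
  "claim_path c \<sigma> vs zs y v t = v + c * t - (\<Sum>k<claim_count vs t. zs k) + \<sigma> * y t"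

lemma surplus_claim_path:
  "surplus c \<sigma> J Z W u \<omega> = claim_path c \<sigma> (\<lambda>k. absorption_time (J k) \<omega>) (\<lambda>k. Z k \<omega>) (\<lambda>t. W t \<omega>) u"
  by (rule ext) (simp add: surplus_def claim_path_def claim_number_def claim_count_def)

text \<open>Positive interclaim times whose partial sums pass every time bound: no two claims at
  once and no accumulation of claims. This holds almost surely by
  \<open>clocks_regular\<close>.\<close>

definition regular :: "(nat \<Rightarrow> ennreal) \<Rightarrow> bool" where
  "regular vs \<longleftrightarrow> (\<forall>k. 0 < vs k) \<and> (\<forall>t. \<exists>m. ennreal t < (\<Sum>k<m. vs k))"

lemma sum_lessThan_mono_ennreal:
  fixes m n :: nat
  shows "m \<le> n \<Longrightarrow> (\<Sum>k<m. vs k) \<le> (\<Sum>k<n. vs k :: ennreal)"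
  by (rule sum_mono2) auto

lemma count_eqI:
  assumes "m = 0 \<or> (\<Sum>k<m. vs k) \<le> ennreal t" and up: "ennreal t < (\<Sum>k<Suc m. vs k)"
  shows "claim_count vs t = m"
proof -
  have "{n. 1 \<le> n \<and> (\<Sum>k<n. vs k) \<le> ennreal t} = {1..m}"
  proof (intro set_eqI iffI)
    fix n assume n: "n \<in> {n. 1 \<le> n \<and> (\<Sum>k<n. vs k) \<le> ennreal t}"
    have "\<not> Suc m \<le> n"
      using sum_lessThan_mono_ennreal[of "Suc m" n vs] n up by auto
    with n show "n \<in> {1..m}" by auto
  next
    fix n assume n: "n \<in> {1..m}"
    then have "(\<Sum>k<m. vs k) \<le> ennreal t" using assms(1) by auto
    with sum_lessThan_mono_ennreal[of n m vs] n show "n \<in> {n. 1 \<le> n \<and> (\<Sum>k<n. vs k) \<le> ennreal t}"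
      by (auto intro: order.trans)
  qed
  then have "claim_count vs t = (if {1..m} = {} then 0 else Max {1..m})" unfolding claim_count_def Let_def by (simp only:)
  moreover have "Max {1..m} = m" if "m \<ge> 1" by (rule Max_eqI) (use that in auto)
  ultimately show ?thesis by (cases "m \<ge> 1") auto
qed

lemma count_bounds:
  assumes "regular vs" "0 \<le> t"
  shows "(\<Sum>k<claim_count vs t. vs k) \<le> ennreal t" "ennreal t < (\<Sum>k<Suc (claim_count vs t). vs k)"
proof -
  obtain n where n: "ennreal t < (\<Sum>k<n. vs k)" using assms(1) by (auto simp: regular_def)
  define n0 where "n0 = (LEAST n. ennreal t < (\<Sum>k<n. vs k))"
  have n0: "ennreal t < (\<Sum>k<n0. vs k)" unfolding n0_def using n by (rule LeastI)
  then have "n0 \<noteq> 0" by (intro notI) simp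
  then obtain m where m: "n0 = Suc m" by (cases n0) auto
  have le: "(\<Sum>k<m. vs k) \<le> ennreal t"
    using not_less_Least[of m "\<lambda>n. ennreal t < (\<Sum>k<n. vs k)"] m unfolding n0_def by (simp add: not_less)
  have "claim_count vs t = m" by (rule count_eqI) (use le n0 m in auto)
  with le n0 m show "(\<Sum>k<claim_count vs t. vs k) \<le> ennreal t" "ennreal t < (\<Sum>k<Suc (claim_count vs t). vs k)"
    by (simp_all only:)
qed

lemma count_early: "ennreal t < vs 0 \<Longrightarrow> claim_count vs t = 0"
  by (rule count_eqI) auto

lemma regular_tail:
  assumes "regular vs" and V: "vs 0 = ennreal V" "0 \<le> V"
  shows "regular (\<lambda>k. vs (Suc k))"
  unfolding regular_def
proof (intro conjI allI)
  show "0 < vs (Suc k)" for k using assms by (simp add: regular_def)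
  fix t
  obtain m where m: "ennreal (V + max 0 t) < (\<Sum>k<m. vs k)" using assms(1) unfolding regular_def by blast
  then have "m \<noteq> 0" by (intro notI) simp
  then obtain n where n: "m = Suc n" by (cases m) auto
  have "ennreal V + ennreal (max 0 t) < ennreal V + (\<Sum>k<n. vs (Suc k))"
    using m V unfolding n sum.lessThan_Suc_shift by simp
  then have "ennreal (max 0 t) < (\<Sum>k<n. vs (Suc k))" by (simp add: ennreal_add_left_cancel_less)
  moreover have "ennreal t \<le> ennreal (max 0 t)" by (rule ennreal_leI) simp
  ultimately show "\<exists>m. ennreal t < (\<Sum>k<m. vs (Suc k))" by (blast intro: le_less_trans)
qed

text \<open>The recursion behind the restart: after the first interclaim time \<open>V\<close> the
  counter is one more than that of the shifted sequence.\<close>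

lemma count_Suc:
  assumes vs: "regular vs" and V: "vs 0 = ennreal V" "0 \<le> V" and t: "0 \<le> t"
  shows "claim_count vs (V + t) = Suc (claim_count (\<lambda>k. vs (Suc k)) t)"
proof (rule count_eqI)
  let ?m = "claim_count (\<lambda>k. vs (Suc k)) t"
  note b = count_bounds[OF regular_tail[OF vs V] t]
  have e: "ennreal (V + t) = vs 0 + ennreal t" using V t by simp
  have "(\<Sum>k<Suc ?m. vs k) \<le> ennreal (V + t)"
    unfolding e sum.lessThan_Suc_shift by (intro add_left_mono b)
  then show "Suc ?m = 0 \<or> (\<Sum>k<Suc ?m. vs k) \<le> ennreal (V + t)" by simp
  show "ennreal (V + t) < (\<Sum>k<Suc (Suc ?m). vs k)"
    unfolding e sum.lessThan_Suc_shift[of _ "Suc ?m"] V(1) ennreal_add_left_cancel_less using b(2) by simp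
qed

lemma claim_path_early: "ennreal t < vs 0 \<Longrightarrow> claim_path c \<sigma> vs zs y v t = drifted c \<sigma> v y t"
  by (simp add: claim_path_def drifted_def count_early)

lemma claim_path_restart:
  assumes "regular vs" "vs 0 = ennreal V" "0 \<le> V" "0 \<le> t"
  shows "claim_path c \<sigma> vs zs y v (V + t)
    = claim_path c \<sigma> (\<lambda>k. vs (Suc k)) (\<lambda>k. zs (Suc k)) (path_shift V y) (drifted c \<sigma> v y V - zs 0) t"
  unfolding claim_path_def count_Suc[OF assms] sum.lessThan_Suc_shift
  by (simp add: drifted_def path_shift_def algebra_simps)

section \<open>Splitting the penalty at the claim epochs\<close>

type_synonym payoff = "ennreal \<Rightarrow> real \<Rightarrow> (real \<Rightarrow> real) \<Rightarrow> real \<Rightarrow> ennreal"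

locale surplus_path =
  fixes c \<sigma> \<delta> :: real
begin

abbreviation ruin :: "(real \<Rightarrow> real) \<Rightarrow> real \<Rightarrow> ennreal" where
  "ruin y v \<equiv> ruin_time (drifted c \<sigma> v y)"

text \<open>The inequality with the ruin time is not strict, so that it complements ruin strictly
  before the claim. For a positive claim equality is ruled out by the last conjunct, as the path is
  at zero at its ruin time.\<close>

definition survives :: "ennreal \<Rightarrow> real \<Rightarrow> (real \<Rightarrow> real) \<Rightarrow> real \<Rightarrow> bool" where
  "survives V z y v \<longleftrightarrow> V < \<infinity> \<and> V \<le> ruin y v \<and> z < drifted c \<sigma> v y (enn2real V)"

text \<open>The continuous path evaluated at the claim time is the left limit of the surplus there,
  hence the first argument of the penalty.\<close>

definition claim_payoff :: "(real \<Rightarrow> real \<Rightarrow> real) \<Rightarrow> payoff" where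
  "claim_payoff w V z y v = (if V < \<infinity> \<and> V \<le> ruin y v \<and> drifted c \<sigma> v y (enn2real V) < z
     then ennreal (exp (- \<delta> * enn2real V)) * ennreal (w (drifted c \<sigma> v y (enn2real V)) (z - drifted c \<sigma> v y (enn2real V))) else 0)"

text \<open>The second alternative, a claim that takes the surplus exactly to zero, has probability zero but is
  part of the pathwise penalty.\<close>

definition diffusion_payoff :: payoff where
  "diffusion_payoff V z y v = (if ruin y v < V then ennreal (exp (- \<delta> * enn2real (ruin y v)))
     else if V < \<infinity> \<and> drifted c \<sigma> v y (enn2real V) = z then ennreal (exp (- \<delta> * enn2real V)) else 0)"

text \<open>The part of the discounted penalty that is due to ruin after claim \<open>n\<close> and no later than claim \<open>n + 1\<close>.\<close>

primrec stage :: "payoff \<Rightarrow> nat \<Rightarrow> (nat \<Rightarrow> ennreal) \<Rightarrow> (nat \<Rightarrow> real) \<Rightarrow> (real \<Rightarrow> real) \<Rightarrow> real \<Rightarrow> ennreal" where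
  "stage \<Theta> 0 vs zs y v = \<Theta> (vs 0) (zs 0) y v"
| "stage \<Theta> (Suc n) vs zs y v = (if survives (vs 0) (zs 0) y v
     then ennreal (exp (- \<delta> * enn2real (vs 0))) *
       stage \<Theta> n (\<lambda>k. vs (Suc k)) (\<lambda>k. zs (Suc k)) (path_shift (enn2real (vs 0)) y) (drifted c \<sigma> v y (enn2real (vs 0)) - zs 0)
     else 0)"

definition admissible :: "(nat \<Rightarrow> ennreal) \<Rightarrow> (nat \<Rightarrow> real) \<Rightarrow> (real \<Rightarrow> real) \<Rightarrow> real \<Rightarrow> bool" where
  "admissible vs zs y v \<longleftrightarrow> regular vs \<and> (\<forall>k. 0 < zs k) \<and> continuous_on {0..} y \<and> y 0 = 0 \<and> 0 < v"

abbreviation path where "path \<equiv> claim_path c \<sigma>"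

lemma admissible_restart:
  assumes "admissible vs zs y v" and s: "survives (vs 0) (zs 0) y v"
  shows "admissible (\<lambda>k. vs (Suc k)) (\<lambda>k. zs (Suc k)) (path_shift (enn2real (vs 0)) y) (drifted c \<sigma> v y (enn2real (vs 0)) - zs 0)"
proof -
  have V: "vs 0 = ennreal (enn2real (vs 0))" using s by (simp add: survives_def)
  have "continuous_on {0..} (\<lambda>t. y (enn2real (vs 0) + t))"
    by (rule continuous_on_compose2[of "{0..}" y]) (use assms in \<open>auto simp: admissible_def intro!: continuous_intros\<close>)
  then have "continuous_on {0..} (path_shift (enn2real (vs 0)) y)" unfolding path_shift_def by (intro continuous_intros)
  then show ?thesis
    using assms regular_tail[of vs, OF _ V] by (auto simp: admissible_def survives_def path_shift_def)
qed

context
  fixes vs zs y v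
  assumes adm: "admissible vs zs y v"
begin

private lemma facts:
  "regular vs" "0 < vs 0" "0 < zs 0" "continuous_on {0..} y" "y 0 = 0" "0 < v" "continuous_on {0..} (drifted c \<sigma> v y)" "0 < drifted c \<sigma> v y 0"
  using adm continuous_on_drifted[of y c \<sigma> v] by (auto simp: admissible_def regular_def drifted_def)

lemma early_ruin:
  assumes r: "ruin y v < vs 0"
  shows "ruin_time (path vs zs y v) = ruin y v" "path vs zs y v (enn2real (ruin y v)) = 0"
proof -
  have fin: "ruin y v < \<infinity>" by (rule less_le_trans[OF r]) simp
  define T where "T = enn2real (ruin y v)"
  note h = ruin_time_hit[OF facts(7,8) fin, folded T_def]
  have T: "ennreal T < vs 0" using r h(3) by simp
  have eq: "path vs zs y v t = drifted c \<sigma> v y t" if "t \<le> T" for t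
    by (rule claim_path_early) (rule le_less_trans[OF ennreal_leI[OF that] T])
  have zT: "path vs zs y v T = 0" using eq[of T] h(2) by simp
  then show "path vs zs y v (enn2real (ruin y v)) = 0" by (simp only: T_def)
  show "ruin_time (path vs zs y v) = ruin y v"
  proof (rule antisym)
    show "ruin_time (path vs zs y v) \<le> ruin y v"
      unfolding h(3) by (rule ruin_time_less) (use zT h(1) in simp_all)
    show "ruin y v \<le> ruin_time (path vs zs y v)"
      unfolding ruin_time_def[of "path vs zs y v"]
    proof (rule INF_greatest)
      fix t assume "t \<in> {t. 0 \<le> t \<and> path vs zs y v t \<le> 0}"
      then have t: "0 \<le> t" "path vs zs y v t \<le> 0" by auto
      show "ruin y v \<le> ennreal t"
      proof (cases "t \<le> T")
        case True
        then show ?thesis using t eq[OF True] by (intro ruin_time_less) auto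
      next
        case False
        then show ?thesis unfolding h(3) by (intro ennreal_leI) simp
      qed
    qed
  qed
qed

lemma no_claim_no_ruin:
  assumes "vs 0 = \<infinity>" "ruin y v = \<infinity>"
  shows "ruin_time (path vs zs y v) = \<infinity>"
proof -
  have "path vs zs y v t = drifted c \<sigma> v y t" for t by (rule claim_path_early) (simp add: assms)
  then have "path vs zs y v = drifted c \<sigma> v y" by (rule ext)
  then show ?thesis using assms by simp
qed

context
  fixes V
  assumes V: "vs 0 = ennreal V" "0 \<le> V" and sv: "vs 0 \<le> ruin y v"
begin

abbreviation "vs' \<equiv> \<lambda>k. vs (Suc k)"
abbreviation "zs' \<equiv> \<lambda>k. zs (Suc k)"
abbreviation "x' \<equiv> path vs' zs' (path_shift V y) (drifted c \<sigma> v y V - zs 0)"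

lemma V_pos: "0 < V" using facts(2) V by simp

lemma before_claim: "t < V \<Longrightarrow> path vs zs y v t = drifted c \<sigma> v y t"
  by (rule claim_path_early) (simp add: V ennreal_lessI V_pos)

lemma after_claim: "0 \<le> t \<Longrightarrow> path vs zs y v (V + t) = x' t"
  by (rule claim_path_restart[OF facts(1) V])

lemma restart_0: "x' 0 = drifted c \<sigma> v y V - zs 0"
proof -
  have "0 < vs' 0" using facts(1) by (simp add: regular_def)
  then have "x' 0 = drifted c \<sigma> (drifted c \<sigma> v y V - zs 0) (path_shift V y) 0"
    by (intro claim_path_early) simp
  then show ?thesis by (simp add: drifted_def path_shift_def)
qed

lemma ruin_restart: "ruin_time (path vs zs y v) = ennreal V + ruin_time x'"
proof -
  have "ruin_time (path vs zs y v) = ennreal V + ruin_time (\<lambda>t. path vs zs y v (V + t))"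
  proof (rule ruin_time_shift[OF V(2)])
    fix r assume r: "0 \<le> r" "r < V"
    then have "ennreal r < ruin y v" using sv V by (auto intro!: less_le_trans[OF _ sv] simp: ennreal_lessI)
    then have "alive (drifted c \<sigma> v y) r" using alive_iff_ruin_time[OF facts(7) r(1)] by simp
    then show "0 < path vs zs y v r" using r before_claim by (simp add: alive_def)
  qed
  also have "ruin_time (\<lambda>t. path vs zs y v (V + t)) = ruin_time x'"
    unfolding ruin_time_def by (intro INF_cong refl) (auto simp: after_claim)
  finally show ?thesis .
qed

lemma ruin_at_claim:
  assumes "drifted c \<sigma> v y V \<le> zs 0"
  shows "ruin_time (path vs zs y v) = ennreal V" "path vs zs y v V = drifted c \<sigma> v y V - zs 0"
proof -
  have "ruin_time x' \<le> ennreal 0" by (rule ruin_time_less) (use assms restart_0 in auto)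
  then have "ruin_time x' = 0" by simp
  then show "ruin_time (path vs zs y v) = ennreal V" using ruin_restart by simp
  show "path vs zs y v V = drifted c \<sigma> v y V - zs 0" using after_claim[of 0] restart_0 by simp
qed

lemma left_limit_at_claim: "Lim (at_left V) (path vs zs y v) = drifted c \<sigma> v y V"
proof (rule tendsto_Lim)
  have "(drifted c \<sigma> v y \<longlongrightarrow> drifted c \<sigma> v y V) (at V within {0..})"
    using facts(7) V by (simp add: continuous_on_def)
  then have "(drifted c \<sigma> v y \<longlongrightarrow> drifted c \<sigma> v y V) (at_left V)"
    using V_pos by (subst (asm) at_within_interior) (auto simp: interior_Ici filterlim_at_split)
  then show "(path vs zs y v \<longlongrightarrow> drifted c \<sigma> v y V) (at_left V)"
    by (rule filterlim_cong[THEN iffD1, OF refl refl, rotated]) (auto simp: eventually_at_filter before_claim)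
qed simp

lemma left_limit_after_claim:
  assumes r: "0 < r"
  shows "Lim (at_left (V + r)) (path vs zs y v) = Lim (at_left r) x'"
proof -
  have "(path vs zs y v \<longlongrightarrow> l) (at_left (V + r)) \<longleftrightarrow> (x' \<longlongrightarrow> l) (at_left r)" for l
  proof -
    have "at_left (V + r) = filtermap (\<lambda>t. t + V) (at_left r)"
      using filtermap_at_left_shift[of "- V" r] by (simp add: add.commute)
    then have "(path vs zs y v \<longlongrightarrow> l) (at_left (V + r)) \<longleftrightarrow> ((\<lambda>t. path vs zs y v (V + t)) \<longlongrightarrow> l) (at_left r)"
      by (simp add: filterlim_filtermap add.commute)
    also have "\<dots> \<longleftrightarrow> (x' \<longlongrightarrow> l) (at_left r)"
    proof (rule filterlim_cong[OF refl refl])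
      show "\<forall>\<^sub>F t in at_left r. path vs zs y v (V + t) = x' t"
        using eventually_at_left_real[OF r] by eventually_elim (simp add: after_claim)
    qed
    finally show ?thesis .
  qed
  then show ?thesis unfolding t2_space_class.Lim_def by simp
qed

end
end

text \<open>Strict positivity is what allows the left limit at ruin to be taken inside the restarted
  path, after the claim.\<close>

lemma restart_ruin_pos:
  assumes adm: "admissible vs zs y v" and fin: "ruin_time (path vs zs y v) < \<infinity>"
  shows "0 < enn2real (ruin_time (path vs zs y v))"
proof (cases "ruin y v < vs 0")
  case True
  have "0 < drifted c \<sigma> v y 0" "continuous_on {0..} (drifted c \<sigma> v y)"
    using adm continuous_on_drifted[of y c \<sigma> v] by (auto simp: admissible_def drifted_def)
  then show ?thesis using early_ruin(1)[OF adm True] ruin_time_hit(1)[of "drifted c \<sigma> v y"] fin by simp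
next
  case False
  have V0: "0 < vs 0" using adm by (simp add: admissible_def regular_def)
  show ?thesis
  proof (cases "vs 0" rule: ennreal_cases)
    case (real V)
    have sv: "vs 0 \<le> ruin y v" using False by simp
    note rr = ruin_restart[OF adm real(2,1) sv]
    have "V > 0" using V0 real by simp
    moreover have "V \<le> enn2real (ruin_time (path vs zs y v))"
      using fin rr real by (metis enn2real_ennreal enn2real_mono infinity_ennreal_def le_iff_add)
    ultimately show ?thesis by simp
  next
    case top
    then have "ruin y v = \<infinity>" using False by (metis less_top infinity_ennreal_def)
    then show ?thesis using no_claim_no_ruin[OF adm] top fin by simp
  qed
qed

text \<open>The one-step recursion shared by both penalty functionals: a contribution up to and
  including the first claim, plus the discounted penalty of the path restarted after it. Everything
  later about the penalty uses only this property.\<close>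

definition stepwise :: "payoff \<Rightarrow> ((real \<Rightarrow> real) \<Rightarrow> real) \<Rightarrow> bool" where
  "stepwise \<Theta> pen \<longleftrightarrow>
    (\<forall>x. ruin_time x = \<infinity> \<longrightarrow> pen x = 0) \<and>
    (\<forall>vs zs y v. admissible vs zs y v \<longrightarrow> ennreal (pen (path vs zs y v)) = \<Theta> (vs 0) (zs 0) y v +
      (if survives (vs 0) (zs 0) y v then ennreal (exp (- \<delta> * enn2real (vs 0))) *
        ennreal (pen (path (\<lambda>k. vs (Suc k)) (\<lambda>k. zs (Suc k)) (path_shift (enn2real (vs 0)) y) (drifted c \<sigma> v y (enn2real (vs 0)) - zs 0))) else 0))"

lemma stepwiseI:
  assumes inf: "\<And>x. ruin_time x = \<infinity> \<Longrightarrow> pen x = 0"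
    and early: "\<And>vs zs y v. admissible vs zs y v \<Longrightarrow> ruin y v < vs 0 \<Longrightarrow> ennreal (pen (path vs zs y v)) = \<Theta> (vs 0) (zs 0) y v"
    and never: "\<And>z y v. ruin y v = \<infinity> \<Longrightarrow> \<Theta> \<infinity> z y v = 0"
    and at: "\<And>vs zs y v V. admissible vs zs y v \<Longrightarrow> vs 0 = ennreal V \<Longrightarrow> 0 \<le> V \<Longrightarrow> vs 0 \<le> ruin y v \<Longrightarrow>
      drifted c \<sigma> v y V \<le> zs 0 \<Longrightarrow> ennreal (pen (path vs zs y v)) = \<Theta> (vs 0) (zs 0) y v"
    and after: "\<And>vs zs y v V r. admissible vs zs y v \<Longrightarrow> vs 0 = ennreal V \<Longrightarrow> 0 \<le> V \<Longrightarrow> vs 0 \<le> ruin y v \<Longrightarrow>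
      0 < r \<Longrightarrow> zs 0 < drifted c \<sigma> v y V \<Longrightarrow>
      ruin_time (path vs zs y v) = ennreal (V + r) \<Longrightarrow>
      ruin_time (path (\<lambda>k. vs (Suc k)) (\<lambda>k. zs (Suc k)) (path_shift V y) (drifted c \<sigma> v y V - zs 0)) = ennreal r \<Longrightarrow>
      pen (path vs zs y v) = exp (- \<delta> * V) * pen (path (\<lambda>k. vs (Suc k)) (\<lambda>k. zs (Suc k)) (path_shift V y) (drifted c \<sigma> v y V - zs 0))"
    and after0: "\<And>V z y v. V \<le> ruin y v \<Longrightarrow> z < drifted c \<sigma> v y (enn2real V) \<Longrightarrow> \<Theta> V z y v = 0"
  shows "stepwise \<Theta> pen"
  unfolding stepwise_def
proof (intro conjI allI impI)
  fix vs zs y v assume adm: "admissible vs zs y v"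
  let ?x' = "path (\<lambda>k. vs (Suc k)) (\<lambda>k. zs (Suc k)) (path_shift (enn2real (vs 0)) y) (drifted c \<sigma> v y (enn2real (vs 0)) - zs 0)"
  show "ennreal (pen (path vs zs y v)) = \<Theta> (vs 0) (zs 0) y v +
      (if survives (vs 0) (zs 0) y v then ennreal (exp (- \<delta> * enn2real (vs 0))) * ennreal (pen ?x') else 0)"
  proof (cases "ruin y v < vs 0")
    case True
    then have "\<not> survives (vs 0) (zs 0) y v" by (auto simp: survives_def)
    then show ?thesis using early[OF adm True] by simp
  next
    case False
    then have sv: "vs 0 \<le> ruin y v" by simp
    show ?thesis
    proof (cases "vs 0" rule: ennreal_cases)
      case top
      then have "ruin y v = \<infinity>" using sv by (simp add: top_unique)
      then show ?thesis using no_claim_no_ruin[OF adm _ \<open>ruin y v = \<infinity>\<close>] top inf never[OF \<open>ruin y v = \<infinity>\<close>] by (simp add: survives_def)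
    next
      case (real V)
      show ?thesis
      proof (cases "drifted c \<sigma> v y V \<le> zs 0")
        case True
        then show ?thesis using at[OF adm real(2,1) sv True] real by (simp add: survives_def)
      next
        case z: False
        have surv: "survives (vs 0) (zs 0) y v" using z real sv by (simp add: survives_def)
        have 0: "\<Theta> (vs 0) (zs 0) y v = 0" using after0[OF sv, of "zs 0"] z real by simp
        have x': "?x' = path (\<lambda>k. vs (Suc k)) (\<lambda>k. zs (Suc k)) (path_shift V y) (drifted c \<sigma> v y V - zs 0)"
          using real by simp
        note rr = ruin_restart[OF adm real(2,1) sv, folded x']
        have "pen (path vs zs y v) = exp (- \<delta> * V) * pen ?x'"
        proof (cases "ruin_time ?x'" rule: ennreal_cases)
          case (real r)
          have "0 < enn2real (ruin_time ?x')"
            by (rule restart_ruin_pos[OF admissible_restart[OF adm surv]]) (use real in simp)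
          then have "0 < r" using real by simp
          moreover have "ruin_time (path vs zs y v) = ennreal (V + r)"
            using rr real \<open>0 \<le> V\<close> by simp
          ultimately show ?thesis
            unfolding x' using z real(2) unfolding x' by (intro after[OF adm \<open>vs 0 = ennreal V\<close> \<open>0 \<le> V\<close> sv]) auto
        next
          case top
          then have "ruin_time (path vs zs y v) = \<infinity>" using rr by simp
          then show ?thesis using inf top by simp
        qed
        then show ?thesis using 0 surv real by (simp add: ennreal_mult')
      qed
    qed
  qed
qed (use inf in auto)

lemma stepwise_claim:
  assumes w: "\<And>a b. 0 \<le> w a b"
  shows "stepwise (claim_payoff w) (penalty_claim \<delta> w)"
proof (rule stepwiseI)
  show "penalty_claim \<delta> w x = 0" if "ruin_time x = \<infinity>" for x
    using that by (simp add: penalty_claim_def)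
  fix vs zs y v
  { assume "admissible vs zs y v" "ruin y v < vs 0"
    then show "ennreal (penalty_claim \<delta> w (path vs zs y v)) = claim_payoff w (vs 0) (zs 0) y v"
      using early_ruin[of vs zs y v] by (auto simp: penalty_claim_def claim_payoff_def Let_def) }
  { fix V assume a: "admissible vs zs y v" "vs 0 = ennreal V" "0 \<le> V" "vs 0 \<le> ruin y v" "drifted c \<sigma> v y V \<le> zs 0"
    show "ennreal (penalty_claim \<delta> w (path vs zs y v)) = claim_payoff w (vs 0) (zs 0) y v"
      using ruin_at_claim[OF a] left_limit_at_claim[OF a(1-4)] a
      by (auto simp: penalty_claim_def claim_payoff_def Let_def ennreal_mult' abs_if) }
  { fix V r assume a: "admissible vs zs y v" "vs 0 = ennreal V" "0 \<le> V" "vs 0 \<le> ruin y v" and r: "0 < r"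
      and rt: "ruin_time (path vs zs y v) = ennreal (V + r)"
       "ruin_time (path (\<lambda>k. vs (Suc k)) (\<lambda>k. zs (Suc k)) (path_shift V y) (drifted c \<sigma> v y V - zs 0)) = ennreal r"
    have e: "exp (- (\<delta> * (V + r))) = exp (- (\<delta> * V)) * exp (- (\<delta> * r))" by (simp add: exp_add[symmetric] algebra_simps)
    show "penalty_claim \<delta> w (path vs zs y v) = exp (- \<delta> * V) * penalty_claim \<delta> w (path (\<lambda>k. vs (Suc k)) (\<lambda>k. zs (Suc k)) (path_shift V y) (drifted c \<sigma> v y V - zs 0))"
      using left_limit_after_claim[OF a r] after_claim[OF a, of r] r a(3)
      unfolding penalty_claim_def rt by (simp add: Let_def e del: ennreal_plus) }
qed (auto simp: claim_payoff_def)

lemma stepwise_diffusion: "stepwise diffusion_payoff (penalty_diffusion \<delta>)"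
proof (rule stepwiseI)
  show "penalty_diffusion \<delta> x = 0" if "ruin_time x = \<infinity>" for x
    using that by (simp add: penalty_diffusion_def)
  fix vs zs y v
  { assume a: "admissible vs zs y v" "ruin y v < vs 0"
    have "ruin y v < \<infinity>" by (rule less_le_trans[OF a(2)]) simp
    then show "ennreal (penalty_diffusion \<delta> (path vs zs y v)) = diffusion_payoff (vs 0) (zs 0) y v"
      using early_ruin[OF a] a by (simp add: penalty_diffusion_def diffusion_payoff_def Let_def) }
  { fix V assume a: "admissible vs zs y v" "vs 0 = ennreal V" "0 \<le> V" "vs 0 \<le> ruin y v" "drifted c \<sigma> v y V \<le> zs 0"
    show "ennreal (penalty_diffusion \<delta> (path vs zs y v)) = diffusion_payoff (vs 0) (zs 0) y v"
      using ruin_at_claim[OF a] a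
      by (auto simp: penalty_diffusion_def diffusion_payoff_def Let_def) }
  { fix V r assume a: "admissible vs zs y v" "vs 0 = ennreal V" "0 \<le> V" "vs 0 \<le> ruin y v" and r: "0 < r"
      and rt: "ruin_time (path vs zs y v) = ennreal (V + r)"
       "ruin_time (path (\<lambda>k. vs (Suc k)) (\<lambda>k. zs (Suc k)) (path_shift V y) (drifted c \<sigma> v y V - zs 0)) = ennreal r"
    have e: "exp (- (\<delta> * (V + r))) = exp (- (\<delta> * V)) * exp (- (\<delta> * r))" by (simp add: exp_add[symmetric] algebra_simps)
    show "penalty_diffusion \<delta> (path vs zs y v) = exp (- \<delta> * V) * penalty_diffusion \<delta> (path (\<lambda>k. vs (Suc k)) (\<lambda>k. zs (Suc k)) (path_shift V y) (drifted c \<sigma> v y V - zs 0))"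
      using after_claim[OF a, of r] r a(3)
      unfolding penalty_diffusion_def rt by (simp add: Let_def e del: ennreal_plus) }
qed (auto simp: diffusion_payoff_def)

text \<open>The penalty left after \<open>N\<close> claims vanishes once the claim times have passed the ruin time.\<close>

lemma stage_series:
  assumes step: "stepwise \<Theta> pen" and adm: "admissible vs zs y v"
  shows "ennreal (pen (path vs zs y v)) = (\<Sum>n. stage \<Theta> n vs zs y v)"
proof -
  \<comment> \<open>\<open>rest N\<close> is the penalty still outstanding after \<open>N\<close>
    survived claims, with all discounts and restarts applied. It follows the recursion of
    \<open>stage\<close> but ends in the full penalty, so consecutive remainders differ by one
    stage.\<close>
  define rest where "rest = rec_nat (\<lambda>vs zs y v. ennreal (pen (path vs zs y v)))
    (\<lambda>N r vs zs y v. if survives (vs 0) (zs 0) y v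
     then ennreal (exp (- \<delta> * enn2real (vs 0))) *
       r (\<lambda>k. vs (Suc k)) (\<lambda>k. zs (Suc k)) (path_shift (enn2real (vs 0)) y) (drifted c \<sigma> v y (enn2real (vs 0)) - zs 0)
     else 0)"
  have rest0: "rest 0 vs zs y v = ennreal (pen (path vs zs y v))" for vs zs y v by (simp add: rest_def)
  have restS: "rest (Suc N) vs zs y v = (if survives (vs 0) (zs 0) y v
     then ennreal (exp (- \<delta> * enn2real (vs 0))) *
       rest N (\<lambda>k. vs (Suc k)) (\<lambda>k. zs (Suc k)) (path_shift (enn2real (vs 0)) y) (drifted c \<sigma> v y (enn2real (vs 0)) - zs 0)
     else 0)" for N vs zs y v by (simp add: rest_def)
  have split: "rest N vs zs y v = stage \<Theta> N vs zs y v + rest (Suc N) vs zs y v" if "admissible vs zs y v" for N vs zs y v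
    using that
  proof (induction N arbitrary: vs zs y v)
    case 0
    then show ?case using step unfolding stepwise_def restS rest0 by auto
  next
    case (Suc N)
    show ?case
    proof (cases "survives (vs 0) (zs 0) y v")
      case True
      from Suc.IH[OF admissible_restart[OF Suc.prems True]] True
      show ?thesis by (simp add: restS[of N] restS[of "Suc N"] distrib_left del: mult_minus_left)
    next
      case False
      then show ?thesis by (simp add: restS)
    qed
  qed
  have partial: "ennreal (pen (path vs zs y v)) = (\<Sum>n<N. stage \<Theta> n vs zs y v) + rest N vs zs y v" for N
  proof (induction N)
    case (Suc N)
    then show ?case using split[OF adm, of N] by (simp add: add.assoc)
  qed (simp add: rest0)
  have late: "(\<Sum>k<N. vs k) \<le> ruin_time (path vs zs y v) \<and> ruin_time (path vs zs y v) < \<infinity>"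
    if "admissible vs zs y v" "rest N vs zs y v \<noteq> 0" for N vs zs y v
    using that
  proof (induction N arbitrary: vs zs y v)
    case 0
    have "pen x = 0" if "ruin_time x = \<infinity>" for x using step that unfolding stepwise_def by blast
    then have "ruin_time (path vs zs y v) \<noteq> \<infinity>" using 0(2) unfolding rest0 by auto
    then show ?case by (simp add: less_top)
  next
    case (Suc N)
    then have s: "survives (vs 0) (zs 0) y v" by (auto simp: restS split: if_splits)
    then obtain V where V: "vs 0 = ennreal V" "0 \<le> V" "vs 0 \<le> ruin y v"
      by (cases "vs 0" rule: ennreal_cases) (auto simp: survives_def)
    have "rest N (\<lambda>k. vs (Suc k)) (\<lambda>k. zs (Suc k)) (path_shift (enn2real (vs 0)) y) (drifted c \<sigma> v y (enn2real (vs 0)) - zs 0) \<noteq> 0"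
      using Suc.prems(2) s by (auto simp: restS)
    from Suc.IH[OF admissible_restart[OF Suc.prems(1) s] this]
    show ?case
      using ruin_restart[OF Suc.prems(1) V] V unfolding sum.lessThan_Suc_shift by (simp add: add_left_mono)
  qed
  obtain N0 where N0: "rest N vs zs y v = 0" if "N \<ge> N0" for N
  proof (cases "ruin_time (path vs zs y v)" rule: ennreal_cases)
    case (real r)
    obtain m where m: "ennreal r < (\<Sum>k<m. vs k)" using adm unfolding admissible_def regular_def by blast
    have "rest N vs zs y v = 0" if "m \<le> N" for N
    proof (rule ccontr)
      assume "rest N vs zs y v \<noteq> 0"
      then have "(\<Sum>k<N. vs k) \<le> ennreal r" using late[OF adm] real by auto
      then show False using m sum_lessThan_mono_ennreal[OF that, of vs] by auto
    qed
    then show ?thesis by (rule that)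
  next
    case top
    then have "rest N vs zs y v = 0" for N using late[OF adm] by auto
    then show ?thesis using that by blast
  qed
  have "(\<lambda>N. \<Sum>n<N. stage \<Theta> n vs zs y v) \<longlonglongrightarrow> ennreal (pen (path vs zs y v))"
  proof (rule tendsto_eventually, unfold eventually_sequentially, intro exI allI impI)
    fix n assume "N0 \<le> n"
    then show "(\<Sum>n<n. stage \<Theta> n vs zs y v) = ennreal (pen (path vs zs y v))" using partial[of n] N0 by simp
  qed
  then have "(\<lambda>n. stage \<Theta> n vs zs y v) sums ennreal (pen (path vs zs y v))" by (simp add: sums_def)
  then show ?thesis by (rule sums_unique)
qed

end

section \<open>Measurability of the ruin time and of the diffusion penalty\<close>

lemma count_eq:
  "claim_count vs t = (if \<exists>m. ennreal t < (\<Sum>k<Suc m. vs k) then LEAST m. ennreal t < (\<Sum>k<Suc m. vs k) else Max {1..})"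
proof (cases "\<exists>m. ennreal t < (\<Sum>k<Suc m. vs k)")
  case True
  define m where "m = (LEAST m. ennreal t < (\<Sum>k<Suc m. vs k))"
  have up: "ennreal t < (\<Sum>k<Suc m. vs k)" unfolding m_def by (rule LeastI_ex[OF True])
  have "m = 0 \<or> (\<Sum>k<m. vs k) \<le> ennreal t"
  proof (cases m)
    case (Suc l)
    then have "\<not> ennreal t < (\<Sum>k<Suc l. vs k)"
      using not_less_Least[of l "\<lambda>m. ennreal t < (\<Sum>k<Suc m. vs k)"] m_def by auto
    then show ?thesis by (simp only: Suc not_less simp_thms)
  qed simp
  from count_eqI[OF this up] show ?thesis by (simp only: m_def True if_True)
next
  case False
  have "(\<Sum>k<m. vs k) \<le> ennreal t" if "1 \<le> m" for m
    using False that by (metis Suc_pred' not_less One_nat_def Suc_le_eq)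
  then have "{m. 1 \<le> m \<and> (\<Sum>k<m. vs k) \<le> ennreal t} = {1..}" by auto
  then show ?thesis unfolding claim_count_def Let_def using False by auto
qed

lemma cont_process_from:
  assumes X: "cont_process F X" and T: "T \<in> borel_measurable F" and T0: "\<And>\<omega>. \<omega> \<in> space F \<Longrightarrow> 0 \<le> T \<omega>"
  shows "cont_process F (\<lambda>t \<omega>. X (T \<omega> + t) \<omega>)"
proof -
  have a: "(\<lambda>\<omega>. X (max 0 (T \<omega>)) \<omega>) \<in> borel_measurable F" by (rule cont_process_at[OF X T])
  have s: "cont_process F (\<lambda>t \<omega>. path_shift (T \<omega>) (\<lambda>t. X t \<omega>) t)" by (rule cont_process_shift[OF X T T0])
  \<comment> \<open>With drift zero and unit volatility, \<open>drifted\<close> merely adds the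
    value at time \<open>T\<close> back to the increments after it.\<close>
  have "cont_process F (\<lambda>t \<omega>. drifted 0 1 (X (max 0 (T \<omega>)) \<omega>) (\<lambda>t. path_shift (T \<omega>) (\<lambda>t. X t \<omega>) t) t)"
    by (rule cont_process_drifted[OF s a])
  moreover have "drifted 0 1 (X (max 0 (T \<omega>)) \<omega>) (\<lambda>t. path_shift (T \<omega>) (\<lambda>t. X t \<omega>) t) t = X (T \<omega> + t) \<omega>" if "\<omega> \<in> space F" for \<omega> t
    using T0[OF that] by (simp add: drifted_def path_shift_def max_def)
  ultimately show ?thesis unfolding cont_process_def by (auto cong: measurable_cong continuous_on_cong)
qed

text \<open>The left-hand term is the first time from \<open>a\<close> on at which the path is not
  positive. As the comparison with \<open>y\<close> is strict, a single witness time replaces the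
  infimum.\<close>

lemma ruin_time_add_less:
  assumes "a < \<infinity>"
  shows "a + ruin_time (\<lambda>t. x (enn2real a + t)) < y \<longleftrightarrow> (\<exists>t\<ge>0. a \<le> ennreal t \<and> ennreal t < y \<and> x t \<le> 0)"
proof -
  obtain r where r: "0 \<le> r" "a = ennreal r" using assms by (cases a rule: ennreal_cases) auto
  show ?thesis
  proof
    assume L: "a + ruin_time (\<lambda>t. x (enn2real a + t)) < y"
    have "\<exists>t. 0 \<le> t \<and> x (r + t) \<le> 0 \<and> ennreal r + ennreal t < y"
    proof (rule ccontr)
      assume n: "\<not> ?thesis"
      have "y - ennreal r \<le> ruin_time (\<lambda>t. x (r + t))"
        unfolding ruin_time_def
      proof (rule INF_greatest)
        fix t assume "t \<in> {t. 0 \<le> t \<and> x (r + t) \<le> 0}"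
        then have "\<not> ennreal r + ennreal t < y" using n by auto
        then show "y - ennreal r \<le> ennreal t" by (simp add: ennreal_minus_le_iff not_less)
      qed
      then have "y \<le> ennreal r + ruin_time (\<lambda>t. x (r + t))" by (simp add: ennreal_minus_le_iff)
      then show False using L r by simp
    qed
    then obtain t where t: "0 \<le> t" "x (r + t) \<le> 0" "ennreal r + ennreal t < y" by auto
    then show "\<exists>t\<ge>0. a \<le> ennreal t \<and> ennreal t < y \<and> x t \<le> 0"
      using r by (intro exI[of _ "r + t"]) auto
  next
    assume "\<exists>t\<ge>0. a \<le> ennreal t \<and> ennreal t < y \<and> x t \<le> 0"
    then obtain t where t: "0 \<le> t" "r \<le> t" "ennreal t < y" "x t \<le> 0" using r by auto
    then have "ruin_time (\<lambda>t. x (r + t)) \<le> ennreal (t - r)" by (intro ruin_time_less) auto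
    then have "ennreal r + ruin_time (\<lambda>t. x (r + t)) \<le> ennreal r + ennreal (t - r)" by (rule add_left_mono)
    also have "\<dots> = ennreal t" using r t by (simp flip: ennreal_plus)
    finally show "a + ruin_time (\<lambda>t. x (enn2real a + t)) < y" using r t by simp
  qed
qed

context
  fixes F :: "'a measure" and V :: "nat \<Rightarrow> 'a \<Rightarrow> ennreal" and Z :: "nat \<Rightarrow> 'a \<Rightarrow> real" and Y :: "real \<Rightarrow> 'a \<Rightarrow> real"
    and c \<sigma> u :: real
  assumes V [measurable]: "\<And>k. V k \<in> borel_measurable F" and Z [measurable]: "\<And>k. Z k \<in> borel_measurable F"
    and Y: "cont_process F Y"
begin

abbreviation "claim_epoch m \<omega> \<equiv> \<Sum>k<m. V k \<omega>"
abbreviation "path_piece m \<omega> \<equiv> drifted c \<sigma> (u - (\<Sum>k<m. Z k \<omega>)) (\<lambda>t. Y t \<omega>)"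
abbreviation "model_path \<omega> \<equiv> claim_path c \<sigma> (\<lambda>k. V k \<omega>) (\<lambda>k. Z k \<omega>) (\<lambda>t. Y t \<omega>) u"

lemma model_path_piece: "model_path \<omega> t = path_piece (claim_count (\<lambda>k. V k \<omega>) t) \<omega> t"
  by (simp add: claim_path_def drifted_def)

text \<open>If the claim epochs accumulate, then the number of claims is the unspecified value \<open>Max {1..}\<close> from
  their limit on. This has probability zero, but measurability concerns every path.\<close>

lemma ruin_model_path_less:
  "ruin_time (model_path \<omega>) < y \<longleftrightarrow>
    (\<exists>m. claim_epoch m \<omega> < \<infinity> \<and> claim_epoch m \<omega> + ruin_time (\<lambda>t. path_piece m \<omega> (enn2real (claim_epoch m \<omega>) + t)) < min (claim_epoch (Suc m) \<omega>) y) \<or>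
    ((SUP m. claim_epoch m \<omega>) < \<infinity> \<and> (SUP m. claim_epoch m \<omega>) + ruin_time (\<lambda>t. path_piece (Max {1..}) \<omega> (enn2real (SUP m. claim_epoch m \<omega>) + t)) < y)"
  (is "?L \<longleftrightarrow> ?A \<or> ?B")
proof
  assume ?L
  then obtain t where t: "0 \<le> t" "model_path \<omega> t \<le> 0" "ennreal t < y" unfolding ruin_time_def INF_less_iff by blast
  show "?A \<or> ?B"
  proof (cases "\<exists>m. ennreal t < claim_epoch (Suc m) \<omega>")
    case True
    define m where "m = (LEAST m. ennreal t < claim_epoch (Suc m) \<omega>)"
    have c: "claim_count (\<lambda>k. V k \<omega>) t = m" unfolding count_eq m_def using True by simp
    have up: "ennreal t < claim_epoch (Suc m) \<omega>" unfolding m_def by (rule LeastI_ex[OF True])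
    have lo: "claim_epoch m \<omega> \<le> ennreal t"
    proof (cases m)
      case (Suc l)
      then have "\<not> ennreal t < claim_epoch (Suc l) \<omega>"
        using not_less_Least[of l "\<lambda>m. ennreal t < claim_epoch (Suc m) \<omega>"] m_def by auto
      then show ?thesis by (simp only: Suc not_less)
    qed simp
    then have fin: "claim_epoch m \<omega> < \<infinity>" by (rule le_less_trans) simp
    have "\<exists>t\<ge>0. claim_epoch m \<omega> \<le> ennreal t \<and> ennreal t < min (claim_epoch (Suc m) \<omega>) y \<and> path_piece m \<omega> t \<le> 0"
      using t lo up unfolding model_path_piece c by (intro exI[of _ t]) auto
    then have "claim_epoch m \<omega> + ruin_time (\<lambda>t. path_piece m \<omega> (enn2real (claim_epoch m \<omega>) + t)) < min (claim_epoch (Suc m) \<omega>) y"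
      using ruin_time_add_less[OF fin] by blast
    then show ?thesis using fin by blast
  next
    case False
    then have c: "claim_count (\<lambda>k. V k \<omega>) t = Max {1..}" unfolding count_eq by simp
    have "claim_epoch m \<omega> \<le> ennreal t" for m
    proof (cases m)
      case (Suc l)
      then show ?thesis using False by (simp only: Suc not_less not_ex)
    qed simp
    then have lo: "(SUP m. claim_epoch m \<omega>) \<le> ennreal t" by (rule SUP_least)
    then have fin: "(SUP m. claim_epoch m \<omega>) < \<infinity>" by (rule le_less_trans) simp
    have "\<exists>t\<ge>0. (SUP m. claim_epoch m \<omega>) \<le> ennreal t \<and> ennreal t < y \<and> path_piece (Max {1..}) \<omega> t \<le> 0"
      using t lo unfolding model_path_piece c by (intro exI[of _ t]) auto
    then have ?B using ruin_time_add_less[OF fin] fin by blast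
    then show ?thesis ..
  qed
next
  assume "?A \<or> ?B"
  then show ?L
  proof
    assume ?A
    then obtain m where m: "claim_epoch m \<omega> < \<infinity>" "claim_epoch m \<omega> + ruin_time (\<lambda>t. path_piece m \<omega> (enn2real (claim_epoch m \<omega>) + t)) < min (claim_epoch (Suc m) \<omega>) y" by blast
    then obtain t where t: "0 \<le> t" "claim_epoch m \<omega> \<le> ennreal t" "ennreal t < min (claim_epoch (Suc m) \<omega>) y" "path_piece m \<omega> t \<le> 0"
      using ruin_time_add_less[OF m(1)] by blast
    have "claim_count (\<lambda>k. V k \<omega>) t = m" by (rule count_eqI) (use t in auto)
    then have "model_path \<omega> t \<le> 0" using t unfolding model_path_piece by simp
    then have "ruin_time (model_path \<omega>) \<le> ennreal t" using t by (intro ruin_time_less)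
    then show ?L using t(3) by (auto intro: le_less_trans)
  next
    assume B: ?B
    then obtain t where t: "0 \<le> t" "(SUP m. claim_epoch m \<omega>) \<le> ennreal t" "ennreal t < y" "path_piece (Max {1..}) \<omega> t \<le> 0"
      using ruin_time_add_less[of "SUP m. claim_epoch m \<omega>"] by blast
    have "\<not> ennreal t < claim_epoch (Suc m) \<omega>" for m
      using t(2) by (meson SUP_upper UNIV_I not_less order.trans)
    then have "claim_count (\<lambda>k. V k \<omega>) t = Max {1..}" unfolding count_eq by simp
    then have "model_path \<omega> t \<le> 0" using t unfolding model_path_piece by simp
    then have "ruin_time (model_path \<omega>) \<le> ennreal t" using t by (intro ruin_time_less)
    then show ?L using t(3) by (rule le_less_trans)
  qed
qed

lemma cont_piece: "cont_process F (\<lambda>t \<omega>. path_piece m \<omega> t)"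
  by (rule cont_process_drifted[OF Y]) measurable

lemma ruin_piece_measurable:
  assumes [measurable]: "T \<in> borel_measurable F"
  shows "(\<lambda>\<omega>. ruin_time (\<lambda>t. path_piece m \<omega> (enn2real (T \<omega>) + t))) \<in> borel_measurable F"
  using ruin_time_measurable[OF cont_process_from[OF cont_piece, of "\<lambda>\<omega>. enn2real (T \<omega>)" m]] by simp

lemma ruin_model_path_measurable [measurable]: "(\<lambda>\<omega>. ruin_time (model_path \<omega>)) \<in> borel_measurable F"
proof (rule borel_measurableI_less)
  fix y
  note [measurable] = ruin_piece_measurable
  have "{\<omega> \<in> space F. (\<exists>m. claim_epoch m \<omega> < \<infinity> \<and> claim_epoch m \<omega> + ruin_time (\<lambda>t. path_piece m \<omega> (enn2real (claim_epoch m \<omega>) + t)) < min (claim_epoch (Suc m) \<omega>) y) \<or>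
    ((SUP m. claim_epoch m \<omega>) < \<infinity> \<and> (SUP m. claim_epoch m \<omega>) + ruin_time (\<lambda>t. path_piece (Max {1..}) \<omega> (enn2real (SUP m. claim_epoch m \<omega>) + t)) < y)} \<in> sets F"
    by (rule predE) measurable
  then show "{\<omega> \<in> space F. ruin_time (model_path \<omega>) < y} \<in> sets F" unfolding ruin_model_path_less .
qed

lemma model_path_at_ruin_measurable [measurable]: "(\<lambda>\<omega>. model_path \<omega> (enn2real (ruin_time (model_path \<omega>)))) \<in> borel_measurable F"
proof -
  let ?T = "\<lambda>\<omega>. enn2real (ruin_time (model_path \<omega>))"
  have [measurable]: "(\<lambda>\<omega>. claim_count (\<lambda>k. V k \<omega>) (?T \<omega>)) \<in> measurable F (count_space UNIV)"
    unfolding count_eq by measurable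
  have "(\<lambda>\<omega>. path_piece (claim_count (\<lambda>k. V k \<omega>) (?T \<omega>)) \<omega> (max 0 (?T \<omega>))) \<in> borel_measurable F"
    by (rule measurable_compose_countable[where f="\<lambda>m \<omega>. path_piece m \<omega> (max 0 (?T \<omega>))"])
       (use cont_process_at[OF cont_piece] in measurable)
  then show ?thesis unfolding model_path_piece by (simp add: max_def)
qed

lemma penalty_diffusion_measurable: "(\<lambda>\<omega>. penalty_diffusion \<delta> (model_path \<omega>)) \<in> borel_measurable F"
  unfolding penalty_diffusion_def Let_def by measurable

end

section \<open>Integrating out the claims\<close>

context surplus_path
begin

lemma drifted_at_measurable:
  assumes Y: "cont_process F Y" and v: "v \<in> borel_measurable F" and V: "V \<in> borel_measurable F"
  shows "(\<lambda>\<omega>. drifted c \<sigma> (v \<omega>) (\<lambda>t. Y t \<omega>) (enn2real (V \<omega>))) \<in> borel_measurable F"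
  using cont_process_drifted_at[OF Y v, of "\<lambda>\<omega>. enn2real (V \<omega>)" c \<sigma>] V by simp

lemma ruin_measurable:
  assumes "cont_process F Y" and "v \<in> borel_measurable F"
  shows "(\<lambda>\<omega>. ruin (\<lambda>t. Y t \<omega>) (v \<omega>)) \<in> borel_measurable F"
  using ruin_time_measurable[OF cont_process_drifted[OF assms]] by simp

text \<open>\<open>None\<close> stands for ruin by diffusion.\<close>

definition pay :: "(real \<Rightarrow> real \<Rightarrow> real) option \<Rightarrow> payoff" where
  "pay k = (case k of None \<Rightarrow> diffusion_payoff | Some w \<Rightarrow> claim_payoff w)"

lemma pay_measurable:
  assumes Y: "cont_process F Y" and v: "v \<in> borel_measurable F" and V [measurable]: "V \<in> borel_measurable F"
    and z [measurable]: "z \<in> borel_measurable F"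
    and w: "\<And>w. k = Some w \<Longrightarrow> (\<lambda>(x, y). w x y) \<in> borel_measurable borel"
  shows "(\<lambda>\<omega>. pay k (V \<omega>) (z \<omega>) (\<lambda>t. Y t \<omega>) (v \<omega>)) \<in> borel_measurable F"
proof -
  note [measurable] = drifted_at_measurable[OF Y v V] ruin_measurable[OF Y v]
  show ?thesis
  proof (cases k)
    case None
    show ?thesis unfolding pay_def None diffusion_payoff_def option.case by measurable
  next
    case (Some w)
    have [measurable]: "(\<lambda>\<omega>. w (f \<omega>) (g \<omega>)) \<in> borel_measurable F"
      if [measurable]: "f \<in> borel_measurable F" "g \<in> borel_measurable F" for f g
    proof -
      have "(\<lambda>\<omega>. (f \<omega>, g \<omega>)) \<in> borel_measurable F" by measurable
      from measurable_compose[OF this assms(5)[OF Some]] show ?thesis by simp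
    qed
    show ?thesis unfolding pay_def Some claim_payoff_def option.case by measurable
  qed
qed

lemma survives_measurable:
  assumes Y: "cont_process F Y" and v: "v \<in> borel_measurable F" and V [measurable]: "V \<in> borel_measurable F"
    and z [measurable]: "z \<in> borel_measurable F"
  shows "Measurable.pred F (\<lambda>\<omega>. survives (V \<omega>) (z \<omega>) (\<lambda>t. Y t \<omega>) (v \<omega>))"
proof -
  note [measurable] = drifted_at_measurable[OF Y v V] ruin_measurable[OF Y v]
  show ?thesis unfolding survives_def by measurable
qed

lemma stage_measurable:
  assumes Y: "cont_process F Y" and v: "v \<in> borel_measurable F" and V: "\<And>j. V j \<in> borel_measurable F"
    and Z: "\<And>j. Z j \<in> borel_measurable F"
    and w: "\<And>w. k = Some w \<Longrightarrow> (\<lambda>(x, y). w x y) \<in> borel_measurable borel"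
  shows "(\<lambda>\<omega>. stage (pay k) n (\<lambda>j. V j \<omega>) (\<lambda>j. Z j \<omega>) (\<lambda>t. Y t \<omega>) (v \<omega>)) \<in> borel_measurable F"
  using Y v V Z
proof (induction n arbitrary: Y v V Z)
  case 0
  then show ?case by (simp add: pay_measurable[OF _ _ _ _ w])
next
  case (Suc n)
  note [measurable] = Suc.prems(3,4) drifted_at_measurable[OF Suc.prems(1,2,3)] survives_measurable[OF Suc.prems(1,2)]
  have [measurable]: "(\<lambda>\<omega>. stage (pay k) n (\<lambda>j. V (Suc j) \<omega>) (\<lambda>j. Z (Suc j) \<omega>) (path_shift (enn2real (V 0 \<omega>)) (\<lambda>t. Y t \<omega>))
      (drifted c \<sigma> (v \<omega>) (\<lambda>t. Y t \<omega>) (enn2real (V 0 \<omega>)) - Z 0 \<omega>)) \<in> borel_measurable F"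
  proof -
    have "cont_process F (\<lambda>t \<omega>. path_shift (enn2real (V 0 \<omega>)) (\<lambda>t. Y t \<omega>) t)"
      by (rule cont_process_shift[OF Suc.prems(1)]) auto
    moreover have "(\<lambda>\<omega>. drifted c \<sigma> (v \<omega>) (\<lambda>t. Y t \<omega>) (enn2real (V 0 \<omega>)) - Z 0 \<omega>) \<in> borel_measurable F" by measurable
    ultimately show ?thesis using Suc.IH[of _ _ "\<lambda>j. V (Suc j)" "\<lambda>j. Z (Suc j)"] Suc.prems(3,4) by simp
  qed
  show ?case unfolding stage.simps by measurable
qed

end

section \<open>Independence of clocks, claims and diffusion\<close>

locale risk_model = phase_type B b q + prob_space P
  for B :: "real ^ 'n::finite ^ 'n" and b q and P :: "'a measure" +
  fixes \<beta> \<alpha> :: "real ^ 'n" and p :: "real \<Rightarrow> real"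
    and J :: "nat \<Rightarrow> real \<Rightarrow> 'a \<Rightarrow> 'n option" and Z :: "nat \<Rightarrow> 'a \<Rightarrow> real" and W :: "real \<Rightarrow> 'a \<Rightarrow> real"
  assumes law: "risk_law P \<beta> \<alpha> B b p J Z W"
    and beta: "\<And>i. 0 \<le> \<beta> $ i" "(\<Sum>i\<in>UNIV. \<beta> $ i) = 1"
    and alpha: "\<And>i. 0 \<le> \<alpha> $ i" "(\<Sum>i\<in>UNIV. \<alpha> $ i) = 1"
    and p_nonneg: "\<And>x. 0 \<le> p x"
begin

definition source_events :: "source \<Rightarrow> 'a set set" where
  "source_events s = (case s of Clock k \<Rightarrow> process_events P (count_space UNIV) {0..} (J k)
            | Claim k \<Rightarrow> process_events P borel {k} Z
            | Diffusion \<Rightarrow> process_events P borel {0..} W)"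

definition info :: "source set \<Rightarrow> 'a measure" where
  "info A = sigma (space P) (\<Union>s\<in>A. source_events s)"

definition init :: "nat \<Rightarrow> real ^ 'n" where "init k = (if k = 0 then \<beta> else \<alpha>)"

abbreviation clock :: "nat \<Rightarrow> 'a \<Rightarrow> ennreal" where "clock k \<equiv> absorption_time (J k)"

lemma phase_clock: "phase_clock B b q P (J k) (init k)"
  using law beta alpha by unfold_locales (auto simp: risk_law_def init_def)

lemma brownian_W: "brownian P W"
  using law by unfold_locales (simp add: risk_law_def)

lemma claim_distr: "distributed P lborel (Z k) (\<lambda>x. ennreal (p x))"
  and indep_sources: "indep_sets source_events UNIV"
  using law by (auto simp: risk_law_def source_events_def[abs_def])

lemma p_measurable [measurable]: "p \<in> borel_measurable borel"
proof -
  have "(\<lambda>x. enn2real (ennreal (p x))) \<in> borel_measurable borel"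
    using distributed_borel_measurable[OF claim_distr] by measurable
  then show ?thesis using p_nonneg by simp
qed

lemma source_events_sub: "source_events s \<subseteq> events"
  using indep_sources by (simp add: indep_sets_def)

lemma space_info [simp]: "space (info A) = space P"
  by (simp add: info_def space_measure_of_conv)

lemma sets_info: "sets (info A) = sigma_sets (space P) (\<Union>s\<in>A. source_events s)"
  unfolding info_def by (rule sets_measure_of) (use source_events_sub sets.space_closed in blast)

lemma sets_info_sub: "sets (info A) \<subseteq> sets P"
  unfolding sets_info by (rule sets.sigma_sets_subset) (use source_events_sub in blast)

text \<open>Grouping independent sources into disjoint sets preserves independence. Used to separate
  a clock from its claim, present from future claims, and the diffusion from all claims.\<close>

lemma indep_info:
  assumes "A \<inter> C = {}"
  shows "indep_set (sets (info A)) (sets (info C))"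
proof -
  define I where "I = (\<lambda>b. if b then A else C)"
  have "indep_sets (\<lambda>j. sigma_sets (space P) (\<Union>i\<in>I j. source_events i)) UNIV"
  proof (rule indep_sets_collect_sigma)
    show "indep_sets source_events (\<Union>j\<in>UNIV. I j)"
      by (rule indep_sets_mono_index[OF _ indep_sources]) auto
    show "Int_stable (source_events i)" for i
      unfolding source_events_def by (cases i) (simp_all add: Int_stable_process_events)
    show "disjoint_family_on I UNIV" using assms by (auto simp: disjoint_family_on_def I_def)
  qed
  moreover have "(\<lambda>j. sigma_sets (space P) (\<Union>i\<in>I j. source_events i)) = case_bool (sets (info A)) (sets (info C))"
    by (auto simp: fun_eq_iff sets_info I_def split: bool.split)
  ultimately show ?thesis by (simp add: indep_set_def)
qed

lemma measurable_info:
  assumes "process_events P N I X = source_events s" "s \<in> A" "t \<in> I" "X t \<in> space P \<rightarrow> space N"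
  shows "X t \<in> measurable (info A) N"
proof (rule measurableI)
  fix D assume "D \<in> sets N"
  then have "X t -` D \<inter> space P \<in> process_events P N I X"
    using assms(3) by (auto simp: process_events_def intro!: sigma_sets.Basic)
  then show "X t -` D \<inter> space (info A) \<in> sets (info A)"
    using assms(1,2) by (auto simp: sets_info intro!: sigma_sets.Basic)
qed (use assms(4) in auto)

lemma clock_measurable:
  assumes "Clock k \<in> A" shows "clock k \<in> borel_measurable (info A)"
proof (rule absorption_time_measurable)
  show "J k t \<in> measurable (info A) (count_space UNIV)" if "t \<ge> 0" for t
    by (rule measurable_info[of _ "{0..}" _ "Clock k"]) (use assms that in \<open>auto simp: source_events_def\<close>)
  show "\<exists>\<epsilon>>0. \<forall>s\<in>{t..<t + \<epsilon>}. J k s \<omega> = J k t \<omega>" if "\<omega> \<in> space (info A)" "t \<ge> 0" for \<omega> t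
    using phase_clock.right_cont[OF phase_clock, of \<omega> t k] that by simp
qed

lemma claim_measurable: "Claim k \<in> A \<Longrightarrow> Z k \<in> borel_measurable (info A)"
  by (rule measurable_info[of _ "{k}" _ "Claim k"]) (auto simp: source_events_def)

lemma diffusion_cont:
  assumes "Diffusion \<in> A" shows "cont_process (info A) W"
proof -
  interpret BW: brownian P W by (rule brownian_W)
  show ?thesis unfolding cont_process_def
    by (auto intro!: measurable_info[of borel "{0..}" W Diffusion] BW.W_cont assms simp: source_events_def)
qed

lemma clock_P [measurable]: "clock k \<in> borel_measurable P" and claim_P [measurable]: "Z k \<in> borel_measurable P"
proof -
  have "f \<in> borel_measurable P" if "f \<in> borel_measurable (info UNIV)" for f :: "'a \<Rightarrow> 'b::topological_space"
    using measurable_mono[OF order_refl refl sets_info_sub[of UNIV], of "borel :: 'b measure"] that by auto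
  then show "clock k \<in> borel_measurable P" "Z k \<in> borel_measurable P"
    using clock_measurable[of k UNIV] claim_measurable[of k UNIV] by blast+
qed

text \<open>Freezing the clock integrates out the independent claim with density \<open>p\<close>;
  the law of the clock then contributes the phase-type density.\<close>

lemma clock_claim_law:
  assumes h [measurable]: "case_prod h \<in> borel_measurable (borel \<Otimes>\<^sub>M borel)"
  shows "(\<integral>\<^sup>+\<omega>. (if clock k \<omega> < \<infinity> then h (enn2real (clock k \<omega>)) (Z k \<omega>) else 0) \<partial>P)
    = (\<integral>\<^sup>+t. (if 0 \<le> t then ennreal (phase_series (init k) b t) * (\<integral>\<^sup>+z. ennreal (p z) * h t z \<partial>lborel) else 0) \<partial>lborel)"
proof -
  interpret C: phase_clock B b q P "J k" "init k" by (rule phase_clock)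
  let ?C = "info {Clock k}" and ?D = "info {Claim k}"
  have [measurable]: "clock k \<in> borel_measurable ?C" "Z k \<in> borel_measurable ?D"
    by (auto intro: clock_measurable claim_measurable)
  have [measurable]: "(\<lambda>x. h (f x) (g x)) \<in> borel_measurable F" if "f \<in> borel_measurable F" "g \<in> borel_measurable F" for f g and F :: "'x measure"
    using measurable_compose[OF measurable_Pair[OF that] h] by simp
  have "(\<integral>\<^sup>+\<omega>. (if clock k \<omega> < \<infinity> then h (enn2real (clock k \<omega>)) (Z k \<omega>) else 0) \<partial>P)
     = (\<integral>\<^sup>+\<omega>. \<integral>\<^sup>+\<omega>'. (if clock k \<omega> < \<infinity> then h (enn2real (clock k \<omega>)) (Z k \<omega>') else 0) \<partial>P \<partial>P)"
  proof (rule nn_integral_freeze[OF _ _ sets_info_sub sets_info_sub indep_info])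
    show "{Clock k} \<inter> {Claim k} = {}" by auto
    show "(\<lambda>(\<omega>, \<omega>'). if clock k \<omega> < \<infinity> then h (enn2real (clock k \<omega>)) (Z k \<omega>') else 0) \<in> borel_measurable (?C \<Otimes>\<^sub>M ?D)"
      unfolding split_beta by measurable
  qed simp_all
  also have "\<dots> = (\<integral>\<^sup>+\<omega>. (if clock k \<omega> < \<infinity> then (\<integral>\<^sup>+z. ennreal (p z) * h (enn2real (clock k \<omega>)) z \<partial>lborel) else 0) \<partial>P)"
  proof (rule nn_integral_cong)
    fix \<omega>
    have "(\<integral>\<^sup>+\<omega>'. h (enn2real (clock k \<omega>)) (Z k \<omega>') \<partial>P) = (\<integral>\<^sup>+z. ennreal (p z) * h (enn2real (clock k \<omega>)) z \<partial>lborel)"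
      by (rule distributed_nn_integral[OF claim_distr, symmetric]) simp
    then show "(\<integral>\<^sup>+\<omega>'. (if clock k \<omega> < \<infinity> then h (enn2real (clock k \<omega>)) (Z k \<omega>') else 0) \<partial>P)
      = (if clock k \<omega> < \<infinity> then (\<integral>\<^sup>+z. ennreal (p z) * h (enn2real (clock k \<omega>)) z \<partial>lborel) else 0)" by simp
  qed
  also have "\<dots> = (\<integral>\<^sup>+t. (if 0 \<le> t then ennreal (phase_series (init k) b t) * (\<integral>\<^sup>+z. ennreal (p z) * h t z \<partial>lborel) else 0) \<partial>lborel)"
    by (rule C.absorption_law) measurable
  finally show ?thesis .
qed

end

section \<open>The expected contribution of each stage\<close>

definition claim_conv :: "(real \<Rightarrow> real) \<Rightarrow> (real \<Rightarrow> ennreal) \<Rightarrow> real \<Rightarrow> ennreal" where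
  "claim_conv p g x = (\<integral>\<^sup>+z. ennreal (p z) * (if z < x then g (x - z) else 0) \<partial>lborel)"

locale gerber_shiu = risk_model B b q P \<beta> \<alpha> p J Z W + drift_diffusion c \<sigma> lam + surplus_path c \<sigma> \<delta>
  for B :: "real ^ 'n::finite ^ 'n" and b q and P :: "'a measure" and \<beta> \<alpha> p J Z W c \<sigma> lam \<delta> +
  fixes kind :: "(real \<Rightarrow> real \<Rightarrow> real) option"
  assumes lam_eq: "lam = q + \<delta>"
    and kind_measurable: "\<And>w. kind = Some w \<Longrightarrow> (\<lambda>(x, y). w x y) \<in> borel_measurable borel"
begin

text \<open>The discounted expectation of \<open>g\<close> at the position just before the first
  claim, when no ruin has occurred by then. The factor \<open>exp (- q * t) t ^ m / fact m\<close>
  of the density gives the power \<open>Suc m\<close> of the resolvent at rate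
  \<open>lam = q + \<delta>\<close>.\<close>

definition green :: "real ^ 'n \<Rightarrow> (real \<Rightarrow> ennreal) \<Rightarrow> real \<Rightarrow> ennreal" where
  "green \<gamma> g v = (\<Sum>m. ennreal (weight \<gamma> b m) * (resolvent ^^ Suc m) g v)"

text \<open>The extended nonnegative counterpart of \<open>claim_ruin_rate\<close>.\<close>

definition ruin_rate :: "(real \<Rightarrow> real \<Rightarrow> real) \<Rightarrow> real \<Rightarrow> ennreal" where
  "ruin_rate w x = (\<integral>\<^sup>+z. ennreal (p z) * (if x < z then ennreal (w x (z - x)) else 0) \<partial>lborel)"

text \<open>The contribution of ruin no later than the first claim. For ruin by diffusion the
  weights belong to the vector of ones, since the clock only has to outlast the hitting time; its
  powers start at zero because the hitting time itself already supplies one transform.\<close>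

definition base :: "real ^ 'n \<Rightarrow> real \<Rightarrow> ennreal" where
  "base \<gamma> v = (case kind of
     Some w \<Rightarrow> green \<gamma> (ruin_rate w) v
   | None \<Rightarrow> (\<Sum>m. ennreal (weight \<gamma> 1 m) * (resolvent ^^ m) (\<lambda>v. ennreal (exp (- rho * v))) v))"

primrec stage_mean :: "real ^ 'n \<Rightarrow> nat \<Rightarrow> real \<Rightarrow> ennreal" where
  "stage_mean \<gamma> 0 = base \<gamma>"
| "stage_mean \<gamma> (Suc n) = green \<gamma> (claim_conv p (stage_mean \<alpha> n))"

lemma claim_conv_measurable [measurable]:
  assumes [measurable]: "g \<in> borel_measurable borel" shows "claim_conv p g \<in> borel_measurable borel"
  unfolding claim_conv_def by measurable

lemma green_measurable [measurable]:
  assumes [measurable]: "g \<in> borel_measurable borel" shows "green \<gamma> g \<in> borel_measurable borel"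
  unfolding green_def by measurable

lemma ruin_rate_measurable [measurable]:
  assumes "kind = Some w" shows "ruin_rate w \<in> borel_measurable borel"
proof -
  have "(\<lambda>x. (fst x, snd x - fst x)) \<in> borel_measurable (borel \<Otimes>\<^sub>M lborel)" by measurable
  from measurable_compose[OF this kind_measurable[OF assms]]
  have [measurable]: "(\<lambda>x. w (fst x) (snd x - fst x)) \<in> borel_measurable (borel \<Otimes>\<^sub>M lborel)" by simp
  show ?thesis unfolding ruin_rate_def by measurable
qed

lemma base_measurable [measurable]: "base \<gamma> \<in> borel_measurable borel"
  unfolding base_def[abs_def] by (cases kind) (auto intro!: green_measurable ruin_rate_measurable borel_measurable_suminf_order)

lemma stage_mean_measurable [measurable]: "stage_mean \<gamma> n \<in> borel_measurable borel"
  by (induction n arbitrary: \<gamma>) auto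

lemma base_diffusion:
  assumes "kind = None"
  shows "base \<gamma> v = (\<Sum>m. ennreal (weight \<gamma> 1 m) * (resolvent ^^ m) (\<lambda>v. ennreal (exp (- rho * v))) v)"
  unfolding base_def using assms by simp

lemma base_claim:
  assumes "kind = Some w"
  shows "base \<gamma> v = green \<gamma> (ruin_rate w) v"
  unfolding base_def using assms by simp

lemma init_nonneg: "0 \<le> init k $ i"
  using beta alpha by (simp add: init_def)

text \<open>The density is expanded into its nonnegative series, the discount merges with the
  uniformization rate into \<open>lam\<close>, and each term is a weighted killed
  occupation.\<close>

lemma phase_occupation:
  assumes W': "brownian P W'" and v: "v > 0" and g [measurable]: "g \<in> borel_measurable borel" and \<gamma>: "\<And>i. 0 \<le> \<gamma> $ i"
  shows "(\<integral>\<^sup>+\<omega>. \<integral>\<^sup>+t. (if 0 \<le> t \<and> alive (drifted c \<sigma> v (\<lambda>r. W' r \<omega>)) t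
     then ennreal (phase_series \<gamma> b t) * ennreal (exp (- \<delta> * t)) * g (drifted c \<sigma> v (\<lambda>r. W' r \<omega>) t) else 0) \<partial>lborel \<partial>P) = green \<gamma> g v"
proof -
  interpret BW: brownian P W' by (rule W')
  have [measurable]: "(\<lambda>\<omega>. killed_occ m g v (\<lambda>r. W' r \<omega>)) \<in> borel_measurable P" for m
    by (rule killed_occ_measurable[OF BW.cont_W]) auto
  have "(\<integral>\<^sup>+t. (if 0 \<le> t \<and> alive (drifted c \<sigma> v (\<lambda>r. W' r \<omega>)) t
     then ennreal (phase_series \<gamma> b t) * ennreal (exp (- \<delta> * t)) * g (drifted c \<sigma> v (\<lambda>r. W' r \<omega>) t) else 0) \<partial>lborel)
     = (\<Sum>m. ennreal (weight \<gamma> b m) * killed_occ m g v (\<lambda>r. W' r \<omega>))" if w: "\<omega> \<in> space P" for \<omega>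
  proof -
    let ?X = "drifted c \<sigma> v (\<lambda>r. W' r \<omega>)"
    have c: "continuous_on {0..} ?X" by (rule continuous_on_drifted[OF BW.W_cont[OF w]])
    note [measurable] = alive_time_measurable[OF c] cont_time_measurable[OF c]
    let ?k = "\<lambda>m t. if 0 \<le> t \<and> alive ?X t then ennreal (exp (- lam * t) * t ^ m / fact m) * g (?X (max 0 t)) else 0"
    have "(\<integral>\<^sup>+t. (if 0 \<le> t \<and> alive ?X t then ennreal (phase_series \<gamma> b t) * ennreal (exp (- \<delta> * t)) * g (?X t) else 0) \<partial>lborel)
      = (\<integral>\<^sup>+t. (\<Sum>m. ennreal (weight \<gamma> b m) * ?k m t) \<partial>lborel)"
    proof (rule nn_integral_cong)
      fix t
      show "(if 0 \<le> t \<and> alive ?X t then ennreal (phase_series \<gamma> b t) * ennreal (exp (- \<delta> * t)) * g (?X t) else 0) = (\<Sum>m. ennreal (weight \<gamma> b m) * ?k m t)"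
      proof (cases "0 \<le> t \<and> alive ?X t")
        case True
        have e: "ennreal (exp (- q * t) * t ^ m / fact m) * ennreal (weight \<gamma> b m) * (ennreal (exp (- \<delta> * t)) * g (?X t))
          = ennreal (weight \<gamma> b m) * (ennreal (exp (- lam * t) * t ^ m / fact m) * g (?X t))" for m
        proof -
          have "exp (- lam * t) * t ^ m / fact m = exp (- q * t) * t ^ m / fact m * exp (- \<delta> * t)"
            by (simp add: lam_eq exp_add[symmetric] algebra_simps)
          then have "ennreal (exp (- lam * t) * t ^ m / fact m) = ennreal (exp (- q * t) * t ^ m / fact m) * ennreal (exp (- \<delta> * t))"
            using True by (simp only:) (intro ennreal_mult, auto)
          then show ?thesis by (simp only: mult_ac)
        qed
        have "ennreal (phase_series \<gamma> b t) * ennreal (exp (- \<delta> * t)) * g (?X t)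
           = (\<Sum>m. ennreal (exp (- q * t) * t ^ m / fact m) * ennreal (weight \<gamma> b m)) * (ennreal (exp (- \<delta> * t)) * g (?X t))"
          using True \<gamma> b_nonneg by (subst phase_series_ennreal) (auto simp: mult.assoc)
        also have "\<dots> = (\<Sum>m. ennreal (exp (- q * t) * t ^ m / fact m) * ennreal (weight \<gamma> b m) * (ennreal (exp (- \<delta> * t)) * g (?X t)))"
          by (rule ennreal_suminf_multc[symmetric])
        finally show ?thesis unfolding e using True by (simp add: max_def)
      next
        case False
        then have "?k m t = 0" for m by auto
        then show ?thesis unfolding if_not_P[OF False] by simp
      qed
    qed
    also have "\<dots> = (\<Sum>m. \<integral>\<^sup>+t. ennreal (weight \<gamma> b m) * ?k m t \<partial>lborel)"
      by (rule nn_integral_suminf) measurable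
    also have "\<dots> = (\<Sum>m. ennreal (weight \<gamma> b m) * (\<integral>\<^sup>+t. ?k m t \<partial>lborel))"
      by (intro suminf_cong nn_integral_cmult) measurable
    also have "(\<lambda>m. \<integral>\<^sup>+t. ?k m t \<partial>lborel) = (\<lambda>m. killed_occ m g v (\<lambda>r. W' r \<omega>))"
      unfolding killed_occ_def by (intro ext nn_integral_cong) (simp add: max_def)
    finally show ?thesis by (simp only:)
  qed
  then have "(\<integral>\<^sup>+\<omega>. \<integral>\<^sup>+t. (if 0 \<le> t \<and> alive (drifted c \<sigma> v (\<lambda>r. W' r \<omega>)) t
     then ennreal (phase_series \<gamma> b t) * ennreal (exp (- \<delta> * t)) * g (drifted c \<sigma> v (\<lambda>r. W' r \<omega>) t) else 0) \<partial>lborel \<partial>P)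
     = (\<integral>\<^sup>+\<omega>. (\<Sum>m. ennreal (weight \<gamma> b m) * killed_occ m g v (\<lambda>r. W' r \<omega>)) \<partial>P)"
    by (intro nn_integral_cong)
  also have "\<dots> = (\<Sum>m. \<integral>\<^sup>+\<omega>. ennreal (weight \<gamma> b m) * killed_occ m g v (\<lambda>r. W' r \<omega>) \<partial>P)"
    by (rule nn_integral_suminf) measurable
  also have "\<dots> = (\<Sum>m. ennreal (weight \<gamma> b m) * (\<integral>\<^sup>+\<omega>. killed_occ m g v (\<lambda>r. W' r \<omega>) \<partial>P))"
    by (intro suminf_cong nn_integral_cmult) measurable
  also have "\<dots> = green \<gamma> g v"
    unfolding green_def killed_resolvent_power[OF W' v g] ..
  finally show ?thesis .
qed

text \<open>Only clocks and claims are averaged; the Brownian path is a parameter. The offset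
  \<open>k\<close> records which clock comes next, as the first one has its own initial
  distribution.\<close>

definition stage_given :: "nat \<Rightarrow> nat \<Rightarrow> (real \<Rightarrow> real) \<Rightarrow> real \<Rightarrow> ennreal" where
  "stage_given k n y v = (\<integral>\<^sup>+\<omega>. stage (pay kind) n (\<lambda>j. clock (k + j) \<omega>) (\<lambda>j. Z (k + j) \<omega>) y v \<partial>P)"

definition after_claim_given :: "nat \<Rightarrow> nat \<Rightarrow> real \<Rightarrow> (real \<Rightarrow> real) \<Rightarrow> ennreal" where
  "after_claim_given k n x y = (\<integral>\<^sup>+z. ennreal (p z) * (if z < x then stage_given k n y (x - z) else 0) \<partial>lborel)"

lemma stage_given_measurable:
  assumes Y: "cont_process F Y" and v: "v \<in> borel_measurable F"
  shows "(\<lambda>\<omega>. stage_given k n (\<lambda>t. Y t \<omega>) (v \<omega>)) \<in> borel_measurable F"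
proof -
  have "(\<lambda>z. stage (pay kind) n (\<lambda>j. clock (k + j) (snd z)) (\<lambda>j. Z (k + j) (snd z)) (\<lambda>t. Y t (fst z)) (v (fst z))) \<in> borel_measurable (F \<Otimes>\<^sub>M P)"
    by (rule stage_measurable[OF cont_process_compose[OF Y measurable_fst] measurable_compose[OF measurable_fst v] _ _ kind_measurable]) measurable
  then show ?thesis unfolding stage_given_def by (intro borel_measurable_nn_integral) (simp add: split_beta)
qed

lemma after_claim_given_measurable:
  assumes Y: "cont_process F Y" and v [measurable]: "v \<in> borel_measurable F"
  shows "(\<lambda>\<omega>. after_claim_given k n (v \<omega>) (\<lambda>t. Y t \<omega>)) \<in> borel_measurable F"
proof -
  have [measurable]: "(\<lambda>z. stage_given k n (\<lambda>t. Y t (fst z)) (v (fst z) - snd z)) \<in> borel_measurable (F \<Otimes>\<^sub>M lborel)"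
    by (rule stage_given_measurable[OF cont_process_compose[OF Y measurable_fst]]) measurable
  show ?thesis unfolding after_claim_given_def
    by (rule lborel.borel_measurable_nn_integral) (simp add: split_beta)
qed

text \<open>The pathwise decomposition compares with the ruin time by a weak inequality, the
  resolvent calculus by a strict one; they differ at a single time.\<close>

lemma ruin_time_AE:
  assumes c: "continuous_on {0..} (drifted c \<sigma> v y)"
  shows "AE t in lborel. 0 \<le> t \<longrightarrow> (ennreal t \<le> ruin y v \<longleftrightarrow> alive (drifted c \<sigma> v y) t)"
proof -
  have "AE t in lborel. t \<noteq> enn2real (ruin y v)" by (rule AE_lborel_singleton)
  then show ?thesis
  proof eventually_elim
    case (elim t)
    show ?case
    proof
      assume t: "0 \<le> t"
      have "ennreal t \<noteq> ruin y v" using elim t by (metis enn2real_ennreal)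
      then show "ennreal t \<le> ruin y v \<longleftrightarrow> alive (drifted c \<sigma> v y) t"
        using alive_iff_ruin_time[OF c t] by (simp add: order.order_iff_strict)
    qed
  qed
qed

text \<open>The common computation for ruin at the first claim and for survival of it:
  \<open>Q\<close> is the condition on the claim size, \<open>H\<close> the reward, and
  \<open>K\<close> the reward averaged over the claim.\<close>

lemma first_claim:
  assumes y: "continuous_on {0..} y"
    and h: "\<And>t z. 0 \<le> t \<Longrightarrow> h t z = (if ennreal t \<le> ruin y v \<and> Q t z then ennreal (exp (- \<delta> * t)) * H t z else 0)"
    and h_meas: "case_prod h \<in> borel_measurable (borel \<Otimes>\<^sub>M borel)"
    and HK: "\<And>t. 0 \<le> t \<Longrightarrow> (\<integral>\<^sup>+z. ennreal (p z) * (if Q t z then H t z else 0) \<partial>lborel) = K t"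
    and HQ [measurable]: "\<And>t. 0 \<le> t \<Longrightarrow> (\<lambda>z. if Q t z then H t z else 0) \<in> borel_measurable borel"
  shows "(\<integral>\<^sup>+\<omega>. (if clock k \<omega> < \<infinity> then h (enn2real (clock k \<omega>)) (Z k \<omega>) else 0) \<partial>P)
    = (\<integral>\<^sup>+t. (if 0 \<le> t \<and> alive (drifted c \<sigma> v y) t then ennreal (phase_series (init k) b t) * ennreal (exp (- \<delta> * t)) * K t else 0) \<partial>lborel)"
  unfolding clock_claim_law[OF h_meas]
proof (rule nn_integral_cong_AE)
  show "AE t in lborel. (if 0 \<le> t then ennreal (phase_series (init k) b t) * (\<integral>\<^sup>+z. ennreal (p z) * h t z \<partial>lborel) else 0)
     = (if 0 \<le> t \<and> alive (drifted c \<sigma> v y) t then ennreal (phase_series (init k) b t) * ennreal (exp (- \<delta> * t)) * K t else 0)"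
    using ruin_time_AE[OF continuous_on_drifted[OF y], of v]
  proof eventually_elim
    case (elim t)
    show ?case
    proof (cases "0 \<le> t")
      case True
      have "(\<integral>\<^sup>+z. ennreal (p z) * h t z \<partial>lborel)
        = (\<integral>\<^sup>+z. (if ennreal t \<le> ruin y v then ennreal (exp (- \<delta> * t)) else 0) * (ennreal (p z) * (if Q t z then H t z else 0)) \<partial>lborel)"
        by (intro nn_integral_cong) (simp add: h[OF True] mult_ac)
      also have "\<dots> = (if ennreal t \<le> ruin y v then ennreal (exp (- \<delta> * t)) else 0) * K t"
      proof -
        have "(\<lambda>z. ennreal (p z) * (if Q t z then H t z else 0)) \<in> borel_measurable borel"
          by (intro borel_measurable_times_ennreal HQ[OF True]) measurable
        then have "(\<lambda>z. ennreal (p z) * (if Q t z then H t z else 0)) \<in> borel_measurable lborel" by simp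
        from nn_integral_cmult[OF this] show ?thesis unfolding HK[OF True, symmetric] .
      qed
      finally show ?thesis using elim True by (simp add: mult.assoc)
    qed simp
  qed
qed

lemma stage_given_Suc:
  assumes y: "continuous_on {0..} y"
  shows "stage_given k (Suc n) y v = (\<integral>\<^sup>+t. (if 0 \<le> t \<and> alive (drifted c \<sigma> v y) t
    then ennreal (phase_series (init k) b t) * ennreal (exp (- \<delta> * t)) * after_claim_given (Suc k) n (drifted c \<sigma> v y t) (path_shift t y) else 0) \<partial>lborel)"
proof -
  \<comment> \<open>Given the Brownian path, the first clock and claim decide survival and the
    restart point, while the remaining stages depend on later sources only.\<close>
  let ?now = "info {Clock k, Claim k}" and ?later = "info {s. \<exists>j>k. s = Clock j \<or> s = Claim j}"
  have cpy: "cont_process F (\<lambda>t _. y t)" for F :: "'x measure" using y by (simp add: cont_process_def)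
  have [measurable]: "clock k \<in> borel_measurable ?now" "Z k \<in> borel_measurable ?now"
    by (auto intro!: clock_measurable claim_measurable)
  have late [measurable]: "clock (Suc k + j) \<in> borel_measurable ?later" "Z (Suc k + j) \<in> borel_measurable ?later" for j
    by (auto intro!: clock_measurable claim_measurable simp del: add_Suc)
  let ?H = "\<lambda>\<omega> \<omega>'. if survives (clock k \<omega>) (Z k \<omega>) y v then ennreal (exp (- \<delta> * enn2real (clock k \<omega>))) *
      stage (pay kind) n (\<lambda>j. clock (Suc k + j) \<omega>') (\<lambda>j. Z (Suc k + j) \<omega>') (path_shift (enn2real (clock k \<omega>)) y)
        (drifted c \<sigma> v y (enn2real (clock k \<omega>)) - Z k \<omega>) else 0"
  let ?h = "\<lambda>t z. if ennreal t \<le> ruin y v \<and> z < drifted c \<sigma> v y (max 0 t)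
      then ennreal (exp (- \<delta> * t)) * stage_given (Suc k) n (path_shift (max 0 t) y) (drifted c \<sigma> v y (max 0 t) - z) else 0"
  have dm: "(\<lambda>\<omega>. drifted c \<sigma> v y (enn2real (C \<omega>))) \<in> borel_measurable F" if "C \<in> borel_measurable F" for C and F :: "'x measure"
    by (rule drifted_at_measurable[OF cpy _ that]) simp
  have [measurable]: "Measurable.pred (?now \<Otimes>\<^sub>M ?later) (\<lambda>x. survives (clock k (fst x)) (Z k (fst x)) y v)"
    by (rule survives_measurable[OF cpy]) measurable
  have [measurable]: "(\<lambda>x. stage (pay kind) n (\<lambda>j. clock (Suc k + j) (snd x)) (\<lambda>j. Z (Suc k + j) (snd x)) (path_shift (enn2real (clock k (fst x))) y)
        (drifted c \<sigma> v y (enn2real (clock k (fst x))) - Z k (fst x))) \<in> borel_measurable (?now \<Otimes>\<^sub>M ?later)"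
  proof (rule stage_measurable[OF cont_process_shift[OF cpy] _ _ _ kind_measurable])
    show "(\<lambda>x. drifted c \<sigma> v y (enn2real (clock k (fst x))) - Z k (fst x)) \<in> borel_measurable (?now \<Otimes>\<^sub>M ?later)"
      by (intro borel_measurable_diff dm) measurable
    show "(\<lambda>x. enn2real (clock k (fst x))) \<in> borel_measurable (?now \<Otimes>\<^sub>M ?later)" by measurable
    show "(\<lambda>x. clock (Suc k + j) (snd x)) \<in> borel_measurable (?now \<Otimes>\<^sub>M ?later)" for j
      by (rule measurable_compose[OF measurable_snd late(1)])
    show "(\<lambda>x. Z (Suc k + j) (snd x)) \<in> borel_measurable (?now \<Otimes>\<^sub>M ?later)" for j
      by (rule measurable_compose[OF measurable_snd late(2)])
  qed simp_all
  have "stage_given k (Suc n) y v = (\<integral>\<^sup>+\<omega>. ?H \<omega> \<omega> \<partial>P)"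
    unfolding stage_given_def by (intro nn_integral_cong) simp
  also have "\<dots> = (\<integral>\<^sup>+\<omega>. \<integral>\<^sup>+\<omega>'. ?H \<omega> \<omega>' \<partial>P \<partial>P)"
  proof (rule nn_integral_freeze[OF _ _ sets_info_sub sets_info_sub indep_info])
    show "{Clock k, Claim k} \<inter> {s. \<exists>j>k. s = Clock j \<or> s = Claim j} = {}" by auto
    show "case_prod ?H \<in> borel_measurable (?now \<Otimes>\<^sub>M ?later)" unfolding split_beta by measurable
  qed simp_all
  also have "\<dots> = (\<integral>\<^sup>+\<omega>. (if clock k \<omega> < \<infinity> then ?h (enn2real (clock k \<omega>)) (Z k \<omega>) else 0) \<partial>P)"
  proof (rule nn_integral_cong)
    fix \<omega>
    have [measurable]: "(\<lambda>\<omega>'. stage (pay kind) n (\<lambda>j. clock (Suc k + j) \<omega>') (\<lambda>j. Z (Suc k + j) \<omega>') y' v') \<in> borel_measurable P"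
      if "continuous_on {0..} y'" for y' v'
      by (rule stage_measurable[where Y="\<lambda>t _. y' t", OF _ _ _ _ kind_measurable]) (use that in \<open>auto simp: cont_process_def\<close>)
    have "continuous_on {0..} (path_shift (enn2real (clock k \<omega>)) y)"
      using cont_process_shift[OF cpy, of "\<lambda>_. enn2real (clock k \<omega>)" P] not_empty by (auto simp: cont_process_def)
    note this[THEN \<open>\<And>y' v'. continuous_on {0..} y' \<Longrightarrow> (\<lambda>\<omega>'. stage (pay kind) n (\<lambda>j. clock (Suc k + j) \<omega>') (\<lambda>j. Z (Suc k + j) \<omega>') y' v') \<in> borel_measurable P\<close>, measurable]
    have "(\<integral>\<^sup>+\<omega>'. ?H \<omega> \<omega>' \<partial>P) = (if survives (clock k \<omega>) (Z k \<omega>) y v then ennreal (exp (- \<delta> * enn2real (clock k \<omega>))) *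
       stage_given (Suc k) n (path_shift (enn2real (clock k \<omega>)) y) (drifted c \<sigma> v y (enn2real (clock k \<omega>)) - Z k \<omega>) else 0)"
    proof (cases "survives (clock k \<omega>) (Z k \<omega>) y v")
      case True
      show ?thesis unfolding if_P[OF True] stage_given_def by (rule nn_integral_cmult) measurable
    qed simp
    then show "(\<integral>\<^sup>+\<omega>'. ?H \<omega> \<omega>' \<partial>P) = (if clock k \<omega> < \<infinity> then ?h (enn2real (clock k \<omega>)) (Z k \<omega>) else 0)"
      by (auto simp: survives_def max_def)
  qed
  also have "\<dots> = (\<integral>\<^sup>+t. (if 0 \<le> t \<and> alive (drifted c \<sigma> v y) t
    then ennreal (phase_series (init k) b t) * ennreal (exp (- \<delta> * t)) * after_claim_given (Suc k) n (drifted c \<sigma> v y t) (path_shift t y) else 0) \<partial>lborel)"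
  proof (rule first_claim[OF y, where Q="\<lambda>t z. z < drifted c \<sigma> v y t" and H="\<lambda>t z. stage_given (Suc k) n (path_shift t y) (drifted c \<sigma> v y t - z)"])
    have [measurable]: "(\<lambda>x. drifted c \<sigma> v y (max 0 (fst x))) \<in> borel_measurable (borel \<Otimes>\<^sub>M borel)"
      by (rule measurable_compose[OF measurable_fst cont_time_measurable[OF continuous_on_drifted[OF y]]])
    have [measurable]: "(\<lambda>x. stage_given (Suc k) n (path_shift (max 0 (fst x)) y) (drifted c \<sigma> v y (max 0 (fst x)) - snd x)) \<in> borel_measurable (borel \<Otimes>\<^sub>M borel)"
      by (rule stage_given_measurable[OF cont_process_shift[OF cpy]]) auto
    show "case_prod ?h \<in> borel_measurable (borel \<Otimes>\<^sub>M borel)" unfolding split_beta by measurable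
    fix t :: real assume t: "0 \<le> t"
    show "?h t z = (if ennreal t \<le> ruin y v \<and> z < drifted c \<sigma> v y t then ennreal (exp (- \<delta> * t)) * stage_given (Suc k) n (path_shift t y) (drifted c \<sigma> v y t - z) else 0)" for z
      using t by (simp add: max_def)
    show "(\<integral>\<^sup>+z. ennreal (p z) * (if z < drifted c \<sigma> v y t then stage_given (Suc k) n (path_shift t y) (drifted c \<sigma> v y t - z) else 0) \<partial>lborel)
       = after_claim_given (Suc k) n (drifted c \<sigma> v y t) (path_shift t y)" by (simp add: after_claim_given_def)
    have "continuous_on {0..} (path_shift t y)"
      using cont_process_shift[OF cpy, of "\<lambda>_. t" P] not_empty t by (auto simp: cont_process_def)
    then have [measurable]: "(\<lambda>z. stage_given (Suc k) n (path_shift t y) (drifted c \<sigma> v y t - z)) \<in> borel_measurable borel"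
      by (intro stage_given_measurable[where Y="\<lambda>r _. path_shift t y r"]) (auto simp: cont_process_def)
    show "(\<lambda>z. if z < drifted c \<sigma> v y t then stage_given (Suc k) n (path_shift t y) (drifted c \<sigma> v y t - z) else 0) \<in> borel_measurable borel"
      by measurable
  qed
  finally show ?thesis .
qed

lemma stage_given_0_claim:
  assumes y: "continuous_on {0..} y" and w: "kind = Some w"
  shows "stage_given k 0 y v = (\<integral>\<^sup>+t. (if 0 \<le> t \<and> alive (drifted c \<sigma> v y) t
    then ennreal (phase_series (init k) b t) * ennreal (exp (- \<delta> * t)) * ruin_rate w (drifted c \<sigma> v y t) else 0) \<partial>lborel)"
proof -
  have wm [measurable (raw)]: "(\<lambda>x. w (f x) (g x)) \<in> borel_measurable F"
    if [measurable]: "f \<in> borel_measurable F" "g \<in> borel_measurable F" for f g and F :: "'x measure"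
  proof -
    have "(\<lambda>x. (f x, g x)) \<in> borel_measurable F" by measurable
    from measurable_compose[OF this kind_measurable[OF w]] show ?thesis by simp
  qed
  let ?h = "\<lambda>t z. if ennreal t \<le> ruin y v \<and> drifted c \<sigma> v y (max 0 t) < z
     then ennreal (exp (- \<delta> * t)) * ennreal (w (drifted c \<sigma> v y (max 0 t)) (z - drifted c \<sigma> v y (max 0 t))) else 0"
  have "stage_given k 0 y v = (\<integral>\<^sup>+\<omega>. (if clock k \<omega> < \<infinity> then ?h (enn2real (clock k \<omega>)) (Z k \<omega>) else 0) \<partial>P)"
    unfolding stage_given_def by (intro nn_integral_cong) (auto simp: pay_def w claim_payoff_def max_def)
  also have "\<dots> = (\<integral>\<^sup>+t. (if 0 \<le> t \<and> alive (drifted c \<sigma> v y) t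
    then ennreal (phase_series (init k) b t) * ennreal (exp (- \<delta> * t)) * ruin_rate w (drifted c \<sigma> v y t) else 0) \<partial>lborel)"
  proof (rule first_claim[OF y, where Q="\<lambda>t z. drifted c \<sigma> v y t < z" and H="\<lambda>t z. ennreal (w (drifted c \<sigma> v y t) (z - drifted c \<sigma> v y t))"])
    have [measurable]: "(\<lambda>x. drifted c \<sigma> v y (max 0 (fst x))) \<in> borel_measurable (borel \<Otimes>\<^sub>M borel)"
      by (rule measurable_compose[OF measurable_fst cont_time_measurable[OF continuous_on_drifted[OF y]]])
    show "case_prod ?h \<in> borel_measurable (borel \<Otimes>\<^sub>M borel)" unfolding split_beta by measurable
  qed (auto simp: max_def ruin_rate_def)
  finally show ?thesis .
qed

text \<open>Given the path, ruin by diffusion before the first claim means that the independent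
  clock outlasts the deterministic hitting time; the survival function is then expanded into its
  series.\<close>

lemma stage_given_0_diffusion:
  assumes y: "continuous_on {0..} y" and k: "kind = None"
  shows "stage_given k 0 y v = (\<Sum>m. ennreal (weight (init k) 1 m) * hit_moment m v y)"
proof -
  interpret C: phase_clock B b q P "J k" "init k" by (rule phase_clock)
  let ?D = "if ruin y v < \<infinity> then ennreal (exp (- \<delta> * enn2real (ruin y v))) else 0"
  let ?h = "\<lambda>t z. if drifted c \<sigma> v y (max 0 t) = z \<and> ennreal t \<le> ruin y v then ennreal (exp (- \<delta> * t)) else 0"
  have [measurable]: "(\<lambda>x. drifted c \<sigma> v y (max 0 (fst x))) \<in> borel_measurable (borel \<Otimes>\<^sub>M borel)"
    by (rule measurable_compose[OF measurable_fst cont_time_measurable[OF continuous_on_drifted[OF y]]])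
  have hm: "case_prod ?h \<in> borel_measurable (borel \<Otimes>\<^sub>M borel)" unfolding split_beta by measurable
  have h2: "(\<lambda>x. ?h (f x) (g x)) \<in> borel_measurable P" if "f \<in> borel_measurable P" "g \<in> borel_measurable P" for f g
    using measurable_compose[OF measurable_Pair[OF that] hm] by simp
  have [measurable]: "(\<lambda>\<omega>. ?h (enn2real (clock k \<omega>)) (Z k \<omega>)) \<in> borel_measurable P"
    by (rule h2) measurable
  have "stage_given k 0 y v = (\<integral>\<^sup>+\<omega>. ?D * indicator {\<omega> \<in> space P. ruin y v < clock k \<omega>} \<omega>
      + (if clock k \<omega> < \<infinity> then ?h (enn2real (clock k \<omega>)) (Z k \<omega>) else 0) \<partial>P)"
    unfolding stage_given_def
  proof (rule nn_integral_cong)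
    fix \<omega> assume w: "\<omega> \<in> space P"
    show "stage (pay kind) 0 (\<lambda>j. clock (k + j) \<omega>) (\<lambda>j. Z (k + j) \<omega>) y v = ?D * indicator {\<omega> \<in> space P. ruin y v < clock k \<omega>} \<omega>
      + (if clock k \<omega> < \<infinity> then ?h (enn2real (clock k \<omega>)) (Z k \<omega>) else 0)"
    proof (cases "ruin y v < clock k \<omega>")
      case True
      then have "ruin y v < \<infinity>" by (rule less_le_trans) simp
      moreover have "?h (enn2real (clock k \<omega>)) (Z k \<omega>) = 0" if "clock k \<omega> < \<infinity>" using True that by auto
      ultimately show ?thesis using True w by (simp add: pay_def k diffusion_payoff_def)
    next
      case False
      then show ?thesis using w by (auto simp: pay_def k diffusion_payoff_def max_def)
    qed
  qed
  also have "\<dots> = (\<integral>\<^sup>+\<omega>. ?D * indicator {\<omega> \<in> space P. ruin y v < clock k \<omega>} \<omega> \<partial>P)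
      + (\<integral>\<^sup>+\<omega>. (if clock k \<omega> < \<infinity> then ?h (enn2real (clock k \<omega>)) (Z k \<omega>) else 0) \<partial>P)"
    by (rule nn_integral_add) measurable
  \<comment> \<open>A claim that takes the surplus exactly to zero must equal one prescribed value,
    which has probability zero because the claim size has a density.\<close>
  also have "(\<integral>\<^sup>+\<omega>. (if clock k \<omega> < \<infinity> then ?h (enn2real (clock k \<omega>)) (Z k \<omega>) else 0) \<partial>P) = 0"
  proof -
    have "(\<integral>\<^sup>+z. ennreal (p z) * ?h t z \<partial>lborel) = 0" for t
    proof -
      have "AE z in lborel. z \<noteq> drifted c \<sigma> v y (max 0 t)" by (rule AE_lborel_singleton)
      then have "AE z in lborel. ennreal (p z) * ?h t z = 0" by eventually_elim auto
      then show ?thesis by (subst nn_integral_cong_AE[where v="\<lambda>_. 0"]) auto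
    qed
    then have "(\<lambda>t. if 0 \<le> t then ennreal (phase_series (init k) b t) * (\<integral>\<^sup>+z. ennreal (p z) * ?h t z \<partial>lborel) else 0) = (\<lambda>_. 0)"
      by (simp only: mult_zero_right if_cancel)
    then show ?thesis unfolding clock_claim_law[OF hm] by (simp only: nn_integral_const mult_zero_left)
  qed
  also have "(\<integral>\<^sup>+\<omega>. ?D * indicator {\<omega> \<in> space P. ruin y v < clock k \<omega>} \<omega> \<partial>P) = ?D * emeasure P {\<omega> \<in> space P. ruin y v < clock k \<omega>}"
    by (rule nn_integral_cmult_indicator) measurable
  also have "\<dots> = (\<Sum>m. ennreal (weight (init k) 1 m) * hit_moment m v y)"
  proof (cases "ruin y v" rule: ennreal_cases)
    case (real T)
    have e: "ennreal (exp (- \<delta> * T)) * (ennreal (exp (- q * T) * T ^ m / fact m) * ennreal (weight (init k) 1 m))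
       = ennreal (weight (init k) 1 m) * hit_moment m v y" for m
    proof -
      have "exp (- lam * T) * T ^ m / fact m = exp (- \<delta> * T) * (exp (- q * T) * T ^ m / fact m)"
        by (simp add: lam_eq exp_add[symmetric] algebra_simps)
      then have "ennreal (exp (- lam * T) * T ^ m / fact m) = ennreal (exp (- \<delta> * T)) * ennreal (exp (- q * T) * T ^ m / fact m)"
        using real by (simp only:) (intro ennreal_mult, auto)
      then show ?thesis using real by (simp add: hit_moment_def Let_def mult_ac)
    qed
    have "?D * emeasure P {\<omega> \<in> space P. ruin y v < clock k \<omega>} = ennreal (exp (- \<delta> * T)) * ennreal (phase_series (init k) 1 T)"
      using real C.survival[OF real(1)] by simp
    also have "\<dots> = ennreal (exp (- \<delta> * T)) * (\<Sum>m. ennreal (exp (- q * T) * T ^ m / fact m) * ennreal (weight (init k) 1 m))"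
      using real init_nonneg by (subst phase_series_ennreal) auto
    also have "\<dots> = (\<Sum>m. ennreal (weight (init k) 1 m) * hit_moment m v y)"
      unfolding ennreal_suminf_cmult[symmetric] e ..
    finally show ?thesis by simp
  next
    case top
    then show ?thesis by (simp add: hit_moment_def Let_def)
  qed
  finally show ?thesis by simp
qed

text \<open>After the first claim the next clock and the shifted Brownian motion take over, so the
  induction must cover every offset, motion and starting point. \<open>markov_time\<close> with the
  discounted density as weight replaces the path functional after the claim by its mean.\<close>

lemma expected_stage:
  assumes "brownian P W'" and "v > 0"
  shows "(\<integral>\<^sup>+\<omega>. stage_given k n (\<lambda>t. W' t \<omega>) v \<partial>P) = stage_mean (init k) n v"
  using assms
proof (induction n arbitrary: k W' v)
  case 0
  interpret BW: brownian P W' by (rule 0(1))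
  show ?case
  proof (cases kind)
    case None
    have [measurable]: "(\<lambda>\<omega>. hit_moment m v (\<lambda>t. W' t \<omega>)) \<in> borel_measurable P" for m
      by (rule hit_moment_measurable[OF BW.cont_W]) simp
    have "(\<integral>\<^sup>+\<omega>. stage_given k 0 (\<lambda>t. W' t \<omega>) v \<partial>P) = (\<integral>\<^sup>+\<omega>. (\<Sum>m. ennreal (weight (init k) 1 m) * hit_moment m v (\<lambda>t. W' t \<omega>)) \<partial>P)"
      by (intro nn_integral_cong stage_given_0_diffusion BW.W_cont None)
    also have "\<dots> = (\<Sum>m. \<integral>\<^sup>+\<omega>. ennreal (weight (init k) 1 m) * hit_moment m v (\<lambda>t. W' t \<omega>) \<partial>P)"
      by (rule nn_integral_suminf) measurable
    also have "\<dots> = (\<Sum>m. ennreal (weight (init k) 1 m) * (\<integral>\<^sup>+\<omega>. hit_moment m v (\<lambda>t. W' t \<omega>) \<partial>P))"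
      by (intro suminf_cong nn_integral_cmult) measurable
    finally show ?thesis unfolding hit_moment_power[OF 0] stage_mean.simps base_diffusion[OF None] .
  next
    case (Some w)
    have "(\<integral>\<^sup>+\<omega>. stage_given k 0 (\<lambda>t. W' t \<omega>) v \<partial>P) = (\<integral>\<^sup>+\<omega>. \<integral>\<^sup>+t. (if 0 \<le> t \<and> alive (drifted c \<sigma> v (\<lambda>t. W' t \<omega>)) t
      then ennreal (phase_series (init k) b t) * ennreal (exp (- \<delta> * t)) * ruin_rate w (drifted c \<sigma> v (\<lambda>t. W' t \<omega>) t) else 0) \<partial>lborel \<partial>P)"
      by (intro nn_integral_cong stage_given_0_claim BW.W_cont Some)
    also have "\<dots> = green (init k) (ruin_rate w) v"
      by (rule phase_occupation[OF 0 ruin_rate_measurable[OF Some] init_nonneg])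
    finally show ?thesis unfolding stage_mean.simps base_claim[OF Some] .
  qed
next
  case (Suc n)
  interpret BW: brownian P W' by (rule Suc.prems(1))
  have "(\<integral>\<^sup>+\<omega>. stage_given k (Suc n) (\<lambda>t. W' t \<omega>) v \<partial>P) = (\<integral>\<^sup>+\<omega>. \<integral>\<^sup>+t. (if 0 \<le> t \<and> alive (drifted c \<sigma> v (\<lambda>t. W' t \<omega>)) t
      then ennreal (phase_series (init k) b t) * ennreal (exp (- \<delta> * t)) * after_claim_given (Suc k) n (drifted c \<sigma> v (\<lambda>t. W' t \<omega>) t) (path_shift t (\<lambda>t. W' t \<omega>)) else 0) \<partial>lborel \<partial>P)"
    by (intro nn_integral_cong stage_given_Suc BW.W_cont)
  also have "\<dots> = (\<integral>\<^sup>+\<omega>. \<integral>\<^sup>+t. (if 0 \<le> t \<and> alive (drifted c \<sigma> v (\<lambda>t. W' t \<omega>)) t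
      then ennreal (phase_series (init k) b t) * ennreal (exp (- \<delta> * t)) * claim_conv p (stage_mean \<alpha> n) (drifted c \<sigma> v (\<lambda>t. W' t \<omega>) t) else 0) \<partial>lborel \<partial>P)"
  \<comment> \<open>The weight depends on time only, so the Markov property can be applied at each
    possible first claim time.\<close>
  proof (rule markov_time[OF Suc.prems(1), where u="\<lambda>t. ennreal (phase_series (init k) b t) * ennreal (exp (- \<delta> * t))"])
    show "(\<integral>\<^sup>+\<omega>. after_claim_given (Suc k) n x (path_shift a (\<lambda>t. W' t \<omega>)) \<partial>P) = claim_conv p (stage_mean \<alpha> n) x"
      if a: "a \<ge> 0" and x: "x > 0" for a x
    proof -
      interpret PL: pair_sigma_finite P lborel by standard
      have SW: "brownian P (\<lambda>t \<omega>. path_shift a (\<lambda>t. W' t \<omega>) t)" by (rule BW.brownian_shift[OF a])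
      interpret S: brownian P "\<lambda>t \<omega>. path_shift a (\<lambda>t. W' t \<omega>) t" by (rule SW)
      have [measurable]: "(\<lambda>z. stage_given (Suc k) n (path_shift a (\<lambda>t. W' t (fst z))) (x - snd z)) \<in> borel_measurable (P \<Otimes>\<^sub>M lborel)"
        using stage_given_measurable[OF cont_process_compose[OF S.cont_W measurable_fst], of "\<lambda>z. x - snd z"] by simp
      have [measurable]: "(\<lambda>\<omega>. stage_given (Suc k) n (path_shift a (\<lambda>t. W' t \<omega>)) (x - z)) \<in> borel_measurable P" for z
        using stage_given_measurable[OF S.cont_W, of "\<lambda>_. x - z"] by simp
      have "(\<integral>\<^sup>+\<omega>. after_claim_given (Suc k) n x (path_shift a (\<lambda>t. W' t \<omega>)) \<partial>P)
         = (\<integral>\<^sup>+z. \<integral>\<^sup>+\<omega>. ennreal (p z) * (if z < x then stage_given (Suc k) n (path_shift a (\<lambda>t. W' t \<omega>)) (x - z) else 0) \<partial>P \<partial>lborel)"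
        unfolding after_claim_given_def by (rule PL.Fubini'[symmetric]) (simp add: split_beta)
      also have "\<dots> = claim_conv p (stage_mean \<alpha> n) x"
        unfolding claim_conv_def
      proof (rule nn_integral_cong)
        fix z
        show "(\<integral>\<^sup>+\<omega>. ennreal (p z) * (if z < x then stage_given (Suc k) n (path_shift a (\<lambda>t. W' t \<omega>)) (x - z) else 0) \<partial>P)
           = ennreal (p z) * (if z < x then stage_mean \<alpha> n (x - z) else 0)"
        proof (cases "z < x")
          case True
          have "(\<integral>\<^sup>+\<omega>. stage_given (Suc k) n (path_shift a (\<lambda>t. W' t \<omega>)) (x - z) \<partial>P) = stage_mean (init (Suc k)) n (x - z)"
            using Suc.IH[OF SW, of "x - z" "Suc k"] True by simp
          then show ?thesis using True by (simp add: nn_integral_cmult init_def)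
        qed simp
      qed
      finally show ?thesis .
    qed
    show "(\<lambda>z. after_claim_given (Suc k) n (drifted c \<sigma> v (\<lambda>r. W' r (fst z)) (max 0 (snd z))) (path_shift (max 0 (snd z)) (\<lambda>r. W' r (fst z)))) \<in> borel_measurable (P \<Otimes>\<^sub>M lborel)"
      by (rule shifted_path_measurable[OF Suc.prems(1)]) (rule after_claim_given_measurable)
    show "(\<lambda>z. after_claim_given (Suc k) n (fst z) (path_shift a (\<lambda>r. W' r (snd z)))) \<in> borel_measurable (borel \<Otimes>\<^sub>M brownian.future P W' a)" if "a \<ge> 0" for a
      by (rule future_path_measurable[OF Suc.prems(1) that]) (rule after_claim_given_measurable)
  qed measurable
  also have "\<dots> = green (init k) (claim_conv p (stage_mean \<alpha> n)) v"
    by (rule phase_occupation[OF Suc.prems _ init_nonneg]) measurable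
  finally show ?case by simp
qed

end

section \<open>Summing over the claims\<close>

context risk_model
begin

lemma clock_positive: "AE \<omega> in P. 0 < clock k \<omega>"
proof -
  interpret C: phase_clock B b q P "J k" "init k" by (rule phase_clock)
  have "emeasure P {\<omega> \<in> space P. 0 < clock k \<omega>} = ennreal (init k \<bullet> 1)"
    using C.survival[of 0] by (simp add: phase_series_0)
  also have "init k \<bullet> 1 = 1" using alpha beta by (simp add: inner_vec_def init_def)
  finally have "prob {\<omega> \<in> space P. 0 < clock k \<omega>} = 1" by (simp add: emeasure_eq_measure)
  then show ?thesis by (subst (asm) prob_Collect_eq_1) auto
qed

text \<open>The claim epochs tend to infinity because the mean of \<open>exp (- V)\<close> over an interclaim time \<open>V\<close> is less than one.\<close>

definition damp :: "ennreal \<Rightarrow> ennreal" where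
  "damp x = (if x < \<infinity> then ennreal (exp (- enn2real x)) else 0)"

lemma damp_measurable [measurable]: "damp \<in> borel_measurable borel"
  unfolding damp_def[abs_def] by measurable

lemma damp_le_1: "damp x \<le> 1" and damp_less_1: "0 < x \<Longrightarrow> damp x < 1"
  by (cases x rule: ennreal_cases; simp add: damp_def ennreal_less_iff)+

lemma damp_sum:
  fixes m :: nat
  assumes "(\<Sum>k<m. vs k) \<le> ennreal t" and t: "0 \<le> t"
  shows "ennreal (exp (- t)) \<le> (\<Prod>k<m. damp (vs k))"
proof -
  have fin: "vs k < \<infinity>" if "k < m" for k
  proof -
    have "vs k \<le> (\<Sum>k<m. vs k)" by (rule member_le_sum) (use that in auto)
    also have "\<dots> \<le> ennreal t" by (rule assms(1))
    also have "\<dots> < \<infinity>" by simp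
    finally show ?thesis .
  qed
  have "(\<Sum>k<m. vs k) = (\<Sum>k<m. ennreal (enn2real (vs k)))" using fin by (intro sum.cong) auto
  also have "\<dots> = ennreal (\<Sum>k<m. enn2real (vs k))" by (rule sum_ennreal) simp
  finally have "(\<Sum>k<m. enn2real (vs k)) \<le> t" using assms by (simp add: ennreal_le_iff)
  then have "ennreal (exp (- t)) \<le> ennreal (exp (\<Sum>k<m. - enn2real (vs k)))" by (intro ennreal_leI) (simp add: sum_negf)
  also have "\<dots> = (\<Prod>k<m. ennreal (exp (- enn2real (vs k))))" by (simp add: exp_sum prod_ennreal)
  also have "\<dots> = (\<Prod>k<m. damp (vs k))" using fin by (intro prod.cong) (auto simp: damp_def)
  finally show ?thesis .
qed

text \<open>The initial distribution here is that of all clocks but the first. The first one is left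
  out below, so that the products have identically distributed factors.\<close>

definition damp_mean :: ennreal where
  "damp_mean = (\<integral>\<^sup>+t. (if 0 \<le> t then ennreal (phase_series \<alpha> b t) * ennreal (exp (- t)) else 0) \<partial>lborel)"

lemma damp_mean_eq: "(\<integral>\<^sup>+\<omega>. damp (clock (Suc k) \<omega>) \<partial>P) = damp_mean"
proof -
  interpret C: phase_clock B b q P "J (Suc k)" "init (Suc k)" by (rule phase_clock)
  have "init (Suc k) = \<alpha>" by (simp add: init_def)
  show ?thesis using C.absorption_law[of "\<lambda>t. ennreal (exp (- t))"]
    unfolding damp_def damp_mean_def \<open>init (Suc k) = \<alpha>\<close> by simp
qed

lemma damp_mean_less_1: "damp_mean < 1"
proof -
  have "(\<integral>\<^sup>+\<omega>. damp (clock 1 \<omega>) \<partial>P) < (\<integral>\<^sup>+\<omega>. 1 \<partial>P)"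
  proof (rule nn_integral_less)
    have "(\<integral>\<^sup>+\<omega>. damp (clock 1 \<omega>) \<partial>P) \<le> (\<integral>\<^sup>+\<omega>. 1 \<partial>P)" by (intro nn_integral_mono damp_le_1)
    then show "(\<integral>\<^sup>+\<omega>. damp (clock 1 \<omega>) \<partial>P) \<noteq> \<infinity>" by (auto simp: emeasure_space_1 top_unique)
    show "\<not> (AE \<omega> in P. 1 \<le> damp (clock 1 \<omega>))"
    proof
      assume "AE \<omega> in P. 1 \<le> damp (clock 1 \<omega>)"
      with clock_positive[of 1] have "AE \<omega> in P. False"
        by eventually_elim (use damp_less_1 in \<open>auto simp: not_le[symmetric]\<close>)
      then show False by simp
    qed
  qed (auto intro: damp_le_1)
  then show ?thesis using damp_mean_eq[of 0] by (simp add: emeasure_space_1)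
qed

lemma damp_prod_mean: "(\<integral>\<^sup>+\<omega>. (\<Prod>k<m. damp (clock (Suc k) \<omega>)) \<partial>P) = damp_mean ^ m"
proof (induction m)
  case 0
  show ?case by (simp add: emeasure_space_1)
next
  case (Suc m)
  let ?A = "Clock ` Suc ` {..<m}" and ?C = "{Clock (Suc m)}"
  have [measurable]: "clock (Suc m) \<in> borel_measurable (info ?C)" by (rule clock_measurable) simp
  have [measurable]: "(\<lambda>\<omega>. \<Prod>k<m. damp (clock (Suc k) \<omega>)) \<in> borel_measurable (info ?A)"
  proof (rule borel_measurable_prod_ennreal)
    fix k assume "k \<in> {..<m}"
    then have "clock (Suc k) \<in> borel_measurable (info ?A)" by (intro clock_measurable) auto
    then show "(\<lambda>\<omega>. damp (clock (Suc k) \<omega>)) \<in> borel_measurable (info ?A)" by measurable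
  qed
  have "(\<integral>\<^sup>+\<omega>. (\<Prod>k<m. damp (clock (Suc k) \<omega>)) * damp (clock (Suc m) \<omega>) \<partial>P)
     = (\<integral>\<^sup>+\<omega>. \<integral>\<^sup>+\<omega>'. (\<Prod>k<m. damp (clock (Suc k) \<omega>)) * damp (clock (Suc m) \<omega>') \<partial>P \<partial>P)"
  proof (rule nn_integral_freeze[OF _ _ sets_info_sub sets_info_sub indep_info])
    show "?A \<inter> ?C = {}" by auto
    show "(\<lambda>(\<omega>, \<omega>'). (\<Prod>k<m. damp (clock (Suc k) \<omega>)) * damp (clock (Suc m) \<omega>')) \<in> borel_measurable (info ?A \<Otimes>\<^sub>M info ?C)"
      unfolding split_beta by measurable
  qed simp_all
  also have "\<dots> = (\<integral>\<^sup>+\<omega>. (\<Prod>k<m. damp (clock (Suc k) \<omega>)) * damp_mean \<partial>P)"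
    by (simp add: nn_integral_cmult damp_mean_eq)
  also have "\<dots> = (\<integral>\<^sup>+\<omega>. (\<Prod>k<m. damp (clock (Suc k) \<omega>)) \<partial>P) * damp_mean"
    by (rule nn_integral_multc) measurable
  finally show ?case using Suc.IH by (simp add: mult.commute)
qed

text \<open>An exponential Markov bound: if all epochs stay below \<open>N\<close>, each product of
  damping factors is at least \<open>exp (- N)\<close>, whereas its mean is a power of a number
  below one.\<close>

lemma clocks_diverge: "AE \<omega> in P. \<exists>m. ennreal (real N) < (\<Sum>k<m. clock k \<omega>)"
proof -
  let ?A = "{\<omega> \<in> space P. \<forall>m. (\<Sum>k<m. clock k \<omega>) \<le> ennreal (real N)}"
  have A [measurable]: "?A \<in> sets P" by measurable
  have bound: "ennreal (exp (- real N)) * emeasure P ?A \<le> damp_mean ^ m" for m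
  proof -
    have "ennreal (exp (- real N)) * emeasure P ?A = (\<integral>\<^sup>+\<omega>. ennreal (exp (- real N)) * indicator ?A \<omega> \<partial>P)"
      by (rule nn_integral_cmult_indicator[symmetric]) (rule A)
    also have "\<dots> \<le> (\<integral>\<^sup>+\<omega>. (\<Prod>k<m. damp (clock (Suc k) \<omega>)) \<partial>P)"
    proof (rule nn_integral_mono)
      fix \<omega> assume "\<omega> \<in> space P"
      show "ennreal (exp (- real N)) * indicator ?A \<omega> \<le> (\<Prod>k<m. damp (clock (Suc k) \<omega>))"
      proof (cases "\<omega> \<in> ?A")
        case True
        have "(\<Sum>k<m. clock (Suc k) \<omega>) \<le> (\<Sum>k<Suc m. clock k \<omega>)"
          unfolding sum.lessThan_Suc_shift[of _ m] by simp
        also have "\<dots> \<le> ennreal (real N)" using True by blast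
        finally show ?thesis using damp_sum[of "\<lambda>k. clock (Suc k) \<omega>" m "real N"] True by simp
      qed simp
    qed
    finally show ?thesis unfolding damp_prod_mean .
  qed
  obtain r where r: "damp_mean = ennreal r" "0 \<le> r" "r < 1"
  proof (cases damp_mean rule: ennreal_cases)
    case (real r)
    then show ?thesis using damp_mean_less_1 that[of r] by (simp add: ennreal_less_iff flip: ennreal_1)
  qed (use damp_mean_less_1 in simp)
  have "(\<lambda>m. damp_mean ^ m) \<longlonglongrightarrow> 0"
    unfolding r(1) ennreal_power[OF r(2)] using LIMSEQ_realpow_zero[OF r(2,3)] by (simp flip: ennreal_0)
  then have "ennreal (exp (- real N)) * emeasure P ?A \<le> 0"
    by (rule LIMSEQ_le_const) (use bound in auto)
  then have "emeasure P ?A = 0" by simp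
  then have "AE \<omega> in P. \<omega> \<notin> ?A" using A by (subst AE_iff_measurable[of ?A]) auto
  with AE_space show ?thesis by eventually_elim (auto simp: not_le)
qed

lemma clocks_regular: "AE \<omega> in P. regular (\<lambda>k. clock k \<omega>)"
proof -
  have "AE \<omega> in P. \<forall>k. 0 < clock k \<omega>" unfolding AE_all_countable by (intro allI clock_positive)
  moreover have "AE \<omega> in P. \<forall>N::nat. \<exists>m. ennreal (real N) < (\<Sum>k<m. clock k \<omega>)"
    unfolding AE_all_countable by (intro allI clocks_diverge)
  ultimately show ?thesis
  proof eventually_elim
    case (elim \<omega>)
    have "\<exists>m. ennreal t < (\<Sum>k<m. clock k \<omega>)" for t
    proof -
      obtain N :: nat where "t \<le> real N" using real_arch_simple by blast
      with elim(2) show ?thesis by (meson ennreal_leI le_less_trans)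
    qed
    with elim(1) show ?case by (simp add: regular_def)
  qed
qed

text \<open>With zero capital the surplus is zero at time zero, which already counts as ruin, and
  almost surely no claim arrives then. Both boundary values follow.\<close>

lemma starts_ruined:
  "AE \<omega> in P. surplus c \<sigma> J Z W 0 \<omega> 0 = 0 \<and> ruin_time (surplus c \<sigma> J Z W 0 \<omega>) = 0"
  using clock_positive[of 0] AE_space
proof eventually_elim
  case (elim \<omega>)
  interpret BW: brownian P W by (rule brownian_W)
  have "claim_count (\<lambda>k. clock k \<omega>) 0 = 0" by (rule count_eqI) (use elim in simp_all)
  then have z: "surplus c \<sigma> J Z W 0 \<omega> 0 = 0"
    using BW.W_0[OF elim(2)] by (simp add: surplus_claim_path claim_path_def)
  moreover have "ruin_time (surplus c \<sigma> J Z W 0 \<omega>) \<le> ennreal 0"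
    unfolding ruin_time_def by (rule INF_lower) (use z in simp)
  ultimately show ?case by simp
qed

end

context gerber_shiu
begin

text \<open>Almost every path is admissible, so the pathwise series applies and may be integrated
  term by term. In each term the claims are averaged first, by independence of the diffusion, and
  then the diffusion.\<close>

theorem expected_penalty:
  assumes step: "stepwise (pay kind) pen" and Zpos: "\<And>k. AE \<omega> in P. 0 < Z k \<omega>" and v: "v > 0"
  shows "(\<integral>\<^sup>+\<omega>. ennreal (pen (surplus c \<sigma> J Z W v \<omega>)) \<partial>P) = (\<Sum>n. stage_mean \<beta> n v)"
proof -
  interpret BW: brownian P W by (rule brownian_W)
  let ?A = "info {Diffusion}" and ?C = "info (- {Diffusion})"
  have [measurable]: "clock k \<in> borel_measurable ?C" "Z k \<in> borel_measurable ?C" for k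
    by (auto intro: clock_measurable claim_measurable)
  have "AE \<omega> in P. \<forall>k. 0 < Z k \<omega>" unfolding AE_all_countable by (intro allI Zpos)
  with clocks_regular AE_space
  have "AE \<omega> in P. ennreal (pen (surplus c \<sigma> J Z W v \<omega>))
      = (\<Sum>n. stage (pay kind) n (\<lambda>k. clock k \<omega>) (\<lambda>k. Z k \<omega>) (\<lambda>t. W t \<omega>) v)"
    unfolding surplus_claim_path
  proof eventually_elim
    case (elim \<omega>)
    then show ?case
      by (intro stage_series[OF step]) (simp add: admissible_def v BW.W_cont BW.W_0)
  qed
  then have "(\<integral>\<^sup>+\<omega>. ennreal (pen (surplus c \<sigma> J Z W v \<omega>)) \<partial>P)
      = (\<integral>\<^sup>+\<omega>. (\<Sum>n. stage (pay kind) n (\<lambda>k. clock k \<omega>) (\<lambda>k. Z k \<omega>) (\<lambda>t. W t \<omega>) v) \<partial>P)"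
    by (rule nn_integral_cong_AE)
  also have "\<dots> = (\<Sum>n. \<integral>\<^sup>+\<omega>. stage (pay kind) n (\<lambda>k. clock k \<omega>) (\<lambda>k. Z k \<omega>) (\<lambda>t. W t \<omega>) v \<partial>P)"
    by (rule nn_integral_suminf) (rule stage_measurable[OF BW.cont_W _ _ _ kind_measurable]; measurable)
  also have "\<dots> = (\<Sum>n. stage_mean \<beta> n v)"
  proof (rule suminf_cong)
    fix n
    have "(\<integral>\<^sup>+\<omega>. stage (pay kind) n (\<lambda>k. clock k \<omega>) (\<lambda>k. Z k \<omega>) (\<lambda>t. W t \<omega>) v \<partial>P)
        = (\<integral>\<^sup>+\<omega>. \<integral>\<^sup>+\<omega>'. stage (pay kind) n (\<lambda>k. clock k \<omega>') (\<lambda>k. Z k \<omega>') (\<lambda>t. W t \<omega>) v \<partial>P \<partial>P)"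
    proof (rule nn_integral_freeze[OF _ _ sets_info_sub sets_info_sub indep_info])
      show "{Diffusion} \<inter> - {Diffusion} = {}" by simp
      have "(\<lambda>z. stage (pay kind) n (\<lambda>k. clock k (snd z)) (\<lambda>k. Z k (snd z)) (\<lambda>t. W t (fst z)) v) \<in> borel_measurable (?A \<Otimes>\<^sub>M ?C)"
        by (rule stage_measurable[OF cont_process_compose[OF diffusion_cont measurable_fst] _ _ _ kind_measurable]) auto
      then show "(\<lambda>(\<omega>, \<omega>'). stage (pay kind) n (\<lambda>k. clock k \<omega>') (\<lambda>k. Z k \<omega>') (\<lambda>t. W t \<omega>) v) \<in> borel_measurable (?A \<Otimes>\<^sub>M ?C)"
        by (simp add: split_beta)
    qed simp_all
    also have "\<dots> = (\<integral>\<^sup>+\<omega>. stage_given 0 n (\<lambda>t. W t \<omega>) v \<partial>P)"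
      by (simp add: stage_given_def)
    also have "\<dots> = stage_mean \<beta> n v"
      using expected_stage[OF brownian_W v, of 0 n] by (simp add: init_def)
    finally show "(\<integral>\<^sup>+\<omega>. stage (pay kind) n (\<lambda>k. clock k \<omega>) (\<lambda>k. Z k \<omega>) (\<lambda>t. W t \<omega>) v \<partial>P) = stage_mean \<beta> n v" .
  qed
  finally show ?thesis .
qed

end

section \<open>From the renewal equation to the differential equation\<close>

locale renewal = phase_type B b q + drift_diffusion c \<sigma> lam
  for B :: "real ^ 'n::finite ^ 'n" and b q c \<sigma> lam +
  fixes \<alpha> :: "real ^ 'n" and p :: "real \<Rightarrow> real"
  assumes \<alpha>_nonneg: "0 \<le> \<alpha> $ i"
    and density: "0 \<le> p x" "p \<in> borel_measurable borel" "integrable lborel p" "AE z in lborel. z \<le> 0 \<longrightarrow> p z = 0"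
begin

lemma density_measurable [measurable]: "p \<in> borel_measurable borel" by (rule density(2))

lemma density_pos: "AE z in lborel. p z \<noteq> 0 \<longrightarrow> 0 < z"
  using density(4) by eventually_elim (auto simp: not_le[symmetric])

text \<open>The entries of \<open>B + q I\<close>, nonnegative by the choice of
  \<open>q\<close>.\<close>

definition rate :: "'n \<Rightarrow> 'n \<Rightarrow> real" where "rate i j = B $ i $ j + (if i = j then q else 0)"

lemma rate_nonneg: "0 \<le> rate i j"
  using B_off[of i j] q_ge[of i] by (auto simp: rate_def)

definition source_term :: "('n \<Rightarrow> real \<Rightarrow> ennreal) \<Rightarrow> (real \<Rightarrow> ennreal) \<Rightarrow> 'n \<Rightarrow> real \<Rightarrow> ennreal" where
  "source_term \<Phi> G i x = (\<Sum>j\<in>UNIV. ennreal (rate i j) * \<Phi> j x)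
     + ennreal (b $ i) * (claim_conv p (\<lambda>y. \<Sum>j\<in>UNIV. ennreal (\<alpha> $ j) * \<Phi> j y) x + G x)"

text \<open>The renewal equation in integrated form. Since the resolvent vanishes at zero,
  \<open>a\<close> is the limit there: 1 for ruin by diffusion and 0 for ruin by a claim.\<close>

definition solves :: "real \<Rightarrow> ('n \<Rightarrow> real \<Rightarrow> ennreal) \<Rightarrow> (real \<Rightarrow> ennreal) \<Rightarrow> bool" where
  "solves a \<Phi> G \<longleftrightarrow> (\<forall>i. \<Phi> i \<in> borel_measurable borel) \<and> G \<in> borel_measurable borel \<and>
     (\<forall>i v. 0 < v \<longrightarrow> \<Phi> i v < \<infinity>) \<and> (\<forall>v. 0 < v \<longrightarrow> G v < \<infinity>) \<and>
     (\<forall>i v. 0 < v \<longrightarrow> \<Phi> i v = ennreal (a * exp (- rho * v)) + resolvent (source_term \<Phi> G i) v)"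

lemma source_term_measurable [measurable]:
  assumes [measurable]: "\<And>i. \<Phi> i \<in> borel_measurable borel" "G \<in> borel_measurable borel"
  shows "source_term \<Phi> G i \<in> borel_measurable borel"
  unfolding source_term_def claim_conv_def by measurable

text \<open>Boundedness is required all the way down to zero, not only on compact parts of the half
  line, because the convolution evaluates the function arbitrarily close to zero.\<close>

definition tame :: "(real \<Rightarrow> real) \<Rightarrow> bool" where
  "tame g \<longleftrightarrow> g \<in> borel_measurable borel \<and> (\<forall>y>0. isCont g y) \<and> (\<forall>x>0. \<exists>K. \<forall>y. 0 < y \<longrightarrow> y \<le> x \<longrightarrow> \<bar>g y\<bar> \<le> K)"

definition real_conv :: "(real \<Rightarrow> real) \<Rightarrow> real \<Rightarrow> real" where
  "real_conv g x = (\<integral>z. p z * (if z < x then g (x - z) else 0) \<partial>lborel)"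

lemma tame_bound:
  assumes "tame g" "x > 0"
  obtains K where "0 \<le> K" "AE z in lborel. \<bar>p z * (if z < x then g (x - z) else 0)\<bar> \<le> K * p z"
proof -
  obtain K where K: "\<And>y. 0 < y \<Longrightarrow> y \<le> x \<Longrightarrow> \<bar>g y\<bar> \<le> K"
    using assms unfolding tame_def by blast
  have K0: "0 \<le> K" using K[of x] assms by auto
  show ?thesis
  proof (rule that[OF K0])
    show "AE z in lborel. \<bar>p z * (if z < x then g (x - z) else 0)\<bar> \<le> K * p z"
      using density_pos
    proof eventually_elim
      case (elim z)
      show ?case
      proof (cases "p z = 0")
        case False
        then have "p z * \<bar>if z < x then g (x - z) else 0\<bar> \<le> p z * K"
          using K[of "x - z"] elim K0 density(1) by (intro mult_left_mono) auto
        then show ?thesis unfolding abs_mult using density(1)[of z] by (simp only: abs_of_nonneg mult.commute)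
      qed simp
    qed
  qed
qed

lemma real_conv_integrable:
  assumes "tame g" "x > 0"
  shows "integrable lborel (\<lambda>z. p z * (if z < x then g (x - z) else 0))"
proof -
  obtain K where K: "AE z in lborel. \<bar>p z * (if z < x then g (x - z) else 0)\<bar> \<le> K * p z"
    using tame_bound[OF assms] by blast
  have [measurable]: "g \<in> borel_measurable borel" using assms by (simp add: tame_def)
  show ?thesis
  proof (rule Bochner_Integration.integrable_bound)
    show "integrable lborel (\<lambda>z. K * p z)" using density(3) by simp
    show "AE z in lborel. norm (p z * (if z < x then g (x - z) else 0)) \<le> norm (K * p z)"
      using K by eventually_elim auto
  qed measurable
qed

lemma real_conv_isCont:
  assumes g: "tame g" and u: "u > 0"
  shows "isCont (real_conv g) u"
proof -
  have [measurable]: "g \<in> borel_measurable borel" using g by (simp add: tame_def)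
  obtain K where K: "\<And>y. 0 < y \<Longrightarrow> y \<le> u + 1 \<Longrightarrow> \<bar>g y\<bar> \<le> K"
    using g u unfolding tame_def by (metis add_pos_pos zero_less_one)
  have K0: "0 \<le> K" using K[of u] u by auto
  \<comment> \<open>Staying below \<open>u + 1\<close> makes one bound for \<open>g\<close> valid
    along the whole sequence; \<open>u\<close> is interior, so the restriction does not change the
    limit.\<close>
  have "(real_conv g \<longlongrightarrow> real_conv g u) (at u within {..<u + 1})"
    unfolding tendsto_at_iff_sequentially comp_def real_conv_def
  proof (intro allI impI)
    fix X :: "nat \<Rightarrow> real" assume X: "\<forall>i. X i \<in> {..<u + 1} - {u}" and lim: "X \<longlonglongrightarrow> u"
    show "(\<lambda>n. \<integral>z. p z * (if z < X n then g (X n - z) else 0) \<partial>lborel) \<longlonglongrightarrow> (\<integral>z. p z * (if z < u then g (u - z) else 0) \<partial>lborel)"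
    proof (rule integral_dominated_convergence[where w="\<lambda>z. K * p z"])
      show "integrable lborel (\<lambda>z. K * p z)" using density(3) by simp
      show "AE z in lborel. norm (p z * (if z < X n then g (X n - z) else 0)) \<le> K * p z" for n
        using density_pos
      proof eventually_elim
        case (elim z)
        show ?case
        proof (cases "p z = 0")
          case False
          have "X n < u + 1" using X by auto
          then have "p z * \<bar>if z < X n then g (X n - z) else 0\<bar> \<le> p z * K"
            using K[of "X n - z"] elim False K0 density(1) by (intro mult_left_mono) auto
          then show ?thesis unfolding real_norm_def abs_mult using density(1)[of z] by (simp only: abs_of_nonneg mult.commute)
        qed simp
      qed
      \<comment> \<open>At \<open>z = u\<close> the truncated function may jump; this single claim
        size carries no mass.\<close>
      have "AE z in lborel. z \<noteq> u" by (rule AE_lborel_singleton)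
      then show "AE z in lborel. (\<lambda>n. p z * (if z < X n then g (X n - z) else 0)) \<longlonglongrightarrow> p z * (if z < u then g (u - z) else 0)"
      proof eventually_elim
        case (elim z)
        show ?case
        proof (cases "z < u")
          case True
          have "isCont g (u - z)" using g True by (simp add: tame_def)
          then have "(\<lambda>n. g (X n - z)) \<longlonglongrightarrow> g (u - z)"
            by (rule isCont_tendsto_compose) (intro tendsto_intros lim)
          moreover have "\<forall>\<^sub>F n in sequentially. z < X n" by (rule order_tendstoD(1)[OF lim True])
          ultimately have "(\<lambda>n. if z < X n then g (X n - z) else 0) \<longlonglongrightarrow> g (u - z)"
            by (elim Lim_transform_eventually eventually_mono) simp
          then show ?thesis using True by (simp add: tendsto_mult_left)
        next
          case False
          with elim have "u < z" by simp
          then have "\<forall>\<^sub>F n in sequentially. X n < z" by (rule order_tendstoD(2)[OF lim])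
          then have "\<forall>\<^sub>F n in sequentially. p z * (if z < X n then g (X n - z) else 0) = 0"
            by eventually_elim simp
          then show ?thesis using False by (simp add: tendsto_eventually)
        qed
      qed
    qed measurable
  qed
  moreover have "at u within {..<u + 1} = at u" by (rule at_within_open) auto
  ultimately show ?thesis by (simp add: isCont_def)
qed

lemma tame_diff: "tame f \<Longrightarrow> tame g \<Longrightarrow> tame (\<lambda>x. f x - g x)"
proof -
  assume f: "tame f" and g: "tame g"
  have "\<exists>K. \<forall>y. 0 < y \<longrightarrow> y \<le> x \<longrightarrow> \<bar>f y - g y\<bar> \<le> K" if x: "x > 0" for x
  proof -
    obtain K L where "\<forall>y. 0 < y \<longrightarrow> y \<le> x \<longrightarrow> \<bar>f y\<bar> \<le> K" "\<forall>y. 0 < y \<longrightarrow> y \<le> x \<longrightarrow> \<bar>g y\<bar> \<le> L"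
      using f g x unfolding tame_def by blast
    then have "\<forall>y. 0 < y \<longrightarrow> y \<le> x \<longrightarrow> \<bar>f y - g y\<bar> \<le> K + L" by (smt (verit))
    then show ?thesis by blast
  qed
  with f g show ?thesis by (auto simp: tame_def intro!: borel_measurable_diff)
qed

lemma tame_combination:
  assumes f: "\<And>j. tame (f j)"
  shows "tame (\<lambda>x. \<Sum>j\<in>(UNIV :: 'n set). a j * f j x)"
proof -
  have [measurable]: "f j \<in> borel_measurable borel" for j using f by (simp add: tame_def)
  have "\<exists>K. \<forall>y. 0 < y \<longrightarrow> y \<le> x \<longrightarrow> \<bar>\<Sum>j\<in>UNIV. a j * f j y\<bar> \<le> K" if x: "x > 0" for x
  proof -
    have "\<forall>j. \<exists>K. \<forall>y. 0 < y \<longrightarrow> y \<le> x \<longrightarrow> \<bar>f j y\<bar> \<le> K" using f x unfolding tame_def by blast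
    then obtain K where K: "\<And>j y. 0 < y \<Longrightarrow> y \<le> x \<Longrightarrow> \<bar>f j y\<bar> \<le> K j" by metis
    have "\<bar>\<Sum>j\<in>UNIV. a j * f j y\<bar> \<le> (\<Sum>j\<in>UNIV. \<bar>a j\<bar> * K j)" if "0 < y" "y \<le> x" for y
      by (rule order.trans[OF sum_abs sum_mono]) (use K[OF that] in \<open>auto simp: abs_mult intro: mult_left_mono\<close>)
    then show ?thesis by blast
  qed
  moreover have "isCont (\<lambda>x. \<Sum>j\<in>UNIV. a j * f j x) y" if "y > 0" for y
    using f that by (intro continuous_intros) (auto simp: tame_def)
  ultimately show ?thesis by (auto simp: tame_def)
qed

text \<open>The equation itself provides the regularity: a resolvent is differentiable wherever it
  is finite and vanishes at zero. Near zero this limit gives a bound, and elsewhere continuity on a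
  compact interval does.\<close>

lemma solves_tame:
  assumes s: "solves a \<Phi> G" and a: "0 \<le> a"
  shows "tame (\<lambda>v. enn2real (\<Phi> i v))"
    and "0 < v \<Longrightarrow> enn2real (\<Phi> i v) = a * exp (- rho * v) + enn2real (resolvent (source_term \<Phi> G i) v)"
    and "0 < v \<Longrightarrow> resolvent (source_term \<Phi> G i) v < \<infinity>"
proof -
  let ?F = "source_term \<Phi> G i"
  have [measurable]: "\<Phi> i \<in> borel_measurable borel" "G \<in> borel_measurable borel" for i using s by (auto simp: solves_def)
  have F: "?F \<in> borel_measurable borel" by measurable
  have eq: "\<Phi> i v = ennreal (a * exp (- rho * v)) + resolvent ?F v" and fin: "\<Phi> i v < \<infinity>" if "v > 0" for v
    using s that unfolding solves_def by blast+
  have R: "resolvent ?F v < \<infinity>" if "v > 0" for v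
    using fin[OF that] unfolding eq[OF that] by (simp add: ennreal_add_eq_top less_top)
  show "0 < v \<Longrightarrow> resolvent ?F v < \<infinity>" by (rule R)
  have eq': "enn2real (\<Phi> i v) = a * exp (- rho * v) + enn2real (resolvent ?F v)" if "v > 0" for v
    unfolding eq[OF that] using R[OF that] a by (simp add: enn2real_plus)
  then show "0 < v \<Longrightarrow> enn2real (\<Phi> i v) = a * exp (- rho * v) + enn2real (resolvent ?F v)" .
  let ?g = "\<lambda>v. enn2real (\<Phi> i v)" and ?k = "\<lambda>v. a * exp (- rho * v) + enn2real (resolvent ?F v)"
  have k: "isCont ?k y" if "y > 0" for y
  proof -
    have "isCont (\<lambda>v. enn2real (resolvent ?F v)) y"
      by (rule DERIV_isCont[OF resolvent_has_derivative[OF F R that]])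
    then show ?thesis by (intro continuous_intros)
  qed
  have "(?k \<longlongrightarrow> a * exp (- rho * 0) + 0) (at_right 0)"
    by (intro tendsto_intros resolvent_tendsto_0[OF F R])
  then have "\<forall>\<^sub>F v in at_right 0. ?k v < a + 1" by (rule order_tendstoD(2)) simp
  then obtain e where e: "e > 0" "\<And>v. 0 < v \<Longrightarrow> v < e \<Longrightarrow> ?k v < a + 1"
    unfolding eventually_at_right[OF zero_less_one] by blast
  have c: "isCont ?g y" if "y > 0" for y
  proof -
    have "\<forall>\<^sub>F v in nhds y. 0 < v" by (rule eventually_nhds_in_open[of "{0<..}", simplified]) (use that in auto)
    then have "\<forall>\<^sub>F v in nhds y. ?g v = ?k v" by eventually_elim (rule eq')
    from isCont_cong[OF this] k[OF that] show ?thesis by simp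
  qed
  have "\<exists>K. \<forall>y. 0 < y \<longrightarrow> y \<le> x \<longrightarrow> \<bar>?g y\<bar> \<le> K" if x: "x > 0" for x
  proof -
    have "compact (?g ` {min e x / 2..x})"
      by (intro compact_continuous_image continuous_at_imp_continuous_on) (use c e(1) x in auto)
    then obtain L where L: "\<And>y. y \<in> {min e x / 2..x} \<Longrightarrow> \<bar>?g y\<bar> \<le> L"
      by (metis (no_types, lifting) bounded_iff compact_imp_bounded image_eqI real_norm_def)
    have "\<bar>?g y\<bar> \<le> max L (a + 1)" if "0 < y" "y \<le> x" for y
    proof (cases "y < e")
      case True
      then have "?g y \<le> a + 1" using e(2)[of y] eq'[of y] that by simp
      then show ?thesis by simp
    next
      case False
      then show ?thesis using L[of y] that e(1) x by (auto simp: max.coboundedI1)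
    qed
    then show ?thesis by blast
  qed
  with c show "tame ?g" by (simp add: tame_def)
qed

lemma claim_conv_real:
  assumes g: "tame g" "\<And>y. 0 \<le> g y" and x: "x > 0" and H: "\<And>y. y > 0 \<Longrightarrow> H y = ennreal (g y)"
  shows "claim_conv p H x = ennreal (real_conv g x)" "0 \<le> real_conv g x"
proof -
  have "claim_conv p H x = (\<integral>\<^sup>+z. ennreal (p z * (if z < x then g (x - z) else 0)) \<partial>lborel)"
    unfolding claim_conv_def by (intro nn_integral_cong) (auto simp: ennreal_mult' density(1) H)
  also have "\<dots> = ennreal (real_conv g x)"
    unfolding real_conv_def by (rule nn_integral_eq_integral[OF real_conv_integrable[OF g(1) x]]) (auto simp: density(1) g(2))
  finally show "claim_conv p H x = ennreal (real_conv g x)" .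
  show "0 \<le> real_conv g x" unfolding real_conv_def by (rule integral_nonneg_AE) (auto simp: density(1) g(2))
qed

lemma source_term_real:
  assumes s: "solves a \<Phi> G" and a: "0 \<le> a" and v: "v > 0"
  shows "source_term \<Phi> G i v < \<infinity>"
    and "enn2real (source_term \<Phi> G i v) = (\<Sum>j\<in>UNIV. rate i j * enn2real (\<Phi> j v))
      + b $ i * (real_conv (\<lambda>y. \<Sum>j\<in>UNIV. \<alpha> $ j * enn2real (\<Phi> j y)) v + enn2real (G v))"
proof -
  let ?g = "\<lambda>y. \<Sum>j\<in>UNIV. \<alpha> $ j * enn2real (\<Phi> j y)"
  have fin: "ennreal (enn2real (\<Phi> j y)) = \<Phi> j y" if "y > 0" for j y
  proof -
    have "\<Phi> j y < \<infinity>" using s that unfolding solves_def by blast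
    then show ?thesis by simp
  qed
  have G: "ennreal (enn2real (G v)) = G v" using s v by (simp add: solves_def)
  have comb: "(\<Sum>j\<in>UNIV. ennreal (k j) * \<Phi> j y) = ennreal (\<Sum>j\<in>UNIV. k j * enn2real (\<Phi> j y))"
    if "y > 0" "\<And>j. 0 \<le> k j" for k :: "'n \<Rightarrow> real" and y
  proof -
    have "(\<Sum>j\<in>UNIV. ennreal (k j) * \<Phi> j y) = (\<Sum>j\<in>UNIV. ennreal (k j * enn2real (\<Phi> j y)))"
      using fin[OF that(1)] that(2) by (intro sum.cong) (auto simp: ennreal_mult)
    then show ?thesis using that(2) by (simp add: sum_ennreal)
  qed
  have c: "claim_conv p (\<lambda>y. \<Sum>j\<in>UNIV. ennreal (\<alpha> $ j) * \<Phi> j y) v = ennreal (real_conv ?g v)" "0 \<le> real_conv ?g v"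
    using comb \<alpha>_nonneg v by (intro claim_conv_real tame_combination solves_tame[OF s a] sum_nonneg; auto)+
  have "source_term \<Phi> G i v = ennreal (\<Sum>j\<in>UNIV. rate i j * enn2real (\<Phi> j v)) + ennreal (b $ i) * (ennreal (real_conv ?g v) + ennreal (enn2real (G v)))"
    unfolding source_term_def c G using comb[OF v, of "rate i"] rate_nonneg by simp
  also have "\<dots> = ennreal ((\<Sum>j\<in>UNIV. rate i j * enn2real (\<Phi> j v)) + b $ i * (real_conv ?g v + enn2real (G v)))"
    using c(2) rate_nonneg b_nonneg by (simp add: ennreal_mult sum_nonneg)
  finally have e: "source_term \<Phi> G i v = ennreal ((\<Sum>j\<in>UNIV. rate i j * enn2real (\<Phi> j v)) + b $ i * (real_conv ?g v + enn2real (G v)))" .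
  then show "source_term \<Phi> G i v < \<infinity>" by simp
  have "0 \<le> (\<Sum>j\<in>UNIV. rate i j * enn2real (\<Phi> j v)) + b $ i * (real_conv ?g v + enn2real (G v))"
    using c(2) rate_nonneg b_nonneg by (intro add_nonneg_nonneg mult_nonneg_nonneg sum_nonneg) auto
  then show "enn2real (source_term \<Phi> G i v) = (\<Sum>j\<in>UNIV. rate i j * enn2real (\<Phi> j v))
      + b $ i * (real_conv ?g v + enn2real (G v))" unfolding e by (rule enn2real_ennreal)
qed

lemma real_conv_diff:
  assumes "tame f" "tame g" "x > 0"
  shows "real_conv f x - real_conv g x = real_conv (\<lambda>y. f y - g y) x"
  unfolding real_conv_def
  unfolding Bochner_Integration.integral_diff[OF real_conv_integrable[OF assms(1,3)] real_conv_integrable[OF assms(2,3)], symmetric]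
  by (intro Bochner_Integration.integral_cong) (auto simp: algebra_simps)

text \<open>The resolvent sees only positive arguments. Setting the source to zero elsewhere makes
  it finite everywhere, as \<open>resolvent_ode\<close> demands.\<close>

lemma resolvent_restrict: "resolvent (\<lambda>x. if 0 < x then F x else 0) = resolvent F"
  unfolding resolvent_def by (intro ext nn_integral_cong) (auto split: split_indicator)

text \<open>\<open>exp (- rho * u)\<close> solves the homogeneous equation, so adding the boundary
  term leaves the equation intact.\<close>

lemma boundary_ode:
  assumes f: "\<And>v. v > 0 \<Longrightarrow> (f has_real_derivative f' v) (at v)" and u: "u > 0"
    and f2: "(f' has_real_derivative f2) (at u)" and eq: "\<sigma>\<^sup>2 / 2 * f2 + c * f' u - lam * f u + s = 0"
  shows "\<sigma>\<^sup>2 / 2 * (a * (rho * rho) * exp (- rho * u) + f2) + c * (- (a * rho) * exp (- rho * u) + f' u)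
    - lam * (a * exp (- rho * u) + f u) + s = 0"
proof -
  have e: "\<sigma>\<^sup>2 / 2 * (rho - eta) = c" "\<sigma>\<^sup>2 / 2 * (rho * eta) = lam" using sigma_pos by (simp_all add: rho_eta_diff rho_eta_prod)
  have "\<sigma>\<^sup>2 / 2 * (rho * rho) = (\<sigma>\<^sup>2 / 2 * (rho - eta)) * rho + \<sigma>\<^sup>2 / 2 * (rho * eta)" by (simp only: right_diff_distrib left_diff_distrib ac_simps)
  then have "\<sigma>\<^sup>2 / 2 * (rho * rho) - c * rho - lam = 0" unfolding e by linarith
  then have "(\<sigma>\<^sup>2 / 2 * (rho * rho) - c * rho - lam) * (a * exp (- rho * u)) + (\<sigma>\<^sup>2 / 2 * f2 + c * f' u - lam * f u + s) = 0"
    using eq by simp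
  moreover have "S * (a * (rho * rho) * e + f2) + c * (- (a * rho) * e + f' u) - lam * (a * e + f u) + s
    = (S * (rho * rho) - c * rho - lam) * (a * e) + (S * f2 + c * f' u - lam * f u + s)" for S e
    by (simp add: algebra_simps)
  ultimately show ?thesis by metis
qed

text \<open>The two solutions stand for the positive and the negative part of a penalty. Continuity
  at \<open>u\<close> is asked of the difference \<open>R\<close> alone, since nothing is known
  about the rates of the two parts separately.\<close>

theorem renewal_ode:
  assumes s1: "solves a \<Phi>1 G1" and a: "0 \<le> a" and s2: "solves 0 \<Phi>2 G2"
  defines "h \<equiv> \<lambda>i v. enn2real (\<Phi>1 i v) - enn2real (\<Phi>2 i v)"
    and "R \<equiv> \<lambda>v. enn2real (G1 v) - enn2real (G2 v)"
  obtains h' where "\<And>i v. v > 0 \<Longrightarrow> (h i has_real_derivative h' i v) (at v)"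
    and "\<And>u i. u > 0 \<Longrightarrow> isCont R u \<Longrightarrow> \<exists>h2. (h' i has_real_derivative h2) (at u) \<and>
      \<sigma>\<^sup>2 / 2 * h2 + c * h' i u - lam * h i u + ((\<Sum>j\<in>UNIV. rate i j * h j u)
        + b $ i * (real_conv (\<lambda>y. \<Sum>j\<in>UNIV. \<alpha> $ j * h j y) u + R u)) = 0"
    and "\<And>i. tame (h i)"
proof -
  note t1 = solves_tame[OF s1 a] and t2 = solves_tame[OF s2 order_refl]
  have tame_h: "tame (h i)" for i unfolding h_def by (intro tame_diff t1 t2)
  define F where "F = (\<lambda>\<Phi> G i x. if 0 < x then source_term \<Phi> G i x else 0)"
  define f where "f = (\<lambda>i v. enn2real (F \<Phi>1 G1 i v) - enn2real (F \<Phi>2 G2 i v))"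
  define k where "k = (\<lambda>i v. enn2real (resolvent (F \<Phi>1 G1 i) v) - enn2real (resolvent (F \<Phi>2 G2 i) v))"
  have m: "\<Phi>1 i \<in> borel_measurable borel" "\<Phi>2 i \<in> borel_measurable borel" "G1 \<in> borel_measurable borel" "G2 \<in> borel_measurable borel" for i
    using s1 s2 by (auto simp: solves_def)
  note [measurable] = m
  have "\<exists>k'. (\<forall>v>0. (k i has_real_derivative k' v) (at v)) \<and> (\<forall>u>0. isCont (f i) u \<longrightarrow>
      (\<exists>h2. (k' has_real_derivative h2) (at u) \<and> \<sigma>\<^sup>2 / 2 * h2 + c * k' u - lam * k i u + f i u = 0))" for i
  proof -
    have F1: "F \<Phi>1 G1 i \<in> borel_measurable borel" "F \<Phi>2 G2 i \<in> borel_measurable borel" unfolding F_def by measurable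
    have F2: "F \<Phi>1 G1 i y < \<infinity>" "F \<Phi>2 G2 i y < \<infinity>" for y
      using source_term_real(1)[OF s1 a] source_term_real(1)[OF s2 order_refl] by (auto simp: F_def)
    have F3: "resolvent (F \<Phi>1 G1 i) v < \<infinity>" "resolvent (F \<Phi>2 G2 i) v < \<infinity>" if "v > 0" for v
      using t1(3)[OF that] t2(3)[OF that] unfolding F_def resolvent_restrict by auto
    show ?thesis
    proof (rule resolvent_ode[OF F1 F2 F3], assumption, assumption)
      fix k'
      assume "\<And>v. v > 0 \<Longrightarrow> ((\<lambda>v. enn2real (resolvent (F \<Phi>1 G1 i) v) - enn2real (resolvent (F \<Phi>2 G2 i) v)) has_real_derivative k' v) (at v)"
        and "\<And>u. u > 0 \<Longrightarrow> isCont (\<lambda>v. enn2real (F \<Phi>1 G1 i v) - enn2real (F \<Phi>2 G2 i v)) u \<Longrightarrow> \<exists>h2. (k' has_real_derivative h2) (at u) \<and>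
        \<sigma>\<^sup>2 / 2 * h2 + c * k' u - lam * (enn2real (resolvent (F \<Phi>1 G1 i) u) - enn2real (resolvent (F \<Phi>2 G2 i) u))
          + (enn2real (F \<Phi>1 G1 i u) - enn2real (F \<Phi>2 G2 i u)) = 0"
      then show ?thesis unfolding k_def f_def by (intro exI[of _ k'] conjI allI impI)
    qed
  qed
  then obtain k' where k1: "\<And>i v. v > 0 \<Longrightarrow> (k i has_real_derivative k' i v) (at v)"
    and k2: "\<And>i u. u > 0 \<Longrightarrow> isCont (f i) u \<Longrightarrow>
      \<exists>h2. (k' i has_real_derivative h2) (at u) \<and> \<sigma>\<^sup>2 / 2 * h2 + c * k' i u - lam * k i u + f i u = 0" by metis
  have hk: "h i v = a * exp (- rho * v) + k i v" if "v > 0" for i v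
    using t1(2)[OF that, of i] t2(2)[OF that, of i] unfolding h_def k_def F_def resolvent_restrict by simp
  have tc1: "tame (\<lambda>y. \<Sum>j\<in>UNIV. \<alpha> $ j * enn2real (\<Phi>1 j y))" and tc2: "tame (\<lambda>y. \<Sum>j\<in>UNIV. \<alpha> $ j * enn2real (\<Phi>2 j y))"
    by (intro tame_combination t1 t2)+
  define S where "S = (\<lambda>i v. (\<Sum>j\<in>UNIV. rate i j * h j v) + b $ i * (real_conv (\<lambda>y. \<Sum>j\<in>UNIV. \<alpha> $ j * h j y) v + R v))"
  have fS: "f i v = S i v" if v: "v > 0" for i v
  proof -
    have e: "(\<lambda>y. \<Sum>j\<in>UNIV. \<alpha> $ j * h j y) = (\<lambda>y. (\<Sum>j\<in>UNIV. \<alpha> $ j * enn2real (\<Phi>1 j y)) - (\<Sum>j\<in>UNIV. \<alpha> $ j * enn2real (\<Phi>2 j y)))"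
      by (simp add: h_def algebra_simps sum_subtractf)
    have "f i v = enn2real (source_term \<Phi>1 G1 i v) - enn2real (source_term \<Phi>2 G2 i v)" using v by (simp add: f_def F_def)
    also have "\<dots> = S i v"
      unfolding source_term_real(2)[OF s1 a v] source_term_real(2)[OF s2 order_refl v] S_def e real_conv_diff[OF tc1 tc2 v, symmetric]
      by (simp add: h_def R_def algebra_simps sum_subtractf)
    finally show ?thesis .
  qed
  define h' where "h' = (\<lambda>i v. - (a * rho) * exp (- rho * v) + k' i v)"
  show ?thesis
  proof (rule that[of h'])
    fix i and v :: real assume v: "v > 0"
    have ev: "\<forall>\<^sub>F x in nhds v. 0 < x" by (rule eventually_nhds_in_open[of "{0<..}", simplified]) (use v in auto)
    have "((\<lambda>v. a * exp (- rho * v) + k i v) has_real_derivative h' i v) (at v)"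
      unfolding h'_def by (rule derivative_eq_intros k1 v refl | simp)+
    moreover have "\<forall>\<^sub>F x in nhds v. h i x = a * exp (- rho * x) + k i x" using ev by eventually_elim (rule hk)
    ultimately show "(h i has_real_derivative h' i v) (at v)" by (subst DERIV_cong_ev) auto
  next
    fix u :: real and i assume u: "u > 0" and R: "isCont R u"
    have ev: "\<forall>\<^sub>F x in nhds u. 0 < x" by (rule eventually_nhds_in_open[of "{0<..}", simplified]) (use u in auto)
    have "isCont (S i) u"
      unfolding S_def using tame_h u
      by (intro continuous_intros R real_conv_isCont[OF tame_combination]) (auto simp: tame_def)
    moreover have "\<forall>\<^sub>F x in nhds u. f i x = S i x" using ev by eventually_elim (rule fS)
    ultimately have "isCont (f i) u" using isCont_cong by blast
    from k2[OF u this] obtain h2 where h2: "(k' i has_real_derivative h2) (at u)" "\<sigma>\<^sup>2 / 2 * h2 + c * k' i u - lam * k i u + f i u = 0" by blast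
    have "(h' i has_real_derivative a * (rho * rho) * exp (- rho * u) + h2) (at u)"
      unfolding h'_def by (rule derivative_eq_intros h2 refl | simp)+
    moreover have "\<sigma>\<^sup>2 / 2 * (a * (rho * rho) * exp (- rho * u) + h2) + c * h' i u - lam * h i u + S i u = 0"
      unfolding h'_def hk[OF u] fS[OF u, symmetric] by (rule boundary_ode[OF k1 u h2])
    ultimately show "\<exists>h2. (h' i has_real_derivative h2) (at u) \<and>
      \<sigma>\<^sup>2 / 2 * h2 + c * h' i u - lam * h i u + ((\<Sum>j\<in>UNIV. rate i j * h j u)
        + b $ i * (real_conv (\<lambda>y. \<Sum>j\<in>UNIV. \<alpha> $ j * h j y) u + R u)) = 0"
      unfolding S_def by blast
  next
    show "tame (h i)" for i by (rule tame_h)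
  qed
qed

end

section \<open>Linearity of the operators and summation over the stages\<close>

lemma suminf_commute_ennreal:
  fixes f :: "nat \<Rightarrow> nat \<Rightarrow> ennreal"
  shows "(\<Sum>m. \<Sum>n. f m n) = (\<Sum>n. \<Sum>m. f m n)"
  using nn_integral_suminf[of "\<lambda>n m. f m n" "count_space UNIV"] by (simp add: nn_integral_count_space_nat)

context drift_diffusion
begin

lemma resolvent_cmult:
  assumes [measurable]: "F \<in> borel_measurable borel"
  shows "resolvent (\<lambda>x. k * F x) v = k * resolvent F v"
  unfolding resolvent_def
  by (subst nn_integral_cmult[symmetric]) (auto intro!: nn_integral_cong simp: mult_ac)

lemma resolvent_suminf:
  assumes [measurable]: "\<And>n. F n \<in> borel_measurable borel"
  shows "resolvent (\<lambda>x. \<Sum>n. F n x) v = (\<Sum>n. resolvent (F n) v)"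
  unfolding resolvent_def by (subst nn_integral_suminf[symmetric]) (auto intro!: nn_integral_cong)

lemma resolvent_add:
  assumes [measurable]: "F \<in> borel_measurable borel" "G \<in> borel_measurable borel"
  shows "resolvent (\<lambda>x. F x + G x) v = resolvent F v + resolvent G v"
  unfolding resolvent_def by (subst nn_integral_add[symmetric]) (auto intro!: nn_integral_cong simp: distrib_left distrib_right)

lemma resolvent_sum:
  assumes [measurable]: "\<And>j. F j \<in> borel_measurable borel"
  shows "resolvent (\<lambda>x. \<Sum>j\<in>A. F j x) v = (\<Sum>j\<in>A. resolvent (F j) v)"
  unfolding resolvent_def
  by (subst nn_integral_sum[symmetric]) (auto intro!: nn_integral_cong simp: sum_distrib_left sum_distrib_right)

lemma resolvent_power_suminf:
  assumes [measurable]: "\<And>n. F n \<in> borel_measurable borel"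
  shows "(resolvent ^^ m) (\<lambda>x. \<Sum>n. F n x) = (\<lambda>v. \<Sum>n. (resolvent ^^ m) (F n) v)"
proof (induction m)
  case (Suc m)
  then show ?case by (simp add: resolvent_suminf)
qed simp

end

lemma (in phase_type) weight_sum:
  "weight \<gamma> x m = (\<Sum>i\<in>UNIV. \<gamma> $ i * weight (axis i 1) x m)"
  unfolding weight_def vector_nth_inner[symmetric] by (simp add: inner_vec_def)

lemma (in renewal) weight_Suc_axis:
  "weight (axis i 1) x (Suc m) = (\<Sum>j\<in>UNIV. rate i j * weight (axis j 1) x m)"
proof -
  have "(B + q *\<^sub>R mat 1) $ i $ j = rate i j" for j by (simp add: rate_def mat_def)
  then show ?thesis
    unfolding weight_def funpow.simps o_apply vector_nth_inner[symmetric]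
    by (subst (1) uni_matrix) (simp add: matrix_vector_mult_def del: vector_add_component vector_scaleR_component)
qed

context gerber_shiu
begin

lemma claim_density: "integrable lborel p" "(\<integral>\<^sup>+x. ennreal (p x) \<partial>lborel) = 1"
proof -
  have "(\<integral>\<^sup>+x. ennreal (p x) \<partial>lborel) = emeasure (density lborel (\<lambda>x. ennreal (p x))) UNIV"
    by (simp add: emeasure_density)
  also have "\<dots> = emeasure (distr P lborel (Z 0)) UNIV"
    using distributed_distr_eq_density[OF claim_distr[of 0]] by simp
  also have "\<dots> = 1" by (subst emeasure_distr) (auto simp: emeasure_space_1)
  finally show 1: "(\<integral>\<^sup>+x. ennreal (p x) \<partial>lborel) = 1" .
  then show "integrable lborel p" by (intro integrableI_nonneg) (auto simp: p_nonneg)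
qed

definition boundary :: real where "boundary = (case kind of None \<Rightarrow> 1 | Some w \<Rightarrow> 0)"

definition claims :: "real \<Rightarrow> ennreal" where "claims = (case kind of None \<Rightarrow> (\<lambda>_. 0) | Some w \<Rightarrow> ruin_rate w)"

lemma claims_measurable [measurable]: "claims \<in> borel_measurable borel"
  unfolding claims_def by (cases kind) (auto intro: ruin_rate_measurable)

definition mean_penalty :: "real ^ 'n \<Rightarrow> real \<Rightarrow> ennreal" where
  "mean_penalty \<gamma> v = (\<Sum>n. stage_mean \<gamma> n v)"

lemma mean_penalty_measurable [measurable]: "mean_penalty \<gamma> \<in> borel_measurable borel"
  unfolding mean_penalty_def by measurable

lemma green_suminf:
  assumes [measurable]: "\<And>n. F n \<in> borel_measurable borel"
  shows "green \<gamma> (\<lambda>x. \<Sum>n. F n x) v = (\<Sum>n. green \<gamma> (F n) v)"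
proof -
  have "green \<gamma> (\<lambda>x. \<Sum>n. F n x) v = (\<Sum>m. \<Sum>n. ennreal (weight \<gamma> b m) * (resolvent ^^ Suc m) (F n) v)"
    unfolding green_def resolvent_power_suminf[OF assms] by (simp add: ennreal_suminf_cmult)
  also have "\<dots> = (\<Sum>n. green \<gamma> (F n) v)"
    unfolding green_def by (rule suminf_commute_ennreal)
  finally show ?thesis .
qed

lemma claim_conv_suminf:
  assumes [measurable]: "\<And>n. F n \<in> borel_measurable borel"
  shows "claim_conv p (\<lambda>x. \<Sum>n. F n x) v = (\<Sum>n. claim_conv p (F n) v)"
  unfolding claim_conv_def
  by (subst nn_integral_suminf[symmetric]) (auto intro!: nn_integral_cong)

text \<open>Splitting off stage zero; every later stage passes through the first claim, after which
  the clock has initial distribution \<open>\<alpha>\<close>.\<close>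

lemma mean_penalty_eq: "mean_penalty \<gamma> v = base \<gamma> v + green \<gamma> (claim_conv p (mean_penalty \<alpha>)) v"
proof -
  have "mean_penalty \<gamma> v = (\<Sum>n. stage_mean \<gamma> (Suc n) v) + base \<gamma> v"
    unfolding mean_penalty_def using suminf_offset[of "\<lambda>n. stage_mean \<gamma> n v" 1] by (simp add: add.commute)
  also have "(\<Sum>n. stage_mean \<gamma> (Suc n) v) = green \<gamma> (claim_conv p (mean_penalty \<alpha>)) v"
    unfolding mean_penalty_def[abs_def] claim_conv_suminf[OF stage_mean_measurable, abs_def]
    by (simp add: green_suminf)
  finally show ?thesis by (simp add: add.commute)
qed

lemma green_sum:
  assumes "\<And>i. 0 \<le> \<gamma> $ i"
  shows "green \<gamma> g v = (\<Sum>i\<in>UNIV. ennreal (\<gamma> $ i) * green (axis i 1) g v)"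
proof -
  have w: "0 \<le> weight (axis i 1) b m" for i :: 'n and m by (rule weight_nonneg) (auto simp: axis_def b_nonneg)
  have "green \<gamma> g v = (\<Sum>m. \<Sum>i\<in>UNIV. ennreal (\<gamma> $ i) * (ennreal (weight (axis i 1) b m) * (resolvent ^^ Suc m) g v))"
    unfolding green_def weight_sum[of \<gamma>]
    by (subst sum_ennreal[symmetric]) (auto simp: assms w ennreal_mult sum_distrib_right mult.assoc)
  also have "\<dots> = (\<Sum>i\<in>UNIV. ennreal (\<gamma> $ i) * green (axis i 1) g v)"
    unfolding green_def by (subst suminf_sum) (auto simp: ennreal_suminf_cmult)
  finally show ?thesis .
qed

lemma base_sum:
  assumes "\<And>i. 0 \<le> \<gamma> $ i"
  shows "base \<gamma> v = (\<Sum>i\<in>UNIV. ennreal (\<gamma> $ i) * base (axis i 1) v)"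
proof (cases kind)
  case None
  have w: "0 \<le> weight (axis i 1) 1 m" for i :: 'n and m by (rule weight_nonneg) (auto simp: axis_def)
  have "base \<gamma> v = (\<Sum>m. \<Sum>i\<in>UNIV. ennreal (\<gamma> $ i) * (ennreal (weight (axis i 1) 1 m) * (resolvent ^^ m) (\<lambda>v. ennreal (exp (- rho * v))) v))"
    unfolding base_diffusion[OF None] weight_sum[of \<gamma>]
    by (subst sum_ennreal[symmetric]) (auto simp: assms w ennreal_mult sum_distrib_right mult.assoc)
  also have "\<dots> = (\<Sum>i\<in>UNIV. ennreal (\<gamma> $ i) * base (axis i 1) v)"
    unfolding base_diffusion[OF None] by (subst suminf_sum) (auto simp: ennreal_suminf_cmult)
  finally show ?thesis .
next
  case (Some w)
  show ?thesis unfolding base_claim[OF Some] by (rule green_sum[OF assms])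
qed

text \<open>Linearity in the initial distribution, inherited from the weights. It expresses the
  penalty after a claim through the vector of penalties for fixed starting phases and so closes the
  system.\<close>

lemma mean_penalty_sum:
  assumes "\<And>i. 0 \<le> \<gamma> $ i"
  shows "mean_penalty \<gamma> v = (\<Sum>i\<in>UNIV. ennreal (\<gamma> $ i) * mean_penalty (axis i 1) v)"
  unfolding mean_penalty_eq[of \<gamma>] mean_penalty_eq[of "axis _ 1"]
  by (subst base_sum[OF assms], subst green_sum[OF assms]) (simp add: distrib_left sum.distrib)

end

section \<open>The renewal equation for the expected penalty\<close>

locale gerber_shiu_renewal = gerber_shiu B b q P \<beta> \<alpha> p J Z W c \<sigma> lam \<delta> kind
  for B :: "real ^ 'n::finite ^ 'n" and b q and P :: "'a measure" and \<beta> \<alpha> p J Z W c \<sigma> lam \<delta> kind +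
  assumes claims_pos: "AE \<omega> in P. 0 < Z k \<omega>"
begin

sublocale renewal B b q c \<sigma> lam \<alpha> p
proof
  show "integrable lborel p" by (rule claim_density)
  have "emeasure (density lborel (\<lambda>x. ennreal (p x))) {..0} = emeasure (distr P lborel (Z 0)) {..0}"
    using distributed_distr_eq_density[OF claim_distr[of 0]] by simp
  also have "\<dots> = emeasure P (Z 0 -` {..0} \<inter> space P)" by (rule emeasure_distr) auto
  also have "\<dots> = 0"
  proof -
    have "AE \<omega> in P. \<omega> \<notin> Z 0 -` {..0} \<inter> space P" using claims_pos[of 0] by eventually_elim auto
    then show ?thesis by (subst (asm) AE_iff_measurable[OF _ refl]) (auto simp: vimage_def Int_def conj_commute)
  qed
  finally have "(\<integral>\<^sup>+x. ennreal (p x) * indicator {..0} x \<partial>lborel) = 0" by (simp add: emeasure_density)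
  then have "AE x in lborel. ennreal (p x) * indicator {..0} x = 0"
    by (subst (asm) nn_integral_0_iff_AE) auto
  then show "AE z in lborel. z \<le> 0 \<longrightarrow> p z = 0"
    by eventually_elim (use p_nonneg in \<open>auto simp: ennreal_eq_0_iff intro: antisym\<close>)
qed (use alpha p_nonneg p_measurable in auto)

lemma sum_mult_ennreal:
  fixes r w :: "'n \<Rightarrow> real"
  assumes "\<And>j. 0 \<le> r j" "\<And>j. 0 \<le> w j"
  shows "ennreal (\<Sum>j\<in>UNIV. r j * w j) = (\<Sum>j\<in>UNIV. ennreal (r j) * ennreal (w j))"
  by (subst sum_ennreal[symmetric]) (auto simp: assms ennreal_mult)

text \<open>The geometric-series argument: after the term of order zero, one factor of
  \<open>B + q I\<close> and one resolvent can be taken out of all the others.\<close>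

lemma series_unfold:
  assumes x: "\<And>i. 0 \<le> x $ i" and [measurable]: "g \<in> borel_measurable borel"
  shows "(\<Sum>m. ennreal (weight (axis i 1) x m) * (resolvent ^^ m) g v)
    = ennreal (x $ i) * g v + resolvent (\<lambda>y. \<Sum>j\<in>UNIV. ennreal (rate i j) * (\<Sum>m. ennreal (weight (axis j 1) x m) * (resolvent ^^ m) g y)) v"
proof -
  let ?s = "\<lambda>i m v. ennreal (weight (axis i 1) x m) * (resolvent ^^ m) g v"
  have w: "0 \<le> weight (axis i 1) x m" for i :: 'n and m by (rule weight_nonneg) (auto simp: axis_def x)
  have [measurable]: "(\<lambda>v. \<Sum>m. ?s j m v) \<in> borel_measurable borel" for j by measurable
  have "(\<Sum>m. ?s i m v) = (\<Sum>m. ?s i (Suc m) v) + ?s i 0 v"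
    using suminf_offset[of "\<lambda>m. ?s i m v" 1] by (simp add: add.commute)
  also have "?s i 0 v = ennreal (x $ i) * g v" by (simp add: weight_def vector_nth_inner)
  also have "(\<Sum>m. ?s i (Suc m) v) = (\<Sum>m. \<Sum>j\<in>UNIV. ennreal (rate i j) * resolvent (?s j m) v)"
    by (simp add: weight_Suc_axis sum_mult_ennreal rate_nonneg w sum_distrib_right resolvent_cmult mult.assoc)
  also have "\<dots> = (\<Sum>j\<in>UNIV. ennreal (rate i j) * resolvent (\<lambda>y. \<Sum>m. ?s j m y) v)"
    by (subst suminf_sum) (auto simp: ennreal_suminf_cmult resolvent_suminf)
  also have "\<dots> = resolvent (\<lambda>y. \<Sum>j\<in>UNIV. ennreal (rate i j) * (\<Sum>m. ?s j m y)) v"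
    by (subst resolvent_sum) (auto simp: resolvent_cmult)
  finally show ?thesis by (simp add: add.commute)
qed

lemma green_series:
  assumes [measurable]: "g \<in> borel_measurable borel"
  shows "green \<gamma> g v = resolvent (\<lambda>y. \<Sum>m. ennreal (weight \<gamma> b m) * (resolvent ^^ m) g y) v"
  unfolding green_def by (subst resolvent_suminf) (auto simp: resolvent_cmult)

lemma green_unfold:
  assumes [measurable]: "g \<in> borel_measurable borel"
  shows "green (axis i 1) g v = resolvent (\<lambda>y. ennreal (b $ i) * g y + (\<Sum>j\<in>UNIV. ennreal (rate i j) * green (axis j 1) g y)) v"
proof -
  have "(\<lambda>y. \<Sum>m. ennreal (weight (axis i 1) b m) * (resolvent ^^ m) g y)
     = (\<lambda>y. ennreal (b $ i) * g y + (\<Sum>j\<in>UNIV. ennreal (rate i j) * green (axis j 1) g y))"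
  proof
    fix y
    show "(\<Sum>m. ennreal (weight (axis i 1) b m) * (resolvent ^^ m) g y)
     = ennreal (b $ i) * g y + (\<Sum>j\<in>UNIV. ennreal (rate i j) * green (axis j 1) g y)"
      unfolding series_unfold[OF b_nonneg assms, of i y] green_series[OF assms]
      by (subst resolvent_sum) (auto simp: resolvent_cmult)
  qed
  then show ?thesis unfolding green_series[OF assms, of "axis i 1"] by simp
qed

text \<open>The same unfolding gives the boundary exponential for ruin by diffusion, and the claim
  rate times \<open>b\<close> for ruin by a claim.\<close>

lemma base_unfold:
  "base (axis i 1) v = ennreal (boundary * exp (- rho * v))
     + resolvent (\<lambda>y. ennreal (b $ i) * claims y + (\<Sum>j\<in>UNIV. ennreal (rate i j) * base (axis j 1) y)) v"
proof (cases kind)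
  case None
  have c: "claims = (\<lambda>_. 0)" and bd: "boundary = 1" unfolding claims_def boundary_def using None by simp_all
  have one: "0 \<le> (1 :: real ^ 'n) $ i" for i by simp
  have "base (axis i 1) v = ennreal (exp (- rho * v)) + resolvent (\<lambda>y. \<Sum>j\<in>UNIV. ennreal (rate i j) * base (axis j 1) y) v"
    unfolding base_diffusion[OF None] by (subst series_unfold[OF one]) auto
  then show ?thesis unfolding c bd mult_1 mult_zero_right add_0 .
next
  case (Some w)
  have c: "claims = ruin_rate w" and bd: "boundary = 0" unfolding claims_def boundary_def using Some by simp_all
  show ?thesis unfolding base_claim[OF Some] c bd    unfolding mult_zero_left ennreal_0 add_0 by (rule green_unfold[OF ruin_rate_measurable[OF Some]])
qed

text \<open>The unfolded equations for \<open>base\<close> and for \<open>green\<close> have the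
  same matrix \<open>rate\<close>, so their sum is again a single resolvent and the full source term
  appears.\<close>

lemma mean_penalty_unfold:
  "mean_penalty (axis i 1) v = ennreal (boundary * exp (- rho * v)) + resolvent (source_term (\<lambda>j. mean_penalty (axis j 1)) claims i) v"
proof -
  have a: "mean_penalty \<alpha> = (\<lambda>y. \<Sum>j\<in>UNIV. ennreal (\<alpha> $ j) * mean_penalty (axis j 1) y)"
    by (rule ext) (rule mean_penalty_sum, rule alpha)
  let ?G = "claim_conv p (mean_penalty \<alpha>)"
  have "mean_penalty (axis i 1) v = ennreal (boundary * exp (- rho * v))
    + (resolvent (\<lambda>y. ennreal (b $ i) * claims y + (\<Sum>j\<in>UNIV. ennreal (rate i j) * base (axis j 1) y)) v
      + resolvent (\<lambda>y. ennreal (b $ i) * ?G y + (\<Sum>j\<in>UNIV. ennreal (rate i j) * green (axis j 1) ?G y)) v)"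
    unfolding mean_penalty_eq[of "axis i 1" v] by (subst base_unfold, subst green_unfold) (auto simp: add.assoc)
  also have "(resolvent (\<lambda>y. ennreal (b $ i) * claims y + (\<Sum>j\<in>UNIV. ennreal (rate i j) * base (axis j 1) y)) v
      + resolvent (\<lambda>y. ennreal (b $ i) * ?G y + (\<Sum>j\<in>UNIV. ennreal (rate i j) * green (axis j 1) ?G y)) v)
     = resolvent (source_term (\<lambda>j. mean_penalty (axis j 1)) claims i) v"
    unfolding source_term_def[abs_def] a[symmetric]
    by (subst resolvent_add[symmetric], measurable, unfold mean_penalty_eq[of "axis _ 1"] distrib_left sum.distrib)
      (simp only: ac_simps)
  finally show ?thesis .
qed

lemma mean_penalty_solves:
  assumes "\<And>i v. 0 < v \<Longrightarrow> mean_penalty (axis i 1) v < \<infinity>" and "\<And>v. 0 < v \<Longrightarrow> claims v < \<infinity>"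
  shows "solves boundary (\<lambda>i. mean_penalty (axis i 1)) claims"
  unfolding solves_def using assms mean_penalty_unfold by auto

end

section \<open>The Gerber--Shiu functions\<close>

lemma has_vector_derivative_vec_lambda:
  fixes h :: "'n::finite \<Rightarrow> real \<Rightarrow> real"
  assumes "\<And>i. (h i has_real_derivative d i) (at v)"
  shows "((\<lambda>v. \<chi> i. h i v) has_vector_derivative (\<chi> i. d i)) (at v)"
proof -
  have e: "(\<chi> i. f i) = (\<Sum>i\<in>UNIV. f i *\<^sub>R axis i 1)" for f :: "'n \<Rightarrow> real"
    by (simp add: vec_eq_iff axis_def if_distrib[of "\<lambda>x. _ * x"] cong: if_cong)
  have "((\<lambda>v. h i v *\<^sub>R axis i 1) has_vector_derivative d i *\<^sub>R axis i (1::real)) (at v)" for i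
    using assms[of i] unfolding has_real_derivative_iff_has_vector_derivative
    by (rule bounded_linear.has_vector_derivative[OF bounded_linear_scaleR_left])
  then show ?thesis unfolding e by (intro has_vector_derivative_sum)
qed

locale phase_type_risk =
  fixes M :: "'a measure" and Pr :: "'n::finite \<Rightarrow> 'a measure"
    and J :: "nat \<Rightarrow> real \<Rightarrow> 'a \<Rightarrow> 'n option" and Z :: "nat \<Rightarrow> 'a \<Rightarrow> real" and W :: "real \<Rightarrow> 'a \<Rightarrow> real"
    and c \<sigma> \<delta> :: real and \<alpha> b :: "real ^ 'n" and B :: "real ^ 'n ^ 'n" and p :: "real \<Rightarrow> real"
  assumes c: "c > 0" and \<sigma>: "\<sigma> > 0" and \<delta>: "\<delta> \<ge> 0"
    and model: "perturbed_phase_type_model M Pr J Z W c \<alpha> B b p"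
begin

text \<open>The sum dominates every negative diagonal entry of \<open>B\<close>, and the summand 1
  keeps \<open>q\<close>, and with it \<open>q + \<delta>\<close>, strictly positive.\<close>

definition q :: real where "q = 1 + (\<Sum>i\<in>UNIV. \<bar>B $ i $ i\<bar>)"

abbreviation lam :: real where "lam \<equiv> q + \<delta>"

abbreviation U :: "real \<Rightarrow> 'a \<Rightarrow> real \<Rightarrow> real" where "U \<equiv> surplus c \<sigma> J Z W"

lemma q_bound: "q > 0" "- B $ i $ i \<le> q"
proof -
  show "q > 0" unfolding q_def by (intro add_pos_nonneg sum_nonneg) auto
  have "\<bar>B $ i $ i\<bar> \<le> (\<Sum>i\<in>UNIV. \<bar>B $ i $ i\<bar>)" by (rule member_le_sum) auto
  then show "- B $ i $ i \<le> q" by (simp add: q_def)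
qed

lemma rep: "phase_type_rep \<alpha> B b" and p_nonneg: "0 \<le> p x"
  and law_M: "risk_law M \<alpha> \<alpha> B b p J Z W" and law_Pr: "risk_law (Pr i) (axis i 1) \<alpha> B b p J Z W"
  and cdf_M: "cdf (distr M borel (Z k)) 0 = 0"
  using model by (auto simp: perturbed_phase_type_model_def)

lemma phase_type_B: "phase_type B b q"
  using rep q_bound by unfold_locales (auto simp: phase_type_rep_def)

lemma drift_diffusion_lam: "drift_diffusion c \<sigma> lam"
  using c \<sigma> \<delta> q_bound by unfold_locales auto

lemma risk_model_Pr: "risk_model B b q (Pr i) (axis i 1) \<alpha> p J Z W"
proof -
  interpret phase_type B b q by (rule phase_type_B)
  interpret prob_space "Pr i" using law_Pr by (simp add: risk_law_def)
  show ?thesis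
  proof
    show "risk_law (Pr i) (axis i 1) \<alpha> B b p J Z W" by (rule law_Pr)
    show "(\<Sum>j\<in>UNIV. (axis i 1 :: real ^ 'n) $ j) = 1" by (simp add: axis_def)
  qed (use rep p_nonneg in \<open>auto simp: phase_type_rep_def axis_def\<close>)
qed

text \<open>Positivity of claims is stated under \<open>M\<close>; it carries over because the claim
  sizes have the same density under every \<open>Pr i\<close>.\<close>

lemma claims_positive: "AE \<omega> in Pr i. 0 < Z k \<omega>"
proof -
  interpret PM: prob_space M using law_M by (simp add: risk_law_def)
  interpret R: risk_model B b q "Pr i" "axis i 1" \<alpha> p J Z W by (rule risk_model_Pr)
  have dM: "distributed M lborel (Z k) (\<lambda>x. ennreal (p x))" using law_M by (simp add: risk_law_def)
  have "emeasure (distr M lborel (Z k)) {..0} = emeasure (distr (Pr i) lborel (Z k)) {..0}"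
    using distributed_distr_eq_density[OF dM] distributed_distr_eq_density[OF R.claim_distr[of k]] by simp
  moreover have "emeasure (distr M lborel (Z k)) {..0} = 0"
    using cdf_M[of k] distributed_measurable[OF dM]
    by (simp add: cdf_def measure_distr emeasure_distr PM.emeasure_eq_measure)
  ultimately have "emeasure (Pr i) (Z k -` {..0} \<inter> space (Pr i)) = 0"
    by (simp add: emeasure_distr)
  then have "AE \<omega> in Pr i. \<omega> \<notin> Z k -` {..0} \<inter> space (Pr i)" by (intro AE_not_in) (simp add: null_sets_def)
  with AE_space show ?thesis by eventually_elim auto
qed

lemma gerber_shiu_Pr:
  assumes "\<And>w. k = Some w \<Longrightarrow> (\<lambda>(x, y). w x y) \<in> borel_measurable borel"
  shows "gerber_shiu_renewal B b q (Pr i) (axis i 1) \<alpha> p J Z W c \<sigma> lam \<delta> k"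
proof -
  interpret risk_model B b q "Pr i" "axis i 1" \<alpha> p J Z W by (rule risk_model_Pr)
  interpret drift_diffusion c \<sigma> lam by (rule drift_diffusion_lam)
  interpret surplus_path c \<sigma> \<delta> .
  show ?thesis using claims_positive assms by unfold_locales auto
qed

sublocale renewal B b q c \<sigma> lam \<alpha> p
proof -
  interpret G: gerber_shiu_renewal B b q "Pr i" "axis i 1" \<alpha> p J Z W c \<sigma> lam \<delta> None for i by (rule gerber_shiu_Pr) simp
  show "renewal B b q c \<sigma> lam \<alpha> p" by (rule G.renewal_axioms)
qed

lemma diffusion_solves:
  obtains \<Phi> where "solves 1 \<Phi> (\<lambda>_. 0)" "\<And>i v. v > 0 \<Longrightarrow> \<Phi> i v = (\<integral>\<^sup>+\<omega>. ennreal (penalty_diffusion \<delta> (U v \<omega>)) \<partial>Pr i)"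
proof -
  interpret G: gerber_shiu_renewal B b q "Pr i" "axis i 1" \<alpha> p J Z W c \<sigma> lam \<delta> None for i by (rule gerber_shiu_Pr) simp
  have pay: "G.pay None = G.diffusion_payoff" by (simp add: G.pay_def)
  have claims: "G.claims = (\<lambda>_. 0)" and bd: "G.boundary = 1" unfolding G.claims_def G.boundary_def by simp_all
  have eq: "G.mean_penalty (axis i 1) v = (\<integral>\<^sup>+\<omega>. ennreal (penalty_diffusion \<delta> (U v \<omega>)) \<partial>Pr i)" if "v > 0" for i v
    unfolding G.mean_penalty_def
    by (rule G.expected_penalty[symmetric]) (use G.stepwise_diffusion pay claims_positive that in auto)
  have le1: "(\<integral>\<^sup>+\<omega>. ennreal (penalty_diffusion \<delta> (U v \<omega>)) \<partial>Pr i) \<le> 1" for i v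
  proof -
    have "(\<integral>\<^sup>+\<omega>. ennreal (penalty_diffusion \<delta> (U v \<omega>)) \<partial>Pr i) \<le> (\<integral>\<^sup>+\<omega>. 1 \<partial>Pr i)"
      by (rule nn_integral_mono) (auto simp: penalty_diffusion_def Let_def \<delta>)
    then show ?thesis by (simp add: G.emeasure_space_1)
  qed
  have fin: "G.mean_penalty (axis i 1) v < \<infinity>" if "v > 0" for i v
    unfolding eq[OF that] by (rule le_less_trans[OF le1]) simp
  have "solves 1 (\<lambda>i. G.mean_penalty (axis i 1)) (\<lambda>_. 0)"
    using G.mean_penalty_solves fin unfolding claims bd by simp
  then show ?thesis using eq that by blast
qed

lemma claim_solves:
  assumes w: "(\<lambda>(x, y). w x y) \<in> borel_measurable borel" "\<And>x y. 0 \<le> w x y"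
    and fin: "\<And>v i. v > 0 \<Longrightarrow> (\<integral>\<^sup>+\<omega>. ennreal (penalty_claim \<delta> w (U v \<omega>)) \<partial>Pr i) < \<infinity>"
    and rate_fin: "\<And>v. v > 0 \<Longrightarrow> (\<integral>\<^sup>+x. ennreal (indicator {v<..} x * (w v (x - v) * p x)) \<partial>lborel) < \<infinity>"
  obtains \<Phi> where "solves 0 \<Phi> (\<lambda>v. \<integral>\<^sup>+x. ennreal (indicator {v<..} x * (w v (x - v) * p x)) \<partial>lborel)"
    "\<And>i v. v > 0 \<Longrightarrow> \<Phi> i v = (\<integral>\<^sup>+\<omega>. ennreal (penalty_claim \<delta> w (U v \<omega>)) \<partial>Pr i)"
proof -
  interpret G: gerber_shiu_renewal B b q "Pr i" "axis i 1" \<alpha> p J Z W c \<sigma> lam \<delta> "Some w" for i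
    by (rule gerber_shiu_Pr) (use w in auto)
  have pay: "G.pay (Some w) = G.claim_payoff w" by (simp add: G.pay_def)
  have claims: "G.claims = (\<lambda>v. \<integral>\<^sup>+x. ennreal (indicator {v<..} x * (w v (x - v) * p x)) \<partial>lborel)"
    unfolding G.claims_def option.case G.ruin_rate_def
    by (intro ext nn_integral_cong) (auto simp: ennreal_mult w p_nonneg mult.commute split: split_indicator)
  have bd: "G.boundary = 0" unfolding G.boundary_def by simp
  have eq: "G.mean_penalty (axis i 1) v = (\<integral>\<^sup>+\<omega>. ennreal (penalty_claim \<delta> w (U v \<omega>)) \<partial>Pr i)" if "v > 0" for i v
    unfolding G.mean_penalty_def
    by (rule G.expected_penalty[symmetric]) (use G.stepwise_claim[OF w(2)] pay claims_positive that in auto)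
  have "solves 0 (\<lambda>i. G.mean_penalty (axis i 1)) (\<lambda>v. \<integral>\<^sup>+x. ennreal (indicator {v<..} x * (w v (x - v) * p x)) \<partial>lborel)"
    using G.mean_penalty_solves eq fin rate_fin unfolding claims bd by simp
  then show ?thesis using eq that by blast
qed

text \<open>The integral over \<open>{0..u}\<close> also evaluates \<open>f\<close> at zero, where
  it need not agree with \<open>g\<close>; that happens only at the null point \<open>x = u\<close>.
  Negative claim sizes drop out because \<open>p\<close> vanishes there almost everywhere.\<close>

lemma conv_at_claims:
  assumes g: "tame g" and u: "u > 0" and f: "\<And>v. v > 0 \<Longrightarrow> f v = g v"
  shows "set_integrable lborel {0..u} (\<lambda>x. f (u - x) * p x)"
    and "(LBINT x:{0..u}. f (u - x) * p x) = real_conv g u"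
proof -
  have [measurable]: "g \<in> borel_measurable borel" using g by (simp add: tame_def)
  \<comment> \<open>Separating the end point gives measurability, as nothing is known about
    \<open>f\<close> outside the positive half line.\<close>
  have "(\<lambda>x. indicator {0..u} x *\<^sub>R (f (u - x) * p x))
      = (\<lambda>x. indicator {0..<u} x * (g (u - x) * p x) + indicator {u} x * (f 0 * p u))"
    using u by (auto simp: fun_eq_iff f split: split_indicator)
  moreover have "(\<lambda>x. indicator {0..<u} x * (g (u - x) * p x) + indicator {u} x * (f 0 * p u)) \<in> borel_measurable lborel"
    by measurable
  ultimately have m: "(\<lambda>x. indicator {0..u} x *\<^sub>R (f (u - x) * p x)) \<in> borel_measurable lborel" by simp
  have "AE x in lborel. x \<noteq> u" by (rule AE_lborel_singleton)
  with density_pos have ae: "AE x in lborel. indicator {0..u} x *\<^sub>R (f (u - x) * p x) = p x * (if x < u then g (u - x) else 0)"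
  proof eventually_elim
    case (elim x)
    then show ?case by (cases "p x = 0") (auto simp: f split: split_indicator)
  qed
  show "set_integrable lborel {0..u} (\<lambda>x. f (u - x) * p x)"
    unfolding set_integrable_def
    by (subst integrable_cong_AE[OF m _ ae]) (use real_conv_integrable[OF g u] in auto)
  show "(LBINT x:{0..u}. f (u - x) * p x) = real_conv g u"
    unfolding set_lebesgue_integral_def real_conv_def by (rule integral_cong_AE[OF m _ ae]) measurable
qed

definition solves_ode :: "(real \<Rightarrow> real ^ 'n) \<Rightarrow> real \<Rightarrow> real \<Rightarrow> bool" where
  "solves_ode \<phi> u r \<longleftrightarrow> (\<forall>v>0. \<phi> differentiable (at v)) \<and>
     (\<lambda>v. vector_derivative \<phi> (at v)) differentiable (at u) \<and>
     set_integrable lborel {0..u} (\<lambda>x. (\<alpha> \<bullet> \<phi> (u - x)) * p x) \<and>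
     (\<sigma>\<^sup>2 / 2) *\<^sub>R vector_derivative (\<lambda>v. vector_derivative \<phi> (at v)) (at u)
       + c *\<^sub>R vector_derivative \<phi> (at u) + (B - \<delta> *\<^sub>R mat 1) *v \<phi> u
       + ((LBINT x:{0..u}. (\<alpha> \<bullet> \<phi> (u - x)) * p x) + r) *\<^sub>R b = 0"

lemma vector_equation:
  fixes \<phi> :: "real \<Rightarrow> real ^ 'n"
  assumes h': "\<And>i v. v > 0 \<Longrightarrow> (h i has_real_derivative h' i v) (at v)"
    and h2: "\<And>i. \<exists>h2. (h' i has_real_derivative h2) (at u) \<and>
      \<sigma>\<^sup>2 / 2 * h2 + c * h' i u - lam * h i u + ((\<Sum>j\<in>UNIV. rate i j * h j u)
        + b $ i * (real_conv (\<lambda>y. \<Sum>j\<in>UNIV. \<alpha> $ j * h j y) u + r)) = 0"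
    and tame: "\<And>i. tame (h i)" and u: "u > 0" and \<phi>: "\<And>v i. v > 0 \<Longrightarrow> \<phi> v $ i = h i v"
  shows "solves_ode \<phi> u r"
proof -
  have vec: "\<phi> v = (\<chi> i. h i v)" if "v > 0" for v using \<phi>[OF that] by (simp add: vec_eq_iff)
  have d1: "(\<phi> has_vector_derivative (\<chi> i. h' i v)) (at v)" if "v > 0" for v
    by (rule has_vector_derivative_transform_within_open[OF has_vector_derivative_vec_lambda[of h "\<lambda>i. h' i v" v], of "{0<..}"])
      (use that h' vec in auto)
  then have s1: "\<forall>v>0. \<phi> differentiable (at v)" by (auto intro: differentiableI_vector)
  have vd: "vector_derivative \<phi> (at v) = (\<chi> i. h' i v)" if "v > 0" for v by (rule vector_derivative_at[OF d1[OF that]])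
  have ex: "\<forall>i. \<exists>h2. (h' i has_real_derivative h2) (at u) \<and>
      \<sigma>\<^sup>2 / 2 * h2 + c * h' i u - lam * h i u + ((\<Sum>j\<in>UNIV. rate i j * h j u)
        + b $ i * (real_conv (\<lambda>y. \<Sum>j\<in>UNIV. \<alpha> $ j * h j y) u + r)) = 0" by (intro allI h2)
  obtain h2 where h2_all: "\<forall>i. (h' i has_real_derivative h2 i) (at u) \<and>
      \<sigma>\<^sup>2 / 2 * h2 i + c * h' i u - lam * h i u + ((\<Sum>j\<in>UNIV. rate i j * h j u)
        + b $ i * (real_conv (\<lambda>y. \<Sum>j\<in>UNIV. \<alpha> $ j * h j y) u + r)) = 0"
    by (rule exE[OF choice[OF ex]], rule that)
  then have h2': "\<And>i. (h' i has_real_derivative h2 i) (at u)"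
    and eq: "\<And>i. \<sigma>\<^sup>2 / 2 * h2 i + c * h' i u - lam * h i u + ((\<Sum>j\<in>UNIV. rate i j * h j u)
        + b $ i * (real_conv (\<lambda>y. \<Sum>j\<in>UNIV. \<alpha> $ j * h j y) u + r)) = 0"
    by (auto simp only:)
  have d2: "((\<lambda>v. vector_derivative \<phi> (at v)) has_vector_derivative (\<chi> i. h2 i)) (at u)"
    by (rule has_vector_derivative_transform_within_open[OF has_vector_derivative_vec_lambda[of h' h2 u], of "{0<..}"])
      (use u h2' vd in auto)
  then have s2: "(\<lambda>v. vector_derivative \<phi> (at v)) differentiable (at u)" by (rule differentiableI_vector)
  have inner: "\<alpha> \<bullet> \<phi> v = (\<Sum>j\<in>UNIV. \<alpha> $ j * h j v)" if "v > 0" for v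
    using \<phi>[OF that] by (simp add: inner_vec_def)
  note conv = conv_at_claims[where f="\<lambda>v. \<alpha> \<bullet> \<phi> v", OF tame_combination[OF tame] u inner]
  have conv2: "(LBINT x:{0..u}. (\<alpha> \<bullet> \<phi> (u - x)) * p x) = real_conv (\<lambda>y. \<Sum>j\<in>UNIV. \<alpha> $ j * h j y) u"
    by (rule conv(2))
  \<comment> \<open>The uniformization rate \<open>q\<close> is contained in both
    \<open>rate\<close> and \<open>lam\<close> and cancels, leaving \<open>B\<close> and
    \<open>\<delta>\<close>.\<close>
  have Bm: "((B - \<delta> *\<^sub>R mat 1) *v \<phi> u) $ i = (\<Sum>j\<in>UNIV. rate i j * h j u) - lam * h i u" for i
  proof -
    have "(\<Sum>j\<in>UNIV. rate i j * h j u) = (\<Sum>j\<in>UNIV. B $ i $ j * h j u) + q * h i u"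
      by (simp add: rate_def distrib_right sum.distrib if_distrib[of "\<lambda>x. x * _"] cong: if_cong)
    moreover have "((B - \<delta> *\<^sub>R mat 1) *v \<phi> u) $ i = (\<Sum>j\<in>UNIV. B $ i $ j * h j u) - \<delta> * h i u"
      by (simp add: matrix_vector_mult_diff_rdistrib scaleR_matrix_vector_assoc[symmetric] \<phi>[OF u])
        (simp add: matrix_vector_mult_def \<phi>[OF u])
    ultimately show ?thesis by (simp add: algebra_simps)
  qed
  have "(\<sigma>\<^sup>2 / 2) *\<^sub>R vector_derivative (\<lambda>v. vector_derivative \<phi> (at v)) (at u)
       + c *\<^sub>R vector_derivative \<phi> (at u) + (B - \<delta> *\<^sub>R mat 1) *v \<phi> u
       + ((LBINT x:{0..u}. (\<alpha> \<bullet> \<phi> (u - x)) * p x) + r) *\<^sub>R b = 0"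
    unfolding vector_derivative_at[OF d2] vd[OF u] conv2
  proof (rule vec_eq_iff[THEN iffD2], rule allI)
    fix i
    show "((\<sigma>\<^sup>2 / 2) *\<^sub>R (\<chi> i. h2 i) + c *\<^sub>R (\<chi> i. h' i u) + (B - \<delta> *\<^sub>R mat 1) *v \<phi> u
       + (real_conv (\<lambda>y. \<Sum>j\<in>UNIV. \<alpha> $ j * h j y) u + r) *\<^sub>R b) $ i = (0 :: real ^ 'n) $ i"
      unfolding vector_add_component Bm using eq[of i] by (simp add: algebra_simps)
  qed
  then show ?thesis unfolding solves_ode_def using s1 s2 conv(1) by (intro conjI)
qed

lemma solution_equation:
  fixes \<phi> :: "real \<Rightarrow> real ^ 'n"
  assumes s1: "solves a \<Phi>1 G1" and a: "0 \<le> a" and s2: "solves 0 \<Phi>2 G2" and u: "u > 0"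
    and \<phi>: "\<And>v i. v > 0 \<Longrightarrow> \<phi> v $ i = enn2real (\<Phi>1 i v) - enn2real (\<Phi>2 i v)"
    and R: "isCont (\<lambda>v. enn2real (G1 v) - enn2real (G2 v)) u" "enn2real (G1 u) - enn2real (G2 u) = r"
  shows "solves_ode \<phi> u r"
proof -
  let ?h = "\<lambda>i v. enn2real (\<Phi>1 i v) - enn2real (\<Phi>2 i v)" and ?R = "\<lambda>v. enn2real (G1 v) - enn2real (G2 v)"
  obtain h' where h': "\<And>i v. v > 0 \<Longrightarrow> (?h i has_real_derivative h' i v) (at v)"
      "\<And>u i. u > 0 \<Longrightarrow> isCont ?R u \<Longrightarrow> \<exists>h2. (h' i has_real_derivative h2) (at u) \<and>
      \<sigma>\<^sup>2 / 2 * h2 + c * h' i u - lam * ?h i u + ((\<Sum>j\<in>UNIV. rate i j * ?h j u)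
        + b $ i * (real_conv (\<lambda>y. \<Sum>j\<in>UNIV. \<alpha> $ j * ?h j y) u + ?R u)) = 0"
      "\<And>i. tame (?h i)"
    by (rule renewal_ode[OF s1 a s2], rule that, assumption+)
  show ?thesis
    by (rule vector_equation[where h="?h" and h'=h', OF h'(1) h'(2)[OF u R(1), unfolded R(2)] h'(3) u \<phi>])
qed

lemma gs_diffusion_nonneg_integral:
  "gs_diffusion Pr \<delta> U v $ i = enn2real (\<integral>\<^sup>+\<omega>. ennreal (penalty_diffusion \<delta> (U v \<omega>)) \<partial>Pr i)"
  and penalty_diffusion_U_measurable: "(\<lambda>\<omega>. penalty_diffusion \<delta> (U v \<omega>)) \<in> borel_measurable (Pr i)"
proof -
  interpret R: risk_model B b q "Pr i" "axis i 1" \<alpha> p J Z W by (rule risk_model_Pr)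
  interpret BW: brownian "Pr i" W by (rule R.brownian_W)
  show m: "(\<lambda>\<omega>. penalty_diffusion \<delta> (U v \<omega>)) \<in> borel_measurable (Pr i)"
    unfolding surplus_claim_path by (rule penalty_diffusion_measurable[OF R.clock_P R.claim_P BW.cont_W])
  show "gs_diffusion Pr \<delta> U v $ i = enn2real (\<integral>\<^sup>+\<omega>. ennreal (penalty_diffusion \<delta> (U v \<omega>)) \<partial>Pr i)"
    unfolding gs_diffusion_def vec_lambda_beta
    by (rule integral_eq_nn_integral[OF m]) (auto simp: penalty_diffusion_def Let_def)
qed

lemma gs_diffusion_0: "gs_diffusion Pr \<delta> U 0 = 1"
proof (rule vec_eq_iff[THEN iffD2], rule allI)
  fix i
  interpret R: risk_model B b q "Pr i" "axis i 1" \<alpha> p J Z W by (rule risk_model_Pr)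
  have "AE \<omega> in Pr i. penalty_diffusion \<delta> (U 0 \<omega>) = 1"
    using R.starts_ruined[of c \<sigma>] by eventually_elim (simp add: penalty_diffusion_def)
  then have "(\<integral>\<omega>. penalty_diffusion \<delta> (U 0 \<omega>) \<partial>Pr i) = (\<integral>\<omega>. 1 \<partial>Pr i)"
    by (intro integral_cong_AE penalty_diffusion_U_measurable) auto
  then show "gs_diffusion Pr \<delta> U 0 $ i = 1 $ i" by (simp add: gs_diffusion_def R.prob_space)
qed

lemma gs_claim_0: "gs_claim Pr \<delta> w U 0 = 0"
proof (rule vec_eq_iff[THEN iffD2], rule allI)
  fix i
  interpret R: risk_model B b q "Pr i" "axis i 1" \<alpha> p J Z W by (rule risk_model_Pr)
  have "AE \<omega> in Pr i. penalty_claim \<delta> w (U 0 \<omega>) = 0"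
    using R.starts_ruined[of c \<sigma>] by eventually_elim (simp add: penalty_claim_def)
  then show "gs_claim Pr \<delta> w U 0 $ i = 0 $ i" by (simp add: gs_claim_def integral_eq_zero_AE)
qed

theorem diffusion_equation:
  assumes u: "u > 0"
  defines "\<phi> \<equiv> gs_diffusion Pr \<delta> U"
  shows "solves_ode \<phi> u 0"
proof -
  obtain \<Phi> where s: "solves 1 \<Phi> (\<lambda>_. 0)"
    and eq: "\<And>i v. v > 0 \<Longrightarrow> \<Phi> i v = (\<integral>\<^sup>+\<omega>. ennreal (penalty_diffusion \<delta> (U v \<omega>)) \<partial>Pr i)"
    using diffusion_solves by blast
  \<comment> \<open>The penalty is nonnegative here, so its negative part is represented by the zero
    solution.\<close>
  have z: "solves 0 (\<lambda>_ _. 0) (\<lambda>_. 0)"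
    by (simp add: solves_def source_term_def claim_conv_def resolvent_def)
  have \<phi>: "\<phi> v $ i = enn2real (\<Phi> i v) - enn2real 0" if "v > 0" for v i
    by (simp add: \<phi>_def gs_diffusion_nonneg_integral eq[OF that])
  show ?thesis by (rule solution_equation[OF s zero_le_one z u \<phi>]) simp_all
qed

theorem claim_equation:
  assumes u: "u > 0" and w: "(\<lambda>(x, y). w x y) \<in> borel_measurable borel"
    and int: "\<And>v i. v > 0 \<Longrightarrow> integrable (Pr i) (\<lambda>\<omega>. penalty_claim \<delta> w (U v \<omega>))"
    and rate: "\<And>v. v > 0 \<Longrightarrow> set_integrable lborel {v<..} (\<lambda>x. w v (x - v) * p x)"
    and cont: "isCont (claim_ruin_rate w p) u"
  defines "\<phi> \<equiv> gs_claim Pr \<delta> w U"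
  shows "solves_ode \<phi> u (claim_ruin_rate w p u)"
proof -
  \<comment> \<open>For \<open>s = 1\<close> and \<open>s = - 1\<close> these are the positive and
    negative parts of the penalty. Treating \<open>s\<close> as a parameter gives both solutions
    from one argument.\<close>
  define part where "part = (\<lambda>s x y. max 0 (s * w x y))"
  define G where "G = (\<lambda>s v. \<integral>\<^sup>+x. ennreal (indicator {v<..} x * (part s v (x - v) * p x)) \<partial>lborel)"
  have pos: "ennreal (E * max 0 (s * y)) = ennreal (s * (E * y))" if "0 \<le> E" for E s y :: real
  proof -
    have e: "s * (E * y) = E * (s * y)" by simp
    show ?thesis unfolding e using that by (cases "0 \<le> s * y") (simp_all add: max_def ennreal_neg mult_nonneg_nonpos)
  qed
  \<comment> \<open>Along one path the penalty is a nonnegative factor times one value of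
    \<open>w\<close>, or zero, so taking parts of \<open>w\<close> and taking parts of the penalty
    coincide.\<close>
  have pen: "ennreal (penalty_claim \<delta> (part s) x) = ennreal (s * penalty_claim \<delta> w x)" for s x
    unfolding penalty_claim_def Let_def part_def by (simp only: pos exp_ge_zero mult_zero_right split: if_split) auto
  have G: "G s v = (\<integral>\<^sup>+x. ennreal (s * (indicator {v<..} x *\<^sub>R (w v (x - v) * p x))) \<partial>lborel)" for s v
    unfolding G_def
  proof (rule nn_integral_cong)
    fix x
    show "ennreal (indicator {v<..} x * (part s v (x - v) * p x)) = ennreal (s * (indicator {v<..} x *\<^sub>R (w v (x - v) * p x)))"
      using p_nonneg[of x]
      by (cases "0 \<le> s * w v (x - v)")
        (auto simp: part_def max_def mult.assoc[symmetric] ennreal_neg mult_nonpos_nonneg split: split_indicator)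
  qed
  have "\<exists>\<Phi>. solves 0 \<Phi> (G s) \<and> (\<forall>i v. v > 0 \<longrightarrow> \<Phi> i v = (\<integral>\<^sup>+\<omega>. ennreal (s * penalty_claim \<delta> w (U v \<omega>)) \<partial>Pr i))"
    for s
  proof -
    have "(\<lambda>x. max 0 (s * (case x of (x, y) \<Rightarrow> w x y))) \<in> borel_measurable borel" using w by measurable
    then have m1: "(\<lambda>(x, y). part s x y) \<in> borel_measurable borel" by (simp add: part_def split_beta)
    have m2: "0 \<le> part s x y" for x y by (simp add: part_def)
    have m3: "(\<integral>\<^sup>+\<omega>. ennreal (penalty_claim \<delta> (part s) (U v \<omega>)) \<partial>Pr i) < \<infinity>" if "v > 0" for v i
      using integrableD(2)[OF integrable_mult_right[where c=s, OF int[OF that, of i]]] unfolding pen by (simp add: less_top)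
    have m4: "G s v < \<infinity>" if "v > 0" for v
      using integrableD(2)[OF integrable_mult_right[where c=s, OF rate[OF that, unfolded set_integrable_def]]] unfolding G by (simp add: less_top)
    show ?thesis
      unfolding G_def
    proof (rule claim_solves[OF m1 m2 m3 m4[unfolded G_def]], assumption, assumption)
      fix \<Phi> assume "solves 0 \<Phi> (\<lambda>v. \<integral>\<^sup>+x. ennreal (indicator {v<..} x * (part s v (x - v) * p x)) \<partial>lborel)"
        and "\<And>i v. v > 0 \<Longrightarrow> \<Phi> i v = (\<integral>\<^sup>+\<omega>. ennreal (penalty_claim \<delta> (part s) (U v \<omega>)) \<partial>Pr i)"
      then show "\<exists>\<Phi>. solves 0 \<Phi> (\<lambda>v. \<integral>\<^sup>+x. ennreal (indicator {v<..} x * (part s v (x - v) * p x)) \<partial>lborel) \<and>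
        (\<forall>i v. v > 0 \<longrightarrow> \<Phi> i v = (\<integral>\<^sup>+\<omega>. ennreal (s * penalty_claim \<delta> w (U v \<omega>)) \<partial>Pr i))"
        unfolding pen by (intro exI[of _ \<Phi>] conjI allI impI)
    qed
  qed
  then obtain \<Phi> where s: "\<And>s. solves 0 (\<Phi> s) (G s)"
    and eq: "\<And>s i v. v > 0 \<Longrightarrow> \<Phi> s i v = (\<integral>\<^sup>+\<omega>. ennreal (s * penalty_claim \<delta> w (U v \<omega>)) \<partial>Pr i)" by metis
  let ?h = "\<lambda>i v. enn2real (\<Phi> 1 i v) - enn2real (\<Phi> (- 1) i v)" and ?R = "\<lambda>v. enn2real (G 1 v) - enn2real (G (- 1) v)"
  have \<phi>: "\<phi> v $ i = ?h i v" if "v > 0" for v i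
    using real_lebesgue_integral_def[OF int[OF that, of i]] eq[OF that] by (simp add: \<phi>_def gs_claim_def)
  have R: "?R v = claim_ruin_rate w p v" if "v > 0" for v
    using real_lebesgue_integral_def[OF rate[OF that, unfolded set_integrable_def]]
    unfolding G claim_ruin_rate_def set_lebesgue_integral_def by simp
  \<comment> \<open>The difference of the two rates equals the given rate only at positive
    arguments; as \<open>u\<close> is positive this holds near \<open>u\<close>, which is enough to
    transfer continuity.\<close>
  have "\<forall>\<^sub>F v in nhds u. 0 < v" by (rule eventually_nhds_in_open[of "{0<..}", simplified]) (use u in auto)
  then have ev: "\<forall>\<^sub>F v in nhds u. ?R v = claim_ruin_rate w p v" by eventually_elim (rule R)
  have cont': "isCont ?R u" using cont unfolding isCont_cong[OF ev] .
  show ?thesis by (rule solution_equation[OF s[of 1] order_refl s[of "- 1"] u \<phi> cont' R[OF u]])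
qed

end

theorem theorem2p1:
  fixes M :: "'a measure" and Pr :: "'n::finite \<Rightarrow> 'a measure"
    and J :: "nat \<Rightarrow> real \<Rightarrow> 'a \<Rightarrow> 'n option"
    and Z :: "nat \<Rightarrow> 'a \<Rightarrow> real" and W :: "real \<Rightarrow> 'a \<Rightarrow> real"
    and c \<sigma> \<delta> u :: real
    and \<alpha> b :: "real ^ 'n" and B :: "real ^ 'n ^ 'n"
    and p :: "real \<Rightarrow> real" and w :: "real \<Rightarrow> real \<Rightarrow> real"
    and U :: "real \<Rightarrow> 'a \<Rightarrow> real \<Rightarrow> real"
    and \<phi>\<^sub>w \<phi>\<^sub>d :: "real \<Rightarrow> real ^ 'n"
  assumes "c > 0" "\<sigma> > 0" "\<delta> \<ge> 0"
    and "perturbed_phase_type_model M Pr J Z W c \<alpha> B b p"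
    and U: "U = surplus c \<sigma> J Z W"
    and \<phi>\<^sub>w: "\<phi>\<^sub>w = gs_claim Pr \<delta> w U"
    and \<phi>\<^sub>d: "\<phi>\<^sub>d = gs_diffusion Pr \<delta> U"
    and w_measurable: "(\<lambda>(x, y). w x y) \<in> borel_measurable borel"
    and w_integrable: "\<And>v i. v > 0 \<Longrightarrow> integrable (Pr i) (\<lambda>\<omega>. penalty_claim \<delta> w (U v \<omega>))"
    and rate_integrable: "\<And>v. v > 0 \<Longrightarrow> set_integrable lborel {v<..} (\<lambda>x. w v (x - v) * p x)"
    and "u > 0"
    and rate_continuous: "isCont (claim_ruin_rate w p) u"
  shows
    "(\<forall>v>0. \<phi>\<^sub>w differentiable (at v)) \<and>
     (\<lambda>v. vector_derivative \<phi>\<^sub>w (at v)) differentiable (at u) \<and>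
     set_integrable lborel {0..u} (\<lambda>x. (\<alpha> \<bullet> \<phi>\<^sub>w (u - x)) * p x) \<and>
     (\<sigma>\<^sup>2 / 2) *\<^sub>R vector_derivative (\<lambda>v. vector_derivative \<phi>\<^sub>w (at v)) (at u)
       + c *\<^sub>R vector_derivative \<phi>\<^sub>w (at u)
       + (B - \<delta> *\<^sub>R mat 1) *v \<phi>\<^sub>w u
       + ((LBINT x:{0..u}. (\<alpha> \<bullet> \<phi>\<^sub>w (u - x)) * p x) + claim_ruin_rate w p u) *\<^sub>R b = 0 \<and>
     \<phi>\<^sub>w 0 = 0 \<and>
     (\<forall>v>0. \<phi>\<^sub>d differentiable (at v)) \<and>
     (\<lambda>v. vector_derivative \<phi>\<^sub>d (at v)) differentiable (at u) \<and>
     set_integrable lborel {0..u} (\<lambda>x. (\<alpha> \<bullet> \<phi>\<^sub>d (u - x)) * p x) \<and>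
     (\<sigma>\<^sup>2 / 2) *\<^sub>R vector_derivative (\<lambda>v. vector_derivative \<phi>\<^sub>d (at v)) (at u)
       + c *\<^sub>R vector_derivative \<phi>\<^sub>d (at u)
       - \<delta> *\<^sub>R \<phi>\<^sub>d u
       + B *v \<phi>\<^sub>d u
       + (LBINT x:{0..u}. (\<alpha> \<bullet> \<phi>\<^sub>d (u - x)) * p x) *\<^sub>R b = 0 \<and>
     \<phi>\<^sub>d 0 = 1"
proof -
  interpret phase_type_risk M Pr J Z W c \<sigma> \<delta> \<alpha> b B p by unfold_locales (rule assms)+
  note claim = claim_equation[OF \<open>u > 0\<close> w_measurable w_integrable[unfolded U] rate_integrable rate_continuous, folded U \<phi>\<^sub>w, unfolded solves_ode_def]
  note diffusion = diffusion_equation[OF \<open>u > 0\<close>, folded U \<phi>\<^sub>d, unfolded solves_ode_def]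
  have "(B - \<delta> *\<^sub>R mat 1) *v \<phi>\<^sub>d u = B *v \<phi>\<^sub>d u - \<delta> *\<^sub>R \<phi>\<^sub>d u"
    by (simp add: matrix_vector_mult_diff_rdistrib scaleR_matrix_vector_assoc[symmetric])
  with diffusion have "(\<sigma>\<^sup>2 / 2) *\<^sub>R vector_derivative (\<lambda>v. vector_derivative \<phi>\<^sub>d (at v)) (at u)
       + c *\<^sub>R vector_derivative \<phi>\<^sub>d (at u) - \<delta> *\<^sub>R \<phi>\<^sub>d u + B *v \<phi>\<^sub>d u
       + (LBINT x:{0..u}. (\<alpha> \<bullet> \<phi>\<^sub>d (u - x)) * p x) *\<^sub>R b = 0"
    by (simp add: algebra_simps)
  then show ?thesis
    using claim diffusion gs_claim_0[of w, folded U \<phi>\<^sub>w] gs_diffusion_0[folded U \<phi>\<^sub>d] by blast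
qed

end
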